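(* Let $n\ge1$ and let $Q$, $B$ be real $n\times n$ matrices with $Q$ symmetric positive semidefinite, such that $$\mathrm{Rank}\,[Q^{1/2},BQ^{1/2},\dots,B^{n-1}Q^{1/2}]=n\quad\text{and}\quad \sigma(B)\subset\mathbb{C}_-=\{z\in\mathbb{C}:\mathrm{Re}\,z<0\}.$$ Let $P=\frac12\mathrm{Tr}(Q\nabla_x^2)+\langle Bx,\nabla_x\rangle$ be the associated Ornstein-Uhlenbeck operator acting on $L^2(\mathbb{R}^n,\rho(x)dx)$. Let $T>0$ and let $\omega\subset\mathbb{R}^n$ be an open set such that $$\exists \delta,r>0,\ \forall y\in\mathbb{R}^n,\ \exists y'\in\omega,\quad B(y',r)\subset\omega \ \text{ and }\ |y-y'|<\delta .$$ Then $$\exists C_T>0,\ \forall g\in L^2(\mathbb{R}^n,\rho(x)dx),\quad \|e^{TP}g\|^2_{L^2(\mathbb{R}^n,\rho(x)dx)}\le C_T\int_0^T\|e^{tP}g\|^2_{L^2(\omega,\rho(x)dx)}\,dt .$$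
   Context: $\sigma(B)$ is the spectrum of $B$; $Q^{1/2}$ is the symmetric positive semidefinite square root of $Q$; $B(y',r)$ is the Euclidean ball. $[Q^{1/2},BQ^{1/2},\dots,B^{n-1}Q^{1/2}]$ is the $n\times n^2$ matrix obtained by writing consecutively the columns of the $B^jQ^{1/2}$. The weight is $$\rho(x)=\frac{1}{(2\pi)^{n/2}\sqrt{\det Q_\infty}}e^{-\frac12\langle Q_\infty^{-1}x,x\rangle},\qquad Q_\infty=\int_0^{+\infty}e^{sB}Qe^{sB^T}ds,$$ where $Q_\infty$ is symmetric positive definite under the assumptions. The operator $P$ has domain $\{g\in L^2_\rho:Pg\in L^2_\rho\}$ with $L^2_\rho=L^2(\mathbb{R}^n,\rho(x)dx)$, and $(e^{tP})_{t\ge0}$ is the strongly continuous semigroup on $L^2_\rho$ with infinitesimal generator $P$ (i.e. solving $\partial_tf=Pf$). *)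

theory Defs
  imports "HOL-Analysis.Analysis"
begin

section \<open>Matrices\<close>

definition matpow :: "real^'n^'n \<Rightarrow> nat \<Rightarrow> real^'n^'n"
  where "matpow A k = (((**) A) ^^ k) (mat 1)"

(* The product on the type real^'n^'n is componentwise, so the library's power and exp
   are not the matrix ones. *)
definition matexp :: "real^'n^'n \<Rightarrow> real^'n^'n"
  where "matexp A = (\<Sum>k. (1 / fact k) *\<^sub>R matpow A k)"

definition symmetric_psd :: "real^'n^'n \<Rightarrow> bool"
  where "symmetric_psd A \<longleftrightarrow> transpose A = A \<and> (\<forall>x. 0 \<le> (A *v x) \<bullet> x)"

definition matsqrt :: "real^'n^'n \<Rightarrow> real^'n^'n"
  where "matsqrt A = (THE R. symmetric_psd R \<and> R ** R = A)"

definition matspectrum :: "real^'n^'n \<Rightarrow> complex set"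
  where "matspectrum A = {z. \<not> invertible (map_matrix complex_of_real A - mat z)}"

(* The n x n^2 matrix [Q^(1/2), B Q^(1/2), ..., B^(n-1) Q^(1/2)]. Its columns are indexed by
   pairs (k, l): k selects the block through the enumeration to_nat_on UNIV of the index type
   by 0, ..., n-1, and l is the column inside that block. *)
definition kalman_matrix :: "real^'n^'n \<Rightarrow> real^'n^'n \<Rightarrow> real^('n \<times> 'n)^'n"
  where "kalman_matrix Q B =
    (\<chi> i kl. (matpow B (to_nat_on (UNIV :: 'n set) (fst kl)) ** matsqrt Q) $ i $ snd kl)"

section \<open>The weighted space\<close>

definition Q_infty :: "real^'n^'n \<Rightarrow> real^'n^'n \<Rightarrow> real^'n^'n"
  where "Q_infty Q B =
    (LINT s:{0..}|lborel. matexp (s *\<^sub>R B) ** Q ** matexp (s *\<^sub>R transpose B))"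

definition ou_weight :: "real^'n^'n \<Rightarrow> real^'n^'n \<Rightarrow> real^'n \<Rightarrow> real"
  where "ou_weight Q B x =
    1 / ((2 * pi) powr (real CARD('n) / 2) * sqrt (det (Q_infty Q B)))
      * exp (- (1/2) * ((matrix_inv (Q_infty Q B) *v x) \<bullet> x))"

definition ou_measure :: "real^'n^'n \<Rightarrow> real^'n^'n \<Rightarrow> (real^'n) measure"
  where "ou_measure Q B = density lborel (\<lambda>x. ennreal (ou_weight Q B x))"

(* Elements of L^2(M) are represented by functions; equality in L^2(M) is equality
   almost everywhere. *)
definition L2_fun :: "'a measure \<Rightarrow> ('a \<Rightarrow> complex) set"
  where "L2_fun M = {f \<in> borel_measurable M. integrable M (\<lambda>x. (cmod (f x))\<^sup>2)}"

definition L2_norm_on :: "'a measure \<Rightarrow> 'a set \<Rightarrow> ('a \<Rightarrow> complex) \<Rightarrow> real"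
  where "L2_norm_on M A f = sqrt (LINT x:A|M. (cmod (f x))\<^sup>2)"

abbreviation L2_norm :: "'a measure \<Rightarrow> ('a \<Rightarrow> complex) \<Rightarrow> real"
  where "L2_norm M f \<equiv> L2_norm_on M UNIV f"

section \<open>Strongly continuous semigroups on \<open>L\<^sup>2(M)\<close>\<close>

(* Linearity together with boundedness makes T compatible with equality almost everywhere. *)
definition L2_bounded_operator ::
    "'a measure \<Rightarrow> (('a \<Rightarrow> complex) \<Rightarrow> ('a \<Rightarrow> complex)) \<Rightarrow> bool"
  where "L2_bounded_operator M T \<longleftrightarrow>
    (\<forall>f \<in> L2_fun M. T f \<in> L2_fun M) \<and>
    (\<forall>f \<in> L2_fun M. \<forall>g \<in> L2_fun M. \<forall>a b.
       AE x in M. T (\<lambda>x. a * f x + b * g x) x = a * T f x + b * T g x) \<and>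
    (\<exists>K. \<forall>f \<in> L2_fun M. L2_norm M (T f) \<le> K * L2_norm M f)"

definition L2_C0_semigroup ::
    "'a measure \<Rightarrow> (real \<Rightarrow> ('a \<Rightarrow> complex) \<Rightarrow> ('a \<Rightarrow> complex)) \<Rightarrow> bool"
  where "L2_C0_semigroup M S \<longleftrightarrow>
    (\<forall>t\<ge>0. L2_bounded_operator M (S t)) \<and>
    (\<forall>f \<in> L2_fun M. AE x in M. S 0 f x = f x) \<and>
    (\<forall>s\<ge>0. \<forall>t\<ge>0. \<forall>f \<in> L2_fun M. AE x in M. S (s + t) f x = S s (S t f) x) \<and>
    (\<forall>f \<in> L2_fun M. ((\<lambda>t. L2_norm M (\<lambda>x. S t f x - f x)) \<longlongrightarrow> 0) (at_right 0))"

(* The graph of the infinitesimal generator: f is in its domain, with image h. *)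
definition generator_graph ::
    "'a measure \<Rightarrow> (real \<Rightarrow> ('a \<Rightarrow> complex) \<Rightarrow> ('a \<Rightarrow> complex))
      \<Rightarrow> ('a \<Rightarrow> complex) \<Rightarrow> ('a \<Rightarrow> complex) \<Rightarrow> bool"
  where "generator_graph M S f h \<longleftrightarrow>
    f \<in> L2_fun M \<and> h \<in> L2_fun M \<and>
    ((\<lambda>t. L2_norm M (\<lambda>x. (S t f x - f x) / complex_of_real t - h x)) \<longlongrightarrow> 0) (at_right 0)"

section \<open>Distributions and the Ornstein-Uhlenbeck operator\<close>

definition partial :: "'n::finite \<Rightarrow> (real^'n \<Rightarrow> complex) \<Rightarrow> (real^'n \<Rightarrow> complex)"
  where "partial i \<phi> = (\<lambda>x. frechet_derivative \<phi> (at x) (axis i 1))"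

(* C_c^infinity: every iterated partial derivative is differentiable everywhere. *)
definition test_functions :: "(real^'n \<Rightarrow> complex) set"
  where "test_functions =
    {\<phi>. (\<forall>is. fold partial is \<phi> differentiable_on UNIV) \<and> compact (closure {x. \<phi> x \<noteq> 0})}"

(* Only the values on test_functions matter. *)
type_synonym 'n distribution = "(real^'n \<Rightarrow> complex) \<Rightarrow> complex"

definition dist_of_fun :: "(real^'n \<Rightarrow> complex) \<Rightarrow> 'n distribution"
  where "dist_of_fun g = (\<lambda>\<phi>. LINT x|lborel. g x * \<phi> x)"

definition dist_partial :: "'n::finite \<Rightarrow> 'n distribution \<Rightarrow> 'n distribution"
  where "dist_partial i u = (\<lambda>\<phi>. - u (partial i \<phi>))"

definition dist_mult :: "(real^'n \<Rightarrow> real) \<Rightarrow> 'n distribution \<Rightarrow> 'n distribution"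
  where "dist_mult a u = (\<lambda>\<phi>. u (\<lambda>x. complex_of_real (a x) * \<phi> x))"

(* P = 1/2 Tr(Q nabla^2) + <Bx, nabla>, acting on distributions. *)
definition ou_operator :: "real^'n^'n \<Rightarrow> real^'n^'n \<Rightarrow> 'n distribution \<Rightarrow> 'n distribution"
  where "ou_operator Q B u = (\<lambda>\<phi>.
    1/2 * (\<Sum>i\<in>UNIV. \<Sum>j\<in>UNIV. complex_of_real (Q $ i $ j) * dist_partial i (dist_partial j u) \<phi>)
    + (\<Sum>i\<in>UNIV. dist_mult (\<lambda>x. (B *v x) $ i) (dist_partial i u) \<phi>))"

(* The graph of P with its domain {g in L^2_rho. P g in L^2_rho}, where P g is computed
   as a distribution. *)
definition ou_graph ::
    "real^'n^'n \<Rightarrow> real^'n^'n \<Rightarrow> (real^'n \<Rightarrow> complex) \<Rightarrow> (real^'n \<Rightarrow> complex) \<Rightarrow> bool"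
  where "ou_graph Q B g h \<longleftrightarrow>
    g \<in> L2_fun (ou_measure Q B) \<and> h \<in> L2_fun (ou_measure Q B) \<and>
    (\<forall>\<phi> \<in> test_functions. ou_operator Q B (dist_of_fun g) \<phi> = dist_of_fun h \<phi>)"

(* S t = e^(tP). The generator determines each S t f with t >= 0 and f in L^2_rho
   up to equality almost everywhere; the other values of S are unconstrained. *)
definition ou_semigroup ::
    "real^'n^'n \<Rightarrow> real^'n^'n \<Rightarrow> (real \<Rightarrow> (real^'n \<Rightarrow> complex) \<Rightarrow> (real^'n \<Rightarrow> complex)) \<Rightarrow> bool"
  where "ou_semigroup Q B S \<longleftrightarrow>
    L2_C0_semigroup (ou_measure Q B) S \<and>
    (\<forall>g h. generator_graph (ou_measure Q B) S g h \<longleftrightarrow> ou_graph Q B g h)"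

end

theory Submission
  imports Defs "HOL-Computational_Algebra.Fundamental_Theorem_Algebra"
    "HOL-Complex_Analysis.Cauchy_Integral_Formula" "HOL-Real_Asymp.Real_Asymp"
begin

text \<open>On exponentials the semigroup is explicit: \<open>S t\<close> maps \<open>cis (\<xi> \<bullet> x)\<close> to
  \<open>exp (- (Qt t \<xi> \<bullet> \<xi>) / 2) * cis (\<xi> \<bullet> E t x)\<close>, where \<open>E t\<close> is the matrix exponential of \<open>t B\<close> and
  \<open>Qt t\<close> is the integral over \<open>[0, t]\<close> of \<open>E s Q (E s)\<^sup>T\<close>; the right-hand side solves the evolution
  equation, and the solution is unique. The rank condition gives
  \<open>Qt t \<xi> \<bullet> \<xi> \<ge> c t\<^sup>m |\<xi>|\<^sup>2\<close> with \<open>m = 2 n - 1\<close>. Writing \<open>S t g\<close>, for a trigonometric polynomial \<open>g\<close>, as a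
  Gaussian average of \<open>g\<close> (Mehler's formula) and shifting the Gaussian into the complex domain, one sees
  that \<open>S t g\<close> times the square root of the weight is entire in each coordinate, with \<open>L\<^sup>2\<close> norm at most
  \<open>exp (D / t\<^sup>m) \<parallel>g\<parallel>\<close> on the lines at a fixed imaginary distance. A Remez-type inequality, applied to the
  Taylor polynomials of degree less than \<open>N\<close> on a grid of cells each of which meets \<open>\<omega>\<close> in a small cube, gives
  \<open>\<parallel>S t g\<parallel>\<^sup>2 \<le> K A\<^sup>N \<parallel>S t g\<parallel>\<^sup>2\<close> over \<open>\<omega>\<close> plus \<open>K 2\<^sup>-\<^sup>N exp (D / t\<^sup>m) \<parallel>g\<parallel>\<^sup>2\<close>, for every \<open>N\<close>. By density this
  holds for all \<open>g\<close>, and it is telescoped along a geometric sequence of times.\<close>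

section \<open>Symmetric matrices and the square root\<close>

text \<open>The semigroup is given only through its generator, and Q may be degenerate. Exponentials
  are the family on which the distributional P can be evaluated by hand, so every estimate is proved
  on their span, with constants that do not see the number of frequencies. Two obstacles shape the
  rest. The Gaussian weight varies over a cell by a ratio that is unbounded far from the origin;
  making its square root part of the holomorphic function lets smallness propagate in Lebesgue
  measure, with the same constants in every cell. And the Remez constant A^N competes with the
  Taylor error (L/R)^(2N): the functions being entire, the radius R is fixed after A so that A
  (L/R)^2 <= 1/2, and a large R only enlarges D. The exponent m = 2 n - 1 is twice the highest order
  n - 1 at which the rank condition lets the noise reach a direction, plus one from integration in
  time. The free integer N is what the last step lives on: with N of order 1 / t^m the factor 2^-N
  beats exp (D / t^m), at a price A^N with the same kind of blow-up, which decreasing weights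
  absorb.\<close>

lemma symmetric_inner:
  fixes A :: "real^'n^'n"
  assumes "transpose A = A"
  shows "(A *v x) \<bullet> y = x \<bullet> (A *v y)"
  by (metis assms dot_lmul_matrix transpose_matrix_vector)

text \<open>A maximiser \<open>x\<close> of the Rayleigh quotient over the unit sphere of
  \<open>V\<close> is an eigenvector: the residual \<open>w = l x - A x\<close> again lies in
  \<open>V\<close>, and if it were nonzero, moving a little from \<open>x\<close> in the direction
  of \<open>- w\<close> would push the quotient above its maximum.\<close>

lemma symmetric_eigenvector_in_subspace:
  fixes A :: "real^'n^'n"
  assumes sym: "transpose A = A" and V: "subspace V" "V \<noteq> {0}"
    and inv: "\<And>x. x \<in> V \<Longrightarrow> A *v x \<in> V"
  shows "\<exists>x\<in>V. norm x = 1 \<and> (\<exists>l. A *v x = l *\<^sub>R x)"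
proof -
  define K where "K = V \<inter> sphere 0 1"
  have "compact K"
    unfolding K_def using closed_subspace[OF V(1)] by (intro closed_Int_compact) auto
  moreover have "K \<noteq> {}"
  proof -
    obtain v where v: "v \<in> V" "v \<noteq> 0" using V subspace_0 by blast
    then have "v /\<^sub>R norm v \<in> K" unfolding K_def using V(1) by (auto simp: subspace_scale)
    then show ?thesis by blast
  qed
  moreover have "continuous_on K (\<lambda>x. (A *v x) \<bullet> x)"
    by (intro continuous_intros matrix_vector_mult_linear_continuous_on)
  ultimately obtain x where x: "x \<in> K" and mx: "\<And>y. y \<in> K \<Longrightarrow> (A *v y) \<bullet> y \<le> (A *v x) \<bullet> x"
    using continuous_attains_sup[of K "\<lambda>x. (A *v x) \<bullet> x"] by blast
  define l where "l = (A *v x) \<bullet> x"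
  have x1: "norm x = 1" "x \<in> V" using x by (auto simp: K_def)
  have form: "(A *v z) \<bullet> z \<le> l * (z \<bullet> z)" if "z \<in> V" for z
  proof (cases "z = 0")
    case False
    then have "z /\<^sub>R norm z \<in> K" unfolding K_def using V(1) that by (auto simp: subspace_scale)
    from mx[OF this] have "((A *v z) \<bullet> z) / (norm z)\<^sup>2 \<le> l"
      by (simp add: l_def matrix_vector_mult_scaleR power2_eq_square field_simps)
    then show ?thesis using False by (simp add: divide_le_eq power2_norm_eq_inner)
  qed auto
  define w where "w = l *\<^sub>R x - A *v x"
  have wV: "w \<in> V" unfolding w_def using V(1) inv x1(2) by (simp add: subspace_diff subspace_scale)
  have "w = 0"
  proof (rule ccontr)
    assume "w \<noteq> 0"
    define c where "c = l * (w \<bullet> w) - (A *v w) \<bullet> w"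
    have cw: "(A *v w) \<bullet> x = (A *v x) \<bullet> w" using symmetric_inner[OF sym, of w x] by (simp add: inner_commute)
    have cx: "w \<bullet> x = x \<bullet> w" by (rule inner_commute)
    have q: "0 \<le> 2 * t * (w \<bullet> w) + t\<^sup>2 * c" for t
    proof -
      have "x + t *\<^sub>R w \<in> V" using wV x1 V(1) by (simp add: subspace_add subspace_scale)
      from form[OF this] have e0: "(A *v x) \<bullet> x + 2 * t * ((A *v x) \<bullet> w) + t\<^sup>2 * ((A *v w) \<bullet> w)
         \<le> l * (x \<bullet> x + 2 * t * (x \<bullet> w) + t\<^sup>2 * (w \<bullet> w))"
        using cw cx
        by (simp add: matrix_vector_mult_scaleR matrix_vector_right_distrib inner_add_left inner_add_right
            power2_eq_square algebra_simps)
      have xx: "x \<bullet> x = 1" using x1 by (simp add: norm_eq_1)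
      have lw: "l * (x \<bullet> w) - (A *v x) \<bullet> w = w \<bullet> w"
        using inner_diff_left[of "l *\<^sub>R x" "A *v x" w] by (simp add: w_def[symmetric])
      have "0 \<le> 2 * t * (l * (x \<bullet> w) - (A *v x) \<bullet> w) + t\<^sup>2 * (l * (w \<bullet> w) - (A *v w) \<bullet> w)"
        using e0 xx unfolding l_def[symmetric] by (simp add: algebra_simps)
      then show ?thesis unfolding lw c_def .
    qed
    have ww: "w \<bullet> w > 0" using \<open>w \<noteq> 0\<close> by simp
    \<comment> \<open>With \<open>t = - (w \<bullet> w) / d\<close>, where \<open>d\<close> is
      positive and not below \<open>c\<close>, the linear term of the expansion outweighs the
      quadratic one.\<close>
    define d where "d = \<bar>c\<bar> + 1"
    have d: "d > 0" "c \<le> d" by (auto simp: d_def)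
    have "0 \<le> 2 * (-(w \<bullet> w)/d) * (w \<bullet> w) + (-(w \<bullet> w)/d)\<^sup>2 * c" by (rule q)
    also have "\<dots> \<le> 2 * (-(w \<bullet> w)/d) * (w \<bullet> w) + (-(w \<bullet> w)/d)\<^sup>2 * d"
      using d by (intro add_left_mono mult_left_mono) auto
    also have "\<dots> = - (w \<bullet> w)\<^sup>2 / d" using d by (simp add: power2_eq_square field_simps)
    also have "\<dots> < 0" using d ww by simp
    finally show False by simp
  qed
  then have "A *v x = l *\<^sub>R x" by (simp add: w_def)
  with x1 show ?thesis by blast
qed

text \<open>Induction on the dimension: by symmetry the orthogonal complement of an eigenvector
  inside \<open>V\<close> is invariant again, so the eigenvector can be split off.\<close>

lemma symmetric_eigenbasis_subspace:
  fixes A :: "real^'n^'n"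
  assumes sym: "transpose A = A" and V: "subspace V"
    and inv: "\<And>x. x \<in> V \<Longrightarrow> A *v x \<in> V"
  shows "\<exists>B. finite B \<and> B \<subseteq> V \<and> V \<subseteq> span B \<and> pairwise orthogonal B \<and>
    (\<forall>b\<in>B. norm b = 1 \<and> (\<exists>l. A *v b = l *\<^sub>R b))"
  using V inv
proof (induction "dim V" arbitrary: V rule: less_induct)
  case less
  show ?case
  proof (cases "V = {0}")
    case True then show ?thesis by (intro exI[of _ "{}"]) auto
  next
    case False
    obtain x l where x: "x \<in> V" "norm x = 1" "A *v x = l *\<^sub>R x"
      using symmetric_eigenvector_in_subspace[OF sym less.prems(1) False less.prems(2)] by blast
    define W where "W = {y \<in> V. y \<bullet> x = 0}"
    have W: "subspace W" using less.prems(1) by (auto simp: W_def subspace_def inner_simps)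
    have Winv: "A *v y \<in> W" if "y \<in> W" for y
      using that less.prems(2) x symmetric_inner[OF sym, of y x] by (auto simp: W_def)
    have "x \<notin> W" using x by (auto simp: W_def)
    moreover have "W \<subseteq> V" by (auto simp: W_def)
    ultimately have "W \<subset> V" using x(1) by blast
    then have "dim W < dim V"
      using dim_psubset[of W V] span_eq_iff W less.prems(1) by metis
    from less.hyps[OF this W Winv] obtain B where B: "finite B" "B \<subseteq> W" "W \<subseteq> span B" "pairwise orthogonal B"
      "\<forall>b\<in>B. norm b = 1 \<and> (\<exists>l. A *v b = l *\<^sub>R b)" by auto
    have "V \<subseteq> span (insert x B)"
    proof
      fix y assume "y \<in> V"
      have "y - (y \<bullet> x) *\<^sub>R x \<in> W"
        using x \<open>y \<in> V\<close> less.prems(1) by (simp add: W_def subspace_diff subspace_scale inner_simps norm_eq_1)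
      then show "y \<in> span (insert x B)" unfolding span_insert using B(3) by blast
    qed
    moreover have "pairwise orthogonal (insert x B)"
      using B(2,4) by (auto simp: pairwise_insert orthogonal_def W_def inner_commute)
    ultimately show ?thesis using x B by (intro exI[of _ "insert x B"]) (auto simp: W_def)
  qed
qed

lemma symmetric_eigenbasis:
  fixes A :: "real^'n^'n"
  assumes sym: "transpose A = A"
  obtains B l where "finite B" "span B = UNIV" "pairwise orthogonal B" "\<And>b. b \<in> B \<Longrightarrow> norm b = 1"
    "\<And>b. b \<in> B \<Longrightarrow> A *v b = l b *\<^sub>R b"
proof -
  obtain B where B: "finite B" "UNIV \<subseteq> span B" "pairwise orthogonal B"
    "\<forall>b\<in>B. norm b = 1 \<and> (\<exists>l. A *v b = l *\<^sub>R b)"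
    using symmetric_eigenbasis_subspace[OF sym subspace_UNIV] by auto
  then have "\<forall>b\<in>B. \<exists>l. A *v b = l *\<^sub>R b" by blast
  from bchoice[OF this] obtain l where "\<forall>b\<in>B. A *v b = l b *\<^sub>R b" by blast
  then show ?thesis using that[of B l] B by blast
qed

lemma symmetric_psd_sqrt_exists:
  fixes A :: "real^'n^'n"
  assumes "symmetric_psd A"
  shows "\<exists>R. symmetric_psd R \<and> R ** R = A"
proof -
  have sym: "transpose A = A" and psd: "\<And>x. 0 \<le> (A *v x) \<bullet> x" using assms by (auto simp: symmetric_psd_def)
  obtain B l where B: "finite B" "span B = UNIV" "pairwise orthogonal B" "\<And>b. b \<in> B \<Longrightarrow> norm b = 1"
    and l: "\<And>b. b \<in> B \<Longrightarrow> A *v b = l b *\<^sub>R b" using symmetric_eigenbasis[OF sym] by blast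
  have l0: "l b \<ge> 0" if "b \<in> B" for b
    using psd[of b] l[OF that] B(4)[OF that] by (simp add: norm_eq_1)
  have ob: "a \<bullet> b = (if a = b then 1 else 0)" if "a \<in> B" "b \<in> B" for a b
    using that B(3,4) by (auto simp: pairwise_def orthogonal_def norm_eq_1)
  have ex: "(\<Sum>b\<in>B. (v \<bullet> b) *\<^sub>R b) = v" for v
    using orthonormal_basis_expand[OF B(3) B(4) _ B(1)] B(2) by simp
  define f where "f v = (\<Sum>b\<in>B. (sqrt (l b) * (v \<bullet> b)) *\<^sub>R b)" for v
  have lin: "linear f" unfolding f_def
    by (rule linearI) (simp_all add: inner_simps algebra_simps sum.distrib scaleR_sum_right)
  define R where "R = matrix f"
  have R: "R *v v = f v" for v unfolding R_def by (simp add: lin matrix_works)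
  have fb: "f b = sqrt (l b) *\<^sub>R b" if "b \<in> B" for b
  proof -
    have "f b = (\<Sum>a\<in>B. if a = b then sqrt (l b) *\<^sub>R b else 0)"
      unfolding f_def using that ob by (intro sum.cong) auto
    then show ?thesis using that B(1) by simp
  qed
  have "f (f b) = A *v b" if "b \<in> B" for b
    using that l[OF that] l0[OF that] by (simp add: fb linear_scale[OF lin])
  then have "(R ** R) *v v = A *v v" for v
  proof -
    have "f (f v) = A *v v"
    proof (rule linear_eq_on_span[of "\<lambda>v. f (f v)" "\<lambda>v. A *v v" B v])
      show "linear (\<lambda>v. f (f v))" using linear_compose[OF lin lin] by (simp add: o_def)
      show "linear ((*v) A)" by simp
    qed (use B(2) \<open>\<And>b. b \<in> B \<Longrightarrow> f (f b) = A *v b\<close> in auto)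
    then show ?thesis by (simp add: R flip: matrix_vector_mul_assoc)
  qed
  then have RR: "R ** R = A" by (simp add: matrix_eq)
  have "(f x) \<bullet> y = x \<bullet> f y" for x y
    unfolding f_def by (simp add: inner_sum_left inner_sum_right algebra_simps inner_commute)
  then have "transpose R = R"
    by (metis R matrix_eq transpose_matrix_vector dot_lmul_matrix vector_eq_rdot)
  moreover have "0 \<le> f x \<bullet> x" for x
    unfolding f_def inner_sum_left by (intro sum_nonneg) (simp add: l0 inner_commute[of x] mult.assoc)
  ultimately have "symmetric_psd R" by (simp add: symmetric_psd_def R)
  then show ?thesis using RR by blast
qed

text \<open>For an eigenvector \<open>b\<close> of \<open>R\<close> with eigenvalue l, S S b = l^2
  b, so the defect w = S b - l b satisfies S w = - l w. Positivity of \<open>S\<close> leaves only w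
  = 0 or l = 0, and in the second case |S b|^2 = <S S b, b> = 0. Together with existence this gives
  a meaning to \<open>matsqrt\<close>, which is a definite description.\<close>

lemma symmetric_psd_sqrt_unique:
  fixes R S :: "real^'n^'n"
  assumes R: "symmetric_psd R" and S: "symmetric_psd S" and eq: "R ** R = S ** S"
  shows "R = S"
proof -
  have symR: "transpose R = R" using R by (simp add: symmetric_psd_def)
  obtain B l where B: "finite B" "span B = UNIV" "pairwise orthogonal B" "\<And>b. b \<in> B \<Longrightarrow> norm b = 1"
    and l: "\<And>b. b \<in> B \<Longrightarrow> R *v b = l b *\<^sub>R b" using symmetric_eigenbasis[OF symR] by blast
  have "S *v b = R *v b" if b: "b \<in> B" for b
  proof -
    have l0: "l b \<ge> 0" using R l[OF b] B(4)[OF b] by (metis inner_scaleR_left mult.right_neutral norm_eq_1 symmetric_psd_def)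
    have S2: "S *v (S *v b) = (l b * l b) *\<^sub>R b"
      by (metis eq l[OF b] matrix_vector_mul_assoc matrix_vector_mult_scaleR scaleR_scaleR)
    define w where "w = S *v b - l b *\<^sub>R b"
    have sw: "S *v w = - l b *\<^sub>R w"
      unfolding w_def by (simp add: S2 matrix_vector_mult_diff_distrib matrix_vector_mult_scaleR algebra_simps)
    have "0 \<le> (S *v w) \<bullet> w" using S by (simp add: symmetric_psd_def)
    then have "l b * (w \<bullet> w) \<le> 0" by (simp add: sw)
    then have "l b = 0 \<or> w = 0" using l0 by (metis inner_gt_zero_iff mult_pos_pos not_less order_less_le)
    then have "w = 0"
    proof
      assume "l b = 0"
      then have "S *v (S *v b) = 0" using S2 by simp
      then have "(S *v b) \<bullet> (S *v b) = 0"
        using symmetric_inner[of S "S *v b" b] S by (simp add: symmetric_psd_def)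
      then show "w = 0" using \<open>l b = 0\<close> by (simp add: w_def)
    qed
    then show ?thesis by (simp add: w_def l[OF b])
  qed
  then have "R *v x = S *v x" for x
    using linear_eq_on_span[of "(*v) R" "(*v) S" B x] B(2) by auto
  then show ?thesis by (simp add: matrix_eq)
qed

lemma matsqrt_properties:
  fixes A :: "real^'n^'n"
  assumes "symmetric_psd A"
  shows "symmetric_psd (matsqrt A)" "matsqrt A ** matsqrt A = A"
proof -
  have "\<exists>!R. symmetric_psd R \<and> R ** R = A"
    using symmetric_psd_sqrt_exists[OF assms] symmetric_psd_sqrt_unique by metis
  from theI'[OF this] show "symmetric_psd (matsqrt A)" "matsqrt A ** matsqrt A = A"
    unfolding matsqrt_def by auto
qed

lemma norm_matsqrt:
  fixes A :: "real^'n^'n"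
  assumes "symmetric_psd A"
  shows "(norm (matsqrt A *v x))\<^sup>2 = (A *v x) \<bullet> x"
  using matsqrt_properties[OF assms] symmetric_inner[of "matsqrt A"]
  by (metis matrix_vector_mul_assoc power2_norm_eq_inner symmetric_psd_def)

text \<open>The last assumption says that \<xi> is orthogonal to all columns of the Kalman matrix.
  Full rank makes these columns span the space, so \<xi> is itself a combination of them and hence
  orthogonal to itself.\<close>

lemma kalman_kernel_trivial:
  fixes Q B :: "real^'n^'n"
  assumes "symmetric_psd Q" "rank (kalman_matrix Q B) = CARD('n)"
    and z: "\<And>i :: 'n. matsqrt Q *v (transpose (matpow B (to_nat_on UNIV i)) *v \<xi>) = 0"
  shows "\<xi> = 0"
proof -
  obtain v where v: "kalman_matrix Q B *v v = \<xi>"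
    using full_rank_surjective[of "kalman_matrix Q B"] assms(2) by (metis surjD)
  have "\<xi> v* kalman_matrix Q B = 0"
  proof (simp add: vec_eq_iff, intro allI)
    fix k l :: 'n
    define M where "M = matpow B (to_nat_on (UNIV :: 'n set) k) ** matsqrt Q"
    have "transpose M *v \<xi> = 0"
      using z[of k] matsqrt_properties(1)[OF assms(1)]
      by (simp add: M_def matrix_transpose_mul symmetric_psd_def flip: matrix_vector_mul_assoc)
    then have "(transpose M *v \<xi>) $ l = 0" by simp
    then show "(\<xi> v* kalman_matrix Q B) $ (k, l) = 0"
      by (simp add: kalman_matrix_def vector_matrix_mult_def matrix_vector_mult_def transpose_def M_def mult.commute)
  qed
  then have "\<xi> \<bullet> (kalman_matrix Q B *v v) = 0" by (simp flip: dot_lmul_matrix)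
  then show ?thesis using v by simp
qed

section \<open>The matrix exponential\<close>

lemma has_vector_derivative_vec_nth:
  fixes f :: "real \<Rightarrow> 'a::real_normed_vector^'n"
  assumes "\<And>i. ((\<lambda>s. f s $ i) has_vector_derivative d $ i) (at s)"
  shows "(f has_vector_derivative d) (at s)"
proof -
  have "((\<lambda>y. (\<chi> i. ((f y $ i - f s $ i) - (y - s) *\<^sub>R d $ i) /\<^sub>R norm (y - s))) \<longlongrightarrow> (\<chi> i. 0)) (at s)"
    using assms by (intro tendsto_vec_lambda) (auto simp: has_vector_derivative_def has_derivative_at_within)
  moreover have "(\<chi> i. ((f y $ i - f s $ i) - (y - s) *\<^sub>R d $ i) /\<^sub>R norm (y - s)) = ((f y - f s) - (y - s) *\<^sub>R d) /\<^sub>R norm (y - s)" for y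
    by (simp add: vec_eq_iff)
  moreover have "(\<chi> i. 0) = (0 :: 'a^'n)" by (simp add: vec_eq_iff)
  ultimately show ?thesis
    by (simp add: has_vector_derivative_def has_derivative_at_within bounded_linear_scaleR_left)
qed

lemma bounded_bilinear_matrix_mult: "bounded_bilinear ((**) :: real^'n^'m \<Rightarrow> real^'p^'n \<Rightarrow> real^'p^'m)"
  unfolding bilinear_conv_bounded_bilinear[symmetric] bilinear_def
  by (intro conjI allI linearI)
    (simp_all add: vec_eq_iff matrix_matrix_mult_def sum.distrib algebra_simps sum_distrib_left)

lemma bounded_bilinear_matrix_vector_mult: "bounded_bilinear ((*v) :: real^'n^'m \<Rightarrow> real^'n \<Rightarrow> real^'m)"
  unfolding bilinear_conv_bounded_bilinear[symmetric] bilinear_def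
  by (intro conjI allI linearI)
    (simp_all add: vec_eq_iff matrix_vector_mult_def sum.distrib algebra_simps sum_distrib_left)

lemma bounded_linear_transpose: "bounded_linear (transpose :: real^'n^'m \<Rightarrow> real^'m^'n)"
  by (intro linear_conv_bounded_linear[THEN iffD1] linearI) (simp_all add: vec_eq_iff transpose_def)

lemma matpow_0: "matpow A 0 = mat 1" and matpow_Suc: "matpow A (Suc k) = A ** matpow A k"
  by (simp_all add: matpow_def)

lemma matpow_Suc': "matpow A (Suc k) = matpow A k ** A"
proof (induction k)
  case (Suc k)
  then show ?case by (metis matpow_Suc matrix_mul_assoc)
qed (simp add: matpow_0 matpow_Suc)

lemma matpow_transpose: "matpow (transpose A) k = transpose (matpow A k)"
proof (induction k)
  case (Suc k)
  have "matpow (transpose A) (Suc k) = transpose A ** transpose (matpow A k)" by (simp add: matpow_Suc Suc)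
  also have "\<dots> = transpose (matpow A (Suc k))" by (simp only: matpow_Suc' matrix_transpose_mul)
  finally show ?case .
qed (simp add: matpow_0 transpose_mat)

lemma matpow_scaleR: "matpow (s *\<^sub>R A) k = s ^ k *\<^sub>R matpow A k"
  by (induction k) (simp_all add: matpow_0 matpow_Suc scalar_matrix_assoc[symmetric] matrix_scalar_ac scaleR_matrix_vector_assoc)

text \<open>The bound goes through the action on vectors, where it iterates without loss, and
  reaches the entries via the coordinate vectors. It is what makes the exponential series converge
  entry by entry.\<close>

lemma matpow_bound: "\<exists>K\<ge>1. \<forall>k i j. \<bar>matpow A k $ i $ j\<bar> \<le> K ^ k" for A :: "real^'n^'n"
proof -
  obtain K where K: "\<And>x. norm (A *v x) \<le> norm x * K" "K > 0"
    using bounded_linear.pos_bounded[of "(*v) A"] by auto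
  define L where "L = max 1 K"
  have L: "norm (A *v x) \<le> L * norm x" for x
    using K(1)[of x] by (smt (verit) L_def max.cobounded2 mult.commute mult_left_mono norm_ge_zero)
  have L1: "L \<ge> 1" by (simp add: L_def)
  have pw: "norm (matpow A k *v x) \<le> L ^ k * norm x" for k x
  proof (induction k)
    case (Suc k)
    have "norm (matpow A (Suc k) *v x) \<le> L * norm (matpow A k *v x)"
      using L by (simp add: matpow_Suc flip: matrix_vector_mul_assoc)
    also have "\<dots> \<le> L * (L ^ k * norm x)" using Suc L1 by (intro mult_left_mono) auto
    finally show ?case by simp
  qed (simp add: matpow_0)
  have "\<bar>matpow A k $ i $ j\<bar> \<le> L ^ k" for k i j
  proof -
    have "matpow A k $ i $ j = (matpow A k *v axis j 1) $ i"
      by (simp add: matrix_vector_mult_basis column_def)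
    also have "\<bar>\<dots>\<bar> \<le> norm (matpow A k *v axis j 1)" by (rule component_le_norm_cart)
    also have "\<dots> \<le> L ^ k" using pw[of k "axis j 1"] by simp
    finally show ?thesis .
  qed
  with L1 show ?thesis by blast
qed

lemma matpow_series_summable: "summable (\<lambda>k. matpow A k $ i $ j / fact k * s ^ k)" for A :: "real^'n^'n"
proof -
  obtain K where K: "\<And>k i j. \<bar>matpow A k $ i $ j\<bar> \<le> K ^ k" using matpow_bound[of A] by blast
  show ?thesis
  proof (rule summable_comparison_test'[where N = 0])
    show "summable (\<lambda>k. (K * \<bar>s\<bar>) ^ k /\<^sub>R fact k)" by (rule summable_exp_generic)
    show "norm (matpow A k $ i $ j / fact k * s ^ k) \<le> (K * \<bar>s\<bar>) ^ k /\<^sub>R fact k" for k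
      using mult_right_mono[OF K[of k i j], of "\<bar>s\<bar> ^ k"]
      by (simp add: abs_mult power_abs power_mult_distrib divide_simps)
  qed
qed

text \<open>Each entry of exp (s A) is a real power series in s, so differentiation and the Taylor
  remainder become termwise statements about real series.\<close>

lemma matexp_nth: "matexp (s *\<^sub>R A) $ i $ j = (\<Sum>k. matpow A k $ i $ j / fact k * s ^ k)"
  for A :: "real^'n^'n"
proof -
  define S where "S = (\<chi> i j. \<Sum>k. matpow A k $ i $ j / fact k * s ^ k)"
  have "(\<lambda>k. (1 / fact k) *\<^sub>R matpow (s *\<^sub>R A) k) sums S"
    unfolding sums_def
  proof (intro vec_tendstoI)
    fix i j
    show "(\<lambda>n. (\<Sum>k<n. (1 / fact k) *\<^sub>R matpow (s *\<^sub>R A) k) $ i $ j) \<longlonglongrightarrow> S $ i $ j"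
      using summable_sums[OF matpow_series_summable[of A i j s]]
      by (simp add: S_def sums_def matpow_scaleR mult.commute)
  qed
  then have "matexp (s *\<^sub>R A) = S" unfolding matexp_def by (rule sums_unique[symmetric])
  then show ?thesis by (simp add: S_def)
qed

lemma matexp_transpose: "matexp (s *\<^sub>R transpose A) = transpose (matexp (s *\<^sub>R A))"
  for A :: "real^'n^'n"
  by (simp add: vec_eq_iff transpose_def[of "matexp _"] matexp_nth matpow_transpose)
     (simp add: transpose_def)

lemma matexp_0: "matexp (0 *\<^sub>R A) = mat 1" for A :: "real^'n^'n"
proof -
  have "matexp (0 *\<^sub>R A) $ i $ j = mat 1 $ i $ j" for i j
    unfolding matexp_nth using suminf_finite[of "{0}" "\<lambda>k. matpow A k $ i $ j / fact k * 0 ^ k"]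
    by (simp add: matpow_0)
  then show ?thesis by (simp add: vec_eq_iff)
qed

lemma matexp_nth_derivative:
  fixes A :: "real^'n^'n"
  shows "((\<lambda>s. matexp (s *\<^sub>R A) $ i $ j) has_real_derivative
     (\<Sum>k. matpow A (Suc k) $ i $ j / fact k * s ^ k)) (at s)"
proof -
  have "diffs (\<lambda>k. matpow A k $ i $ j / fact k) = (\<lambda>k. matpow A (Suc k) $ i $ j / fact k)"
    by (simp add: fun_eq_iff diffs_def divide_simps)
  then show ?thesis unfolding matexp_nth
    using termdiffs_strong_converges_everywhere[of "\<lambda>k. matpow A k $ i $ j / fact k" s] matpow_series_summable[of A i j]
    by simp
qed

lemma matexp_derivative_series:
  fixes A :: "real^'n^'n"
  shows "(\<Sum>k. matpow A (Suc k) $ i $ j / fact k * s ^ k) = (A ** matexp (s *\<^sub>R A)) $ i $ j"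
    and "(\<Sum>k. matpow A (Suc k) $ i $ j / fact k * s ^ k) = (matexp (s *\<^sub>R A) ** A) $ i $ j"
proof -
  have "(\<Sum>k. matpow A (Suc k) $ i $ j / fact k * s ^ k) = (\<Sum>k. \<Sum>l\<in>UNIV. A $ i $ l * (matpow A k $ l $ j / fact k * s ^ k))"
    by (simp add: matpow_Suc matrix_matrix_mult_def sum_divide_distrib sum_distrib_right mult.assoc)
  also have "\<dots> = (\<Sum>l\<in>UNIV. \<Sum>k. A $ i $ l * (matpow A k $ l $ j / fact k * s ^ k))"
    by (intro suminf_sum summable_mult matpow_series_summable)
  finally show "(\<Sum>k. matpow A (Suc k) $ i $ j / fact k * s ^ k) = (A ** matexp (s *\<^sub>R A)) $ i $ j"
    by (simp only: matrix_matrix_mult_def matexp_nth suminf_mult[OF matpow_series_summable] vec_lambda_beta)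
  have "(\<Sum>k. matpow A (Suc k) $ i $ j / fact k * s ^ k) = (\<Sum>k. \<Sum>l\<in>UNIV. A $ l $ j * (matpow A k $ i $ l / fact k * s ^ k))"
    by (simp add: matpow_Suc' matrix_matrix_mult_def sum_divide_distrib sum_distrib_right sum_distrib_left mult_ac)
  also have "\<dots> = (\<Sum>l\<in>UNIV. \<Sum>k. A $ l $ j * (matpow A k $ i $ l / fact k * s ^ k))"
    by (intro suminf_sum summable_mult matpow_series_summable)
  finally show "(\<Sum>k. matpow A (Suc k) $ i $ j / fact k * s ^ k) = (matexp (s *\<^sub>R A) ** A) $ i $ j"
    by (simp only: matrix_matrix_mult_def matexp_nth suminf_mult[OF matpow_series_summable] vec_lambda_beta mult.commute[of "A $ _ $ _" "suminf _"])
qed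

lemma matexp_commute: "A ** matexp (s *\<^sub>R A) = matexp (s *\<^sub>R A) ** A" for A :: "real^'n^'n"
  by (intro vec_eq_iff[THEN iffD2] allI trans[OF matexp_derivative_series(1)[symmetric] matexp_derivative_series(2)])

lemma matexp_has_derivative:
  fixes A :: "real^'n^'n"
  shows "((\<lambda>s. matexp (s *\<^sub>R A)) has_vector_derivative A ** matexp (s *\<^sub>R A)) (at s)"
proof (intro has_vector_derivative_vec_nth)
  fix i j
  show "((\<lambda>s. matexp (s *\<^sub>R A) $ i $ j) has_vector_derivative (A ** matexp (s *\<^sub>R A)) $ i $ j) (at s)"
    using matexp_nth_derivative[of A i j s]
    unfolding matexp_derivative_series(1) has_real_derivative_iff_has_vector_derivative .
qed

lemma matexp_continuous: "continuous_on S (\<lambda>s. matexp (s *\<^sub>R A))" for A :: "real^'n^'n"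
  by (intro continuous_at_imp_continuous_on ballI has_vector_derivative_continuous[OF matexp_has_derivative])

text \<open>The product exp (- s A) exp ((s + t) A) has derivative zero in s and equals exp (t A) at
  s = 0. The case t = 0 shows that exp (- s A) is the inverse of exp (s A), which is then moved to
  the other side.\<close>

lemma matexp_add: "matexp ((s + t) *\<^sub>R A) = matexp (s *\<^sub>R A) ** matexp (t *\<^sub>R A)"
  for A :: "real^'n^'n"
proof -
  have neg: "((\<lambda>s. matexp ((- s) *\<^sub>R A)) has_vector_derivative - (matexp ((- s) *\<^sub>R A) ** A)) (at s)" for s
    using vector_diff_chain_at[OF _ matexp_has_derivative, of uminus "-1" s A]
      matexp_commute[of A "- s"]
    by (simp add: o_def has_vector_derivative_minus[OF has_vector_derivative_id])
  have pos: "((\<lambda>s. matexp ((s + t) *\<^sub>R A)) has_vector_derivative (A ** matexp ((s + t) *\<^sub>R A))) (at s)" for s t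
    using vector_diff_chain_at[OF _ matexp_has_derivative, of "\<lambda>s. s + t" 1 s A]
    by (simp add: o_def has_vector_derivative_add_const has_vector_derivative_id)
  define F where "F t s = matexp ((- s) *\<^sub>R A) ** matexp ((s + t) *\<^sub>R A)" for s t
  have dF: "(F t has_vector_derivative 0) (at s within UNIV)" for s t
  proof -
    have "matexp ((- s) *\<^sub>R A) ** (A ** matexp ((s + t) *\<^sub>R A)) + - (matexp ((- s) *\<^sub>R A) ** A) ** matexp ((s + t) *\<^sub>R A) = 0"
      by (simp add: matrix_mul_assoc bounded_bilinear.minus_left[OF bounded_bilinear_matrix_mult])
    then show ?thesis
      using bounded_bilinear.has_vector_derivative[OF bounded_bilinear_matrix_mult neg[of s] pos[of t s]]
      unfolding F_def[abs_def] by simp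
  qed
  have FF: "F t s = F t 0" for s t
  proof -
    obtain c where c: "\<And>x. x \<in> UNIV \<Longrightarrow> F t x = c"
      by (rule has_vector_derivative_zero_constant[OF convex_UNIV dF]) auto
    then show ?thesis using c[of s] c[of 0] by simp
  qed
  have F: "matexp ((- s) *\<^sub>R A) ** matexp ((s + t) *\<^sub>R A) = matexp (t *\<^sub>R A)" for s t
    using FF[of t s] by (simp add: F_def matexp_0[simplified])
  have inv: "matexp (s *\<^sub>R A) ** matexp ((- s) *\<^sub>R A) = mat 1" for s
    using F[of "- s" 0] by (simp add: matexp_0[simplified])
  have "matexp ((s + t) *\<^sub>R A) = (matexp (s *\<^sub>R A) ** matexp ((- s) *\<^sub>R A)) ** matexp ((s + t) *\<^sub>R A)"
    by (simp only: inv matrix_mul_lid)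
  also have "\<dots> = matexp (s *\<^sub>R A) ** matexp (t *\<^sub>R A)"
    by (simp only: matrix_mul_assoc[symmetric] F)
  finally show ?thesis .
qed

section \<open>Decay of the matrix exponential\<close>

definition complex_matrix :: "real^'n^'m \<Rightarrow> complex^'n^'m"
  where "complex_matrix A = map_matrix complex_of_real A"

lemma complex_matrix_mult: "complex_matrix (A ** B) = complex_matrix A ** complex_matrix B"
  for A :: "real^'n^'m" and B :: "real^'p^'n"
proof (intro vec_eq_iff[THEN iffD2] allI)
  fix i j
  show "complex_matrix (A ** B) $ i $ j = (complex_matrix A ** complex_matrix B) $ i $ j"
    unfolding complex_matrix_def matrix_matrix_mult_def nth_map_matrix vec_lambda_beta of_real_sum of_real_mult
    by (rule refl)
qed

text \<open>Complex vectors, because the eigenvalues of \<open>B\<close> are complex. Rate and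
  constant may depend on \<open>w\<close>, so that decay can be established vector by
  vector.\<close>

definition exp_decaying :: "real^'n^'n \<Rightarrow> complex^'n \<Rightarrow> bool"
  where "exp_decaying B w \<longleftrightarrow> (\<exists>c>0. \<exists>C\<ge>0. \<forall>s\<ge>0. \<forall>i.
    norm ((complex_matrix (matexp (s *\<^sub>R B)) *v w) $ i) \<le> C * exp (- c * s))"

text \<open>Duhamel's formula. With E s = exp (s B), each coordinate z of E s w solves z' = \<mu> z
  + y, where y is the same coordinate of E s (B w - \<mu> w) and decays by assumption. The
  derivative of exp (- \<mu> s) z is exp (- \<mu> s) y, and its integral is bounded.\<close>

lemma exp_decaying_step:
  fixes B :: "real^'n^'n"
  assumes dec: "exp_decaying B (complex_matrix B *v w - \<mu> *s w)" and \<mu>: "Re \<mu> < 0"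
  shows "exp_decaying B w"
proof -
  define E where "E s = complex_matrix (matexp (s *\<^sub>R B))" for s
  note dec[unfolded exp_decaying_def, folded E_def]
  then obtain c C where c: "c > 0" "C \<ge> 0"
    and y0: "\<forall>s\<ge>0. \<forall>i. norm ((E s *v (complex_matrix B *v w - \<mu> *s w)) $ i) \<le> C * exp (- c * s)"
    by (elim exE conjE)
  have y: "norm ((E s *v (complex_matrix B *v w - \<mu> *s w)) $ i) \<le> C * exp (- c * s)" if "s \<ge> 0" for s i
    using y0 that by blast
  define a where "a = - Re \<mu>"
  \<comment> \<open>Strictly below \<open>a = - Re \<mu>\<close>, so that the forcing integrates to
    the finite constant \<open>C / (a - c')\<close> even when the two rates coincide.\<close>
  define c' where "c' = min c a / 2"
  have c': "c' > 0" "c' < a" "c' \<le> c" using c \<mu> by (auto simp: c'_def a_def)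
  define D where "D = norm w + C / (a - c')"
  have wi: "norm (w $ i) \<le> norm w" for i by (rule Finite_Cartesian_Product.norm_nth_le)
  have "norm ((E s *v w) $ i) \<le> D * exp (- c' * s)" if s: "s \<ge> 0" for s i
  proof (cases "s = 0")
    case True
    have "E 0 = mat 1" unfolding E_def matexp_0
      by (simp add: complex_matrix_def vec_eq_iff mat_def)
    then show ?thesis using True c c' wi[of i] by (simp add: D_def add_increasing2)
  next
    case False
    define z where "z s = (E s *v w) $ i" for s
    have zd: "(z has_vector_derivative (E s *v (complex_matrix B *v w)) $ i) (at s)" for s
    proof -
      have "(E s *v (complex_matrix B *v w)) $ i = ((complex_matrix (matexp (s *\<^sub>R B) ** B)) *v w) $ i"
        by (simp add: E_def complex_matrix_mult matrix_vector_mul_assoc)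
      also have "\<dots> = (\<Sum>j\<in>UNIV. complex_of_real ((B ** matexp (s *\<^sub>R B)) $ i $ j) * w $ j)"
        by (simp add: matexp_commute matrix_vector_mult_def complex_matrix_def)
      finally have eq: "(E s *v (complex_matrix B *v w)) $ i = (\<Sum>j\<in>UNIV. complex_of_real ((B ** matexp (s *\<^sub>R B)) $ i $ j) * w $ j)" .
      have "((\<lambda>s. complex_of_real (matexp (s *\<^sub>R B) $ i $ j)) has_vector_derivative complex_of_real ((B ** matexp (s *\<^sub>R B)) $ i $ j)) (at s)" for j
        using matexp_nth_derivative[of B i j s] unfolding matexp_derivative_series(1)
        by (intro has_vector_derivative_of_real) (simp add: has_real_derivative_iff_has_vector_derivative)
      then have "((\<lambda>s. \<Sum>j\<in>UNIV. complex_of_real (matexp (s *\<^sub>R B) $ i $ j) * w $ j) has_vector_derivative (\<Sum>j\<in>UNIV. complex_of_real ((B ** matexp (s *\<^sub>R B)) $ i $ j) * w $ j)) (at s)"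
        by (intro has_vector_derivative_sum has_vector_derivative_mult_left)
      then show ?thesis unfolding eq by (simp add: z_def[abs_def] E_def matrix_vector_mult_def complex_matrix_def)
    qed
    define y where "y s = (E s *v (complex_matrix B *v w - \<mu> *s w)) $ i" for s
    have yz: "(E s *v (complex_matrix B *v w)) $ i = \<mu> * z s + y s" for s
      by (simp add: y_def z_def matrix_vector_mult_diff_distrib vector_scalar_commute)
    have ed: "((\<lambda>s. exp (- \<mu> * of_real s)) has_vector_derivative (- \<mu> * exp (- \<mu> * of_real s))) (at s)" for s
      by (rule has_vector_derivative_real_field) (auto intro!: derivative_eq_intros)
    define f where "f s = exp (- \<mu> * of_real s) * z s" for s
    have fd: "(f has_vector_derivative exp (- \<mu> * of_real s) * y s) (at s)" for s
      using has_vector_derivative_mult[OF ed zd, of s] unfolding f_def[abs_def] yz by (simp add: algebra_simps)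
    define \<phi> where "\<phi> s = C / (a - c') * exp ((a - c') * s)" for s
    have pd: "(\<phi> has_vector_derivative C * exp ((a - c') * s)) (at s)" for s
      unfolding \<phi>_def[abs_def] has_real_derivative_iff_has_vector_derivative[symmetric] using c'
      by (auto intro!: derivative_eq_intros)
    have "norm (f s - f 0) \<le> \<phi> s - \<phi> 0"
    proof (rule differentiable_bound_general)
      show "0 < s" using False s by simp
      show "continuous_on {0..s} f" "continuous_on {0..s} \<phi>"
        by (meson continuous_at_imp_continuous_on has_vector_derivative_continuous fd pd)+
      fix x assume x: "0 < x" "x < s"
      show "(f has_vector_derivative exp (- \<mu> * of_real x) * y x) (at x)" by (rule fd)
      show "(\<phi> has_vector_derivative C * exp ((a - c') * x)) (at x)" by (rule pd)
      have "norm (exp (- \<mu> * of_real x) * y x) = exp (a * x) * norm (y x)"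
        by (simp add: norm_mult a_def)
      also have "\<dots> \<le> exp (a * x) * (C * exp (- c * x))"
        using y[of x i] x by (intro mult_left_mono) (auto simp: y_def)
      also have "\<dots> = C * exp ((a - c) * x)" by (simp add: algebra_simps flip: exp_add)
      also have "\<dots> \<le> C * exp ((a - c') * x)" using x c' c by (intro mult_left_mono) auto
      finally show "norm (exp (- \<mu> * of_real x) * y x) \<le> C * exp ((a - c') * x)" .
    qed
    then have "norm (f s) \<le> norm (f 0) + \<phi> s"
      using norm_triangle_ineq2[of "f s" "f 0"] c c' by (simp add: \<phi>_def) (smt (verit) divide_nonneg_pos)
    moreover have "norm (f s) = exp (a * s) * norm (z s)" by (simp add: f_def norm_mult a_def)
    moreover have "norm (f 0) \<le> norm w"
    proof -
      have "E 0 = mat 1" unfolding E_def matexp_0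
        by (simp add: complex_matrix_def vec_eq_iff mat_def)
      then show ?thesis by (simp add: f_def z_def wi)
    qed
    ultimately have "exp (a * s) * norm (z s) \<le> norm w + \<phi> s" by linarith
    then have "exp (- a * s) * (exp (a * s) * norm (z s)) \<le> exp (- a * s) * (norm w + \<phi> s)"
      by (intro mult_left_mono) auto
    also have "exp (- a * s) * (exp (a * s) * norm (z s)) = norm (z s)"
      by (simp add: mult.assoc[symmetric] flip: exp_add)
    also have "exp (- a * s) * (norm w + \<phi> s) = exp (- a * s) * norm w + C / (a - c') * exp (- c' * s)"
      by (simp add: \<phi>_def algebra_simps flip: exp_add)
    also have "\<dots> \<le> exp (- c' * s) * norm w + C / (a - c') * exp (- c' * s)"
      using c' s by (intro add_mono mult_right_mono) (auto intro: mult_right_mono)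
    finally show ?thesis by (simp add: D_def z_def algebra_simps)
  qed
  moreover have "D \<ge> 0" using c c' by (simp add: D_def)
  ultimately show ?thesis unfolding exp_decaying_def E_def using c' by blast
qed

text \<open>The vector p(M) w, written with the iterates of \<open>w\<close> so that no polynomial
  of a complex matrix has to be formed.\<close>

definition poly_act :: "complex^'n^'n \<Rightarrow> complex poly \<Rightarrow> complex^'n \<Rightarrow> complex^'n"
  where "poly_act M p w = (\<Sum>k\<le>degree p. coeff p k *s (((*v) M) ^^ k) w)"

lemma poly_act_upto: "degree p \<le> m \<Longrightarrow> poly_act M p w = (\<Sum>k\<le>m. coeff p k *s (((*v) M) ^^ k) w)"
  unfolding poly_act_def by (intro sum.mono_neutral_left) (auto simp: coeff_eq_0)

text \<open>Both sides compare coefficients of the iterates of \<open>w\<close>. The first identity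
  peels one root off an annihilating polynomial; the second recognises q(M) w as an
  eigenvector.\<close>

lemma poly_act_linear_factor:
  fixes M :: "complex^'n^'n"
  shows "poly_act M ([:- \<mu>, 1:] * q) w = poly_act M q (M *v w - \<mu> *s w)"
  "poly_act M q (M *v w - \<mu> *s w) = M *v poly_act M q w - \<mu> *s poly_act M q w"
proof -
  let ?f = "\<lambda>k. (((*v) M) ^^ k) w"
  have pw: "(((*v) M) ^^ k) (M *v w - \<mu> *s w) = ?f (Suc k) - \<mu> *s ?f k" for k
  proof (induction k)
    case (Suc k)
    have "(((*v) M) ^^ Suc k) (M *v w - \<mu> *s w) = M *v (?f (Suc k) - \<mu> *s ?f k)" by (simp add: Suc)
    then show ?case by (simp add: matrix_vector_mult_diff_distrib vector_scalar_commute)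
  qed simp
  define m where "m = degree q"
  have act: "poly_act M q (M *v w - \<mu> *s w) = (\<Sum>k\<le>m. coeff q k *s (?f (Suc k) - \<mu> *s ?f k))"
    unfolding m_def poly_act_def pw ..
  have "degree ([:- \<mu>, 1:] * q) \<le> Suc m" unfolding m_def
    by (metis One_nat_def add.commute degree_mult_le degree_pCons_eq_if le_trans nat_add_left_cancel_le one_neq_zero order_refl plus_1_eq_Suc pCons_eq_0_iff degree_1)
  then have "poly_act M ([:- \<mu>, 1:] * q) w = (\<Sum>k\<le>Suc m. coeff ([:- \<mu>, 1:] * q) k *s ?f k)"
    by (rule poly_act_upto)
  also have "\<dots> = (\<Sum>k\<le>Suc m. (if k = 0 then 0 else coeff q (k - 1)) *s ?f k) - (\<Sum>k\<le>Suc m. (\<mu> * coeff q k) *s ?f k)"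
    unfolding sum_subtractf[symmetric]
    by (intro sum.cong refl) (auto simp: coeff_pCons vector_sub_rdistrib algebra_simps split: nat.split)
  also have "(\<Sum>k\<le>Suc m. (if k = 0 then 0 else coeff q (k - 1)) *s ?f k) = (\<Sum>k\<le>m. coeff q k *s ?f (Suc k))"
    by (subst sum.atMost_Suc_shift) simp
  also have "(\<Sum>k\<le>Suc m. (\<mu> * coeff q k) *s ?f k) = (\<Sum>k\<le>m. (\<mu> * coeff q k) *s ?f k)"
    by (simp add: coeff_eq_0 m_def)
  finally show "poly_act M ([:- \<mu>, 1:] * q) w = poly_act M q (M *v w - \<mu> *s w)"
    unfolding act by (simp add: sum_subtractf[symmetric] vector_ssub_ldistrib vector_smult_assoc mult.commute)
  have act2: "poly_act M q w = (\<Sum>k\<le>m. coeff q k *s ?f k)" by (simp add: poly_act_def m_def)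
  have Msum: "M *v (\<Sum>k\<in>A. g k) = (\<Sum>k\<in>A. M *v g k)" for g :: "nat \<Rightarrow> complex^'n" and A
    by (induction A rule: infinite_finite_induct) (simp_all add: matrix_vector_right_distrib)
  show "poly_act M q (M *v w - \<mu> *s w) = M *v poly_act M q w - \<mu> *s poly_act M q w"
    unfolding act act2
    by (simp add: sum_subtractf vector_ssub_ldistrib vector_smult_assoc Msum
      vec.scale_sum_right mult.commute vector_scalar_commute)
qed


text \<open>The n + 1 vectors w, M w, ..., M^n w live in dimension n; the coefficients of a linear
  dependence between them are those of the polynomial.\<close>

lemma annihilating_poly_exists:
  fixes M :: "complex^'n^'n"
  shows "\<exists>p. p \<noteq> 0 \<and> poly_act M p w = 0"
proof -
  let ?f = "\<lambda>k. (((*v) M) ^^ k) w"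
  define n where "n = CARD('n)"
  show ?thesis
  \<comment> \<open>Dependence is a property of the set of iterates, which hides repetitions; two
    equal iterates already yield the polynomial X^i - X^j.\<close>
  proof (cases "inj_on ?f {..n}")
    case False
    then obtain i j where ij: "i \<noteq> j" "?f i = ?f j" unfolding inj_on_def by blast
    define p :: "complex poly" where "p = monom 1 i - monom 1 j"
    have "coeff p i = 1" using ij by (simp add: p_def)
    then have "p \<noteq> 0" by auto
    moreover have "poly_act M p w = 0"
    proof -
      have "degree p \<le> max i j" unfolding p_def by (metis degree_diff_le_max degree_monom_eq zero_neq_one)
      then have "poly_act M p w = (\<Sum>k\<le>max i j. coeff p k *s ?f k)" by (rule poly_act_upto)
      also have "\<dots> = (\<Sum>k\<le>max i j. (if k = i then ?f i else 0) - (if k = j then ?f j else 0))"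
        using ij by (intro sum.cong) (auto simp: p_def)
      also have "\<dots> = 0" using ij by (simp add: sum_subtractf)
      finally show ?thesis .
    qed
    ultimately show ?thesis by blast
  next
    case True
    have "vec.dependent (?f ` {..n})"
    proof (rule ccontr)
      assume "\<not> vec.dependent (?f ` {..n})"
      then have "card (?f ` {..n}) \<le> vec.dim (UNIV :: (complex^'n) set)"
        by (intro vec.independent_card_le_dim) auto
      then have "card (?f ` {..n}) \<le> n" unfolding vec_dim_card n_def .
      then show False by (simp add: card_image[OF True])
    qed
    then obtain u where u: "\<exists>v\<in>?f ` {..n}. u v \<noteq> 0" "(\<Sum>v\<in>?f ` {..n}. u v *s v) = 0"
      using vec.dependent_finite[of "?f ` {..n}"] by auto
    define p :: "complex poly" where "p = (\<Sum>k\<le>n. monom (u (?f k)) k)"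
    have cf: "coeff p k = (if k \<le> n then u (?f k) else 0)" for k
      unfolding p_def by (simp add: coeff_sum)
    have "p \<noteq> 0" using u(1) cf by (metis (no_types, lifting) atMost_iff coeff_0 imageE)
    moreover have "degree p \<le> n" by (intro degree_le) (simp add: cf)
    then have "poly_act M p w = (\<Sum>k\<le>n. u (?f k) *s ?f k)" by (simp add: poly_act_upto cf)
    then have "poly_act M p w = 0" using u(2) by (simp add: sum.reindex[OF True])
    ultimately show ?thesis by blast
  qed
qed

text \<open>Induction on the degree, in place of the Jordan form. For a root \<mu> of p = (X -
  \<mu>) q, either q already annihilates w, or q(M) w is an eigenvector for \<mu> and Re \<mu> < 0
  by the spectral assumption. In the second case q annihilates M w - \<mu> w, so that vector decays
  by induction, and \<open>exp_decaying_step\<close> passes the decay on to w.\<close>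

lemma exp_decaying_if_annihilated:
  fixes B :: "real^'n^'n"
  assumes spec: "matspectrum B \<subseteq> {z. Re z < 0}" and "p \<noteq> 0" "poly_act (complex_matrix B) p w = 0"
  shows "exp_decaying B w"
  using assms(2,3)
proof (induction "degree p" arbitrary: p w)
  case 0
  have "coeff p 0 \<noteq> 0" using 0 by (metis leading_coeff_0_iff)
  moreover have "coeff p 0 *s w = 0" using 0 by (simp add: poly_act_def)
  ultimately have "w = 0" using vector_mul_eq_0 by blast
  then show ?case unfolding exp_decaying_def by (intro exI[of _ 1] conjI exI[of _ 0]) auto
next
  case (Suc d)
  have "\<not> constant (poly p)" using Suc.hyps(2) by (simp add: constant_degree)
  then have "\<exists>\<mu>. poly p \<mu> = 0" by (rule Fundamental_Theorem_Algebra.fundamental_theorem_of_algebra)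
  then obtain \<mu> where "poly p \<mu> = 0" ..
  then obtain q where q: "p = [:- \<mu>, 1:] * q" by (auto simp: poly_eq_0_iff_dvd dvd_def)
  have qn: "q \<noteq> 0" using Suc.prems(1) unfolding q by (metis mult_zero_right)
  have "degree p = degree [:- \<mu>, 1:] + degree q" unfolding q by (rule degree_mult_eq) (use qn in auto)
  then have q0: "q \<noteq> 0" "degree q = d" using Suc.hyps(2) qn by auto
  let ?M = "complex_matrix B"
  define u where "u = poly_act ?M q w"
  have 0: "?M *v u - \<mu> *s u = 0" "poly_act ?M q (?M *v w - \<mu> *s w) = 0"
    using Suc.prems(2) poly_act_linear_factor[where M = ?M and \<mu> = \<mu> and q = q and w = w] by (simp_all add: q u_def)
  show ?case
  proof (cases "u = 0")
    case True
    then show ?thesis using Suc.hyps(1)[OF q0(2)[symmetric] q0(1)] by (simp add: u_def)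
  next
    case False
    have "(?M - mat \<mu>) *v u = 0"
    proof -
      have "mat \<mu> *v u = \<mu> *s u"
        by (simp add: vec_eq_iff matrix_vector_mult_def mat_def if_distrib if_distribR cong: if_cong)
      then show ?thesis using 0(1) by (simp add: matrix_vector_mult_diff_rdistrib)
    qed
    then have "\<not> invertible (?M - mat \<mu>)" using False
      by (metis invertible_def matrix_vector_mul_assoc matrix_vector_mul_lid matrix_vector_mult_0_right)
    then have "Re \<mu> < 0" using spec by (auto simp: matspectrum_def complex_matrix_def)
    moreover have "exp_decaying B (?M *v w - \<mu> *s w)"
      using Suc.hyps(1)[OF q0(2)[symmetric] q0(1)] 0(2) by blast
    ultimately show ?thesis using exp_decaying_step by blast
  qed
qed

lemma norm_matrix_le_sum: "norm A \<le> (\<Sum>i\<in>UNIV. \<Sum>j\<in>UNIV. \<bar>A $ i $ j\<bar>)" for A :: "real^'n^'m"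
proof -
  have "norm A \<le> (\<Sum>i\<in>UNIV. norm (A $ i))" unfolding norm_vec_def[of A] by (intro L2_set_le_sum) auto
  also have "\<dots> \<le> (\<Sum>i\<in>UNIV. \<Sum>j\<in>UNIV. \<bar>A $ i $ j\<bar>)" by (intro sum_mono norm_le_l1_cart)
  finally show ?thesis .
qed

text \<open>Each column, the image of a coordinate vector, decays with its own rate; there are
  finitely many columns, so the least rate serves for all.\<close>

lemma matexp_decay:
  fixes B :: "real^'n^'n"
  assumes spec: "matspectrum B \<subseteq> {z. Re z < 0}"
  shows "\<exists>c>0. \<exists>C>0. \<forall>s\<ge>0. norm (matexp (s *\<^sub>R B)) \<le> C * exp (- c * s)"
proof -
  have "exp_decaying B (axis j 1)" for j
    using exp_decaying_if_annihilated[OF spec] annihilating_poly_exists by blast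
  then have "\<exists>p. fst p > 0 \<and> snd p \<ge> 0 \<and> (\<forall>s\<ge>0. \<forall>i.
      \<bar>matexp (s *\<^sub>R B) $ i $ j\<bar> \<le> snd p * exp (- fst p * s))" for j
  proof -
    have e: "norm ((complex_matrix M *v axis j 1) $ i) = \<bar>M $ i $ j\<bar>" for M :: "real^'n^'n" and i
      by (simp add: matrix_vector_mult_def complex_matrix_def axis_def if_distrib[of "\<lambda>x. _ * x"] cong: if_cong)
    from \<open>exp_decaying B (axis j 1)\<close> obtain c C where "c > 0" "C \<ge> 0"
      "\<forall>s\<ge>0. \<forall>i. \<bar>matexp (s *\<^sub>R B) $ i $ j\<bar> \<le> C * exp (- c * s)"
      unfolding exp_decaying_def e by (elim exE conjE)
    then show ?thesis by (intro exI[of _ "(c, C)"]) simp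
  qed
  then have "\<forall>j. \<exists>p. fst p > 0 \<and> snd p \<ge> 0 \<and> (\<forall>s\<ge>0. \<forall>i.
      \<bar>matexp (s *\<^sub>R B) $ i $ j\<bar> \<le> snd p * exp (- fst p * s))" by blast
  from choice[OF this] obtain f where f: "\<forall>j. fst (f j) > 0 \<and> snd (f j) \<ge> 0 \<and> (\<forall>s\<ge>0. \<forall>i.
      \<bar>matexp (s *\<^sub>R B) $ i $ j\<bar> \<le> snd (f j) * exp (- fst (f j) * s))" by (elim exE)
  define c where "c j = fst (f j)" for j
  define C where "C j = snd (f j)" for j
  have c: "c j > 0" "C j \<ge> 0"
    and b: "s \<ge> 0 \<Longrightarrow> \<bar>matexp (s *\<^sub>R B) $ i $ j\<bar> \<le> C j * exp (- c j * s)" for j s i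
    using f by (auto simp: c_def C_def)
  define c0 where "c0 = Min (range c)"
  have c0: "c0 > 0" "\<And>j. c0 \<le> c j" using c(1) by (auto simp: c0_def)
  define K where "K = (\<Sum>i\<in>(UNIV :: 'n set). \<Sum>j\<in>UNIV. C j) + 1"
  have "norm (matexp (s *\<^sub>R B)) \<le> K * exp (- c0 * s)" if s: "s \<ge> 0" for s
  proof -
    have "norm (matexp (s *\<^sub>R B)) \<le> (\<Sum>i\<in>UNIV. \<Sum>j\<in>UNIV. \<bar>matexp (s *\<^sub>R B) $ i $ j\<bar>)"
      by (rule norm_matrix_le_sum)
    also have "\<dots> \<le> (\<Sum>i\<in>(UNIV :: 'n set). \<Sum>j\<in>UNIV. C j * exp (- c0 * s))"
    proof (intro sum_mono)
      fix i j
      have "\<bar>matexp (s *\<^sub>R B) $ i $ j\<bar> \<le> C j * exp (- c j * s)" using b s by blast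
      also have "\<dots> \<le> C j * exp (- c0 * s)" using c0 c s by (intro mult_left_mono) (auto intro: mult_right_mono)
      finally show "\<bar>matexp (s *\<^sub>R B) $ i $ j\<bar> \<le> C j * exp (- c0 * s)" .
    qed
    also have "\<dots> \<le> K * exp (- c0 * s)" by (simp add: K_def distrib_right sum_distrib_right mult.assoc)
    finally show ?thesis .
  qed
  moreover have "K > 0" using c(2) by (simp add: K_def add_nonneg_pos sum_nonneg)
  ultimately show ?thesis using c0(1) by blast
qed

section \<open>The covariance matrices\<close>

text \<open>A continuous positive form attains a positive minimum on the compact unit sphere, and
  homogeneity extends the bound.\<close>

lemma quadratic_form_lower_bound:
  fixes F :: "real^'n \<Rightarrow> real"
  assumes cont: "continuous_on UNIV F" and hom: "\<And>a x. F (a *\<^sub>R x) = a\<^sup>2 * F x" and pos: "\<And>x. x \<noteq> 0 \<Longrightarrow> F x > 0"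
  shows "\<exists>k>0. \<forall>x. k * (norm x)\<^sup>2 \<le> F x"
proof -
  obtain u where u: "u \<in> sphere 0 1" "\<And>y. y \<in> sphere 0 1 \<Longrightarrow> F u \<le> F y"
    using continuous_attains_inf[of "sphere (0 :: real^'n) 1" F] continuous_on_subset[OF cont] by auto
  have "F u * (norm x)\<^sup>2 \<le> F x" for x
  proof (cases "x = 0")
    case True then show ?thesis using hom[of 0 x] by simp
  next
    case False
    then have "F u \<le> F ((1 / norm x) *\<^sub>R x)" by (intro u(2)) simp
    also have "\<dots> = F x / (norm x)\<^sup>2" by (simp add: hom power_divide)
    finally show ?thesis using False by (simp add: field_simps)
  qed
  moreover have "F u > 0" using u(1) by (intro pos) auto
  ultimately show ?thesis by blast
qed

lemma has_integral_power_0: "t \<ge> 0 \<Longrightarrow> ((\<lambda>s. s ^ m) has_integral (t ^ Suc m / real (Suc m))) {0..t}"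
  for t :: real
proof -
  assume t: "t \<ge> 0"
  have "((\<lambda>s. s ^ m) has_integral (t ^ Suc m / real (Suc m) - 0 ^ Suc m / real (Suc m))) {0..t}"
  proof (rule fundamental_theorem_of_calculus[OF t])
    fix x assume "x \<in> {0..t}"
    have "((\<lambda>s. s ^ Suc m / real (Suc m)) has_real_derivative x ^ m) (at x within {0..t})"
      by (auto intro!: derivative_eq_intros simp del: power_Suc of_nat_Suc)
    then show "((\<lambda>s. s ^ Suc m / real (Suc m)) has_vector_derivative x ^ m) (at x within {0..t})"
      by (simp add: has_real_derivative_iff_has_vector_derivative)
  qed
  then show ?thesis by simp
qed

text \<open>The zero-based enumeration that also orders the blocks of \<open>kalman_matrix\<close>.
  It lets the one type \<open>'n\<close> serve both for coordinates and for the exponents 0, ..., n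
  - 1 of a polynomial.\<close>

definition ix :: "'n::finite \<Rightarrow> nat" where "ix = to_nat_on UNIV"

lemma ix_bij: "bij_betw (ix :: 'n::finite \<Rightarrow> nat) UNIV {..<CARD('n)}"
  unfolding ix_def using to_nat_on_finite[of "UNIV :: 'n set"] by (simp add: atLeast0LessThan)

lemma ix_less: "ix (i :: 'n::finite) < CARD('n)"
  using ix_bij[where 'n='n] by (auto simp: bij_betw_def)

lemma ix_inj: "ix i = ix j \<longleftrightarrow> i = (j :: 'n::finite)"
  using ix_bij[where 'n='n] by (auto simp: bij_betw_def inj_on_def)

text \<open>The quadratic form of the Hilbert matrix, with entries 1 / (i + j + 1): the integral
  over [0, 1] of the square of the polynomial with coefficients \<open>b\<close>.\<close>

definition hilbert_form :: "real^'n \<Rightarrow> real"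
  where "hilbert_form b = (\<Sum>i\<in>UNIV. \<Sum>j\<in>UNIV. b $ i * b $ j / real (Suc (ix i + ix j)))"

lemma poly_square_integral:
  fixes a :: "real^'n"
  assumes t: "t \<ge> 0"
  shows "((\<lambda>s. (\<Sum>i\<in>UNIV. a $ i * s ^ ix i)\<^sup>2) has_integral (t * hilbert_form (\<chi> i. a $ i * t ^ ix i))) {0..t}"
proof -
  have "((\<lambda>s. \<Sum>i\<in>UNIV. \<Sum>j\<in>UNIV. (a $ i * a $ j) * s ^ (ix i + ix j)) has_integral
     (\<Sum>i\<in>UNIV. \<Sum>j\<in>UNIV. (a $ i * a $ j) * (t ^ Suc (ix i + ix j) / real (Suc (ix i + ix j))))) {0..t}"
    by (intro has_integral_sum has_integral_mult_right has_integral_power_0 t) auto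
  moreover have "(\<Sum>i\<in>UNIV. \<Sum>j\<in>UNIV. (a $ i * a $ j) * s ^ (ix i + ix j)) = (\<Sum>i\<in>UNIV. a $ i * s ^ ix i)\<^sup>2" for s
    unfolding power2_eq_square sum_product by (simp add: power_add mult_ac)
  moreover have "(\<Sum>i\<in>UNIV. \<Sum>j\<in>UNIV. (a $ i * a $ j) * (t ^ Suc (ix i + ix j) / real (Suc (ix i + ix j)))) = t * hilbert_form (\<chi> i. a $ i * t ^ ix i)"
    unfolding hilbert_form_def sum_distrib_left by (simp add: power_add mult_ac)
  ultimately show ?thesis by simp
qed

text \<open>If the form vanishes at \<open>x\<close>, the polynomial with coefficients
  \<open>x\<close> vanishes on all of [0, 1]; it has infinitely many roots and is zero.\<close>

lemma hilbert_form_lower_bound: "\<exists>k>0. \<forall>x :: real^'n. k * (norm x)\<^sup>2 \<le> hilbert_form x"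
proof (rule quadratic_form_lower_bound)
  show "continuous_on UNIV (hilbert_form :: real^'n \<Rightarrow> real)"
    unfolding hilbert_form_def[abs_def] by (intro continuous_intros) auto
  show "hilbert_form (a *\<^sub>R x) = a\<^sup>2 * hilbert_form x" for a and x :: "real^'n"
    unfolding hilbert_form_def sum_distrib_left by (simp add: power2_eq_square mult_ac)
  fix x :: "real^'n" assume x: "x \<noteq> 0"
  define g where "g s = (\<Sum>i\<in>UNIV. x $ i * s ^ ix i)" for s :: real
  have hi: "((\<lambda>s. (g s)\<^sup>2) has_integral hilbert_form x) {0..1}"
    using poly_square_integral[of 1 x] by (simp add: g_def vec_lambda_eta)
  then have "hilbert_form x \<ge> 0" by (rule has_integral_nonneg) simp
  moreover have "hilbert_form x \<noteq> 0"
  proof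
    assume "hilbert_form x = 0"
    with hi have "((\<lambda>s. (g s)\<^sup>2) has_integral 0) (cbox 0 1)" by simp
    then have z: "g s = 0" if "s \<in> {0..1}" for s
    proof -
      have "continuous_on (cbox 0 1) (\<lambda>s. (g s)\<^sup>2)" unfolding g_def by (intro continuous_intros)
      from has_integral_0_cbox_imp_0[OF this] \<open>((\<lambda>s. (g s)\<^sup>2) has_integral 0) (cbox 0 1)\<close> that
      show ?thesis by auto
    qed
    define p where "p = (\<Sum>i\<in>UNIV. monom (x $ i) (ix i))"
    have "poly p s = g s" for s by (simp add: p_def g_def poly_sum poly_monom)
    then have "{0..1} \<subseteq> {s. poly p s = 0}" using z by auto
    moreover have "infinite {0..1 :: real}" by (rule infinite_Icc) simp
    ultimately have "infinite {s. poly p s = 0}" using finite_subset by blast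
    then have "p = 0" using poly_roots_finite by blast
    then have "coeff p (ix i) = 0" for i :: 'n by simp
    moreover have "coeff p (ix i) = x $ i" for i
      by (simp add: p_def coeff_sum ix_inj)
    ultimately have "x = 0" by (simp add: vec_eq_iff)
    with x show False by simp
  qed
  ultimately show "hilbert_form x > 0" by simp
qed

text \<open>For s <= 1 every term of the tail carries a factor s^(k+m) <= s^m, so the sum of all
  absolute coefficients serves as the constant.\<close>

lemma matexp_taylor_remainder:
  fixes A :: "real^'n^'n"
  shows "\<exists>M\<ge>0. \<forall>s. 0 \<le> s \<longrightarrow> s \<le> 1 \<longrightarrow>
    norm (matexp (s *\<^sub>R A) - (\<Sum>k<m. (s ^ k / fact k) *\<^sub>R matpow A k)) \<le> M * s ^ m"
proof -
  define c where "c i j k = matpow A k $ i $ j / fact k" for i j k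
  have sm: "summable (\<lambda>k. \<bar>c i j k\<bar>)" for i j
  proof -
    obtain K where K: "\<And>k i j. \<bar>matpow A k $ i $ j\<bar> \<le> K ^ k" using matpow_bound[of A] by blast
    show ?thesis
    proof (rule summable_comparison_test'[where N = 0])
      show "summable (\<lambda>k. K ^ k /\<^sub>R fact k)" by (rule summable_exp_generic)
      show "norm \<bar>c i j k\<bar> \<le> K ^ k /\<^sub>R fact k" for k using K[of k i j] by (simp add: c_def divide_simps)
    qed
  qed
  define M where "M = (\<Sum>i\<in>UNIV. \<Sum>j\<in>UNIV. \<Sum>k. \<bar>c i j k\<bar>)"
  have "norm (matexp (s *\<^sub>R A) - (\<Sum>k<m. (s ^ k / fact k) *\<^sub>R matpow A k)) \<le> M * s ^ m" if s: "0 \<le> s" "s \<le> 1" for s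
  proof -
    let ?D = "matexp (s *\<^sub>R A) - (\<Sum>k<m. (s ^ k / fact k) *\<^sub>R matpow A k)"
    have ent: "\<bar>?D $ i $ j\<bar> \<le> (\<Sum>k. \<bar>c i j k\<bar>) * s ^ m" for i j
    proof -
      have s1: "summable (\<lambda>k. c i j k * s ^ k)" unfolding c_def by (rule matpow_series_summable)
      have "?D $ i $ j = (\<Sum>k. c i j k * s ^ k) - (\<Sum>k<m. c i j k * s ^ k)"
        by (simp add: matexp_nth c_def mult.commute)
      also have "\<dots> = (\<Sum>k. c i j (k + m) * s ^ (k + m))"
        using suminf_split_initial_segment[OF s1, of m] by simp
      also have "norm \<dots> \<le> (\<Sum>k. \<bar>c i j (k + m)\<bar> * s ^ m)"
      proof (rule norm_suminf_le)
        show "summable (\<lambda>k. \<bar>c i j (k + m)\<bar> * s ^ m)" by (intro summable_mult2 summable_ignore_initial_segment sm)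
        fix k
        have "s ^ (k + m) \<le> s ^ m" using s by (intro power_decreasing) auto
        then show "norm (c i j (k + m) * s ^ (k + m)) \<le> \<bar>c i j (k + m)\<bar> * s ^ m"
          using s by (simp add: abs_mult mult_left_mono)
      qed
      also have "\<dots> = (\<Sum>k. \<bar>c i j (k + m)\<bar>) * s ^ m"
        by (intro suminf_mult2[symmetric] summable_ignore_initial_segment sm)
      also have "(\<Sum>k. \<bar>c i j (k + m)\<bar>) \<le> (\<Sum>k. \<bar>c i j k\<bar>)"
        using suminf_split_initial_segment[OF sm[of i j], of m] by (simp add: sum_nonneg)
      finally show ?thesis using s by (simp add: mult_right_mono)
    qed
    have "norm ?D \<le> (\<Sum>i\<in>UNIV. \<Sum>j\<in>UNIV. \<bar>?D $ i $ j\<bar>)" by (rule norm_matrix_le_sum)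
    also have "\<dots> \<le> (\<Sum>i\<in>UNIV. \<Sum>j\<in>UNIV. (\<Sum>k. \<bar>c i j k\<bar>) * s ^ m)" by (intro sum_mono ent)
    also have "\<dots> = M * s ^ m" by (simp add: M_def sum_distrib_right)
    finally show ?thesis .
  qed
  moreover have "M \<ge> 0" unfolding M_def using sm by (intro sum_nonneg suminf_nonneg) auto
  ultimately show ?thesis by blast
qed

lemma norm_transpose_mult_le: "\<exists>K>0. \<forall>(A :: real^'n^'n) x. norm (transpose A *v x) \<le> K * norm A * norm x"
proof -
  obtain K1 where K1: "K1 > 0" "\<forall>(A :: real^'n^'n) x. norm (A *v x) \<le> norm A * norm x * K1"
    using bounded_bilinear.pos_bounded[OF bounded_bilinear_matrix_vector_mult] by (elim exE conjE)
  obtain K2 where K2: "K2 > 0" "\<forall>A :: real^'n^'n. norm (transpose A) \<le> norm A * K2"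
    using bounded_linear.pos_bounded[OF bounded_linear_transpose] by (elim exE conjE)
  show ?thesis
  proof (intro exI conjI allI)
    show "0 < K1 * K2" using K1(1) K2(1) by (rule mult_pos_pos)
    fix A :: "real^'n^'n" and x
    have "norm (transpose A *v x) \<le> norm (transpose A) * norm x * K1" using K1(2) by (elim allE)
    also have "\<dots> \<le> (norm A * K2) * norm x * K1"
      by (rule mult_right_mono[OF mult_right_mono[OF K2(2)[rule_format] norm_ge_zero] less_imp_le[OF K1(1)]])
    also have "\<dots> = (K1 * K2) * norm A * norm x" by (simp only: mult_ac)
    finally show "norm (transpose A *v x) \<le> (K1 * K2) * norm A * norm x" .
  qed
qed

locale ornstein_uhlenbeck =
  fixes Q B :: "real^'n^'n"
  assumes psd: "symmetric_psd Q"
    and kalman: "rank (kalman_matrix Q B) = CARD('n)"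
    and spectrum: "matspectrum B \<subseteq> {z. Re z < 0}"
begin

definition E :: "real \<Rightarrow> real^'n^'n" where "E s = matexp (s *\<^sub>R B)"

text \<open>Equal to |Q^(1/2) exp (s B)^T \<xi>|^2; integrated over [0, t] it becomes the quadratic
  form of \<open>Qt t\<close>.\<close>

definition flow_form :: "real^'n \<Rightarrow> real \<Rightarrow> real"
  where "flow_form \<xi> s = (Q *v (transpose (E s) *v \<xi>)) \<bullet> (transpose (E s) *v \<xi>)"

lemma E_0: "E 0 = mat 1"
  unfolding E_def by (rule matexp_0)

lemma E_add: "E (s + t) = E s ** E t"
  unfolding E_def by (rule matexp_add)

lemma E_continuous: "continuous_on S E"
  unfolding E_def[abs_def] by (rule matexp_continuous)

lemma transpose_E_add: "transpose (E (s + t)) *v \<xi> = transpose (E s) *v (transpose (E t) *v \<xi>)"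
  by (simp add: add.commute[of s t] E_add matrix_transpose_mul matrix_vector_mul_assoc del: transpose_matrix_vector)

lemma transpose_E_derivative:
  "((\<lambda>s. transpose (E s) *v \<xi>) has_vector_derivative transpose B *v (transpose (E s) *v \<xi>)) (at s)"
proof -
  have "((\<lambda>s. E s) has_vector_derivative E s ** B) (at s)"
    unfolding E_def matexp_commute[symmetric] by (rule matexp_has_derivative)
  from bounded_linear.has_vector_derivative[OF bounded_linear_compose[OF
      bounded_bilinear.bounded_linear_left[OF bounded_bilinear_matrix_vector_mult] bounded_linear_transpose] this]
  show ?thesis by (simp add: matrix_transpose_mul matrix_vector_mul_assoc del: transpose_matrix_vector)
qed

lemma transpose_E_continuous: "continuous_on S (\<lambda>s. transpose (E s) *v \<xi>)"
  by (intro continuous_at_imp_continuous_on ballI has_vector_derivative_continuous[OF transpose_E_derivative])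

lemma flow_form_continuous: "continuous_on S (flow_form \<xi>)"
  unfolding flow_form_def[abs_def]
  by (intro continuous_intros transpose_E_continuous bounded_linear.continuous_on[OF matrix_vector_mul_bounded_linear])

lemma flow_form_nonneg: "0 \<le> flow_form \<xi> s"
  using psd by (simp add: flow_form_def symmetric_psd_def)

lemma flow_form_sqrt: "flow_form \<xi> s = (norm (matsqrt Q *v (transpose (E s) *v \<xi>)))\<^sup>2"
  unfolding flow_form_def norm_matsqrt[OF psd] ..

lemma flow_form_shift: "flow_form (transpose (E t) *v \<xi>) s = flow_form \<xi> (s + t)"
  unfolding flow_form_def transpose_E_add ..

lemma E_decay: "\<exists>c>0. \<exists>C>0. \<forall>s\<ge>0. norm (E s) \<le> C * exp (- c * s)"
  unfolding E_def by (rule matexp_decay[OF spectrum])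

lemma kalman_form_lower_bound:
  "\<exists>k>0. \<forall>\<xi>. k * (norm \<xi>)\<^sup>2 \<le> (\<Sum>i\<in>(UNIV :: 'n set). (norm (matsqrt Q *v (transpose (matpow B (ix i)) *v \<xi>)))\<^sup>2)"
proof (rule quadratic_form_lower_bound)
  show "continuous_on UNIV (\<lambda>\<xi>. \<Sum>i\<in>(UNIV :: 'n set). (norm (matsqrt Q *v (transpose (matpow B (ix i)) *v \<xi>)))\<^sup>2)"
    by (intro continuous_intros bounded_linear.continuous_on[OF matrix_vector_mul_bounded_linear])
  show "(\<Sum>i\<in>(UNIV :: 'n set). (norm (matsqrt Q *v (transpose (matpow B (ix i)) *v (a *\<^sub>R \<xi>))))\<^sup>2)
      = a\<^sup>2 * (\<Sum>i\<in>(UNIV :: 'n set). (norm (matsqrt Q *v (transpose (matpow B (ix i)) *v \<xi>)))\<^sup>2)" for a \<xi>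
    by (simp add: matrix_vector_mult_scaleR power_mult_distrib sum_distrib_left)
  fix \<xi> :: "real^'n" assume \<xi>: "\<xi> \<noteq> 0"
  show "(\<Sum>i\<in>(UNIV :: 'n set). (norm (matsqrt Q *v (transpose (matpow B (ix i)) *v \<xi>)))\<^sup>2) > 0"
  proof (rule ccontr)
    assume "\<not> ?thesis"
    then have "(\<Sum>i\<in>(UNIV :: 'n set). (norm (matsqrt Q *v (transpose (matpow B (ix i)) *v \<xi>)))\<^sup>2) = 0"
      by (simp add: order_antisym not_less sum_nonneg)
    then have "\<forall>i\<in>(UNIV :: 'n set). (norm (matsqrt Q *v (transpose (matpow B (ix i)) *v \<xi>)))\<^sup>2 = 0"
      by (subst (asm) sum_nonneg_eq_0_iff) auto
    then have "matsqrt Q *v (transpose (matpow B (to_nat_on UNIV i)) *v \<xi>) = 0" for i :: 'n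
      by (simp add: ix_def)
    then have "\<xi> = 0" by (rule kalman_kernel_trivial[OF psd kalman])
    with \<xi> show False by simp
  qed
qed

text \<open>For small times \<open>E s\<close> is replaced by its Taylor polynomial of degree below
  n. The vector polynomial \<open>P \<xi>\<close> then has the coefficients Q^(1/2) (B^T)^k \<xi> /
  k!, whose squares add up to at least a multiple of |\<xi>|^2 by the rank condition. The Hilbert
  form bounds the integral of its square from below by the coefficients scaled with t^k: the
  smallest squared scale t^(2 (n - 1)) and one t from the integration make the exponent 2 n -
  1.\<close>

lemma flow_form_integral_lower_bound_small:
  "\<exists>c>0. \<exists>t0>0. \<forall>t \<xi>. 0 < t \<longrightarrow> t \<le> t0 \<longrightarrow>
     c * t ^ (2 * CARD('n) - 1) * (norm \<xi>)\<^sup>2 \<le> integral {0..t} (flow_form \<xi>)"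
proof -
  define n where "n = CARD('n)"
  define V where "V = matsqrt Q"
  have n: "n \<ge> 1" unfolding n_def by (simp add: Suc_leI)
  obtain M0 where M0: "M0 \<ge> 0" "\<And>s. 0 \<le> s \<Longrightarrow> s \<le> 1 \<Longrightarrow>
    norm (E s - (\<Sum>k<n. (s ^ k / fact k) *\<^sub>R matpow B k)) \<le> M0 * s ^ n"
    using matexp_taylor_remainder[of B n] unfolding E_def by blast
  obtain K where K: "K > 0" "\<And>(A :: real^'n^'n) x. norm (transpose A *v x) \<le> K * norm A * norm x"
    using norm_transpose_mult_le by blast
  obtain KV where KV: "KV > 0" "\<And>x. norm (V *v x) \<le> norm x * KV"
    using bounded_linear.pos_bounded[OF matrix_vector_mul_bounded_linear[of V]] by blast
  define M where "M = KV * K * M0"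
  have M: "M \<ge> 0" using M0 K KV by (simp add: M_def)
  define a where "a \<xi> k = (1 / fact k) *\<^sub>R (V *v (transpose (matpow B k) *v \<xi>))" for \<xi> k
  define P where "P \<xi> s = (\<Sum>k<n. s ^ k *\<^sub>R a \<xi> k)" for \<xi> s
  have P_eq: "P \<xi> s = V *v (transpose (\<Sum>k<n. (s ^ k / fact k) *\<^sub>R matpow B k) *v \<xi>)" for \<xi> s
  proof -
    have "bounded_linear (\<lambda>A. V *v (transpose A *v \<xi>))"
      by (intro bounded_linear_compose[OF matrix_vector_mul_bounded_linear]
          bounded_linear_compose[OF bounded_bilinear.bounded_linear_left[OF bounded_bilinear_matrix_vector_mult] bounded_linear_transpose])
    from linear_sum[OF bounded_linear.linear[OF this], of "\<lambda>k. (s ^ k / fact k) *\<^sub>R matpow B k" "{..<n}"] linear_scale[OF bounded_linear.linear[OF this]]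
    show ?thesis by (simp add: P_def a_def del: transpose_matrix_vector)
  qed
  have diff: "norm (V *v (transpose (E s) *v \<xi>) - P \<xi> s) \<le> M * s ^ n * norm \<xi>" if s: "0 \<le> s" "s \<le> 1" for s \<xi>
  proof -
    let ?D = "E s - (\<Sum>k<n. (s ^ k / fact k) *\<^sub>R matpow B k)"
    have "transpose ?D *v \<xi> = transpose (E s) *v \<xi> - transpose (\<Sum>k<n. (s ^ k / fact k) *\<^sub>R matpow B k) *v \<xi>"
      by (simp add: vec_eq_iff transpose_def matrix_vector_mult_def left_diff_distrib sum_subtractf)
    then have "V *v (transpose (E s) *v \<xi>) - P \<xi> s = V *v (transpose ?D *v \<xi>)"
      unfolding P_eq by (simp add: matrix_vector_mult_diff_distrib)
    also have "norm \<dots> \<le> norm (transpose ?D *v \<xi>) * KV" by (rule KV(2))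
    also have "\<dots> \<le> (K * norm ?D * norm \<xi>) * KV" using KV by (intro mult_right_mono K(2)) auto
    also have "\<dots> \<le> (K * (M0 * s ^ n) * norm \<xi>) * KV" using M0(2)[OF s] K KV by (intro mult_right_mono mult_left_mono) auto
    finally show ?thesis by (simp add: M_def mult_ac)
  qed
  obtain k1 where k1: "k1 > 0" "\<And>x :: real^'n. k1 * (norm x)\<^sup>2 \<le> hilbert_form x" using hilbert_form_lower_bound by blast
  obtain k2 where k2: "k2 > 0" "\<And>\<xi>. k2 * (norm \<xi>)\<^sup>2 \<le> (\<Sum>i\<in>(UNIV :: 'n set). (norm (V *v (transpose (matpow B (ix i)) *v \<xi>)))\<^sup>2)"
    using kalman_form_lower_bound unfolding V_def by blast
  define k where "k = k1 * k2 / (fact n)\<^sup>2"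
  have k: "k > 0" using k1 k2 by (simp add: k_def)
  have Pc: "continuous_on S (P \<xi>)" for S \<xi> unfolding P_def[abs_def] by (intro continuous_intros)
  have Plow: "k * t ^ (2 * n - 1) * (norm \<xi>)\<^sup>2 \<le> integral {0..t} (\<lambda>s. (norm (P \<xi> s))\<^sup>2)" if t: "0 < t" "t \<le> 1" for t \<xi>
  proof -
    define b where "b l = (\<chi> i :: 'n. a \<xi> (ix i) $ l)" for l
    have Pl: "P \<xi> s $ l = (\<Sum>i\<in>UNIV. b l $ i * s ^ ix i)" for s l
      unfolding P_def b_def n_def using sum.reindex_bij_betw[OF ix_bij[where 'n='n], of "\<lambda>k. s ^ k * a \<xi> k $ l"] by (simp add: mult.commute)
    have "((\<lambda>s. \<Sum>l\<in>UNIV. (P \<xi> s $ l)\<^sup>2) has_integral (\<Sum>l\<in>UNIV. t * hilbert_form (\<chi> i. b l $ i * t ^ ix i))) {0..t}"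
      unfolding Pl using t by (intro has_integral_sum poly_square_integral) auto
    moreover have "(\<Sum>l\<in>UNIV. (P \<xi> s $ l)\<^sup>2) = (norm (P \<xi> s))\<^sup>2" for s
      by (simp add: norm_vec_def L2_set_def sum_nonneg)
    ultimately have I: "integral {0..t} (\<lambda>s. (norm (P \<xi> s))\<^sup>2) = (\<Sum>l\<in>UNIV. t * hilbert_form (\<chi> i. b l $ i * t ^ ix i))"
      by (simp add: integral_unique)
    have "k * t ^ (2 * n - 1) * (norm \<xi>)\<^sup>2 \<le> t ^ (2 * n - 1) * k1 / (fact n)\<^sup>2 * (\<Sum>i\<in>(UNIV :: 'n set). (norm (V *v (transpose (matpow B (ix i)) *v \<xi>)))\<^sup>2)"
      using k2(2)[of \<xi>] t k1 by (simp add: k_def field_simps mult_left_mono)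
    also have "\<dots> \<le> t ^ (2 * n - 1) * k1 * (\<Sum>i\<in>(UNIV :: 'n set). (norm (a \<xi> (ix i)))\<^sup>2)"
    proof -
      have "(norm (V *v (transpose (matpow B (ix i)) *v \<xi>)))\<^sup>2 / (fact n)\<^sup>2 \<le> (norm (a \<xi> (ix i)))\<^sup>2" for i :: 'n
      proof -
        have "fact (ix i) \<le> (fact n :: real)" using ix_less[of i] by (intro fact_mono) (simp add: n_def)
        then have "norm (V *v (transpose (matpow B (ix i)) *v \<xi>)) / fact n \<le> norm (a \<xi> (ix i))"
          by (simp add: a_def divide_inverse mult.commute[of _ "norm _"]) (intro mult_left_mono, auto simp: le_imp_inverse_le)
        then have "(norm (V *v (transpose (matpow B (ix i)) *v \<xi>)) / fact n)\<^sup>2 \<le> (norm (a \<xi> (ix i)))\<^sup>2" by (intro power_mono) auto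
        then show ?thesis by (simp add: power_divide)
      qed
      then have "(\<Sum>i\<in>(UNIV :: 'n set). (norm (V *v (transpose (matpow B (ix i)) *v \<xi>)))\<^sup>2 / (fact n)\<^sup>2) \<le> (\<Sum>i\<in>(UNIV :: 'n set). (norm (a \<xi> (ix i)))\<^sup>2)"
        by (intro sum_mono)
      then have "t ^ (2 * n - 1) * k1 * (\<Sum>i\<in>(UNIV :: 'n set). (norm (V *v (transpose (matpow B (ix i)) *v \<xi>)))\<^sup>2 / (fact n)\<^sup>2) \<le> t ^ (2 * n - 1) * k1 * (\<Sum>i\<in>(UNIV :: 'n set). (norm (a \<xi> (ix i)))\<^sup>2)"
        using t k1 by (intro mult_left_mono) auto
      then show ?thesis by (simp add: sum_divide_distrib[symmetric])
    qed
    also have "\<dots> = (\<Sum>l\<in>UNIV. t * (k1 * (t ^ (2 * n - 2) * (norm (b l))\<^sup>2)))"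
    proof -
      have "(\<Sum>i\<in>(UNIV :: 'n set). (norm (a \<xi> (ix i)))\<^sup>2) = (\<Sum>l\<in>UNIV. (norm (b l))\<^sup>2)"
        unfolding b_def norm_vec_def L2_set_def by (simp add: sum_nonneg) (rule sum.swap)
      moreover have "t ^ (2 * n - 1) = t * t ^ (2 * n - 2)" using n by (metis Suc_diff_le Suc_1 add_leD2 diff_Suc_Suc mult_2 power_Suc le_add1 nat_mult_le_cancel_disj One_nat_def Suc_leI le_trans mult_le_mono2 mult.right_neutral)
      ultimately show ?thesis by (simp only: sum_distrib_left[symmetric]) (simp add: mult_ac)
    qed
    also have "\<dots> \<le> (\<Sum>l\<in>UNIV. t * hilbert_form (\<chi> i. b l $ i * t ^ ix i))"
    proof (intro sum_mono mult_left_mono)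
      fix l
      have "t ^ (2 * n - 2) * (norm (b l))\<^sup>2 \<le> (norm (\<chi> i. b l $ i * t ^ ix i))\<^sup>2"
      proof -
        have "t ^ (2 * n - 2) * (b l $ i)\<^sup>2 \<le> (b l $ i * t ^ ix i)\<^sup>2" for i
        proof -
          have "t ^ (2 * n - 2) \<le> t ^ (2 * ix i)" using t ix_less[of i] by (intro power_decreasing) (auto simp: n_def)
          then have "t ^ (2 * n - 2) \<le> (t ^ ix i)\<^sup>2" by (simp add: power_even_eq)
          then show ?thesis by (simp add: power_mult_distrib mult.commute mult_left_mono)
        qed
        then show ?thesis by (simp add: norm_vec_def L2_set_def sum_nonneg sum_distrib_left sum_mono)
      qed
      then have "k1 * (t ^ (2 * n - 2) * (norm (b l))\<^sup>2) \<le> k1 * (norm (\<chi> i. b l $ i * t ^ ix i))\<^sup>2" using k1 by (intro mult_left_mono) auto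
      also have "\<dots> \<le> hilbert_form (\<chi> i. b l $ i * t ^ ix i)" by (rule k1(2))
      finally show "k1 * (t ^ (2 * n - 2) * (norm (b l))\<^sup>2) \<le> hilbert_form (\<chi> i. b l $ i * t ^ ix i)" .
    qed (use t in auto)
    finally show ?thesis using I by simp
  qed
  \<comment> \<open>The remainder contributes 2 M^2 t^(2 n + 1) |\<xi>|^2, two orders smaller than
    the main term; up to this \<open>t0\<close> it is at most half of it. The added 1 keeps the
    quotient defined when M = 0.\<close>
  define t0 where "t0 = min 1 (k / (4 * (M\<^sup>2 + 1)))"
  have t0: "t0 > 0" "t0 \<le> 1" using k by (auto simp: t0_def add_nonneg_pos)
  have "k / 4 * t ^ (2 * n - 1) * (norm \<xi>)\<^sup>2 \<le> integral {0..t} (flow_form \<xi>)" if t: "0 < t" "t \<le> t0" for t \<xi>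
  proof -
    have t1: "t \<le> 1" using t t0 by simp
    have fi: "flow_form \<xi> integrable_on {0..t}" by (intro integrable_continuous_interval flow_form_continuous)
    define m where "m = M\<^sup>2 * t ^ (2 * n) * (norm \<xi>)\<^sup>2"
    have "integral {0..t} (\<lambda>s. (norm (P \<xi> s))\<^sup>2) \<le> integral {0..t} (\<lambda>s. 2 * flow_form \<xi> s + 2 * m)"
    proof (rule integral_le)
      show "(\<lambda>s. (norm (P \<xi> s))\<^sup>2) integrable_on {0..t}" by (intro integrable_continuous_interval continuous_intros Pc)
      show "(\<lambda>s. 2 * flow_form \<xi> s + 2 * m) integrable_on {0..t}" by (intro integrable_continuous_interval continuous_intros flow_form_continuous)
      fix s assume s: "s \<in> {0..t}"
      let ?f = "V *v (transpose (E s) *v \<xi>)"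
      have "(norm (?f - P \<xi> s))\<^sup>2 \<le> (M * s ^ n * norm \<xi>)\<^sup>2" using diff[of s \<xi>] s t1 by (intro power_mono) auto
      also have "\<dots> \<le> (M * t ^ n * norm \<xi>)\<^sup>2" using s M by (intro power_mono mult_right_mono mult_left_mono) auto
      also have "\<dots> = m" by (simp add: m_def power_mult_distrib power_even_eq)
      finally have d: "(norm (?f - P \<xi> s))\<^sup>2 \<le> m" .
      have "norm (P \<xi> s) \<le> norm ?f + norm (?f - P \<xi> s)" by (metis norm_minus_commute norm_triangle_sub)
      then have "(norm (P \<xi> s))\<^sup>2 \<le> (norm ?f + norm (?f - P \<xi> s))\<^sup>2" by (intro power_mono) auto
      also have "\<dots> \<le> 2 * (norm ?f)\<^sup>2 + 2 * (norm (?f - P \<xi> s))\<^sup>2"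
        using zero_le_power2[of "norm ?f - norm (?f - P \<xi> s)"] by (simp add: power2_eq_square algebra_simps)
      finally show "(norm (P \<xi> s))\<^sup>2 \<le> 2 * flow_form \<xi> s + 2 * m" using d by (simp add: flow_form_sqrt V_def)
    qed
    also have "\<dots> = 2 * integral {0..t} (flow_form \<xi>) + 2 * m * t"
      using fi t by (subst integral_add) (auto simp: integrable_on_cmult_left)
    finally have "k * t ^ (2 * n - 1) * (norm \<xi>)\<^sup>2 \<le> 2 * integral {0..t} (flow_form \<xi>) + 2 * m * t"
      using Plow[OF t(1) t1, of \<xi>] by linarith
    moreover have "2 * m * t \<le> k / 2 * t ^ (2 * n - 1) * (norm \<xi>)\<^sup>2"
    proof -
      have "t * t \<le> t * 1" using t t1 by (intro mult_left_mono) auto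
      also have "\<dots> \<le> k / (4 * (M\<^sup>2 + 1))" using t by (simp add: t0_def)
      finally have "(M\<^sup>2 + 1) * (t * t) \<le> k / 4"
        by (simp add: field_simps add_pos_nonneg add_nonneg_pos)
      moreover have "M\<^sup>2 * (t * t) \<le> (M\<^sup>2 + 1) * (t * t)" by (intro mult_right_mono) auto
      ultimately have "2 * (M\<^sup>2 * (t * t)) \<le> k / 2" by linarith
      then have "2 * (M\<^sup>2 * (t * t)) * (t ^ (2 * n - 1) * (norm \<xi>)\<^sup>2) \<le> k / 2 * (t ^ (2 * n - 1) * (norm \<xi>)\<^sup>2)"
        using t by (intro mult_right_mono) auto
      moreover have "t ^ (2 * n) = t * t ^ (2 * n - 1)" using n by (metis mult_pos_pos pos2 power_minus_mult mult.commute Suc_le_eq One_nat_def)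
      ultimately show ?thesis by (simp add: m_def mult_ac)
    qed
    ultimately show ?thesis by linarith
  qed
  then show ?thesis using k t0 unfolding n_def by (intro exI[of _ "k / 4"] conjI exI[of _ t0]) auto
qed

text \<open>The form is nonnegative, so the integral up to t dominates the one up to
  \<open>q * t\<close>, and \<open>q\<close> is chosen so that \<open>q * t\<close> stays in the
  range of small times. Only the constant suffers, by q^m.\<close>

lemma flow_form_integral_lower_bound:
  assumes "T > 0"
  shows "\<exists>c>0. \<forall>t \<xi>. 0 < t \<longrightarrow> t \<le> T \<longrightarrow>
     c * t ^ (2 * CARD('n) - 1) * (norm \<xi>)\<^sup>2 \<le> integral {0..t} (flow_form \<xi>)"
proof -
  define m where "m = 2 * CARD('n) - 1"
  obtain c t0 where c: "c > 0" "t0 > 0" and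
    lb: "\<And>t \<xi>. 0 < t \<Longrightarrow> t \<le> t0 \<Longrightarrow> c * t ^ m * (norm \<xi>)\<^sup>2 \<le> integral {0..t} (flow_form \<xi>)"
    using flow_form_integral_lower_bound_small unfolding m_def by blast
  define q where "q = min 1 (t0 / T)"
  have q: "0 < q" "q \<le> 1" "q * T \<le> t0" using c assms by (auto simp: q_def min_def field_simps)
  have "c * q ^ m * t ^ m * (norm \<xi>)\<^sup>2 \<le> integral {0..t} (flow_form \<xi>)" if t: "0 < t" "t \<le> T" for t \<xi>
  proof -
    have "q * t \<le> q * T" using q t by (intro mult_left_mono) auto
    then have "q * t \<le> t0" using q(3) by linarith
    then have "c * (q * t) ^ m * (norm \<xi>)\<^sup>2 \<le> integral {0..q * t} (flow_form \<xi>)" using q t by (intro lb) auto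
    also have "\<dots> \<le> integral {0..t} (flow_form \<xi>)"
      using q t mult_right_mono[of q 1 t]
      by (intro integral_subset_le integrable_continuous_interval flow_form_continuous) (auto simp: flow_form_nonneg)
    finally show ?thesis by (simp add: power_mult_distrib mult.assoc)
  qed
  then show ?thesis using c q unfolding m_def by (intro exI[of _ "c * q ^ m"]) (auto simp: m_def)
qed

end

lemma set_integrable_exp_decay:
  fixes c :: real
  assumes "c > 0"
  shows "set_integrable lborel {0..} (\<lambda>s. exp (- c * s))"
proof -
  have "((\<lambda>s. exp (- c * s)) has_integral exp (- c * 0) / c) {0..}"
    by (rule has_integral_exp_minus_to_infinity[OF assms])
  then have "(\<integral>\<^sup>+s. ennreal (exp (- c * s)) * indicator {0..} s \<partial>lborel) = ennreal (exp (- c * 0) / c)"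
    by (intro nn_integral_has_integral_lebesgue') auto
  moreover have "ennreal (norm (indicator {0..} s *\<^sub>R exp (- c * s))) = ennreal (exp (- c * s)) * indicator {0..} s" for s
    by (simp add: indicator_def)
  ultimately show ?thesis unfolding set_integrable_def
    by (intro integrableI_bounded) auto
qed

section \<open>The covariance matrices of infinite and of finite time\<close>

context ornstein_uhlenbeck
begin

definition Qinf :: "real^'n^'n" where "Qinf = Q_infty Q B"

definition covariance_density :: "real \<Rightarrow> real^'n^'n"
  where "covariance_density s = matexp (s *\<^sub>R B) ** Q ** matexp (s *\<^sub>R transpose B)"

lemma covariance_density_form:
  "(covariance_density s *v \<xi>) \<bullet> \<eta> = (Q *v (transpose (E s) *v \<xi>)) \<bullet> (transpose (E s) *v \<eta>)"
proof -
  have "(covariance_density s *v \<xi>) \<bullet> \<eta> = (E s *v (Q *v (transpose (E s) *v \<xi>))) \<bullet> \<eta>"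
    unfolding covariance_density_def matexp_transpose E_def by (simp only: matrix_vector_mul_assoc[symmetric])
  also have "\<dots> = (Q *v (transpose (E s) *v \<xi>)) \<bullet> (transpose (E s) *v \<eta>)"
    by (metis dot_lmul_matrix inner_commute transpose_matrix_vector)
  finally show ?thesis .
qed

lemma covariance_density_integrable: "set_integrable lborel {0..} covariance_density"
proof -
  obtain c C where c: "c > 0" "C > 0" "\<And>s. s \<ge> 0 \<Longrightarrow> norm (E s) \<le> C * exp (- c * s)" using E_decay by blast
  obtain K1 where K1: "K1 > 0" "\<And>(a :: real^'n^'n) (b :: real^'n^'n). norm (a ** b) \<le> norm a * norm b * K1"
    using bounded_bilinear.pos_bounded[OF bounded_bilinear_matrix_mult] by blast
  obtain K2 where K2: "K2 > 0" "\<And>A :: real^'n^'n. norm (transpose A) \<le> norm A * K2"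
    using bounded_linear.pos_bounded[OF bounded_linear_transpose] by blast
  define D where "D = C * norm Q * K1 * (C * K2) * K1"
  have D: "D \<ge> 0" using c K1(1) K2(1) by (simp add: D_def)
  have eq: "covariance_density s = (E s ** Q) ** transpose (E s)" for s
    unfolding covariance_density_def E_def matexp_transpose ..
  have bound: "norm (covariance_density s) \<le> D * exp (- c * s)" if s: "s \<ge> 0" for s
  proof -
    have n1: "norm (E s ** Q) \<le> C * exp (- c * s) * norm Q * K1"
      by (rule order_trans[OF K1(2)]) (use c(3)[OF s] K1(1) in \<open>intro mult_right_mono, auto\<close>)
    have "norm (transpose (E s)) \<le> C * exp (- c * s) * K2"
      by (rule order_trans[OF K2(2)]) (use c(3)[OF s] K2(1) in \<open>intro mult_right_mono, auto\<close>)
    \<comment> \<open>Decay of one exponential factor is enough for integrability; this one is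
      merely bounded.\<close>
    also have "\<dots> \<le> C * K2" using c s K2(1) by (simp add: mult_left_le)
    finally have n2: "norm (transpose (E s)) \<le> C * K2" .
    have "norm (covariance_density s) \<le> norm (E s ** Q) * norm (transpose (E s)) * K1" unfolding eq by (rule K1(2))
    also have "\<dots> \<le> (C * exp (- c * s) * norm Q * K1) * (C * K2) * K1"
      using n1 n2 K1(1) c by (intro mult_right_mono mult_mono) auto
    finally show ?thesis by (simp add: D_def mult_ac)
  qed
  have "continuous_on UNIV covariance_density"
    unfolding eq[abs_def] by (intro bounded_bilinear.continuous_on[OF bounded_bilinear_matrix_mult] E_continuous continuous_on_const
        bounded_linear.continuous_on[OF bounded_linear_transpose])
  then have m: "covariance_density \<in> borel_measurable borel" by (rule borel_measurable_continuous_onI)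
  show ?thesis unfolding set_integrable_def
  proof (rule Bochner_Integration.integrable_bound)
    show "integrable lborel (\<lambda>s. D * (indicator {0..} s *\<^sub>R exp (- c * s)))"
      using set_integrable_exp_decay[OF c(1)] by (intro integrable_mult_right) (simp add: set_integrable_def)
    show "(\<lambda>s. indicator {0..} s *\<^sub>R covariance_density s) \<in> borel_measurable lborel" using m by measurable
    show "AE s in lborel. norm (indicator {0..} s *\<^sub>R covariance_density s) \<le> norm (D * (indicator {0..} s *\<^sub>R exp (- c * s)))"
      using bound D by (intro AE_I2) (auto simp: indicator_def)
  qed
qed

text \<open>Bounded linear functionals commute with the Bochner integral, so symmetry and positivity
  of \<open>Qinf\<close> can be read off scalar integrals.\<close>

lemma Qinf_form:
  "(Qinf *v \<xi>) \<bullet> \<eta> = (LINT s|lborel. indicator {0..} s * ((Q *v (transpose (E s) *v \<xi>)) \<bullet> (transpose (E s) *v \<eta>)))"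
proof -
  have bl: "bounded_linear (\<lambda>A :: real^'n^'n. (A *v \<xi>) \<bullet> \<eta>)"
    by (intro bounded_linear_compose[OF bounded_linear_inner_left] bounded_bilinear.bounded_linear_left[OF bounded_bilinear_matrix_vector_mult])
  have "(Qinf *v \<xi>) \<bullet> \<eta> = (LINT s|lborel. ((indicator {0..} s *\<^sub>R covariance_density s) *v \<xi>) \<bullet> \<eta>)"
    unfolding Qinf_def Q_infty_def covariance_density_def[symmetric] set_lebesgue_integral_def
    using integral_bounded_linear[OF bl covariance_density_integrable[unfolded set_integrable_def]] by simp
  also have "\<dots> = (LINT s|lborel. indicator {0..} s * ((covariance_density s *v \<xi>) \<bullet> \<eta>))"
    by (intro Bochner_Integration.integral_cong) (auto simp: indicator_def)
  finally show ?thesis unfolding covariance_density_form .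
qed

lemma flow_form_integrable: "integrable lborel (\<lambda>s. indicator {0..} s * flow_form \<xi> s)"
proof -
  have bl: "bounded_linear (\<lambda>A :: real^'n^'n. (A *v \<xi>) \<bullet> \<xi>)"
    by (intro bounded_linear_compose[OF bounded_linear_inner_left] bounded_bilinear.bounded_linear_left[OF bounded_bilinear_matrix_vector_mult])
  have "integrable lborel (\<lambda>s. ((indicator {0..} s *\<^sub>R covariance_density s) *v \<xi>) \<bullet> \<xi>)"
    by (rule integrable_bounded_linear[OF bl covariance_density_integrable[unfolded set_integrable_def]])
  moreover have "((indicator {0..} s *\<^sub>R covariance_density s) *v \<xi>) \<bullet> \<xi> = indicator {0..} s * flow_form \<xi> s" for s
    unfolding flow_form_def covariance_density_form[symmetric] by (simp add: indicator_def)
  ultimately show ?thesis by simp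
qed

lemma Qinf_symmetric: "transpose Qinf = Qinf"
proof -
  have sQ: "(Q *v a) \<bullet> b = (Q *v b) \<bullet> a" for a b
    using psd symmetric_inner[of Q a b] by (simp add: symmetric_psd_def inner_commute)
  have "(Qinf *v \<xi>) \<bullet> \<eta> = (Qinf *v \<eta>) \<bullet> \<xi>" for \<xi> \<eta>
    unfolding Qinf_form by (subst sQ) (rule refl)
  then have "(transpose Qinf *v \<eta>) \<bullet> \<xi> = (Qinf *v \<eta>) \<bullet> \<xi>" for \<xi> \<eta>
    by (metis dot_lmul_matrix inner_commute transpose_matrix_vector)
  then have "transpose Qinf *v \<eta> = Qinf *v \<eta>" for \<eta>
    using vector_eq_rdot by blast
  then show ?thesis unfolding matrix_eq by blast
qed

text \<open>The covariance accumulated on [0, t], written as a difference rather than as an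
  integral: the identity Qinf = Qt t + E t Qinf (E t)^T, which expresses the invariance of the
  weight, then holds by definition.\<close>

definition Qt :: "real \<Rightarrow> real^'n^'n" where "Qt t = Qinf - E t ** Qinf ** transpose (E t)"

lemma E_Qinf_form: "((E t ** Qinf ** transpose (E t)) *v \<xi>) \<bullet> \<eta> = (Qinf *v (transpose (E t) *v \<xi>)) \<bullet> (transpose (E t) *v \<eta>)"
proof -
  have "((E t ** Qinf ** transpose (E t)) *v \<xi>) \<bullet> \<eta> = (E t *v (Qinf *v (transpose (E t) *v \<xi>))) \<bullet> \<eta>"
    by (simp only: matrix_vector_mul_assoc[symmetric])
  also have "\<dots> = (Qinf *v (transpose (E t) *v \<xi>)) \<bullet> (transpose (E t) *v \<eta>)"
    by (metis dot_lmul_matrix inner_commute transpose_matrix_vector)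
  finally show ?thesis .
qed

lemma Qt_symmetric: "transpose (Qt t) = Qt t"
proof -
  have "transpose (A - C) = transpose A - transpose C" for A C :: "real^'n^'n"
    by (simp add: vec_eq_iff transpose_def)
  then show ?thesis unfolding Qt_def
    by (simp only: matrix_transpose_mul transpose_transpose Qinf_symmetric matrix_mul_assoc)
qed

text \<open>The integral for \<open>Qinf\<close> is split at time t. By the flow property and a
  translation, the part beyond t is the form of \<open>Qinf\<close> at (E t)^T \<xi>, which the
  definition of \<open>Qt\<close> subtracts.\<close>

lemma Qt_form:
  assumes t: "t \<ge> 0"
  shows "(Qt t *v \<xi>) \<bullet> \<xi> = integral {0..t} (flow_form \<xi>)"
proof -
  define G where "G S = (LINT s|lborel. indicator S s * flow_form \<xi> s)" for S
  have int: "integrable lborel (\<lambda>s. indicator S s * flow_form \<xi> s)" if "S \<in> sets borel" "S \<subseteq> {0..}" for S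
  proof (rule Bochner_Integration.integrable_bound[OF flow_form_integrable[of \<xi>]])
    have [measurable]: "flow_form \<xi> \<in> borel_measurable borel" by (rule borel_measurable_continuous_onI[OF flow_form_continuous])
    show "(\<lambda>s. indicator S s * flow_form \<xi> s) \<in> borel_measurable lborel" using that(1) by measurable
    show "AE s in lborel. norm (indicator S s * flow_form \<xi> s) \<le> norm (indicator {0..} s * flow_form \<xi> s)"
      using that(2) by (intro AE_I2) (auto simp: indicator_def)
  qed
  have "(Qinf *v (transpose (E t) *v \<xi>)) \<bullet> (transpose (E t) *v \<xi>) = (LINT s|lborel. indicator {0..} s * flow_form \<xi> (s + t))"
    unfolding Qinf_form flow_form_def[symmetric] flow_form_shift ..
  also have "\<dots> = (LINT s|lborel. indicator {t..} (t + 1 * s) * flow_form \<xi> (t + 1 * s))"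
    by (intro Bochner_Integration.integral_cong) (auto simp: indicator_def add.commute)
  also have "\<dots> = G {t..}"
    unfolding G_def using lborel_integral_real_affine[of 1 "\<lambda>s. indicator {t..} s * flow_form \<xi> s" t] by simp
  finally have 1: "(Qinf *v (transpose (E t) *v \<xi>)) \<bullet> (transpose (E t) *v \<xi>) = G {t..}" .
  have "(Qinf *v \<xi>) \<bullet> \<xi> = G {0..}" unfolding Qinf_form flow_form_def[symmetric] G_def ..
  also have "\<dots> = (LINT s|lborel. indicator {0..<t} s * flow_form \<xi> s + indicator {t..} s * flow_form \<xi> s)"
    unfolding G_def using t by (intro Bochner_Integration.integral_cong) (auto simp: indicator_def)
  also have "\<dots> = G {0..<t} + G {t..}"
    unfolding G_def using t by (intro Bochner_Integration.integral_add int) auto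
  also have "G {0..<t} = G {0..t}"
    unfolding G_def
  proof (rule integral_cong_AE)
    show "AE s in lborel. indicator {0..<t} s * flow_form \<xi> s = indicator {0..t} s * flow_form \<xi> s"
      by (rule eventually_mono[OF AE_lborel_singleton[of t]]) (auto simp: indicator_def)
    have [measurable]: "flow_form \<xi> \<in> borel_measurable borel" by (rule borel_measurable_continuous_onI[OF flow_form_continuous])
    show "(\<lambda>s. indicator {0..<t} s * flow_form \<xi> s) \<in> borel_measurable lborel"
      "(\<lambda>s. indicator {0..t} s * flow_form \<xi> s) \<in> borel_measurable lborel" by measurable
  qed
  also have "G {0..t} = (LINT s:{0..t}|lborel. flow_form \<xi> s)"
    by (simp add: G_def set_lebesgue_integral_def)
  also have "\<dots> = integral {0..t} (flow_form \<xi>)"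
    using int[of "{0..t}"] by (intro set_borel_integral_eq_integral) (simp add: set_integrable_def)
  finally show ?thesis
    using 1 by (simp add: Qt_def matrix_vector_mult_diff_rdistrib inner_diff_left E_Qinf_form del: transpose_matrix_vector)
qed

lemma Qt_lower_bound:
  assumes "T > 0"
  shows "\<exists>c>0. \<forall>t \<xi>. 0 < t \<longrightarrow> t \<le> T \<longrightarrow> c * t ^ (2 * CARD('n) - 1) * (norm \<xi>)\<^sup>2 \<le> (Qt t *v \<xi>) \<bullet> \<xi>"
  using flow_form_integral_lower_bound[OF assms] by (simp add: Qt_form)

lemma Qt_psd: "t \<ge> 0 \<Longrightarrow> symmetric_psd (Qt t)"
  unfolding symmetric_psd_def using Qt_symmetric
  by (auto simp: Qt_form intro!: Henstock_Kurzweil_Integration.integral_nonneg integrable_continuous_interval flow_form_continuous flow_form_nonneg)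

text \<open>\<open>Qinf\<close> dominates \<open>Qt 1\<close>, their difference being a positive
  semidefinite conjugate of \<open>Qinf\<close>.\<close>

lemma Qinf_pos_def: "\<exists>c>0. \<forall>\<xi>. c * (norm \<xi>)\<^sup>2 \<le> (Qinf *v \<xi>) \<bullet> \<xi>"
proof -
  obtain c where c: "c > 0" "\<And>t \<xi>. 0 < t \<Longrightarrow> t \<le> 1 \<Longrightarrow> c * t ^ (2 * CARD('n) - 1) * (norm \<xi>)\<^sup>2 \<le> (Qt t *v \<xi>) \<bullet> \<xi>"
    using Qt_lower_bound[of 1] by auto
  have "c * (norm \<xi>)\<^sup>2 \<le> (Qinf *v \<xi>) \<bullet> \<xi>" for \<xi>
  proof -
    have nn: "0 \<le> (Qinf *v \<eta>) \<bullet> \<eta>" for \<eta>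
      unfolding Qinf_form flow_form_def[symmetric] by (intro Bochner_Integration.integral_nonneg) (simp add: flow_form_nonneg)
    have "c * (norm \<xi>)\<^sup>2 \<le> (Qt 1 *v \<xi>) \<bullet> \<xi>" using c(2)[of 1 \<xi>] by simp
    also have "\<dots> \<le> (Qinf *v \<xi>) \<bullet> \<xi>"
      using nn[of "transpose (E 1) *v \<xi>"]
      by (simp add: Qt_def matrix_vector_mult_diff_rdistrib inner_diff_left E_Qinf_form del: transpose_matrix_vector)
    finally show ?thesis .
  qed
  with c(1) show ?thesis by blast
qed

lemma Qinf_psd: "symmetric_psd Qinf"
proof -
  obtain c where "c > 0" "\<And>\<xi>. c * (norm \<xi>)\<^sup>2 \<le> (Qinf *v \<xi>) \<bullet> \<xi>" using Qinf_pos_def by blast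
  then have "0 \<le> (Qinf *v \<xi>) \<bullet> \<xi>" for \<xi> by (meson less_imp_le mult_nonneg_nonneg order_trans zero_le_power2)
  then show ?thesis using Qinf_symmetric by (simp add: symmetric_psd_def)
qed

end

section \<open>The seminormed space \<open>L\<^sup>2(M)\<close>\<close>

lemma L2_funD: "f \<in> L2_fun M \<Longrightarrow> f \<in> borel_measurable M" "f \<in> L2_fun M \<Longrightarrow> integrable M (\<lambda>x. (cmod (f x))\<^sup>2)"
  by (auto simp: L2_fun_def)

lemma L2_norm_on_altdef: "L2_norm_on M A f = L2_norm M (\<lambda>x. indicator A x * f x)"
proof -
  have "(\<lambda>x. indicator A x *\<^sub>R (cmod (f x))\<^sup>2) = (\<lambda>x. (cmod (indicator A x * f x))\<^sup>2)"
    by (auto simp: indicator_def)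
  then show ?thesis by (simp add: L2_norm_on_def set_lebesgue_integral_def)
qed

lemma L2_norm_altdef: "L2_norm M f = sqrt (LINT x|M. (cmod (f x))\<^sup>2)"
  by (simp add: L2_norm_on_def set_lebesgue_integral_def)

lemma L2_norm_nonneg: "0 \<le> L2_norm M f"
  by (simp add: L2_norm_altdef)

lemma L2_norm_power2: "(L2_norm M f)\<^sup>2 = (LINT x|M. (cmod (f x))\<^sup>2)"
  by (simp add: L2_norm_altdef)

lemma L2_fun_dominated:
  assumes "g \<in> L2_fun M" "f \<in> borel_measurable M" "\<And>x. cmod (f x) \<le> c * cmod (g x)"
  shows "f \<in> L2_fun M"
proof -
  have "integrable M (\<lambda>x. (cmod (f x))\<^sup>2)"
  proof (rule Bochner_Integration.integrable_bound)
    show "integrable M (\<lambda>x. c\<^sup>2 * (cmod (g x))\<^sup>2)" using L2_funD(2)[OF assms(1)] by simp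
    show "AE x in M. norm ((cmod (f x))\<^sup>2) \<le> norm (c\<^sup>2 * (cmod (g x))\<^sup>2)"
      using assms(3) by (auto simp: power_mult_distrib[symmetric] intro!: power_mono)
  qed (use assms(2) in measurable)
  then show ?thesis using assms(2) by (simp add: L2_fun_def)
qed

lemma L2_fun_cmult: "f \<in> L2_fun M \<Longrightarrow> (\<lambda>x. c * f x) \<in> L2_fun M"
  by (rule L2_fun_dominated[of f M _ "cmod c"]) (auto simp: norm_mult dest: L2_funD)

lemma L2_fun_indicator: "f \<in> L2_fun M \<Longrightarrow> A \<in> sets M \<Longrightarrow> (\<lambda>x. indicator A x * f x) \<in> L2_fun M"
  by (rule L2_fun_dominated[of f M _ 1]) (auto dest: L2_funD simp: indicator_def)

lemma cmod_add_square_le: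
  assumes "s > 0"
  shows "(cmod (a + b))\<^sup>2 \<le> (1 + s) * (cmod a)\<^sup>2 + (1 + 1 / s) * (cmod b)\<^sup>2"
proof -
  have "(cmod (a + b))\<^sup>2 \<le> (cmod a + cmod b)\<^sup>2" by (intro power_mono norm_triangle_ineq) auto
  moreover have "0 \<le> (s * cmod a - cmod b)\<^sup>2 / s" using assms by simp
  then have "2 * cmod a * cmod b \<le> s * (cmod a)\<^sup>2 + (cmod b)\<^sup>2 / s"
    using assms by (simp add: power2_eq_square field_simps)
  ultimately show ?thesis by (simp add: power2_sum algebra_simps)
qed

lemma L2_fun_add:
  assumes "f \<in> L2_fun M" "g \<in> L2_fun M"
  shows "(\<lambda>x. f x + g x) \<in> L2_fun M"
proof -
  note [measurable] = L2_funD(1)[OF assms(1)] L2_funD(1)[OF assms(2)]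
  have "integrable M (\<lambda>x. (cmod (f x + g x))\<^sup>2)"
  proof (rule Bochner_Integration.integrable_bound)
    show "integrable M (\<lambda>x. 2 * (cmod (f x))\<^sup>2 + 2 * (cmod (g x))\<^sup>2)"
      using L2_funD(2)[OF assms(1)] L2_funD(2)[OF assms(2)] by simp
    show "AE x in M. norm ((cmod (f x + g x))\<^sup>2) \<le> norm (2 * (cmod (f x))\<^sup>2 + 2 * (cmod (g x))\<^sup>2)"
      using cmod_add_square_le[of 1] by simp
  qed measurable
  then show ?thesis by (simp add: L2_fun_def)
qed

lemma L2_fun_diff: "f \<in> L2_fun M \<Longrightarrow> g \<in> L2_fun M \<Longrightarrow> (\<lambda>x. f x - g x) \<in> L2_fun M"
  using L2_fun_add[of f M "\<lambda>x. (-1) * g x"] L2_fun_cmult[of g M "-1"] by simp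

lemma L2_fun_zero: "(\<lambda>x. 0) \<in> L2_fun M"
  by (simp add: L2_fun_def)

lemma L2_fun_sum: "(\<And>j. j \<in> J \<Longrightarrow> f j \<in> L2_fun M) \<Longrightarrow> (\<lambda>x. \<Sum>j\<in>J. f j x) \<in> L2_fun M"
  by (induction J rule: infinite_finite_induct) (auto intro: L2_fun_zero L2_fun_add)

text \<open>The free parameter in \<open>cmod_add_square_le\<close> is set to the ratio b / a of the
  two norms, for which the right-hand side becomes the perfect square (a + b)^2. Both norms are
  first enlarged by e / 2 so that the ratio exists when a norm vanishes.\<close>

lemma L2_norm_triangle:
  assumes "f \<in> L2_fun M" "g \<in> L2_fun M"
  shows "L2_norm M (\<lambda>x. f x + g x) \<le> L2_norm M f + L2_norm M g"
proof (rule field_le_epsilon)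
  fix e :: real assume e: "e > 0"
  define a where "a = L2_norm M f + e / 2"
  define b where "b = L2_norm M g + e / 2"
  have ab: "a > 0" "b > 0" using e L2_norm_nonneg[of M] by (auto simp: a_def b_def intro: add_nonneg_pos)
  have le: "(L2_norm M f)\<^sup>2 \<le> a\<^sup>2" "(L2_norm M g)\<^sup>2 \<le> b\<^sup>2"
    using e L2_norm_nonneg[of M] by (auto simp: a_def b_def intro!: power_mono)
  have "(L2_norm M (\<lambda>x. f x + g x))\<^sup>2 \<le> (LINT x|M. (1 + b / a) * (cmod (f x))\<^sup>2 + (1 + 1 / (b / a)) * (cmod (g x))\<^sup>2)"
    unfolding L2_norm_power2
    using L2_funD(2)[OF assms(1)] L2_funD(2)[OF assms(2)] L2_funD(2)[OF L2_fun_add[OF assms]] ab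
    by (intro integral_mono cmod_add_square_le) auto
  also have "\<dots> = (1 + b / a) * (L2_norm M f)\<^sup>2 + (1 + 1 / (b / a)) * (L2_norm M g)\<^sup>2"
    unfolding L2_norm_power2 using L2_funD(2)[OF assms(1)] L2_funD(2)[OF assms(2)]
    by (subst Bochner_Integration.integral_add) auto
  also have "\<dots> \<le> (1 + b / a) * a\<^sup>2 + (1 + 1 / (b / a)) * b\<^sup>2"
    using le ab by (intro add_mono mult_left_mono) auto
  also have "\<dots> = (a + b)\<^sup>2" using ab by (simp add: power2_eq_square field_simps)
  finally have "L2_norm M (\<lambda>x. f x + g x) \<le> a + b"
    by (rule power2_le_imp_le) (use ab in simp)
  then show "L2_norm M (\<lambda>x. f x + g x) \<le> L2_norm M f + L2_norm M g + e" by (simp add: a_def b_def)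
qed

lemma L2_norm_cmult: "L2_norm M (\<lambda>x. c * f x) = cmod c * L2_norm M f"
  by (simp add: L2_norm_altdef norm_mult power_mult_distrib real_sqrt_mult)

lemma L2_norm_minus_commute: "L2_norm M (\<lambda>x. f x - g x) = L2_norm M (\<lambda>x. g x - f x)"
  by (simp add: L2_norm_altdef norm_minus_commute)

lemma L2_norm_triangle_diff:
  assumes "f \<in> L2_fun M" "g \<in> L2_fun M" "h \<in> L2_fun M"
  shows "L2_norm M (\<lambda>x. f x - h x) \<le> L2_norm M (\<lambda>x. f x - g x) + L2_norm M (\<lambda>x. g x - h x)"
  using L2_norm_triangle[OF L2_fun_diff[OF assms(1,2)] L2_fun_diff[OF assms(2,3)]] by simp

lemma L2_norm_le_add_diff:
  assumes "f \<in> L2_fun M" "g \<in> L2_fun M"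
  shows "L2_norm M f \<le> L2_norm M g + L2_norm M (\<lambda>x. f x - g x)"
  using L2_norm_triangle[OF assms(2) L2_fun_diff[OF assms]] by simp

lemma L2_norm_cong_AE:
  assumes "f \<in> borel_measurable M" "g \<in> borel_measurable M" "AE x in M. f x = g x"
  shows "L2_norm M f = L2_norm M g"
proof -
  note [measurable] = assms(1,2)
  have "(LINT x|M. (cmod (f x))\<^sup>2) = (LINT x|M. (cmod (g x))\<^sup>2)"
  proof (rule integral_cong_AE)
    show "AE x in M. (cmod (f x))\<^sup>2 = (cmod (g x))\<^sup>2" using assms(3) by (rule eventually_mono) simp
  qed measurable
  then show ?thesis by (simp add: L2_norm_altdef)
qed

lemma L2_norm_on_le:
  assumes "f \<in> L2_fun M" "A \<in> sets M"
  shows "L2_norm_on M A f \<le> L2_norm M f"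
  unfolding L2_norm_on_altdef[of M A] L2_norm_altdef
  using L2_funD(2)[OF assms(1)] L2_funD(2)[OF L2_fun_indicator[OF assms]]
  by (intro real_sqrt_le_mono integral_mono) (auto simp: indicator_def)

lemma L2_norm_on_diff_le:
  assumes "f \<in> L2_fun M" "g \<in> L2_fun M" "A \<in> sets M"
  shows "\<bar>L2_norm_on M A f - L2_norm_on M A g\<bar> \<le> L2_norm M (\<lambda>x. f x - g x)"
proof -
  have *: "L2_norm_on M A f - L2_norm_on M A g \<le> L2_norm M (\<lambda>x. f x - g x)"
    if "f \<in> L2_fun M" "g \<in> L2_fun M" for f g
    using L2_norm_le_add_diff[OF L2_fun_indicator[OF that(1) assms(3)] L2_fun_indicator[OF that(2) assms(3)]]
      L2_norm_on_le[OF L2_fun_diff[OF that] assms(3)]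
    unfolding L2_norm_on_altdef[of M A] by (simp add: algebra_simps)
  show ?thesis
    using *[OF assms(1,2)] *[OF assms(2,1)] by (simp add: L2_norm_minus_commute[of M g f])
qed

lemma L2_norm_eq_0_AE:
  assumes "f \<in> L2_fun M" "L2_norm M f = 0"
  shows "AE x in M. f x = 0"
proof -
  have "(LINT x|M. (cmod (f x))\<^sup>2) = 0" using assms(2) by (simp add: L2_norm_altdef)
  then show ?thesis
    using integral_nonneg_eq_0_iff_AE[OF L2_funD(2)[OF assms(1)]] by auto
qed

lemma nn_integral_L2_norm:
  assumes "f \<in> L2_fun M"
  shows "(\<integral>\<^sup>+x. ennreal ((cmod (f x))\<^sup>2) \<partial>M) = ennreal ((L2_norm M f)\<^sup>2)"
  unfolding L2_norm_power2 by (intro nn_integral_eq_integral L2_funD(2)[OF assms]) auto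

lemma L2_bounded_operatorD:
  assumes "L2_bounded_operator M T"
  shows "f \<in> L2_fun M \<Longrightarrow> T f \<in> L2_fun M"
    and "f \<in> L2_fun M \<Longrightarrow> g \<in> L2_fun M \<Longrightarrow> AE x in M. T (\<lambda>x. a * f x + b * g x) x = a * T f x + b * T g x"
    and "\<exists>K\<ge>0. \<forall>f\<in>L2_fun M. L2_norm M (T f) \<le> K * L2_norm M f"
proof -
  obtain K where K: "\<forall>f\<in>L2_fun M. L2_norm M (T f) \<le> K * L2_norm M f"
    using assms by (auto simp: L2_bounded_operator_def)
  then have "\<forall>f\<in>L2_fun M. L2_norm M (T f) \<le> max 0 K * L2_norm M f"
    using L2_norm_nonneg[of M] by (meson max.cobounded2 mult_right_mono order_trans)
  then show "\<exists>K\<ge>0. \<forall>f\<in>L2_fun M. L2_norm M (T f) \<le> K * L2_norm M f"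
    by (intro exI[of _ "max 0 K"]) auto
qed (use assms in \<open>auto simp: L2_bounded_operator_def\<close>)

lemma L2_operator_norm_diff:
  assumes T: "L2_bounded_operator M T" and fg: "f \<in> L2_fun M" "g \<in> L2_fun M"
  shows "L2_norm M (\<lambda>x. T f x - T g x) = L2_norm M (T (\<lambda>x. f x - g x))"
proof (rule L2_norm_cong_AE)
  show "AE x in M. T f x - T g x = T (\<lambda>x. f x - g x) x"
    using L2_bounded_operatorD(2)[OF T fg, of 1 "-1"] by (rule eventually_mono) simp
  show "(\<lambda>x. T f x - T g x) \<in> borel_measurable M" "T (\<lambda>x. f x - g x) \<in> borel_measurable M"
    using L2_bounded_operatorD(1)[OF T] fg by (auto intro!: L2_funD(1) L2_fun_diff)
qed

lemma L2_operator_norm_cmult: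
  assumes T: "L2_bounded_operator M T" and f: "f \<in> L2_fun M"
  shows "L2_norm M (T (\<lambda>x. c * f x)) = cmod c * L2_norm M (T f)"
proof -
  have "L2_norm M (T (\<lambda>x. c * f x)) = L2_norm M (\<lambda>x. c * T f x)"
  proof (rule L2_norm_cong_AE)
    show "AE x in M. T (\<lambda>x. c * f x) x = c * T f x"
      using L2_bounded_operatorD(2)[OF T f f, of c 0] by simp
  qed (use L2_bounded_operatorD(1)[OF T] f in \<open>auto intro!: L2_funD(1) L2_fun_cmult\<close>)
  then show ?thesis by (simp add: L2_norm_cmult)
qed

section \<open>Completeness and uniform boundedness\<close>

text \<open>Riesz-Fischer for increments of size 5^-n. The weights 2^n leave the sum of 2^n |D n|^2
  integrable, with ratio 2/25; it is therefore finite almost everywhere, which forces the increments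
  to decay like 2^(-n/2) and the sequence to converge pointwise. Fatou's lemma carries the L^2 bound
  to the limit. The factor 5/4 is the sum of the geometric series.\<close>

lemma L2_complete_geometric:
  assumes x: "\<And>n. x n \<in> L2_fun M" and d: "\<And>n. L2_norm M (\<lambda>z. x (Suc n) z - x n z) \<le> (1/5) ^ n"
  shows "\<exists>y\<in>L2_fun M. \<forall>n. L2_norm M (\<lambda>z. y z - x n z) \<le> 5/4 * (1/5) ^ n"
proof -
  have [measurable]: "x n \<in> borel_measurable M" for n using x by (rule L2_funD)
  define D where "D n z = x (Suc n) z - x n z" for n z
  have DL: "D n \<in> L2_fun M" for n unfolding D_def[abs_def] by (intro L2_fun_diff x)
  have [measurable]: "D n \<in> borel_measurable M" for n using DL by (rule L2_funD)
  have "(\<integral>\<^sup>+z. (\<Sum>n. ennreal (2 ^ n * (cmod (D n z))\<^sup>2)) \<partial>M) = (\<Sum>n. \<integral>\<^sup>+z. ennreal (2 ^ n * (cmod (D n z))\<^sup>2) \<partial>M)"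
    by (intro nn_integral_suminf) measurable
  also have "\<dots> \<le> (\<Sum>n. ennreal ((2/25) ^ n))"
  proof (intro suminf_le summableI)
    fix n
    have "(\<integral>\<^sup>+z. ennreal (2 ^ n * (cmod (D n z))\<^sup>2) \<partial>M) = ennreal (2 ^ n) * ennreal ((L2_norm M (D n))\<^sup>2)"
      by (simp add: ennreal_mult nn_integral_cmult nn_integral_L2_norm[OF DL])
    also have "\<dots> = ennreal (2 ^ n * (L2_norm M (D n))\<^sup>2)" by (simp add: ennreal_mult)
    also have "\<dots> \<le> ennreal (2 ^ n * ((1/5) ^ n)\<^sup>2)"
      using d[of n] L2_norm_nonneg by (intro ennreal_leI mult_left_mono power_mono) (auto simp: D_def[abs_def])
    also have "2 ^ n * ((1/5) ^ n)\<^sup>2 = ((2/25) ^ n :: real)"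
      by (simp add: power_mult_distrib[symmetric] power2_eq_square flip: power_mult_distrib)
    finally show "(\<integral>\<^sup>+z. ennreal (2 ^ n * (cmod (D n z))\<^sup>2) \<partial>M) \<le> ennreal ((2/25) ^ n)" .
  qed
  also have "\<dots> < \<infinity>" by (subst suminf_ennreal2) (auto intro: summable_geometric)
  finally have "(\<integral>\<^sup>+z. (\<Sum>n. ennreal (2 ^ n * (cmod (D n z))\<^sup>2)) \<partial>M) \<noteq> \<infinity>" by simp
  then have "AE z in M. (\<Sum>n. ennreal (2 ^ n * (cmod (D n z))\<^sup>2)) \<noteq> \<infinity>"
    by (intro nn_integral_PInf_AE) auto
  moreover have "convergent (\<lambda>n. x n z)" if "(\<Sum>n. ennreal (2 ^ n * (cmod (D n z))\<^sup>2)) \<noteq> \<infinity>" for z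
  proof -
    have "summable (\<lambda>n. 2 ^ n * (cmod (D n z))\<^sup>2)"
      using that by (intro summable_suminf_not_top) auto
    then have "bounded (range (\<lambda>n. 2 ^ n * (cmod (D n z))\<^sup>2))"
      using summable_LIMSEQ_zero convergent_imp_bounded by blast
    then obtain C where C: "\<And>n. norm (2 ^ n * (cmod (D n z))\<^sup>2) \<le> C" by (auto simp: bounded_iff)
    have "norm (D n z) \<le> sqrt C * (sqrt (1/2)) ^ n" for n
    proof -
      have "(cmod (D n z))\<^sup>2 \<le> C * (1/2) ^ n" using C[of n] by (simp add: field_simps power_divide)
      then have "cmod (D n z) \<le> sqrt (C * (1/2) ^ n)" by (rule real_le_rsqrt)
      then show ?thesis by (simp add: real_sqrt_mult real_sqrt_power)
    qed
    moreover have "summable (\<lambda>n. sqrt C * (sqrt (1/2)) ^ n)"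
      by (intro summable_mult summable_geometric) simp
    ultimately have "summable (\<lambda>n. D n z)"
      by (metis (no_types, lifting) summable_comparison_test')
    then have "convergent (\<lambda>n. \<Sum>k<n. D k z)" by (simp add: summable_iff_convergent)
    moreover have "(\<Sum>k<n. D k z) = x n z - x 0 z" for n using sum_lessThan_telescope[of "\<lambda>k. x k z"] by (simp add: D_def)
    ultimately have "convergent (\<lambda>n. (x n z - x 0 z) + x 0 z)" by (intro convergent_add convergent_const) simp
    then show ?thesis by simp
  qed
  ultimately have conv: "AE z in M. convergent (\<lambda>n. x n z)" by (rule eventually_mono)
  define y where "y z = lim (\<lambda>n. x n z)" for z
  have [measurable]: "y \<in> borel_measurable M" unfolding y_def[abs_def] by measurable
  \<comment> \<open>The subtracted tail is kept in the bound so that the induction on m closes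
    without loss.\<close>
  have tel: "L2_norm M (\<lambda>z. x (n + m) z - x n z) \<le> 5/4 * (1/5) ^ n - 5/4 * (1/5) ^ (n + m)" for n m
  proof (induction m)
    case 0 then show ?case by (simp add: L2_norm_altdef)
  next
    case (Suc m)
    have "L2_norm M (\<lambda>z. x (n + Suc m) z - x n z) \<le> L2_norm M (\<lambda>z. x (Suc (n + m)) z - x (n + m) z) + L2_norm M (\<lambda>z. x (n + m) z - x n z)"
      using L2_norm_triangle_diff[OF x x x] by simp
    also have "\<dots> \<le> (1/5) ^ (n + m) + (5/4 * (1/5) ^ n - 5/4 * (1/5) ^ (n + m))"
      using d Suc by (intro add_mono) auto
    finally show ?case by (simp add: field_simps)
  qed
  have bd: "(\<integral>\<^sup>+z. ennreal ((cmod (y z - x n z))\<^sup>2) \<partial>M) \<le> ennreal ((5/4 * (1/5) ^ n)\<^sup>2)" for n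
  proof -
    have "(\<integral>\<^sup>+z. ennreal ((cmod (y z - x n z))\<^sup>2) \<partial>M) = (\<integral>\<^sup>+z. liminf (\<lambda>m. ennreal ((cmod (x (n + m) z - x n z))\<^sup>2)) \<partial>M)"
    proof (intro nn_integral_cong_AE, use conv in eventually_elim)
      fix z assume "convergent (\<lambda>n. x n z)"
      then have "(\<lambda>m. x (n + m) z) \<longlonglongrightarrow> y z"
        unfolding y_def convergent_LIMSEQ_iff using LIMSEQ_ignore_initial_segment[of "\<lambda>n. x n z" _ n] by (simp add: add.commute)
      then have "(\<lambda>m. ennreal ((cmod (x (n + m) z - x n z))\<^sup>2)) \<longlonglongrightarrow> ennreal ((cmod (y z - x n z))\<^sup>2)"
        by (intro tendsto_intros) auto
      then show "ennreal ((cmod (y z - x n z))\<^sup>2) = liminf (\<lambda>m. ennreal ((cmod (x (n + m) z - x n z))\<^sup>2))"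
        by (rule lim_imp_Liminf[OF trivial_limit_sequentially, symmetric])
    qed
    also have "\<dots> \<le> liminf (\<lambda>m. \<integral>\<^sup>+z. ennreal ((cmod (x (n + m) z - x n z))\<^sup>2) \<partial>M)"
      by (intro nn_integral_liminf) measurable
    also have "\<dots> \<le> ennreal ((5/4 * (1/5) ^ n)\<^sup>2)"
    proof (rule Liminf_le)
      show "\<forall>\<^sub>F m in sequentially. (\<integral>\<^sup>+z. ennreal ((cmod (x (n + m) z - x n z))\<^sup>2) \<partial>M) \<le> ennreal ((5/4 * (1/5) ^ n)\<^sup>2)"
      proof (intro always_eventually allI)
        fix m
        have "0 \<le> 5/4 * (1/5 :: real) ^ (n + m)" by simp
        with tel[of n m] have "L2_norm M (\<lambda>z. x (n + m) z - x n z) \<le> 5/4 * (1/5) ^ n" by linarith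
        then show "(\<integral>\<^sup>+z. ennreal ((cmod (x (n + m) z - x n z))\<^sup>2) \<partial>M) \<le> ennreal ((5/4 * (1/5) ^ n)\<^sup>2)"
          unfolding nn_integral_L2_norm[OF L2_fun_diff[OF x x]]
          by (intro ennreal_leI power_mono L2_norm_nonneg)
      qed
    qed simp
    finally show ?thesis .
  qed
  have yx: "(\<lambda>z. y z - x n z) \<in> L2_fun M" for n
  proof -
    have "integrable M (\<lambda>z. (cmod (y z - x n z))\<^sup>2)"
    proof (rule integrableI_bounded)
      have "(\<integral>\<^sup>+z. ennreal (norm ((cmod (y z - x n z))\<^sup>2)) \<partial>M) \<le> ennreal ((5/4 * (1/5) ^ n)\<^sup>2)"
        using bd[of n] by simp
      then show "(\<integral>\<^sup>+z. ennreal (norm ((cmod (y z - x n z))\<^sup>2)) \<partial>M) < \<infinity>"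
        by (rule le_less_trans) simp
    qed measurable
    then show ?thesis by (simp add: L2_fun_def)
  qed
  have "y \<in> L2_fun M" using L2_fun_add[OF yx[of 0] x[of 0]] by simp
  moreover have "L2_norm M (\<lambda>z. y z - x n z) \<le> 5/4 * (1/5) ^ n" for n
  proof -
    have "ennreal ((L2_norm M (\<lambda>z. y z - x n z))\<^sup>2) \<le> ennreal ((5/4 * (1/5) ^ n)\<^sup>2)"
      using bd[of n] nn_integral_L2_norm[OF yx] by simp
    then have "(L2_norm M (\<lambda>z. y z - x n z))\<^sup>2 \<le> (5/4 * (1/5) ^ n)\<^sup>2" by (simp add: ennreal_le_iff)
    then show ?thesis by (rule power2_le_imp_le) simp
  qed
  ultimately show ?thesis by blast
qed

text \<open>The operator norm, as the infimum of the admissible constants. The last clause provides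
  the nearly extremal functions from which the steps of the uniform boundedness argument are
  made.\<close>

lemma L2_operator_norm_exists:
  assumes T: "L2_bounded_operator M T"
  shows "\<exists>L\<ge>0. (\<forall>f\<in>L2_fun M. L2_norm M (T f) \<le> L * L2_norm M f) \<and>
     (\<forall>r. 0 \<le> r \<longrightarrow> r < L \<longrightarrow> (\<exists>f\<in>L2_fun M. L2_norm M (T f) > r * L2_norm M f))"
proof -
  define X where "X = {K. K \<ge> 0 \<and> (\<forall>f\<in>L2_fun M. L2_norm M (T f) \<le> K * L2_norm M f)}"
  have X: "X \<noteq> {}" "bdd_below X"
    using L2_bounded_operatorD(3)[OF T] by (auto simp: X_def intro!: bdd_belowI[of _ 0])
  have "Inf X \<ge> 0" using X(1) by (intro cInf_greatest) (auto simp: X_def)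
  moreover have "L2_norm M (T f) \<le> Inf X * L2_norm M f" if f: "f \<in> L2_fun M" for f
  proof (cases "L2_norm M f = 0")
    case True then show ?thesis using X(1) f by (auto simp: X_def)
  next
    case False
    then have pos: "L2_norm M f > 0" using L2_norm_nonneg by (metis less_le)
    have "L2_norm M (T f) / L2_norm M f \<le> Inf X"
      using X(1) f pos by (intro cInf_greatest) (auto simp: X_def divide_le_eq)
    then show ?thesis using pos by (simp add: divide_le_eq)
  qed
  moreover have "\<exists>f\<in>L2_fun M. L2_norm M (T f) > r * L2_norm M f" if "0 \<le> r" "r < Inf X" for r
  proof -
    have "r \<notin> X" using that cInf_lower[OF _ X(2), of r] by auto
    then show ?thesis using that by (auto simp: X_def not_le)
  qed
  ultimately show ?thesis by blast
qed

text \<open>Sokal's elementary proof of the uniform boundedness principle: the point that violates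
  boundedness is built by steps of geometrically decreasing length, the sign of each step being
  chosen so that it cannot be cancelled.\<close>

lemma L2_uniform_boundedness:
  assumes T: "\<And>n :: nat. L2_bounded_operator M (T n)"
    and bd: "\<And>f. f \<in> L2_fun M \<Longrightarrow> \<exists>b. \<forall>n. L2_norm M (T n f) \<le> b"
  shows "\<exists>K. \<forall>n. \<forall>f\<in>L2_fun M. L2_norm M (T n f) \<le> K * L2_norm M f"
proof (rule ccontr)
  assume neg: "\<not> ?thesis"
  have "\<forall>n. \<exists>L. L \<ge> 0 \<and> (\<forall>f\<in>L2_fun M. L2_norm M (T n f) \<le> L * L2_norm M f) \<and>
     (\<forall>r. 0 \<le> r \<longrightarrow> r < L \<longrightarrow> (\<exists>f\<in>L2_fun M. L2_norm M (T n f) > r * L2_norm M f))"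
    using L2_operator_norm_exists[OF T] by blast
  from choice[OF this] obtain L where L: "\<forall>n. L n \<ge> 0 \<and> (\<forall>f\<in>L2_fun M. L2_norm M (T n f) \<le> L n * L2_norm M f) \<and>
     (\<forall>r. 0 \<le> r \<longrightarrow> r < L n \<longrightarrow> (\<exists>f\<in>L2_fun M. L2_norm M (T n f) > r * L2_norm M f))"
    by (elim exE)
  have L0: "L n \<ge> 0" and L1: "f \<in> L2_fun M \<Longrightarrow> L2_norm M (T n f) \<le> L n * L2_norm M f"
    and L2: "0 \<le> r \<Longrightarrow> r < L n \<Longrightarrow> \<exists>f\<in>L2_fun M. L2_norm M (T n f) > r * L2_norm M f" for n f r
    using L by blast+
  \<comment> \<open>Norms above 6^k against steps of length 5^-k: the resulting lower bounds (6/5)^k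
    diverge.\<close>
  have "\<exists>n. L n > 6 ^ k" for k :: nat
  proof (rule ccontr)
    assume "\<not> ?thesis"
    then have "L n \<le> 6 ^ k" for n by (simp add: not_less)
    then have "L2_norm M (T n f) \<le> 6 ^ k * L2_norm M f" if "f \<in> L2_fun M" for n f
      using L1[OF that, of n] L2_norm_nonneg[of M f] by (meson mult_right_mono order_trans)
    then show False using neg by blast
  qed
  then have "\<forall>k. \<exists>n. L n > 6 ^ k" by blast
  from choice[OF this] obtain m where m: "\<And>k :: nat. L (m k) > 6 ^ k" by auto
  have "\<exists>x. \<forall>k. x k \<in> L2_fun M \<and> (L2_norm M (\<lambda>z. x (Suc k) z - x k z) \<le> (1/5) ^ k \<and>
      L2_norm M (T (m k) (x (Suc k))) \<ge> L (m k) / 2 * (1/5) ^ k)"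
  proof (rule dependent_nat_choice)
    show "\<exists>x. x \<in> L2_fun M" using L2_fun_zero by blast
    fix x k assume x: "x \<in> L2_fun M"
    have Lp: "L (m k) > 0" using m[of k] by (metis less_trans zero_less_power zero_less_numeral)
    then obtain f where f: "f \<in> L2_fun M" "L2_norm M (T (m k) f) > L (m k) / 2 * L2_norm M f"
      using L2[of "L (m k) / 2" "m k"] by auto
    have fp: "L2_norm M f > 0"
    proof (rule ccontr)
      assume "\<not> ?thesis"
      then have "L2_norm M f = 0" using L2_norm_nonneg[of M f] by simp
      then show False using f(2) L1[OF f(1), of "m k"] by simp
    qed
    define a where "a = (1/5) ^ k / L2_norm M f"
    have a: "a > 0" using fp by (simp add: a_def)
    define g where "g z = complex_of_real a * f z" for z
    have g: "g \<in> L2_fun M" unfolding g_def[abs_def] by (rule L2_fun_cmult[OF f(1)])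
    have ca: "cmod (complex_of_real a) = a" using a by simp
    have gn: "L2_norm M g = (1/5) ^ k" unfolding g_def[abs_def] L2_norm_cmult ca using fp by (simp add: a_def)
    have Tg: "L2_norm M (T (m k) g) \<ge> L (m k) / 2 * (1/5) ^ k"
    proof -
      have "L2_norm M (T (m k) g) = a * L2_norm M (T (m k) f)"
        unfolding g_def[abs_def] L2_operator_norm_cmult[OF T f(1)] using a by simp
      also have "\<dots> \<ge> a * (L (m k) / 2 * L2_norm M f)" using f(2) a by (intro mult_left_mono) auto
      also have "a * (L (m k) / 2 * L2_norm M f) = L (m k) / 2 * (1/5) ^ k" using fp by (simp add: a_def)
      finally show ?thesis .
    qed
    \<comment> \<open>Since 2 T g = T (x + g) - T (x - g), one of the two points has an image of
      norm at least that of T g, whatever T x is.\<close>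
    let ?p = "\<lambda>z. x z + g z" let ?q = "\<lambda>z. x z - g z"
    have pq: "?p \<in> L2_fun M" "?q \<in> L2_fun M" using x g by (auto intro: L2_fun_add L2_fun_diff)
    have "2 * L2_norm M (T (m k) g) = L2_norm M (T (m k) (\<lambda>z. 2 * g z))"
      by (simp add: L2_operator_norm_cmult[OF T g])
    also have "\<dots> = L2_norm M (\<lambda>z. T (m k) ?p z - T (m k) ?q z)"
      by (simp add: L2_operator_norm_diff[OF T pq])
    also have "\<dots> \<le> L2_norm M (T (m k) ?p) + L2_norm M (T (m k) ?q)"
      using L2_norm_triangle[OF L2_bounded_operatorD(1)[OF T pq(1)] L2_fun_cmult[OF L2_bounded_operatorD(1)[OF T pq(2)], of "-1"], of "m k" "m k"]
        L2_norm_cmult[of M "-1" "T (m k) ?q"] by simp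
    finally have "L2_norm M (T (m k) ?p) \<ge> L2_norm M (T (m k) g) \<or> L2_norm M (T (m k) ?q) \<ge> L2_norm M (T (m k) g)"
      by linarith
    then show "\<exists>y. y \<in> L2_fun M \<and> (L2_norm M (\<lambda>z. y z - x z) \<le> (1/5) ^ k \<and> L2_norm M (T (m k) y) \<ge> L (m k) / 2 * (1/5) ^ k)"
    proof
      assume "L2_norm M (T (m k) ?p) \<ge> L2_norm M (T (m k) g)"
      then show ?thesis using pq(1) Tg gn by (intro exI[of _ ?p]) auto
    next
      assume "L2_norm M (T (m k) ?q) \<ge> L2_norm M (T (m k) g)"
      moreover have "L2_norm M (\<lambda>z. - g z) = L2_norm M g" using L2_norm_cmult[of M "-1" g] by simp
      ultimately show ?thesis using pq(2) Tg gn by (intro exI[of _ ?q]) auto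
    qed
  qed
  then obtain x where x: "\<And>k. x k \<in> L2_fun M" "\<And>k. L2_norm M (\<lambda>z. x (Suc k) z - x k z) \<le> (1/5) ^ k"
    "\<And>k. L2_norm M (T (m k) (x (Suc k))) \<ge> L (m k) / 2 * (1/5) ^ k" by blast
  obtain y where y: "y \<in> L2_fun M" "\<And>n. L2_norm M (\<lambda>z. y z - x n z) \<le> 5/4 * (1/5) ^ n"
    using L2_complete_geometric[OF x(1,2)] by blast
  obtain b where b: "\<And>n. L2_norm M (T n y) \<le> b" using bd[OF y(1)] by blast
  have "(6/5) ^ k \<le> 4 * b" for k :: nat
  proof -
    \<comment> \<open>The k-th step gains L / 2 times 5^-k, while all later steps together move the
      image by at most L times 5/4 times 5^-(k+1), which is half of that gain.\<close>
    have "L (m k) / 2 * (1/5) ^ k \<le> L2_norm M (T (m k) (x (Suc k)))" by (rule x(3))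
    also have "\<dots> \<le> L2_norm M (T (m k) y) + L2_norm M (\<lambda>z. T (m k) (x (Suc k)) z - T (m k) y z)"
      by (intro L2_norm_le_add_diff L2_bounded_operatorD(1)[OF T] x(1) y(1))
    also have "L2_norm M (\<lambda>z. T (m k) (x (Suc k)) z - T (m k) y z) = L2_norm M (T (m k) (\<lambda>z. x (Suc k) z - y z))"
      by (rule L2_operator_norm_diff[OF T x(1) y(1)])
    also have "\<dots> \<le> L (m k) * L2_norm M (\<lambda>z. x (Suc k) z - y z)" by (intro L1 L2_fun_diff x(1) y(1))
    also have "\<dots> \<le> L (m k) * (5/4 * (1/5) ^ Suc k)"
      using y(2)[of "Suc k"] L0 by (intro mult_left_mono) (auto simp: L2_norm_minus_commute[of M y])
    finally have "L (m k) * (1/5) ^ k \<le> 4 * L2_norm M (T (m k) y)" by (simp add: field_simps)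
    then have "L (m k) * (1/5) ^ k \<le> 4 * b" using b[of "m k"] by linarith
    moreover have "6 ^ k * (1/5) ^ k \<le> L (m k) * (1/5) ^ k" using m[of k] by (intro mult_right_mono) auto
    moreover have "6 ^ k * (1/5) ^ k = ((6/5) ^ k :: real)" by (simp flip: power_mult_distrib)
    ultimately show ?thesis by linarith
  qed
  moreover obtain k :: nat where "4 * b < (6/5) ^ k" using real_arch_pow[of "6/5" "4 * b"] by auto
  ultimately show False by (meson not_le)
qed

section \<open>Local boundedness of strongly continuous semigroups\<close>

lemma L2_C0_semigroupD:
  assumes "L2_C0_semigroup M S"
  shows "t \<ge> 0 \<Longrightarrow> L2_bounded_operator M (S t)"
    and "f \<in> L2_fun M \<Longrightarrow> AE x in M. S 0 f x = f x"
    and "s \<ge> 0 \<Longrightarrow> t \<ge> 0 \<Longrightarrow> f \<in> L2_fun M \<Longrightarrow> AE x in M. S (s + t) f x = S s (S t f) x"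
    and "f \<in> L2_fun M \<Longrightarrow> ((\<lambda>t. L2_norm M (\<lambda>x. S t f x - f x)) \<longlongrightarrow> 0) (at_right 0)"
  using assms by (auto simp: L2_C0_semigroup_def)

text \<open>Otherwise there are times t_n <= 1 / (n + 1) at which the constant n + 1 is violated.
  Strong continuity at 0 keeps every orbit bounded along these times, which contradicts uniform
  boundedness.\<close>

lemma C0_semigroup_bounded_near_0:
  assumes S: "L2_C0_semigroup M S"
  shows "\<exists>d>0. \<exists>K\<ge>1. \<forall>t. 0 \<le> t \<longrightarrow> t \<le> d \<longrightarrow> (\<forall>f\<in>L2_fun M. L2_norm M (S t f) \<le> K * L2_norm M f)"
proof (rule ccontr)
  assume neg: "\<not> ?thesis"
  have "\<exists>t. 0 \<le> t \<and> t \<le> 1 / real (Suc n) \<and> (\<exists>f\<in>L2_fun M. L2_norm M (S t f) > real (Suc n) * L2_norm M f)" for n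
  proof (rule ccontr)
    assume "\<not> ?thesis"
    then have "\<forall>t. 0 \<le> t \<longrightarrow> t \<le> 1 / real (Suc n) \<longrightarrow> (\<forall>f\<in>L2_fun M. L2_norm M (S t f) \<le> real (Suc n) * L2_norm M f)"
      by (meson not_le)
    moreover have "1 / real (Suc n) > 0" "real (Suc n) \<ge> 1" by auto
    ultimately show False using neg by blast
  qed
  then have "\<forall>n. \<exists>t. 0 \<le> t \<and> t \<le> 1 / real (Suc n) \<and> (\<exists>f\<in>L2_fun M. L2_norm M (S t f) > real (Suc n) * L2_norm M f)"
    by blast
  from choice[OF this] obtain t where t: "\<And>n. 0 \<le> t n" "\<And>n. t n \<le> 1 / real (Suc n)"
    and tf: "\<And>n. \<exists>f\<in>L2_fun M. L2_norm M (S (t n) f) > real (Suc n) * L2_norm M f" by auto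
  have "\<exists>b. \<forall>n. L2_norm M (S (t n) f) \<le> b" if f: "f \<in> L2_fun M" for f
  proof -
    have "\<forall>\<^sub>F t in at_right 0. L2_norm M (\<lambda>x. S t f x - f x) < 1"
      using L2_C0_semigroupD(4)[OF S f] by (rule order_tendstoD) simp
    then obtain e where e: "e > 0" "\<And>t. 0 < t \<Longrightarrow> t < e \<Longrightarrow> L2_norm M (\<lambda>x. S t f x - f x) < 1"
      by (auto simp: eventually_at_right[OF zero_less_one])
    have e': "L2_norm M (S t f) \<le> L2_norm M f + 1" if "0 \<le> t" "t < e" for t
    proof (cases "t = 0")
      case True
      have "L2_norm M (S 0 f) = L2_norm M f"
        using L2_C0_semigroupD(2)[OF S f] L2_bounded_operatorD(1)[OF L2_C0_semigroupD(1)[OF S order_refl] f] f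
        by (intro L2_norm_cong_AE) (auto dest: L2_funD)
      then show ?thesis using True by simp
    next
      case False
      have "S t f \<in> L2_fun M" by (rule L2_bounded_operatorD(1)[OF L2_C0_semigroupD(1)[OF S that(1)] f])
      from L2_norm_le_add_diff[OF this f] e(2)[of t] that False show ?thesis by simp
    qed
    obtain N where N: "1 / real (Suc N) < e" using e(1) nat_approx_posE by metis
    define b where "b = Max (insert (L2_norm M f + 1) ((\<lambda>n. L2_norm M (S (t n) f)) ` {..N}))"
    have "L2_norm M (S (t n) f) \<le> b" for n
    proof (cases "n \<le> N")
      case True then show ?thesis unfolding b_def by (intro Max_ge) auto
    next
      case False
      then have "1 / real (Suc n) \<le> 1 / real (Suc N)" by (intro divide_left_mono) auto
      then have "L2_norm M (S (t n) f) \<le> L2_norm M f + 1" using t[of n] N by (intro e') auto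
      also have "\<dots> \<le> b" unfolding b_def by (intro Max_ge) auto
      finally show ?thesis .
    qed
    then show ?thesis by blast
  qed
  then obtain K where K: "\<And>n f. f \<in> L2_fun M \<Longrightarrow> L2_norm M (S (t n) f) \<le> K * L2_norm M f"
    using L2_uniform_boundedness[of M "\<lambda>n. S (t n)"] L2_C0_semigroupD(1)[OF S t(1)] by blast
  obtain n where n: "K < real n" using reals_Archimedean2 by blast
  obtain f where f: "f \<in> L2_fun M" "L2_norm M (S (t n) f) > real (Suc n) * L2_norm M f" using tf by blast
  have "real (Suc n) * L2_norm M f < K * L2_norm M f" using K[OF f(1), of n] f(2) by linarith
  moreover have "K * L2_norm M f \<le> real (Suc n) * L2_norm M f" using n L2_norm_nonneg by (intro mult_right_mono) auto
  ultimately show False by simp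
qed

text \<open>Time is cut into steps of length at most d, each of which costs a factor K.\<close>

lemma C0_semigroup_locally_bounded:
  assumes S: "L2_C0_semigroup M S"
  shows "\<exists>K\<ge>0. \<forall>t. 0 \<le> t \<longrightarrow> t \<le> \<tau> \<longrightarrow> (\<forall>f\<in>L2_fun M. L2_norm M (S t f) \<le> K * L2_norm M f)"
proof -
  obtain d K where d: "d > 0" "K \<ge> 1"
    and b: "\<And>t f. 0 \<le> t \<Longrightarrow> t \<le> d \<Longrightarrow> f \<in> L2_fun M \<Longrightarrow> L2_norm M (S t f) \<le> K * L2_norm M f"
    using C0_semigroup_bounded_near_0[OF S] by blast
  have b': "L2_norm M (S t f) \<le> K ^ Suc m * L2_norm M f" if "0 \<le> t" "t \<le> real (Suc m) * d" "f \<in> L2_fun M" for m t f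
    using that
  proof (induction m arbitrary: t)
    case 0 then show ?case using b by simp
  next
    case (Suc m)
    show ?case
    proof (cases "t \<le> d")
      case True
      have "L2_norm M (S t f) \<le> K * L2_norm M f" using True Suc.prems b by simp
      also have "\<dots> \<le> K ^ Suc (Suc m) * L2_norm M f"
        using d power_increasing[of 1 "Suc (Suc m)" K] by (intro mult_right_mono L2_norm_nonneg) auto
      finally show ?thesis .
    next
      case False
      have t': "0 \<le> t - d" "t - d \<le> real (Suc m) * d" using False Suc.prems by (auto simp: algebra_simps)
      note dom = L2_bounded_operatorD(1)[OF L2_C0_semigroupD(1)[OF S]]
      have Sf: "S (t - d) f \<in> L2_fun M" using t' Suc.prems by (intro dom) auto
      have "AE x in M. S (d + (t - d)) f x = S d (S (t - d) f) x"
        using d t' Suc.prems by (intro L2_C0_semigroupD(3)[OF S]) auto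
      then have "L2_norm M (S t f) = L2_norm M (S d (S (t - d) f))"
        using Suc.prems d Sf by (intro L2_norm_cong_AE) (auto intro!: L2_funD(1) dom)
      also have "\<dots> \<le> K * L2_norm M (S (t - d) f)" using d Sf by (intro b) auto
      also have "\<dots> \<le> K * (K ^ Suc m * L2_norm M f)"
        using Suc.IH[OF t' Suc.prems(3)] d by (intro mult_left_mono) auto
      finally show ?thesis by simp
    qed
  qed
  obtain m where m: "\<tau> / d < real m" using reals_Archimedean2 by blast
  then have "\<tau> \<le> real (Suc m) * d" using d by (simp add: field_simps)
  then show ?thesis using b'[of _ m] d by (intro exI[of _ "K ^ Suc m"]) auto
qed

section \<open>Gaussian integrals\<close>

lemma integrable_lborel_translate:
  fixes f :: "'a::euclidean_space \<Rightarrow> 'b::{banach, second_countable_topology}"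
  assumes "integrable lborel f"
  shows "integrable lborel (\<lambda>x. f (c + x))"
proof -
  have "integrable (distr lborel borel ((+) c)) f" using assms by (simp add: lborel_distr_plus)
  then show ?thesis by (subst (asm) integrable_distr_eq) (use assms in auto)
qed

lemma integral_lborel_translate:
  fixes f :: "'a::euclidean_space \<Rightarrow> 'b::{banach, second_countable_topology}"
  assumes [measurable]: "f \<in> borel_measurable borel"
  shows "(LINT x|lborel. f (c + x)) = (LINT x|lborel. f x)"
proof -
  have "(LINT x|lborel. f x) = (LINT x|distr lborel borel ((+) c). f x)" by (simp add: lborel_distr_plus)
  also have "\<dots> = (LINT x|lborel. f (c + x))" by (rule integral_distr) auto
  finally show ?thesis ..
qed

text \<open>Average the increment \<open>\<Psi> (x + v) - \<Psi> x\<close> over all \<open>x\<close> and use translation invariance.\<close>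

lemma integral_directional_derivative:
  fixes \<Psi> D :: "'a::euclidean_space \<Rightarrow> complex"
  assumes der: "\<And>x s. ((\<lambda>s. \<Psi> (x + s *\<^sub>R v)) has_vector_derivative D (x + s *\<^sub>R v)) (at s)"
    and \<Psi>: "integrable lborel \<Psi>" and D: "integrable lborel D" and Dc: "continuous_on UNIV D"
  shows "(LINT x|lborel. D x) = 0"
proof -
  have [measurable]: "D \<in> borel_measurable borel" by (rule borel_measurable_continuous_onI[OF Dc])
  define F where "F s x = indicator {0..1} s *\<^sub>R D (s *\<^sub>R v + x)" for s :: real and x
  have F_meas: "(\<lambda>p. F (fst p) (snd p)) \<in> borel_measurable (lborel \<Otimes>\<^sub>M lborel)"
  proof -
    have "(\<lambda>p :: real \<times> 'a. D (fst p *\<^sub>R v + snd p)) \<in> borel_measurable borel"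
      by (rule borel_measurable_continuous_onI) (auto intro!: continuous_on_compose2[OF Dc] continuous_intros)
    then have [measurable]: "(\<lambda>p :: real \<times> 'a. D (fst p *\<^sub>R v + snd p)) \<in> borel_measurable (borel \<Otimes>\<^sub>M borel)" by (simp add: borel_prod)
    show ?thesis unfolding F_def by measurable
  qed
  have Fs: "(LINT x|lborel. F s x) = indicator {0..1} s *\<^sub>R (LINT x|lborel. D x)" for s
    unfolding F_def by (simp add: integral_lborel_translate)
  have nFs: "(LINT x|lborel. norm (F s x)) = indicator {0..1} s *\<^sub>R (LINT x|lborel. norm (D x))" for s
    unfolding F_def using integral_lborel_translate[of "\<lambda>x. norm (D x)" "s *\<^sub>R v"] by (simp add: indicator_def)
  have int: "integrable (lborel \<Otimes>\<^sub>M lborel) (\<lambda>(s, x). F s x)"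
  proof (rule lborel_pair.Fubini_integrable)
    show "(\<lambda>(s, x). F s x) \<in> borel_measurable (lborel \<Otimes>\<^sub>M lborel)" using F_meas by (simp add: case_prod_beta)
    show "integrable lborel (\<lambda>s. LINT x|lborel. norm (case (s, x) of (s, x) \<Rightarrow> F s x))"
      by (simp add: nFs) 
    show "AE s in lborel. integrable lborel (\<lambda>x. case (s, x) of (s, x) \<Rightarrow> F s x)"
      unfolding F_def using integrable_lborel_translate[OF D] by simp
  qed
  have inner: "(LINT s|lborel. F s x) = \<Psi> (x + 1 *\<^sub>R v) - \<Psi> (x + 0 *\<^sub>R v)" for x
    unfolding F_def add.commute[of _ x]
  proof (rule integral_FTC_Icc)
    show "continuous_on {0..1} (\<lambda>s. D (x + s *\<^sub>R v))" by (auto intro!: continuous_on_compose2[OF Dc] continuous_intros)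
  qed (auto intro: has_vector_derivative_at_within der)
  have "(LINT s|lborel. (LINT x|lborel. F s x)) = (LINT x|lborel. (LINT s|lborel. F s x))"
    by (rule lborel_pair.Fubini_integral[OF int, symmetric])
  also have "(LINT s|lborel. (LINT x|lborel. F s x)) = (LINT x|lborel. D x)" unfolding Fs by simp
  also have "(LINT x|lborel. (LINT s|lborel. F s x)) = (LINT x|lborel. \<Psi> (v + x) - \<Psi> x)" unfolding inner by (simp add: add.commute)
  also have "\<dots> = 0"
    using integrable_lborel_translate[OF \<Psi>, of v] \<Psi> integral_lborel_translate[of \<Psi> v] by simp
  finally show ?thesis .
qed

text \<open>From x^2 >= 2 |x| - 1 the Gaussian lies below a two-sided exponential.\<close>

lemma nn_integral_gaussian_1d_finite:
  assumes c: "c > 0"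
  shows "(\<integral>\<^sup>+x. ennreal (exp (- c * x\<^sup>2)) \<partial>lborel) < \<infinity>"
proof -
  have half: "(\<integral>\<^sup>+x. ennreal (exp (- (2 * c) * x)) * indicator {0..} x \<partial>lborel) = ennreal (exp (- (2 * c) * 0) / (2 * c))"
    using c by (intro nn_integral_has_integral_lebesgue' has_integral_exp_minus_to_infinity) auto
  have half': "(\<integral>\<^sup>+x. ennreal (exp (- (2 * c) * (- x))) * indicator {0..} (- x) \<partial>lborel) = ennreal (exp (- (2 * c) * 0) / (2 * c))"
    unfolding half[symmetric] by (subst nn_integral_real_affine[where c = "-1" and t = 0]) auto
  have ma: "(\<lambda>x. ennreal (exp (- (2 * c) * x)) * indicator {0..} x) \<in> borel_measurable lborel"
    and mb: "(\<lambda>x. ennreal (exp (- (2 * c) * (- x))) * indicator {0..} (- x)) \<in> borel_measurable lborel" by measurable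
  have ma': "(\<lambda>x. ennreal (exp c) * (ennreal (exp (- (2 * c) * x)) * indicator {0..} x)) \<in> borel_measurable lborel"
    and mb': "(\<lambda>x. ennreal (exp c) * (ennreal (exp (- (2 * c) * (- x))) * indicator {0..} (- x))) \<in> borel_measurable lborel" by measurable
  have "(\<integral>\<^sup>+x. ennreal (exp (- c * x\<^sup>2)) \<partial>lborel) \<le>
    (\<integral>\<^sup>+x. ennreal (exp c) * (ennreal (exp (- (2 * c) * x)) * indicator {0..} x) + ennreal (exp c) * (ennreal (exp (- (2 * c) * (- x))) * indicator {0..} (- x)) \<partial>lborel)"
  proof (rule nn_integral_mono)
    fix x :: real
    have "2 * \<bar>x\<bar> - 1 \<le> x\<^sup>2" using zero_le_power2[of "\<bar>x\<bar> - 1"] by (simp add: power2_eq_square algebra_simps)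
    then have "c * (2 * \<bar>x\<bar> - 1) \<le> c * x\<^sup>2" using c by (intro mult_left_mono) auto
    then have "exp (- c * x\<^sup>2) \<le> exp (c + - (2 * c) * \<bar>x\<bar>)" by (simp add: algebra_simps)
    also have "\<dots> = exp c * exp (- (2 * c) * \<bar>x\<bar>)" by (rule exp_add)
    finally have le: "ennreal (exp (- c * x\<^sup>2)) \<le> ennreal (exp c * exp (- (2 * c) * \<bar>x\<bar>))" by (rule ennreal_leI)
    show "ennreal (exp (- c * x\<^sup>2)) \<le> ennreal (exp c) * (ennreal (exp (- (2 * c) * x)) * indicator {0..} x) + ennreal (exp c) * (ennreal (exp (- (2 * c) * (- x))) * indicator {0..} (- x))"
    proof (cases "x \<ge> 0")
      case True
      then have "ennreal (exp (- c * x\<^sup>2)) \<le> ennreal (exp c) * (ennreal (exp (- (2 * c) * x)) * indicator {0..} x)"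
        using le by (simp add: ennreal_mult)
      then show ?thesis by (rule order_trans) simp
    next
      case False
      then have "ennreal (exp (- c * x\<^sup>2)) \<le> ennreal (exp c) * (ennreal (exp (- (2 * c) * (- x))) * indicator {0..} (- x))"
        using le by (simp add: ennreal_mult)
      then show ?thesis by (rule order_trans) simp
    qed
  qed
  also have "\<dots> = ennreal (exp c) * ennreal (exp (- (2 * c) * 0) / (2 * c)) + ennreal (exp c) * ennreal (exp (- (2 * c) * 0) / (2 * c))"
    by (simp only: nn_integral_add[OF ma' mb']
      nn_integral_cmult[OF ma] nn_integral_cmult[OF mb] half half')
  also have "\<dots> < \<infinity>" by (simp add: ennreal_mult_less_top)
  finally show ?thesis .
qed

lemma integrable_gaussian:
  assumes c: "c > 0"
  shows "integrable lborel (\<lambda>x :: 'a::euclidean_space. exp (- c * (norm x)\<^sup>2))"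
proof (rule integrableI_bounded)
  have "ennreal (norm (exp (- c * (norm x)\<^sup>2))) = (\<Prod>b\<in>Basis. ennreal (exp (- c * (x \<bullet> b)\<^sup>2)))" for x :: 'a
  proof -
    have "(norm x)\<^sup>2 = (\<Sum>b\<in>Basis. (x \<bullet> b)\<^sup>2)"
      unfolding power2_norm_eq_inner by (subst euclidean_inner) (simp add: power2_eq_square)
    then have "exp (- c * (norm x)\<^sup>2) = (\<Prod>b\<in>Basis. exp (- c * (x \<bullet> b)\<^sup>2))"
      by (simp add: exp_sum[symmetric] sum_distrib_left sum_negf)
    then have "ennreal (exp (- c * (norm x)\<^sup>2)) = ennreal (\<Prod>b\<in>Basis. exp (- c * (x \<bullet> b)\<^sup>2))" by (simp only:)
    also have "\<dots> = (\<Prod>b\<in>Basis. ennreal (exp (- c * (x \<bullet> b)\<^sup>2)))" by (rule prod_ennreal[symmetric]) simp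
    finally show ?thesis by simp
  qed
  then have "(\<integral>\<^sup>+x. ennreal (norm (exp (- c * (norm (x :: 'a))\<^sup>2))) \<partial>lborel) = (\<Prod>b\<in>(Basis :: 'a set). (\<integral>\<^sup>+x. ennreal (exp (- c * x\<^sup>2)) \<partial>lborel))"
    using nn_integral_lborel_prod[of "\<lambda>(_ :: 'a) x. ennreal (exp (- c * x\<^sup>2))"] by simp
  also have "\<dots> < \<infinity>"
    using nn_integral_gaussian_1d_finite[OF c] by (simp add: power_less_top_ennreal)
  finally show "(\<integral>\<^sup>+x. ennreal (norm (exp (- c * (norm (x :: 'a))\<^sup>2))) \<partial>lborel) < \<infinity>" .
qed auto

text \<open>Half of the exponent absorbs the quadratic factor, by 1 + u <= exp u.\<close>

lemma norm_mult_gaussian_le: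
  fixes x :: "'a::real_normed_vector"
  assumes c: "c > 0"
  shows "(1 + norm x)\<^sup>2 * exp (- c * (norm x)\<^sup>2) \<le> (2 + 4 / c) * exp (- (c / 2) * (norm x)\<^sup>2)"
proof -
  define u where "u = (norm x)\<^sup>2"
  have "(1 + norm x)\<^sup>2 \<le> 2 + 2 * u"
    using zero_le_power2[of "norm x - 1"] by (simp add: u_def power2_eq_square algebra_simps)
  also have "\<dots> \<le> (2 + 4 / c) * exp (c / 2 * u)"
  proof -
    have e: "1 + c / 2 * u \<le> exp (c / 2 * u)" by (rule exp_ge_add_one_self)
    then have e': "c / 2 * u \<le> exp (c / 2 * u)" by linarith
    have "u = 2 / c * (c / 2 * u)" using c by simp
    also have "\<dots> \<le> 2 / c * exp (c / 2 * u)" using e' c by (intro mult_left_mono) auto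
    finally have "2 * u \<le> 4 / c * exp (c / 2 * u)" by simp
    moreover have "1 \<le> exp (c / 2 * u)" using c by (simp add: u_def)
    ultimately show ?thesis unfolding distrib_right by linarith
  qed
  finally have "(1 + norm x)\<^sup>2 * exp (- c * u) \<le> (2 + 4 / c) * exp (c / 2 * u) * exp (- c * u)"
    by (intro mult_right_mono) auto
  also have "\<dots> = (2 + 4 / c) * exp (- (c / 2) * u)" by (simp add: mult.assoc exp_add[symmetric])
  finally show ?thesis by (simp add: u_def)
qed

lemma integrable_norm_square_gaussian:
  assumes c: "c > 0"
  shows "integrable lborel (\<lambda>x :: 'a::euclidean_space. (1 + norm x)\<^sup>2 * exp (- c * (norm x)\<^sup>2))"
proof (rule Bochner_Integration.integrable_bound)
  show "integrable lborel (\<lambda>x :: 'a. (2 + 4 / c) * exp (- (c / 2) * (norm x)\<^sup>2))"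
    using integrable_gaussian[of "c / 2", where 'a = 'a] c by simp
  show "AE x in lborel. norm ((1 + norm (x :: 'a))\<^sup>2 * exp (- c * (norm x)\<^sup>2)) \<le> norm ((2 + 4 / c) * exp (- (c / 2) * (norm x)\<^sup>2))"
    using norm_mult_gaussian_le[OF c] c by (intro AE_I2) (auto simp: abs_mult)
qed auto

lemma tendsto_integral_dominated_within:
  fixes f :: "real \<Rightarrow> 'a \<Rightarrow> 'b::{banach, second_countable_topology}"
  assumes lim: "\<And>x. ((\<lambda>h. f h x) \<longlongrightarrow> g x) (at a within S)"
    and w: "integrable M w" and dom: "\<And>h x. h \<in> S \<Longrightarrow> h \<noteq> a \<Longrightarrow> norm (f h x) \<le> w x"
    and meas: "\<And>h. f h \<in> borel_measurable M" "g \<in> borel_measurable M"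
  shows "((\<lambda>h. LINT x|M. f h x) \<longlongrightarrow> (LINT x|M. g x)) (at a within S)"
  unfolding tendsto_at_iff_sequentially
proof (intro allI impI)
  fix X assume X: "\<forall>i. X i \<in> S - {a}" "X \<longlonglongrightarrow> a"
  show "((\<lambda>h. LINT x|M. f h x) \<circ> X) \<longlonglongrightarrow> (LINT x|M. g x)"
    unfolding o_def
  proof (rule integral_dominated_convergence)
    show "AE x in M. (\<lambda>i. f (X i) x) \<longlonglongrightarrow> g x"
      using lim X unfolding tendsto_at_iff_sequentially by (auto simp: o_def)
    show "AE x in M. norm (f (X i) x) \<le> w x" for i using dom X by auto
  qed (use w meas in auto)
qed

lemma cmod_cis_diff_le: "cmod (cis a - cis b) \<le> \<bar>a - b\<bar>"
proof -
  have *: "cmod (cis t - 1) \<le> \<bar>t\<bar>" for t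
  proof -
    have "(cmod (cis t - 1))\<^sup>2 = (cos t - 1)\<^sup>2 + (sin t)\<^sup>2" by (simp add: cmod_power2)
    also have "\<dots> = 2 - 2 * cos (2 * (t / 2))" using sin_cos_squared_add[of t] by (simp add: power2_diff)
    also have "\<dots> = (2 * sin (t / 2))\<^sup>2" unfolding cos_double_sin by (simp add: power_mult_distrib)
    finally have "cmod (cis t - 1) = \<bar>2 * sin (t / 2)\<bar>"
      by (metis norm_ge_zero real_sqrt_abs real_sqrt_unique)
    then show ?thesis using abs_sin_x_le_abs_x[of "t / 2"] by (simp add: abs_mult)
  qed
  have "cis a - cis b = cis b * (cis (a - b) - 1)" by (simp add: right_diff_distrib cis_mult)
  then show ?thesis using *[of "a - b"] by (simp add: norm_mult)
qed

lemma has_vector_derivative_within_quotient: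
  fixes f :: "real \<Rightarrow> 'a::real_normed_vector"
  shows "(f has_vector_derivative d) (at s within A) \<longleftrightarrow> ((\<lambda>t. (f t - f s) /\<^sub>R (t - s)) \<longlongrightarrow> d) (at s within A)"
proof -
  have eq: "norm ((f t - f s - (t - s) *\<^sub>R d) /\<^sub>R norm (t - s)) = norm ((f t - f s) /\<^sub>R (t - s) - d)" if "t \<noteq> s" for t
  proof -
    have "(f t - f s) /\<^sub>R (t - s) - d = (f t - f s - (t - s) *\<^sub>R d) /\<^sub>R (t - s)"
      using that by (simp add: scaleR_diff_right)
    then show ?thesis by simp
  qed
  have "(f has_vector_derivative d) (at s within A) \<longleftrightarrow> ((\<lambda>t. norm ((f t - f s - (t - s) *\<^sub>R d) /\<^sub>R norm (t - s))) \<longlongrightarrow> 0) (at s within A)"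
    unfolding has_vector_derivative_def has_derivative_within tendsto_norm_zero_iff
    by (simp add: bounded_linear_scaleR_left divide_inverse diff_diff_eq)
  also have "\<dots> \<longleftrightarrow> ((\<lambda>t. norm ((f t - f s) /\<^sub>R (t - s) - d)) \<longlongrightarrow> 0) (at s within A)"
    by (rule filterlim_cong[OF refl refl]) (unfold eventually_at_filter, intro always_eventually allI impI eq)
  also have "\<dots> \<longleftrightarrow> ((\<lambda>t. (f t - f s) /\<^sub>R (t - s)) \<longlongrightarrow> d) (at s within A)"
    by (simp add: tendsto_norm_zero_iff LIM_zero_iff)
  finally show ?thesis .
qed

text \<open>The Fourier transform is found from a differential equation. Let \<phi> s be its value
  at s \<zeta>. A derivative in the direction v = S \<zeta>, chosen because \<Lambda> v = \<zeta>,
  integrates to zero; this expresses the integral of (\<zeta> \<bullet> x) \<Psi> s as i s q times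
  \<phi> s, with q = <S \<zeta>, \<zeta>>. Hence \<phi>' = - s q \<phi>. The total mass \<phi> 0
  stays as a factor.\<close>

lemma gaussian_fourier:
  fixes \<Lambda> S :: "real^'n^'n"
  assumes sym: "transpose \<Lambda> = \<Lambda>" and inv: "\<Lambda> ** S = mat 1" and c: "c > 0" "\<And>x. c * (norm x)\<^sup>2 \<le> (\<Lambda> *v x) \<bullet> x"
  shows "(LINT x|lborel. cis (\<zeta> \<bullet> x) * complex_of_real (exp (- (1/2) * ((\<Lambda> *v x) \<bullet> x))))
    = complex_of_real (exp (- (1/2) * ((S *v \<zeta>) \<bullet> \<zeta>)) * (LINT x|lborel. exp (- (1/2) * ((\<Lambda> *v x) \<bullet> x))))"
proof -
  have LS: "\<Lambda> *v (S *v z) = z" for z by (simp add: matrix_vector_mul_assoc inv)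
  define g where "g x = exp (- (1/2) * ((\<Lambda> *v x) \<bullet> x))" for x
  define q where "q = (S *v \<zeta>) \<bullet> \<zeta>"
  have gc: "continuous_on A g" for A unfolding g_def[abs_def]
    by (intro continuous_intros bounded_linear.continuous_on[OF matrix_vector_mul_bounded_linear])
  have [measurable]: "g \<in> borel_measurable borel" by (rule borel_measurable_continuous_onI[OF gc])
  have gle: "g x \<le> exp (- (c/2) * (norm x)\<^sup>2)" for x using c(2)[of x] by (simp add: g_def)
  have g0: "0 \<le> g x" for x by (simp add: g_def)
  have lin: "integrable lborel (\<lambda>x. (1 + norm x) * g x)"
  proof (rule Bochner_Integration.integrable_bound[OF integrable_norm_square_gaussian[of "c/2"]])
    show "c / 2 > 0" using c by simp
    show "AE x in lborel. norm ((1 + norm x) * g x) \<le> norm ((1 + norm x)\<^sup>2 * exp (- (c/2) * (norm x)\<^sup>2))"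
    proof (intro AE_I2)
      fix x :: "real^'n"
      have "(1 + norm x) * g x \<le> (1 + norm x)\<^sup>2 * exp (- (c/2) * (norm x)\<^sup>2)"
        using g0 gle by (intro mult_mono) (auto simp: power2_eq_square algebra_simps)
      then show "norm ((1 + norm x) * g x) \<le> norm ((1 + norm x)\<^sup>2 * exp (- (c/2) * (norm x)\<^sup>2))"
        using g0[of x] by (simp add: abs_mult)
    qed
  qed measurable
  have dominated: "integrable lborel f" if "f \<in> borel_measurable borel" "\<And>x. norm (f x) \<le> K * ((1 + norm x) * g x)" for f :: "real^'n \<Rightarrow> complex" and K
  proof (rule Bochner_Integration.integrable_bound)
    show "integrable lborel (\<lambda>x. K * ((1 + norm x) * g x))" using lin by simp
    show "AE x in lborel. norm (f x) \<le> norm (K * ((1 + norm x) * g x))" using that(2) by (intro AE_I2) (metis abs_ge_self order_trans real_norm_def)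
  qed (use that(1) in auto)
  define \<Psi> where "\<Psi> s x = cis (s * (\<zeta> \<bullet> x)) * of_real (g x)" for s x
  have \<Psi>c: "continuous_on A (\<Psi> s)" for A s unfolding \<Psi>_def[abs_def] cis_conv_exp by (intro continuous_intros gc)
  have [measurable]: "\<Psi> s \<in> borel_measurable borel" for s by (rule borel_measurable_continuous_onI[OF \<Psi>c])
  have n\<Psi>: "norm (\<Psi> s x) = g x" for s x using g0 by (simp add: \<Psi>_def norm_mult)
  have gle1: "g x \<le> 1 * ((1 + norm x) * g x)" for x using g0[of x] by (simp add: algebra_simps)
  have zle: "\<bar>\<zeta> \<bullet> x\<bar> * g x \<le> norm \<zeta> * ((1 + norm x) * g x)" for x
  proof -
    have "\<bar>\<zeta> \<bullet> x\<bar> \<le> norm \<zeta> * (1 + norm x)" using Cauchy_Schwarz_ineq2[of \<zeta> x] by (simp add: algebra_simps add_increasing)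
    then show ?thesis using g0[of x] by (metis mult.assoc mult_right_mono)
  qed
  have i1: "integrable lborel (\<Psi> s)" for s by (rule dominated[of _ 1]) (use n\<Psi> gle1 in auto)
  have i2: "integrable lborel (\<lambda>x. of_real (\<zeta> \<bullet> x) * \<Psi> s x)" for s
    by (rule dominated[of _ "norm \<zeta>"]) (use zle in \<open>auto simp: norm_mult n\<Psi>\<close>)
  define \<phi> where "\<phi> s = (LINT x|lborel. \<Psi> s x)" for s
  have ibp: "(LINT x|lborel. of_real (\<zeta> \<bullet> x) * \<Psi> s x) = \<i> * of_real (s * q) * \<phi> s" for s
  proof -
    define D where "D x = (\<i> * of_real (s * q) - of_real (\<zeta> \<bullet> x)) * \<Psi> s x" for x
    have Lam: "(\<Lambda> *v x) \<bullet> (S *v \<zeta>) = \<zeta> \<bullet> x" for x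
      by (metis LS dot_lmul_matrix inner_commute sym transpose_matrix_vector)
    have "(LINT x|lborel. D x) = 0"
    proof (rule integral_directional_derivative[where v = "S *v \<zeta>"])
      show "integrable lborel (\<Psi> s)" by (rule i1)
      show "continuous_on UNIV D" unfolding D_def[abs_def] by (intro continuous_intros \<Psi>c)
      show "integrable lborel D"
        using Bochner_Integration.integrable_diff[OF integrable_mult_right[OF i1[of s], of "\<i> * of_real (s * q)"] i2[of s]]
        by (simp add: D_def[abs_def] left_diff_distrib)
      fix x \<sigma>
      let ?v = "S *v \<zeta>"
      have quad: "(\<Lambda> *v (x + \<sigma> *\<^sub>R ?v)) \<bullet> (x + \<sigma> *\<^sub>R ?v) = (\<Lambda> *v x) \<bullet> x + 2 * \<sigma> * (\<zeta> \<bullet> x) + \<sigma>\<^sup>2 * q" for \<sigma>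
      proof -
        have "(\<Lambda> *v (x + \<sigma> *\<^sub>R ?v)) = \<Lambda> *v x + \<sigma> *\<^sub>R \<zeta>" by (simp only: matrix_vector_right_distrib matrix_vector_mult_scaleR LS)
        then have "(\<Lambda> *v (x + \<sigma> *\<^sub>R ?v)) \<bullet> (x + \<sigma> *\<^sub>R ?v) = (\<Lambda> *v x) \<bullet> x + \<sigma> * (\<zeta> \<bullet> x) + \<sigma> * ((\<Lambda> *v x) \<bullet> ?v) + \<sigma>\<^sup>2 * (\<zeta> \<bullet> ?v)"
          by (simp only: inner_add_left inner_add_right inner_scaleR_left inner_scaleR_right) (simp only: power2_eq_square algebra_simps)
        then show ?thesis unfolding Lam q_def inner_commute[of \<zeta> ?v] by simp
      qed
      define a b where "a = \<zeta> \<bullet> x" and "b = (\<Lambda> *v x) \<bullet> x"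
      define F where "F z = exp (\<i> * of_real s * (of_real a + z * of_real q) + (- (1/2)) * (of_real b + 2 * z * of_real a + z\<^sup>2 * of_real q))" for z
      have zv: "\<zeta> \<bullet> (x + \<sigma> *\<^sub>R ?v) = a + \<sigma> * q" for \<sigma>
        by (simp add: inner_add_right a_def q_def inner_commute)
      have \<Psi>F: "\<Psi> s (x + \<sigma> *\<^sub>R ?v) = F (of_real \<sigma>)" for \<sigma>
        unfolding \<Psi>_def g_def quad zv F_def exp_add cis_conv_exp exp_of_real[symmetric]
        by (simp add: a_def[symmetric] b_def[symmetric] mult.assoc)
      have "(F has_field_derivative ((\<i> * of_real (s * q) - of_real (a + \<sigma> * q)) * F (of_real \<sigma>))) (at (of_real \<sigma>))"
        unfolding F_def by (auto intro!: derivative_eq_intros simp: algebra_simps)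
      from has_vector_derivative_real_field[OF this]
      show "((\<lambda>\<sigma>. \<Psi> s (x + \<sigma> *\<^sub>R ?v)) has_vector_derivative D (x + \<sigma> *\<^sub>R ?v)) (at \<sigma>)"
        unfolding D_def \<Psi>F zv .
    qed
    also have "(LINT x|lborel. D x) = \<i> * of_real (s * q) * \<phi> s - (LINT x|lborel. of_real (\<zeta> \<bullet> x) * \<Psi> s x)"
      unfolding D_def left_diff_distrib \<phi>_def using i1 i2 by (subst Bochner_Integration.integral_diff) auto
    finally show ?thesis by simp
  qed
  have d\<phi>: "(\<phi> has_vector_derivative - (of_real (s * q) * \<phi> s)) (at s)" for s
  proof -
    have "((\<lambda>t. LINT x|lborel. (\<Psi> t x - \<Psi> s x) /\<^sub>R (t - s)) \<longlongrightarrow> (LINT x|lborel. \<i> * (of_real (\<zeta> \<bullet> x) * \<Psi> s x))) (at s within UNIV)"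
    proof (rule tendsto_integral_dominated_within)
      fix x
      have "((\<lambda>t. \<Psi> t x) has_vector_derivative \<i> * (of_real (\<zeta> \<bullet> x) * \<Psi> s x)) (at s)"
      proof -
        define F where "F z = exp (\<i> * (z * of_real (\<zeta> \<bullet> x))) * complex_of_real (g x)" for z
        have F: "\<Psi> t x = F (of_real t)" for t by (simp add: \<Psi>_def F_def cis_conv_exp)
        have "(F has_field_derivative \<i> * (of_real (\<zeta> \<bullet> x) * F (of_real s))) (at (of_real s))"
          unfolding F_def by (auto intro!: derivative_eq_intros)
        from has_vector_derivative_real_field[OF this] show ?thesis unfolding F .
      qed
      then show "((\<lambda>t. (\<Psi> t x - \<Psi> s x) /\<^sub>R (t - s)) \<longlongrightarrow> \<i> * (of_real (\<zeta> \<bullet> x) * \<Psi> s x)) (at s within UNIV)"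
        by (simp add: has_vector_derivative_within_quotient)
    next
      show "integrable lborel (\<lambda>x. norm \<zeta> * ((1 + norm x) * g x))" using lin by simp
      fix t x assume "t \<noteq> s"
      have "norm ((\<Psi> t x - \<Psi> s x) /\<^sub>R (t - s)) = cmod (cis (t * (\<zeta> \<bullet> x)) - cis (s * (\<zeta> \<bullet> x))) * g x / \<bar>t - s\<bar>"
      proof -
        have "\<Psi> t x - \<Psi> s x = (cis (t * (\<zeta> \<bullet> x)) - cis (s * (\<zeta> \<bullet> x))) * of_real (g x)"
          by (simp add: \<Psi>_def left_diff_distrib)
        then show ?thesis using g0[of x] by (simp add: norm_mult divide_inverse)
      qed
      also have "\<dots> \<le> \<bar>t * (\<zeta> \<bullet> x) - s * (\<zeta> \<bullet> x)\<bar> * g x / \<bar>t - s\<bar>"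
        using g0 by (intro divide_right_mono mult_right_mono cmod_cis_diff_le) auto
      also have "\<dots> = \<bar>\<zeta> \<bullet> x\<bar> * g x" using \<open>t \<noteq> s\<close> by (simp add: left_diff_distrib[symmetric] abs_mult)
      also have "\<dots> \<le> norm \<zeta> * ((1 + norm x) * g x)" by (rule zle)
      finally show "norm ((\<Psi> t x - \<Psi> s x) /\<^sub>R (t - s)) \<le> norm \<zeta> * ((1 + norm x) * g x)" .
    qed measurable
    moreover have "(LINT x|lborel. (\<Psi> t x - \<Psi> s x) /\<^sub>R (t - s)) = (\<phi> t - \<phi> s) /\<^sub>R (t - s)" for t
      unfolding \<phi>_def using i1 by simp
    moreover have "(LINT x|lborel. \<i> * (of_real (\<zeta> \<bullet> x) * \<Psi> s x)) = - (of_real (s * q) * \<phi> s)"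
    proof -
      have "(LINT x|lborel. \<i> * (of_real (\<zeta> \<bullet> x) * \<Psi> s x)) = \<i> * (LINT x|lborel. of_real (\<zeta> \<bullet> x) * \<Psi> s x)"
        by (rule integral_mult_right_zero)
      also have "\<dots> = (\<i> * \<i>) * (of_real (s * q) * \<phi> s)" unfolding ibp by (simp only: mult.assoc)
      finally show ?thesis by simp
    qed
    ultimately show ?thesis unfolding has_vector_derivative_within_quotient by (simp only:)
  qed
  \<comment> \<open>The integrating factor of \<phi>' = - s q \<phi> makes \<theta> constant; it is
    compared at s = 1 and s = 0.\<close>
  define \<theta> where "\<theta> s = of_real (exp (q * s\<^sup>2 / 2)) * \<phi> s" for s
  have e: "((\<lambda>s. complex_of_real (exp (q * s\<^sup>2 / 2))) has_vector_derivative of_real (exp (q * s\<^sup>2 / 2) * (q * s))) (at s)" for s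
    by (rule has_vector_derivative_of_real) (auto intro!: derivative_eq_intros simp: has_real_derivative_iff_has_vector_derivative[symmetric])
  have "(\<theta> has_vector_derivative 0) (at s within UNIV)" for s
    using has_vector_derivative_mult[OF e[of s] d\<phi>[of s]] unfolding \<theta>_def[abs_def] by (simp add: algebra_simps)
  then obtain k where k: "\<And>s. s \<in> UNIV \<Longrightarrow> \<theta> s = k"
    by (rule has_vector_derivative_zero_constant[OF convex_UNIV]) auto
  have "\<theta> 1 = \<theta> 0" using k[of 1] k[of 0] by simp
  then have "of_real (exp (q / 2)) * \<phi> 1 = \<phi> 0" by (simp add: \<theta>_def)
  then have "of_real (exp (- (1/2) * q)) * (of_real (exp (q / 2)) * \<phi> 1) = of_real (exp (- (1/2) * q)) * \<phi> 0" by simp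
  then have "\<phi> 1 = of_real (exp (- (1/2) * q)) * \<phi> 0"
    by (simp add: mult.assoc[symmetric] flip: of_real_mult exp_add)
  moreover have "\<phi> 0 = of_real (LINT x|lborel. g x)" unfolding \<phi>_def \<Psi>_def by (simp add: integral_complex_of_real)
  ultimately show ?thesis by (simp add: \<phi>_def \<Psi>_def g_def q_def)
qed

section \<open>Density of trigonometric polynomials\<close>

text \<open>Frequencies are arbitrary vectors, not lattice points: the flow moves them continuously,
  and the span has to be preserved by it.\<close>

definition trig_polys :: "(real^'n \<Rightarrow> complex) set"
  where "trig_polys = {g. \<exists>F c. finite F \<and> g = (\<lambda>x. \<Sum>\<xi>\<in>F. c \<xi> * cis (\<xi> \<bullet> x))}"

lemma trig_polys_zero: "(\<lambda>x. 0) \<in> trig_polys"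
  unfolding trig_polys_def by (intro CollectI exI[of _ "{}"]) auto

lemma trig_polys_add:
  assumes "f \<in> trig_polys" "g \<in> trig_polys"
  shows "(\<lambda>x. f x + g x) \<in> trig_polys"
proof -
  obtain F c where F: "finite F" "f = (\<lambda>x. \<Sum>\<xi>\<in>F. c \<xi> * cis (\<xi> \<bullet> x))" using assms(1) by (auto simp: trig_polys_def)
  obtain G d where G: "finite G" "g = (\<lambda>x. \<Sum>\<xi>\<in>G. d \<xi> * cis (\<xi> \<bullet> x))" using assms(2) by (auto simp: trig_polys_def)
  let ?c = "\<lambda>\<xi>. if \<xi> \<in> F then c \<xi> else 0" let ?d = "\<lambda>\<xi>. if \<xi> \<in> G then d \<xi> else 0"
  have "f x = (\<Sum>\<xi>\<in>F \<union> G. ?c \<xi> * cis (\<xi> \<bullet> x))" for x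
    unfolding F(2) by (rule sum.mono_neutral_cong_left) (use F(1) G(1) in auto)
  moreover have "g x = (\<Sum>\<xi>\<in>F \<union> G. ?d \<xi> * cis (\<xi> \<bullet> x))" for x
    unfolding G(2) by (rule sum.mono_neutral_cong_left) (use F(1) G(1) in auto)
  ultimately have "(\<lambda>x. f x + g x) = (\<lambda>x. \<Sum>\<xi>\<in>F \<union> G. (?c \<xi> + ?d \<xi>) * cis (\<xi> \<bullet> x))"
    by (simp only: distrib_right sum.distrib)
  then show ?thesis unfolding trig_polys_def using F(1) G(1)
    by (intro CollectI exI[of _ "F \<union> G"] exI[of _ "\<lambda>\<xi>. ?c \<xi> + ?d \<xi>"]) auto
qed

lemma trig_polys_cis_mult:
  assumes "g \<in> trig_polys"
  shows "(\<lambda>x. a * cis (\<eta> \<bullet> x) * g x) \<in> trig_polys"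
proof -
  obtain G d where G: "finite G" "g = (\<lambda>x. \<Sum>\<xi>\<in>G. d \<xi> * cis (\<xi> \<bullet> x))" using assms by (auto simp: trig_polys_def)
  have "a * cis (\<eta> \<bullet> x) * g x = (\<Sum>\<zeta>\<in>(+) \<eta> ` G. (a * d (\<zeta> - \<eta>)) * cis (\<zeta> \<bullet> x))" for x
    unfolding G(2) sum_distrib_left
    by (subst sum.reindex) (auto simp: inner_add_left cis_mult[symmetric] mult_ac intro!: sum.cong)
  then show ?thesis unfolding trig_polys_def using G(1)
    by (intro CollectI exI[of _ "(+) \<eta> ` G"] exI[of _ "\<lambda>\<zeta>. a * d (\<zeta> - \<eta>)"]) auto
qed

lemma trig_polys_sum:
  assumes "\<And>j. j \<in> J \<Longrightarrow> f j \<in> trig_polys"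
  shows "(\<lambda>x. \<Sum>j\<in>J. f j x) \<in> trig_polys"
  using assms by (induction J rule: infinite_finite_induct) (auto intro: trig_polys_zero trig_polys_add)

lemma trig_polys_mult:
  assumes "f \<in> trig_polys" "g \<in> trig_polys"
  shows "(\<lambda>x. f x * g x) \<in> trig_polys"
proof -
  obtain F c where F: "finite F" "f = (\<lambda>x. \<Sum>\<xi>\<in>F. c \<xi> * cis (\<xi> \<bullet> x))" using assms(1) by (auto simp: trig_polys_def)
  have "(\<lambda>x. \<Sum>\<xi>\<in>F. c \<xi> * cis (\<xi> \<bullet> x) * g x) \<in> trig_polys"
    by (intro trig_polys_sum trig_polys_cis_mult assms(2))
  then show ?thesis unfolding F(2) by (simp add: sum_distrib_right)
qed

lemma trig_polys_const: "(\<lambda>x. a) \<in> trig_polys"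
  unfolding trig_polys_def by (intro CollectI exI[of _ "{0}"] exI[of _ "\<lambda>_. a"]) auto

lemma trig_polys_cmult: "g \<in> trig_polys \<Longrightarrow> (\<lambda>x. a * g x) \<in> trig_polys"
  using trig_polys_cis_mult[of g a 0] by simp

lemma trig_polys_sin:
  fixes \<xi> :: "real^'n"
  shows "(\<lambda>x. of_real (sin (\<xi> \<bullet> x))) \<in> trig_polys"
proof -
  have c: "(\<lambda>x. b * cis (\<eta> \<bullet> x)) \<in> trig_polys" for b and \<eta> :: "real^'n"
    using trig_polys_cis_mult[OF trig_polys_const[of 1], of b \<eta>] by simp
  have "complex_of_real (sin t) = (- \<i> / 2) * cis t + (\<i> / 2) * cis (- t)" for t
    by (simp add: complex_eq_iff)
  then have "(\<lambda>x. complex_of_real (sin (\<xi> \<bullet> x))) = (\<lambda>x. (- \<i> / 2) * cis (\<xi> \<bullet> x) + (\<i> / 2) * cis ((- \<xi>) \<bullet> x))"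
    by (simp add: fun_eq_iff)
  then show ?thesis using trig_polys_add[OF c c] by metis
qed

text \<open>Linear forms in the vector of sines are trigonometric polynomials, and these are closed
  under sums and products. This turns polynomial approximation on a cube into trigonometric
  approximation.\<close>

lemma trig_polys_sin_substitution:
  fixes p :: "real^'n \<Rightarrow> real"
  assumes "real_polynomial_function p"
  shows "(\<lambda>x :: real^'n. of_real (p (\<chi> i. sin (x $ i / N)))) \<in> trig_polys"
  using assms
proof (induction p rule: real_polynomial_function.induct)
  case (linear f)
  have coord: "f v = (\<Sum>i\<in>UNIV. v $ i * f (axis i 1))" for v
  proof -
    have "v = (\<Sum>i\<in>UNIV. v $ i *\<^sub>R axis i 1)" using basis_expansion[of v] by (simp add: scalar_mult_eq_scaleR)
    then have "f v = f (\<Sum>i\<in>UNIV. v $ i *\<^sub>R axis i 1)" by simp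
    also have "\<dots> = (\<Sum>i\<in>UNIV. v $ i * f (axis i 1))"
      using linear_sum[OF bounded_linear.linear[OF linear], of "\<lambda>i. v $ i *\<^sub>R axis i 1" UNIV] linear_scale[OF bounded_linear.linear[OF linear]] by simp
    finally show ?thesis .
  qed
  have "f (\<chi> i. sin (x $ i / N)) = (\<Sum>i\<in>UNIV. f (axis i 1) * sin (axis i (1 / N) \<bullet> x))" for x :: "real^'n"
    using coord[of "\<chi> i. sin (x $ i / N)"] by (simp add: inner_axis' mult.commute)
  then have "(\<lambda>x :: real^'n. of_real (f (\<chi> i. sin (x $ i / N)))) = (\<lambda>x. \<Sum>i\<in>UNIV. of_real (f (axis i 1)) * complex_of_real (sin (axis i (1 / N) \<bullet> x)))"
    by simp
  moreover have "(\<lambda>x. \<Sum>i\<in>UNIV. of_real (f (axis i 1)) * complex_of_real (sin (axis i (1 / N) \<bullet> x))) \<in> trig_polys"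
    by (intro trig_polys_sum trig_polys_cmult trig_polys_sin)
  ultimately show ?case by simp
next
  case (const c)
  show ?case by (rule trig_polys_const)
next
  case (add f g)
  then show ?case using trig_polys_add by fastforce
next
  case (mult f g)
  then show ?case using trig_polys_mult by fastforce
qed

lemma L2_dominated_convergence:
  assumes f: "\<And>n :: nat. f n \<in> borel_measurable M" "g \<in> borel_measurable M"
    and lim: "AE x in M. (\<lambda>n. f n x) \<longlonglongrightarrow> g x"
    and w: "integrable M (\<lambda>x. (w x)\<^sup>2)" and dom: "\<And>n. AE x in M. cmod (f n x - g x) \<le> w x"
  shows "(\<lambda>n. L2_norm M (\<lambda>x. f n x - g x)) \<longlonglongrightarrow> 0"
proof -
  note [measurable] = f
  have "(\<lambda>n. LINT x|M. (cmod (f n x - g x))\<^sup>2) \<longlonglongrightarrow> (LINT x|M. 0)"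
  proof (rule integral_dominated_convergence[OF _ _ w])
    show "AE x in M. (\<lambda>n. (cmod (f n x - g x))\<^sup>2) \<longlonglongrightarrow> 0"
      using lim
    proof (rule eventually_mono)
      fix x assume "(\<lambda>n. f n x) \<longlonglongrightarrow> g x"
      then have "(\<lambda>n. cmod (f n x - g x)) \<longlonglongrightarrow> 0" by (intro tendsto_norm_zero) (simp add: LIM_zero)
      from tendsto_power[OF this, of 2] show "(\<lambda>n. (cmod (f n x - g x))\<^sup>2) \<longlonglongrightarrow> 0" by simp
    qed
    show "AE x in M. norm ((cmod (f n x - g x))\<^sup>2) \<le> (w x)\<^sup>2" for n
      using dom[of n] by (rule eventually_mono) (simp add: power_mono)
  qed measurable
  then have "(\<lambda>n. sqrt (LINT x|M. (cmod (f n x - g x))\<^sup>2)) \<longlonglongrightarrow> sqrt 0" by (intro tendsto_real_sqrt) simp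
  then show ?thesis by (simp add: L2_norm_altdef)
qed

definition trig_approximable :: "(real^'n) measure \<Rightarrow> (real^'n \<Rightarrow> complex) \<Rightarrow> bool"
  where "trig_approximable M f \<longleftrightarrow> (\<forall>e>0. \<exists>g\<in>trig_polys. L2_norm M (\<lambda>x. f x - g x) < e)"

text \<open>The common setting of \<rho> and of the standard Gaussian measure. \<open>ac\<close> is
  phrased with \<open>negligible\<close> because the continuous approximants of a measurable
  function converge off a negligible set.\<close>

locale finite_borel_ac_measure = finite_measure M for M :: "(real^'n) measure" +
  assumes sets_M [measurable_cong]: "sets M = sets borel"
    and ac: "\<And>N. negligible N \<Longrightarrow> AE x in M. x \<notin> N"
begin

lemma L2_fun_bounded:
  assumes "f \<in> borel_measurable borel" "\<And>x. cmod (f x) \<le> K"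
  shows "f \<in> L2_fun M"
proof -
  have "integrable M (\<lambda>x. (cmod (f x))\<^sup>2)"
  proof (rule integrable_const_bound)
    show "AE x in M. norm ((cmod (f x))\<^sup>2) \<le> K\<^sup>2" using assms(2) by (auto intro!: power_mono)
    show "(\<lambda>x. (cmod (f x))\<^sup>2) \<in> borel_measurable M" using assms(1) by measurable
  qed
  then show ?thesis using assms(1) by (simp add: L2_fun_def measurable_cong_sets[OF sets_M refl])
qed

lemma trig_poly_L2: "g \<in> trig_polys \<Longrightarrow> g \<in> L2_fun M"
proof -
  assume "g \<in> trig_polys"
  then obtain F c where g: "g = (\<lambda>x. \<Sum>\<xi>\<in>F. c \<xi> * cis (\<xi> \<bullet> x))" by (auto simp: trig_polys_def)
  have "(\<lambda>x. c \<xi> * cis (\<xi> \<bullet> x)) \<in> L2_fun M" for \<xi>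
  proof (rule L2_fun_bounded)
    show "(\<lambda>x. c \<xi> * cis (\<xi> \<bullet> x)) \<in> borel_measurable borel"
      unfolding cis_conv_exp by (intro borel_measurable_continuous_onI continuous_intros)
    show "cmod (c \<xi> * cis (\<xi> \<bullet> x)) \<le> cmod (c \<xi>)" for x by (simp add: norm_mult)
  qed
  then show ?thesis unfolding g by (intro L2_fun_sum)
qed

lemma trig_approximable_limit:
  assumes f: "\<And>n :: nat. f n \<in> L2_fun M" "\<And>n. trig_approximable M (f n)" and g: "g \<in> L2_fun M"
    and lim: "(\<lambda>n. L2_norm M (\<lambda>x. f n x - g x)) \<longlonglongrightarrow> 0"
  shows "trig_approximable M g"
  unfolding trig_approximable_def
proof (intro allI impI)
  fix e :: real assume e: "e > 0"
  then have "\<forall>\<^sub>F n in sequentially. L2_norm M (\<lambda>x. f n x - g x) < e / 2" using lim by (intro order_tendstoD) auto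
  then obtain n where n: "L2_norm M (\<lambda>x. f n x - g x) < e / 2" by (auto simp: eventually_sequentially)
  obtain h where h: "h \<in> trig_polys" "L2_norm M (\<lambda>x. f n x - h x) < e / 2"
    using f(2)[of n] e unfolding trig_approximable_def by (metis half_gt_zero)
  have "L2_norm M (\<lambda>x. g x - h x) \<le> L2_norm M (\<lambda>x. g x - f n x) + L2_norm M (\<lambda>x. f n x - h x)"
    by (rule L2_norm_triangle_diff[OF g f(1) trig_poly_L2[OF h(1)]])
  then have "L2_norm M (\<lambda>x. g x - h x) < e" using n h(2) by (simp add: L2_norm_minus_commute[of M g])
  then show "\<exists>h\<in>trig_polys. L2_norm M (\<lambda>x. g x - h x) < e" using h(1) by blast
qed

lemma L2_norm_le_sup:
  assumes "f \<in> borel_measurable borel" "\<And>x. cmod (f x) \<le> d"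
  shows "L2_norm M f \<le> d * sqrt (measure M (space M))"
proof -
  have d: "d \<ge> 0" using assms(2) norm_ge_zero order_trans by blast
  have "(LINT x|M. (cmod (f x))\<^sup>2) \<le> (LINT x|M. d\<^sup>2)"
    using assms(2) L2_fun_bounded[OF assms] by (intro integral_mono) (auto intro!: power_mono dest: L2_funD)
  then have "(LINT x|M. (cmod (f x))\<^sup>2) \<le> d\<^sup>2 * measure M (space M)" by (simp add: mult.commute)
  then have "L2_norm M f \<le> sqrt (d\<^sup>2 * measure M (space M))" unfolding L2_norm_altdef by (rule real_sqrt_le_mono)
  then show ?thesis using d by (simp add: real_sqrt_mult)
qed

text \<open>Replacing \<open>x\<close> by \<open>N sin (x / N)\<close> makes the argument periodic and confined to a cube, where
  \<open>u\<close> is uniformly close to a polynomial.\<close>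

lemma bounded_continuous_approximable:
  fixes u :: "real^'n \<Rightarrow> real"
  assumes c: "continuous_on UNIV u" and K: "\<And>x. \<bar>u x\<bar> \<le> K"
  shows "trig_approximable M (\<lambda>x. of_real (u x))"
proof -
  define s where "s n x = (\<chi> i. sin (x $ i / real (Suc n)))" for n and x :: "real^'n"
  define v where "v n x = complex_of_real (u (real (Suc n) *\<^sub>R s n x))" for n x
  have sc: "continuous_on UNIV (s n)" for n unfolding s_def[abs_def] by (intro continuous_intros) auto
  have vm: "v n \<in> borel_measurable borel" for n unfolding v_def[abs_def]
    by (intro borel_measurable_continuous_onI continuous_intros continuous_on_compose2[OF c] sc) auto
  have um: "(\<lambda>x. complex_of_real (u x)) \<in> borel_measurable borel"
    by (intro borel_measurable_continuous_onI continuous_intros c)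
  have vK: "cmod (v n x) \<le> K" for n x using K by (simp add: v_def)
  have vL: "v n \<in> L2_fun M" for n by (rule L2_fun_bounded[OF vm vK])
  have uL: "(\<lambda>x. complex_of_real (u x)) \<in> L2_fun M" by (rule L2_fun_bounded[OF um, of K]) (use K in simp)
  have lim: "(\<lambda>n. real (Suc n) *\<^sub>R s n x) \<longlonglongrightarrow> x" for x
  proof (rule vec_tendstoI)
    fix i
    have "(\<lambda>n. real (Suc n) * sin (t / real (Suc n))) \<longlonglongrightarrow> t" for t :: real by real_asymp
    then show "(\<lambda>n. (real (Suc n) *\<^sub>R s n x) $ i) \<longlonglongrightarrow> x $ i" by (simp add: s_def)
  qed
  have "(\<lambda>n. L2_norm M (\<lambda>x. v n x - of_real (u x))) \<longlonglongrightarrow> 0"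
  proof (rule L2_dominated_convergence[where w = "\<lambda>_. 2 * K"])
    show "AE x in M. (\<lambda>n. v n x) \<longlonglongrightarrow> complex_of_real (u x)"
    proof (rule AE_I2)
      fix x
      have "isCont u x" using c by (simp add: continuous_on_eq_continuous_at)
      then have "(\<lambda>n. u (real (Suc n) *\<^sub>R s n x)) \<longlonglongrightarrow> u x" by (rule isCont_tendsto_compose[OF _ lim])
      then show "(\<lambda>n. v n x) \<longlonglongrightarrow> complex_of_real (u x)" unfolding v_def by (rule tendsto_of_real)
    qed
    show "AE x in M. cmod (v n x - complex_of_real (u x)) \<le> 2 * K" for n
    proof (rule AE_I2)
      fix x
      show "cmod (v n x - complex_of_real (u x)) \<le> 2 * K"
        using norm_triangle_ineq4[of "v n x" "complex_of_real (u x)"] vK[of n x] K[of x] by simp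
    qed
  qed (use vm um in \<open>auto simp: measurable_cong_sets[OF sets_M refl]\<close>)
  moreover have "trig_approximable M (v n)" for n
    unfolding trig_approximable_def
  proof (intro allI impI)
    fix e :: real assume e: "e > 0"
    define m where "m = sqrt (measure M (space M)) + 1"
    define d where "d = e / (2 * m)"
    have m: "m > 0" by (simp add: m_def add_nonneg_pos)
    have d: "d > 0" using e m by (simp add: d_def)
    have "d * sqrt (measure M (space M)) \<le> d * m" using d by (simp add: m_def)
    also have "\<dots> = e / 2" using m by (simp add: d_def)
    finally have de: "d * sqrt (measure M (space M)) < e" using e by simp
    \<comment> \<open>\<open>s n\<close> takes its values in this cube, so uniform approximation on
      a compact set controls the error on the whole space.\<close>
    define C where "C = cbox (- 1) (1 :: real^'n)"
    have "continuous_on C (\<lambda>y. u (real (Suc n) *\<^sub>R y))" by (intro continuous_on_compose2[OF c] continuous_intros) auto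
    then obtain p where p: "real_polynomial_function p" "\<And>y. y \<in> C \<Longrightarrow> \<bar>u (real (Suc n) *\<^sub>R y) - p y\<bar> < d"
      using Stone_Weierstrass_real_polynomial_function[of C "\<lambda>y. u (real (Suc n) *\<^sub>R y)" d] d
      unfolding C_def by (metis compact_cbox)
    define q where "q x = complex_of_real (p (s n x))" for x
    have q: "q \<in> trig_polys" unfolding q_def[abs_def] s_def by (rule trig_polys_sin_substitution[OF p(1)])
    have sC: "s n x \<in> C" for x by (simp add: C_def s_def mem_box_cart)
    have "cmod (v n x - q x) \<le> d" for x
      using p(2)[OF sC, of x] by (simp add: v_def q_def flip: of_real_diff)
    moreover have "q \<in> borel_measurable borel" using L2_funD(1)[OF trig_poly_L2[OF q]] by (simp add: measurable_cong_sets[OF sets_M refl])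
    ultimately have "L2_norm M (\<lambda>x. v n x - q x) \<le> d * sqrt (measure M (space M))"
      using vm by (intro L2_norm_le_sup) auto
    then show "\<exists>g\<in>trig_polys. L2_norm M (\<lambda>x. v n x - g x) < e" using q de by (intro bexI[of _ q]) auto
  qed
  ultimately show ?thesis by (intro trig_approximable_limit[OF vL _ uL])
qed

text \<open>Measurability yields continuous functions converging to \<open>u\<close> off a
  negligible set, but with no bound. Truncation at level k supplies the domination for the limit in
  n; in the limit in k the majorant is |u| itself.\<close>

lemma real_approximable:
  fixes u :: "real^'n \<Rightarrow> real"
  assumes u: "(\<lambda>x. complex_of_real (u x)) \<in> L2_fun M"
  shows "trig_approximable M (\<lambda>x. of_real (u x))"
proof -
  have "(\<lambda>x. complex_of_real (u x)) \<in> borel_measurable M" using L2_funD(1)[OF u] .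
  then have "(\<lambda>x. Re (complex_of_real (u x))) \<in> borel_measurable M" by measurable
  then have um [measurable]: "u \<in> borel_measurable borel" by (simp add: measurable_cong_sets[OF sets_M refl])
  then have "u \<in> borel_measurable lebesgue" by (intro measurable_completion) simp
  then have "u measurable_on UNIV" by (simp add: measurable_on_iff_borel_measurable)
  then obtain N g where N: "negligible N" "\<And>n. continuous_on UNIV (g n)" "\<And>x. x \<notin> N \<Longrightarrow> (\<lambda>n. g n x) \<longlonglongrightarrow> u x"
    by (auto simp: measurable_on_def)
  define cl where "cl k t = max (- real k) (min (real k) t)" for k :: nat and t :: real
  have clb: "\<bar>cl k t\<bar> \<le> real k" for k t by (auto simp: cl_def)
  have clc: "continuous_on A h \<Longrightarrow> continuous_on A (\<lambda>x. cl k (h x))" for A :: "(real^'n) set" and h k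
    unfolding cl_def by (intro continuous_intros)
  have clm: "(\<lambda>x. cl k (u x)) \<in> borel_measurable borel" for k unfolding cl_def by measurable
  have kL: "(\<lambda>x. complex_of_real (cl k (u x))) \<in> L2_fun M" for k
    by (rule L2_fun_bounded[of _ "real k"]) (use clm clb in auto)
  have "trig_approximable M (\<lambda>x. complex_of_real (cl k (u x)))" for k
  proof (rule trig_approximable_limit[OF _ _ kL])
    fix n
    have gm: "(\<lambda>x. complex_of_real (cl k (g n x))) \<in> borel_measurable borel"
      by (intro borel_measurable_continuous_onI continuous_intros clc N(2))
    show "(\<lambda>x. complex_of_real (cl k (g n x))) \<in> L2_fun M"
      by (rule L2_fun_bounded[OF gm, of "real k"]) (use clb in auto)
    show "trig_approximable M (\<lambda>x. complex_of_real (cl k (g n x)))"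
      by (rule bounded_continuous_approximable[OF clc[OF N(2)] clb])
  next
    show "(\<lambda>n. L2_norm M (\<lambda>x. complex_of_real (cl k (g n x)) - complex_of_real (cl k (u x)))) \<longlonglongrightarrow> 0"
    proof (rule L2_dominated_convergence[where w = "\<lambda>_. 2 * real k"])
      show "AE x in M. (\<lambda>n. complex_of_real (cl k (g n x))) \<longlonglongrightarrow> complex_of_real (cl k (u x))"
        using ac[OF N(1)]
      proof (rule eventually_mono)
        fix x assume "x \<notin> N"
        from N(3)[OF this] show "(\<lambda>n. complex_of_real (cl k (g n x))) \<longlonglongrightarrow> complex_of_real (cl k (u x))"
          unfolding cl_def by (intro tendsto_intros)
      qed
      show "AE x in M. cmod (complex_of_real (cl k (g n x)) - complex_of_real (cl k (u x))) \<le> 2 * real k" for n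
      proof (rule AE_I2)
        fix x
        show "cmod (complex_of_real (cl k (g n x)) - complex_of_real (cl k (u x))) \<le> 2 * real k"
          using clb[of k "g n x"] clb[of k "u x"] by (simp flip: of_real_diff)
      qed
      show "(\<lambda>x. complex_of_real (cl k (g n x))) \<in> borel_measurable M" for n
        unfolding measurable_cong_sets[OF sets_M refl]
        by (intro borel_measurable_continuous_onI continuous_intros clc N(2))
      show "(\<lambda>x. complex_of_real (cl k (u x))) \<in> borel_measurable M" by (rule L2_funD(1)[OF kL])
    qed simp
  qed
  moreover have "(\<lambda>k. L2_norm M (\<lambda>x. complex_of_real (cl k (u x)) - complex_of_real (u x))) \<longlonglongrightarrow> 0"
  proof (rule L2_dominated_convergence[where w = "\<lambda>x. \<bar>u x\<bar>"])
    show "AE x in M. (\<lambda>k. complex_of_real (cl k (u x))) \<longlonglongrightarrow> complex_of_real (u x)"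
    proof (rule AE_I2)
      fix x
      obtain m where m: "\<bar>u x\<bar> \<le> real m" using real_arch_simple by blast
      have "\<forall>\<^sub>F k in sequentially. complex_of_real (cl k (u x)) = complex_of_real (u x)"
        unfolding eventually_sequentially by (intro exI[of _ m]) (use m in \<open>auto simp: cl_def\<close>)
      then show "(\<lambda>k. complex_of_real (cl k (u x))) \<longlonglongrightarrow> complex_of_real (u x)" by (rule tendsto_eventually)
    qed
    show "integrable M (\<lambda>x. \<bar>u x\<bar>\<^sup>2)" using L2_funD(2)[OF u] by simp
    show "AE x in M. cmod (complex_of_real (cl k (u x)) - complex_of_real (u x)) \<le> \<bar>u x\<bar>" for k
    proof (rule AE_I2)
      fix x
      have "\<bar>cl k (u x) - u x\<bar> \<le> \<bar>u x\<bar>" by (auto simp: cl_def max_def min_def abs_if)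
      then show "cmod (complex_of_real (cl k (u x)) - complex_of_real (u x)) \<le> \<bar>u x\<bar>" by (simp flip: of_real_diff)
    qed
  qed (use kL u in \<open>auto dest: L2_funD\<close>)
  ultimately show ?thesis by (intro trig_approximable_limit[OF kL _ u])
qed

lemma trig_polys_dense:
  assumes f: "f \<in> L2_fun M"
  shows "trig_approximable M f"
  unfolding trig_approximable_def
proof (intro allI impI)
  fix e :: real assume e: "e > 0"
  have [measurable]: "f \<in> borel_measurable M" using f by (rule L2_funD)
  have ReL: "(\<lambda>x. complex_of_real (Re (f x))) \<in> L2_fun M" and ImL: "(\<lambda>x. complex_of_real (Im (f x))) \<in> L2_fun M"
    by (rule L2_fun_dominated[OF f, of _ 1], measurable, simp add: abs_Re_le_cmod)
      (rule L2_fun_dominated[OF f, of _ 1], measurable, simp add: abs_Im_le_cmod)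
  obtain g where g: "g \<in> trig_polys" "L2_norm M (\<lambda>x. of_real (Re (f x)) - g x) < e / 2"
    using real_approximable[OF ReL] e unfolding trig_approximable_def by (metis half_gt_zero)
  obtain h where h: "h \<in> trig_polys" "L2_norm M (\<lambda>x. of_real (Im (f x)) - h x) < e / 2"
    using real_approximable[OF ImL] e unfolding trig_approximable_def by (metis half_gt_zero)
  have gh: "(\<lambda>x. g x + \<i> * h x) \<in> trig_polys" by (intro trig_polys_add g(1) trig_polys_cmult h(1))
  have "L2_norm M (\<lambda>x. f x - (g x + \<i> * h x)) = L2_norm M (\<lambda>x. (of_real (Re (f x)) - g x) + \<i> * (of_real (Im (f x)) - h x))"
  proof (rule arg_cong[of _ _ "L2_norm M"], rule ext)
    fix x
    show "f x - (g x + \<i> * h x) = (of_real (Re (f x)) - g x) + \<i> * (of_real (Im (f x)) - h x)"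
      by (subst complex_eq[of "f x"]) (simp add: algebra_simps)
  qed
  also have "\<dots> \<le> L2_norm M (\<lambda>x. of_real (Re (f x)) - g x) + L2_norm M (\<lambda>x. \<i> * (of_real (Im (f x)) - h x))"
    by (intro L2_norm_triangle L2_fun_cmult L2_fun_diff ReL ImL trig_poly_L2 g(1) h(1))
  also have "\<dots> < e" using g(2) h(2) by (simp add: L2_norm_cmult)
  finally show "\<exists>g\<in>trig_polys. L2_norm M (\<lambda>x. f x - g x) < e" using gh by (intro bexI[of _ "\<lambda>x. g x + \<i> * h x"])
qed

end

lemma finite_borel_ac_density:
  fixes k :: "real^'n \<Rightarrow> real"
  assumes k: "integrable lborel k" "\<And>x. k x \<ge> 0"
  shows "finite_borel_ac_measure (density lborel (\<lambda>x. ennreal (k x)))"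
proof (rule finite_borel_ac_measure.intro[OF finite_measureI finite_borel_ac_measure_axioms.intro])
  have [measurable]: "k \<in> borel_measurable borel" using k(1) by simp
  show "emeasure (density lborel (\<lambda>x. ennreal (k x))) (space (density lborel (\<lambda>x. ennreal (k x)))) \<noteq> \<infinity>"
    using nn_integral_eq_integral[OF k(1)] k(2) by (simp add: emeasure_density)
  show "sets (density lborel (\<lambda>x. ennreal (k x))) = sets borel" by simp
  fix N :: "(real^'n) set" assume "negligible N"
  then have "N \<in> null_sets lebesgue" by (simp add: negligible_iff_null_sets)
  then obtain N' where N': "N' \<in> null_sets lborel" "N \<subseteq> N'" by (metis null_sets_completion_iff2)
  from AE_not_in[OF N'(1)]
  have "AE x in lborel. x \<notin> N" by (rule eventually_mono) (use N'(2) in auto)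
  then show "AE x in density lborel (\<lambda>x. ennreal (k x)). x \<notin> N" by (subst AE_density) auto
qed

section \<open>The invariant measure\<close>

context ornstein_uhlenbeck
begin

definition \<Lambda> :: "real^'n^'n" where "\<Lambda> = matrix_inv Qinf"

lemma Qinf_invertible: "invertible Qinf"
proof -
  obtain c where c: "c > 0" "\<And>\<xi>. c * (norm \<xi>)\<^sup>2 \<le> (Qinf *v \<xi>) \<bullet> \<xi>" using Qinf_pos_def by blast
  have "\<xi> = 0" if "Qinf *v \<xi> = 0" for \<xi>
  proof -
    have "c * (norm \<xi>)\<^sup>2 \<le> 0" using c(2)[of \<xi>] that by simp
    then show ?thesis using c(1) by (simp add: mult_le_0_iff)
  qed
  then show ?thesis using matrix_left_invertible_ker[of Qinf] invertible_left_inverse[of Qinf] by blast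
qed

lemma Qinf_\<Lambda>: "Qinf ** \<Lambda> = mat 1" and \<Lambda>_Qinf: "\<Lambda> ** Qinf = mat 1"
  using someI_ex[OF Qinf_invertible[unfolded invertible_def]] unfolding \<Lambda>_def matrix_inv_def by auto

lemma \<Lambda>_symmetric: "transpose \<Lambda> = \<Lambda>"
proof -
  have "transpose \<Lambda> ** Qinf = mat 1"
    using arg_cong[OF Qinf_\<Lambda>, of transpose] by (simp add: matrix_transpose_mul Qinf_symmetric transpose_mat)
  then have "(transpose \<Lambda> ** Qinf) ** \<Lambda> = \<Lambda>" by simp
  then show ?thesis unfolding matrix_mul_assoc[symmetric] Qinf_\<Lambda> by simp
qed

lemma \<Lambda>_lower_bound: "\<exists>c>0. \<forall>x. c * (norm x)\<^sup>2 \<le> (\<Lambda> *v x) \<bullet> x"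
proof (rule quadratic_form_lower_bound)
  show "continuous_on UNIV (\<lambda>x. (\<Lambda> *v x) \<bullet> x)"
    by (intro continuous_intros bounded_linear.continuous_on[OF matrix_vector_mul_bounded_linear])
  show "(\<Lambda> *v (a *\<^sub>R x)) \<bullet> (a *\<^sub>R x) = a\<^sup>2 * ((\<Lambda> *v x) \<bullet> x)" for a x
    by (simp add: matrix_vector_mult_scaleR power2_eq_square)
  fix x :: "real^'n" assume x: "x \<noteq> 0"
  obtain c where c: "c > 0" "\<And>\<xi>. c * (norm \<xi>)\<^sup>2 \<le> (Qinf *v \<xi>) \<bullet> \<xi>" using Qinf_pos_def by blast
  have Qx: "Qinf *v (\<Lambda> *v x) = x" by (simp add: matrix_vector_mul_assoc Qinf_\<Lambda>)
  then have "\<Lambda> *v x \<noteq> 0" using x by auto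
  then have "0 < c * (norm (\<Lambda> *v x))\<^sup>2" using c(1) by simp
  also have "\<dots> \<le> x \<bullet> (\<Lambda> *v x)" using c(2)[of "\<Lambda> *v x"] unfolding Qx .
  finally show "0 < (\<Lambda> *v x) \<bullet> x" by (simp add: inner_commute)
qed

definition weight_const :: real
  where "weight_const = 1 / ((2 * pi) powr (real CARD('n) / 2) * sqrt (det Qinf))"

lemma weight_const_pos: "weight_const > 0"
proof -
  obtain R where R: "R ** R = Qinf" using symmetric_psd_sqrt_exists[OF Qinf_psd] by blast
  have "det Qinf = det R * det R" unfolding R[symmetric] by (rule det_mul)
  moreover have "det Qinf \<noteq> 0" using Qinf_invertible invertible_det_nz by blast
  ultimately have "det Qinf > 0" by (metis not_square_less_zero linorder_neqE_linordered_idom)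
  then show ?thesis by (simp add: weight_const_def)
qed

definition gauss :: "real^'n \<Rightarrow> real" where "gauss x = exp (- (1/2) * ((\<Lambda> *v x) \<bullet> x))"

lemma ou_weight_eq: "ou_weight Q B x = weight_const * gauss x"
  by (simp add: ou_weight_def weight_const_def gauss_def \<Lambda>_def Qinf_def)

lemma gauss_pos: "gauss x > 0"
  by (simp add: gauss_def)

lemma gauss_continuous: "continuous_on S gauss"
  unfolding gauss_def[abs_def] by (intro continuous_intros bounded_linear.continuous_on[OF matrix_vector_mul_bounded_linear])

lemma gauss_measurable [measurable]: "gauss \<in> borel_measurable borel"
  by (rule borel_measurable_continuous_onI[OF gauss_continuous])

abbreviation \<rho> :: "(real^'n) measure" where "\<rho> \<equiv> ou_measure Q B"

lemma \<rho>_eq: "\<rho> = density lborel (\<lambda>x. ennreal (weight_const * gauss x))"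
  by (simp add: ou_measure_def ou_weight_eq)

lemma sets_\<rho> [measurable_cong]: "sets \<rho> = sets borel"
  by (simp add: ou_measure_def)

lemma integral_\<rho>:
  fixes f :: "real^'n \<Rightarrow> 'b::{banach, second_countable_topology}"
  assumes [measurable]: "f \<in> borel_measurable borel"
  shows "(LINT x|\<rho>. f x) = weight_const *\<^sub>R (LINT x|lborel. gauss x *\<^sub>R f x)"
    and "integrable \<rho> f \<longleftrightarrow> integrable lborel (\<lambda>x. gauss x *\<^sub>R f x)"
proof -
  have nn: "AE x in lborel. 0 \<le> weight_const * gauss x" using weight_const_pos gauss_pos by (simp add: less_imp_le)
  have "(LINT x|\<rho>. f x) = (LINT x|lborel. (weight_const * gauss x) *\<^sub>R f x)"
    unfolding \<rho>_eq by (rule integral_density) (use nn in auto)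
  then have e: "(LINT x|\<rho>. f x) = (LINT x|lborel. weight_const *\<^sub>R (gauss x *\<^sub>R f x))" by simp
  have "integrable \<rho> f \<longleftrightarrow> integrable lborel (\<lambda>x. (weight_const * gauss x) *\<^sub>R f x)"
    unfolding \<rho>_eq by (rule integrable_density) (use nn in auto)
  also have "\<dots> \<longleftrightarrow> integrable lborel (\<lambda>x. weight_const *\<^sub>R (gauss x *\<^sub>R f x))" by simp
  also have i: "\<dots> \<longleftrightarrow> integrable lborel (\<lambda>x. gauss x *\<^sub>R f x)"
  proof
    assume "integrable lborel (\<lambda>x. weight_const *\<^sub>R (gauss x *\<^sub>R f x))"
    then have "integrable lborel (\<lambda>x. inverse weight_const *\<^sub>R (weight_const *\<^sub>R (gauss x *\<^sub>R f x)))"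
      by (rule integrable_scaleR_right)
    then show "integrable lborel (\<lambda>x. gauss x *\<^sub>R f x)"
      using weight_const_pos by (simp add: mult.assoc[symmetric])
  qed (rule integrable_scaleR_right)
  finally show "integrable \<rho> f \<longleftrightarrow> integrable lborel (\<lambda>x. gauss x *\<^sub>R f x)" .
  show "(LINT x|\<rho>. f x) = weight_const *\<^sub>R (LINT x|lborel. gauss x *\<^sub>R f x)"
  proof (cases "integrable lborel (\<lambda>x. gauss x *\<^sub>R f x)")
    case True
    then show ?thesis unfolding e by (intro integral_scaleR_right)
  next
    case False
    then show ?thesis unfolding e using i by (simp only: not_integrable_integral_eq scaleR_zero_right not_False_eq_True)
  qed
qed

lemma norm_square_integrable: "integrable \<rho> (\<lambda>x. (1 + norm x)\<^sup>2)"
proof -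
  obtain c where c: "c > 0" "\<And>x. c * (norm x)\<^sup>2 \<le> (\<Lambda> *v x) \<bullet> x" using \<Lambda>_lower_bound by blast
  have "integrable lborel (\<lambda>x. gauss x *\<^sub>R (1 + norm x)\<^sup>2)"
  proof (rule Bochner_Integration.integrable_bound[OF integrable_norm_square_gaussian[of "c / 2"]])
    show "AE x in lborel. norm (gauss x *\<^sub>R (1 + norm x)\<^sup>2) \<le> norm ((1 + norm x)\<^sup>2 * exp (- (c / 2) * (norm x)\<^sup>2))"
    proof (rule AE_I2)
      fix x :: "real^'n"
      have "gauss x \<le> exp (- (c / 2) * (norm x)\<^sup>2)" using c(2)[of x] by (simp add: gauss_def)
      then show "norm (gauss x *\<^sub>R (1 + norm x)\<^sup>2) \<le> norm ((1 + norm x)\<^sup>2 * exp (- (c / 2) * (norm x)\<^sup>2))"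
        using gauss_pos[of x] mult_right_mono[of "gauss x" "exp (- (c / 2) * (norm x)\<^sup>2)" "(1 + norm x)\<^sup>2"]
        by (simp add: abs_mult mult.commute[of "(1 + norm x)\<^sup>2"])
    qed
  qed (use c in auto)
  then show ?thesis by (subst integral_\<rho>(2)) auto
qed

lemma finite_borel_ac_\<rho>: "finite_borel_ac_measure \<rho>"
  unfolding \<rho>_eq
proof (rule finite_borel_ac_density)
  have "integrable \<rho> (\<lambda>x. 1 :: real)"
    by (rule Bochner_Integration.integrable_bound[OF norm_square_integrable]) (auto intro!: AE_I2 simp: one_le_power)
  then show "integrable lborel (\<lambda>x. weight_const * gauss x)"
    using integral_\<rho>(2)[of "\<lambda>x. 1 :: real"] by simp
  show "weight_const * gauss x \<ge> 0" for x using weight_const_pos gauss_pos[of x] by simp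
qed

sublocale ac: finite_borel_ac_measure \<rho> by (rule finite_borel_ac_\<rho>)

text \<open>The total mass of \<rho>, kept as a symbol: it appears on both sides of the invariance
  identity.\<close>

definition mass :: real where "mass = weight_const * (LINT x|lborel. gauss x)"

lemma \<rho>_fourier: "(LINT x|\<rho>. cis (\<zeta> \<bullet> x)) = of_real (mass * exp (- (1/2) * ((Qinf *v \<zeta>) \<bullet> \<zeta>)))"
proof -
  obtain c where c: "c > 0" "\<And>x. c * (norm x)\<^sup>2 \<le> (\<Lambda> *v x) \<bullet> x" using \<Lambda>_lower_bound by blast
  have m: "(\<lambda>x. cis (\<zeta> \<bullet> x)) \<in> borel_measurable borel"
    unfolding cis_conv_exp by (intro borel_measurable_continuous_onI continuous_intros)
  have "(LINT x|\<rho>. cis (\<zeta> \<bullet> x)) = of_real weight_const * (LINT x|lborel. cis (\<zeta> \<bullet> x) * of_real (gauss x))"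
    by (simp add: integral_\<rho>(1)[OF m] scaleR_conv_of_real mult.commute)
  also have "\<dots> = of_real (mass * exp (- (1/2) * ((Qinf *v \<zeta>) \<bullet> \<zeta>)))"
    using gaussian_fourier[OF \<Lambda>_symmetric \<Lambda>_Qinf c, of \<zeta>] by (simp add: gauss_def[abs_def] mass_def mult_ac)
  finally show ?thesis .
qed

section \<open>The generator on exponentials\<close>

text \<open>P applied to the exponential of frequency \<eta>. Its drift term grows linearly in
  \<open>x\<close>, which is why the L^2 bounds for \<rho> are stated for functions of linear
  growth.\<close>

definition P_cis :: "real^'n \<Rightarrow> real^'n \<Rightarrow> complex"
  where "P_cis \<eta> x = (of_real (- (1/2) * ((Q *v \<eta>) \<bullet> \<eta>)) + \<i> * of_real ((B *v x) \<bullet> \<eta>)) * cis (\<eta> \<bullet> x)"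

lemma cis_measurable [measurable]: "(\<lambda>x. cis (\<eta> \<bullet> x)) \<in> borel_measurable borel" for \<eta> :: "real^'n"
  unfolding cis_conv_exp by (intro borel_measurable_continuous_onI continuous_intros)

lemma L2_fun_linear_growth:
  assumes "f \<in> borel_measurable borel" "\<And>x. cmod (f x) \<le> K * (1 + norm x)"
  shows "f \<in> L2_fun \<rho>"
proof -
  have [measurable]: "f \<in> borel_measurable \<rho>" using assms(1) by (simp add: measurable_cong_sets[OF sets_\<rho> refl])
  have "integrable \<rho> (\<lambda>x. (cmod (f x))\<^sup>2)"
  proof (rule Bochner_Integration.integrable_bound)
    show "integrable \<rho> (\<lambda>x. K\<^sup>2 * (1 + norm x)\<^sup>2)" using norm_square_integrable by simp
    show "AE x in \<rho>. norm ((cmod (f x))\<^sup>2) \<le> norm (K\<^sup>2 * (1 + norm x)\<^sup>2)"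
      using assms(2) by (auto simp: power_mult_distrib[symmetric] intro!: power_mono)
  qed measurable
  then show ?thesis by (simp add: L2_fun_def)
qed

lemma P_cis_measurable [measurable]: "P_cis \<eta> \<in> borel_measurable borel"
  unfolding P_cis_def[abs_def] cis_conv_exp
  by (intro borel_measurable_continuous_onI continuous_intros bounded_linear.continuous_on[OF matrix_vector_mul_bounded_linear])

lemma P_cis_growth: "\<exists>K. \<forall>x. cmod (P_cis \<eta> x) \<le> K * (1 + norm x)"
proof -
  obtain KB where KB: "KB > 0" "\<And>x. norm (B *v x) \<le> norm x * KB"
    using bounded_linear.pos_bounded[OF matrix_vector_mul_bounded_linear[of B]] by blast
  define K where "K = \<bar>(1/2) * ((Q *v \<eta>) \<bullet> \<eta>)\<bar> + KB * norm \<eta>"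
  have "cmod (P_cis \<eta> x) \<le> K * (1 + norm x)" for x
  proof -
    have "\<bar>(B *v x) \<bullet> \<eta>\<bar> \<le> norm (B *v x) * norm \<eta>" by (rule Cauchy_Schwarz_ineq2)
    also have "\<dots> \<le> (norm x * KB) * norm \<eta>" by (intro mult_right_mono KB(2)) auto
    finally have 1: "\<bar>(B *v x) \<bullet> \<eta>\<bar> \<le> (KB * norm \<eta>) * norm x" by (simp add: mult_ac)
    have "cmod (P_cis \<eta> x) \<le> \<bar>(1/2) * ((Q *v \<eta>) \<bullet> \<eta>)\<bar> + \<bar>(B *v x) \<bullet> \<eta>\<bar>"
      unfolding P_cis_def norm_mult norm_cis mult_1_right
      by (rule order_trans[OF norm_triangle_ineq]) (simp add: norm_mult)
    also have "\<dots> \<le> \<bar>(1/2) * ((Q *v \<eta>) \<bullet> \<eta>)\<bar> * (1 + norm x) + (KB * norm \<eta>) * (1 + norm x)"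
      using 1 KB(1) by (intro add_mono) (auto simp: algebra_simps add_increasing intro: order_trans[OF 1])
    finally show ?thesis by (simp add: K_def distrib_right)
  qed
  then show ?thesis by blast
qed

end

section \<open>Test functions\<close>

lemma outside_support: "x \<notin> closure {x. \<phi> x \<noteq> 0} \<Longrightarrow> \<phi> x = 0"
  using closure_subset[of "{x. \<phi> x \<noteq> 0}"] by auto

lemma test_function_partial:
  assumes \<phi>: "\<phi> \<in> test_functions"
  shows "partial i \<phi> \<in> test_functions"
proof -
  have d: "fold partial is \<phi> differentiable_on UNIV" for "is" using \<phi> by (auto simp: test_functions_def)
  have c: "compact (closure {x. \<phi> x \<noteq> 0})" using \<phi> by (auto simp: test_functions_def)
  have "fold partial is (partial i \<phi>) differentiable_on UNIV" for "is" using d[of "i # is"] by simp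
  moreover have "{x. partial i \<phi> x \<noteq> 0} \<subseteq> closure {x. \<phi> x \<noteq> 0}"
  proof (rule ccontr)
    assume "\<not> ?thesis"
    then obtain x where x: "partial i \<phi> x \<noteq> 0" "x \<in> - closure {x. \<phi> x \<noteq> 0}" by auto
    have "(\<phi> has_derivative (\<lambda>h. 0)) (at x)"
    proof (rule has_derivative_transform_within_open[of "\<lambda>x. 0"])
      show "((\<lambda>x. 0) has_derivative (\<lambda>h. 0 :: complex)) (at x)" by simp
      show "open (- closure {x. \<phi> x \<noteq> 0})" by auto
      show "x \<in> - closure {x. \<phi> x \<noteq> 0}" by (rule x(2))
      show "\<And>y. y \<in> - closure {x. \<phi> x \<noteq> 0} \<Longrightarrow> 0 = \<phi> y" using closure_subset[of "{x. \<phi> x \<noteq> 0}"] by auto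
    qed
    then have "frechet_derivative \<phi> (at x) = (\<lambda>h. 0)" by (rule frechet_derivative_at[symmetric])
    then show False using x(1) by (simp add: partial_def)
  qed
  then have "closure {x. partial i \<phi> x \<noteq> 0} \<subseteq> closure {x. \<phi> x \<noteq> 0}" by (rule closure_minimal) simp
  then have "compact (closure {x. partial i \<phi> x \<noteq> 0})"
    using compact_Int_closed[OF c closed_closure[of "{x. partial i \<phi> x \<noteq> 0}"]] by (metis inf.absorb2)
  ultimately show ?thesis by (simp add: test_functions_def)
qed

lemma test_functionD:
  assumes "\<phi> \<in> test_functions"
  shows "\<phi> differentiable (at x)" "continuous_on S \<phi>" "compact (closure {x. \<phi> x \<noteq> 0})"
proof -
  have d: "\<phi> differentiable_on UNIV" using assms unfolding test_functions_def by (metis (mono_tags, lifting) fold_simps(1) mem_Collect_eq)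
  then show "\<phi> differentiable (at x)" by (simp add: differentiable_on_def)
  show "continuous_on S \<phi>" using differentiable_imp_continuous_on[OF d] continuous_on_subset by blast
  show "compact (closure {x. \<phi> x \<noteq> 0})" using assms by (simp add: test_functions_def)
qed

lemma integrable_compact_support:
  fixes f :: "real^'n \<Rightarrow> complex"
  assumes c: "continuous_on UNIV f" and K: "compact K" "\<And>x. x \<notin> K \<Longrightarrow> f x = 0"
  shows "integrable lborel f"
proof -
  have "integrable lborel (\<lambda>x. indicator K x *\<^sub>R f x)"
    by (rule borel_integrable_compact[OF K(1) continuous_on_subset[OF c]]) simp
  moreover have "(\<lambda>x. indicator K x *\<^sub>R f x) = f" using K(2) by (auto simp: indicator_def fun_eq_iff)
  ultimately show ?thesis by simp
qed

lemma partial_eq: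
  assumes "(\<psi> has_derivative \<psi>') (at x)"
  shows "partial i \<psi> x = \<psi>' (axis i 1)"
  unfolding partial_def using frechet_derivative_at[OF assms] by simp

text \<open>The derivative of the product with the exponential has integral zero. Compact support
  and one continuous partial derivative are assumed rather than a test function, so that a test
  function times a linear coefficient is covered as well.\<close>

lemma cis_integration_by_parts:
  fixes \<psi> :: "real^'n \<Rightarrow> complex" and \<eta> :: "real^'n"
  assumes d: "\<And>x. \<psi> differentiable (at x)" and c: "continuous_on UNIV (partial i \<psi>)"
    and K: "compact K" "\<And>x. x \<notin> K \<Longrightarrow> \<psi> x = 0" "\<And>x. x \<notin> K \<Longrightarrow> partial i \<psi> x = 0"
  shows "(LINT x|lborel. cis (\<eta> \<bullet> x) * partial i \<psi> x) = - (\<i> * of_real (\<eta> $ i)) * (LINT x|lborel. cis (\<eta> \<bullet> x) * \<psi> x)"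
proof -
  have \<psi>c: "continuous_on UNIV \<psi>"
    by (intro continuous_at_imp_continuous_on ballI differentiable_imp_continuous_within d)
  have cc: "continuous_on UNIV (\<lambda>x. cis (\<eta> \<bullet> x))" unfolding cis_conv_exp by (intro continuous_intros)
  define D where "D x = cis (\<eta> \<bullet> x) * partial i \<psi> x + (\<i> * of_real (\<eta> $ i)) * (cis (\<eta> \<bullet> x) * \<psi> x)" for x
  have i1: "integrable lborel (\<lambda>x. cis (\<eta> \<bullet> x) * partial i \<psi> x)"
    by (rule integrable_compact_support[OF _ K(1)]) (auto intro!: continuous_intros cc c simp: K(3))
  have i2: "integrable lborel (\<lambda>x. cis (\<eta> \<bullet> x) * \<psi> x)"
    by (rule integrable_compact_support[OF _ K(1)]) (auto intro!: continuous_intros cc \<psi>c simp: K(2))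
  have "(LINT x|lborel. D x) = 0"
  proof (rule integral_directional_derivative[where v = "axis i 1"])
    show "integrable lborel (\<lambda>x. cis (\<eta> \<bullet> x) * \<psi> x)" by (rule i2)
    show "integrable lborel D" unfolding D_def[abs_def] by (intro Bochner_Integration.integrable_add i1 integrable_mult_right i2)
    show "continuous_on UNIV D" unfolding D_def[abs_def] by (intro continuous_intros cc c \<psi>c)
    fix x :: "real^'n" and s :: real
    let ?y = "x + s *\<^sub>R axis i 1"
    have lin: "((\<lambda>s. x + s *\<^sub>R axis i 1) has_vector_derivative axis i 1) (at s)"
      by (auto intro!: derivative_eq_intros simp: has_vector_derivative_def)
    have "(\<psi> has_derivative frechet_derivative \<psi> (at ?y)) (at ?y)" using d by (simp add: frechet_derivative_works)
    from vector_derivative_diff_chain_within[OF has_vector_derivative_at_within[OF lin, of UNIV] has_derivative_at_withinI[OF this, of "(\<lambda>s. x + s *\<^sub>R axis i 1) ` UNIV"]]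
    have "((\<lambda>s. \<psi> (x + s *\<^sub>R axis i 1)) has_vector_derivative partial i \<psi> ?y) (at s)" by (simp add: partial_def o_def)
    moreover have "((\<lambda>s. cis (\<eta> \<bullet> (x + s *\<^sub>R axis i 1))) has_vector_derivative \<i> * of_real (\<eta> $ i) * cis (\<eta> \<bullet> ?y)) (at s)"
    proof -
      define F where "F z = exp (\<i> * (of_real (\<eta> \<bullet> x) + z * of_real (\<eta> $ i)))" for z
      have F: "cis (\<eta> \<bullet> (x + t *\<^sub>R axis i 1)) = F (of_real t)" for t
        by (simp add: F_def cis_conv_exp inner_add_right inner_axis)
      have "(F has_field_derivative \<i> * of_real (\<eta> $ i) * F (of_real s)) (at (of_real s))"
        unfolding F_def by (auto intro!: derivative_eq_intros)
      from has_vector_derivative_real_field[OF this] show ?thesis unfolding F .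
    qed
    ultimately show "((\<lambda>s. cis (\<eta> \<bullet> (x + s *\<^sub>R axis i 1)) * \<psi> (x + s *\<^sub>R axis i 1)) has_vector_derivative D ?y) (at s)"
      using has_vector_derivative_mult by (fastforce simp: D_def algebra_simps)
  qed
  also have "(LINT x|lborel. D x) = (LINT x|lborel. cis (\<eta> \<bullet> x) * partial i \<psi> x) + (\<i> * of_real (\<eta> $ i)) * (LINT x|lborel. cis (\<eta> \<bullet> x) * \<psi> x)"
    unfolding D_def using i1 i2 by simp
  finally show ?thesis by (simp add: add_eq_0_iff)
qed

lemma test_function_cis_by_parts:
  fixes \<phi> :: "real^'n \<Rightarrow> complex" and \<eta> :: "real^'n"
  assumes \<phi>: "\<phi> \<in> test_functions"
  shows "(LINT x|lborel. cis (\<eta> \<bullet> x) * partial i \<phi> x) = - (\<i> * of_real (\<eta> $ i)) * (LINT x|lborel. cis (\<eta> \<bullet> x) * \<phi> x)"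
proof (rule cis_integration_by_parts[where K = "closure {x. \<phi> x \<noteq> 0} \<union> closure {x. partial i \<phi> x \<noteq> 0}"])
  note p = test_function_partial[OF \<phi>, of i]
  show "\<phi> differentiable (at x)" for x by (rule test_functionD(1)[OF \<phi>])
  show "continuous_on UNIV (partial i \<phi>)" by (rule test_functionD(2)[OF p])
  show "compact (closure {x. \<phi> x \<noteq> 0} \<union> closure {x. partial i \<phi> x \<noteq> 0})"
    by (intro compact_Un test_functionD(3) \<phi> p)
  fix x assume "x \<notin> closure {x. \<phi> x \<noteq> 0} \<union> closure {x. partial i \<phi> x \<noteq> 0}"
  then show "\<phi> x = 0" "partial i \<phi> x = 0" by (auto dest: outside_support)
qed

lemma test_function_linear_cis_by_parts:
  fixes \<phi> :: "real^'n \<Rightarrow> complex" and \<eta> :: "real^'n" and A :: "real^'n^'n"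
  assumes \<phi>: "\<phi> \<in> test_functions"
  shows "(LINT x|lborel. cis (\<eta> \<bullet> x) * partial i (\<lambda>x. of_real ((A *v x) $ j) * \<phi> x) x)
    = - (\<i> * of_real (\<eta> $ i)) * (LINT x|lborel. cis (\<eta> \<bullet> x) * (of_real ((A *v x) $ j) * \<phi> x))"
proof -
  define l where "l x = complex_of_real ((A *v x) $ j)" for x
  have ll: "bounded_linear l"
    unfolding l_def by (intro bounded_linear_compose[OF bounded_linear_of_real] bounded_linear_compose[OF bounded_linear_vec_nth] matrix_vector_mul_bounded_linear)
  have lc: "continuous_on S l" for S by (rule linear_continuous_on[OF ll])
  have der: "((\<lambda>x. l x * \<phi> x) has_derivative (\<lambda>h. l x * frechet_derivative \<phi> (at x) h + l h * \<phi> x)) (at x)" for x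
    using has_derivative_mult[OF bounded_linear_imp_has_derivative[OF ll], of \<phi> "frechet_derivative \<phi> (at x)" x] test_functionD(1)[OF \<phi>, of x]
    by (simp add: frechet_derivative_works)
  have peq: "partial i (\<lambda>x. l x * \<phi> x) = (\<lambda>x. l x * partial i \<phi> x + l (axis i 1) * \<phi> x)"
    by (rule ext, subst partial_eq[OF der]) (simp add: partial_def)
  note p = test_function_partial[OF \<phi>, of i]
  have "(LINT x|lborel. cis (\<eta> \<bullet> x) * partial i (\<lambda>x. l x * \<phi> x) x) = - (\<i> * of_real (\<eta> $ i)) * (LINT x|lborel. cis (\<eta> \<bullet> x) * (l x * \<phi> x))"
  proof (rule cis_integration_by_parts[where K = "closure {x. \<phi> x \<noteq> 0} \<union> closure {x. partial i \<phi> x \<noteq> 0}"])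
    show "(\<lambda>x. l x * \<phi> x) differentiable (at x)" for x using der by (auto simp: differentiable_def)
    show "continuous_on UNIV (partial i (\<lambda>x. l x * \<phi> x))" unfolding peq
      by (intro continuous_intros lc test_functionD(2) \<phi> p)
    show "compact (closure {x. \<phi> x \<noteq> 0} \<union> closure {x. partial i \<phi> x \<noteq> 0})"
      by (intro compact_Un test_functionD(3) \<phi> p)
    fix x assume "x \<notin> closure {x. \<phi> x \<noteq> 0} \<union> closure {x. partial i \<phi> x \<noteq> 0}"
    then have "\<phi> x = 0" "partial i \<phi> x = 0" by (auto dest: outside_support)
    then show "l x * \<phi> x = 0" "partial i (\<lambda>x. l x * \<phi> x) x = 0" unfolding peq by auto
  qed
  then show ?thesis unfolding l_def .
qed

context ornstein_uhlenbeck
begin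

text \<open>The distributional derivatives fall on \<phi> and are moved back to the exponential by
  integration by parts. By the definition of \<open>dist_mult\<close> the drift coefficient
  multiplies \<phi> before the derivative is taken, so it stays inside the derivative until that is
  done.\<close>

lemma ou_graph_cis: "ou_graph Q B (\<lambda>x. a * cis (\<eta> \<bullet> x)) (\<lambda>x. a * P_cis \<eta> x)"
  unfolding ou_graph_def
proof (intro conjI ballI)
  show "(\<lambda>x. a * cis (\<eta> \<bullet> x)) \<in> L2_fun \<rho>"
    by (rule L2_fun_cmult[OF L2_fun_linear_growth[of _ 1]]) auto
  obtain K where "\<forall>x. cmod (P_cis \<eta> x) \<le> K * (1 + norm x)" using P_cis_growth by blast
  then show "(\<lambda>x. a * P_cis \<eta> x) \<in> L2_fun \<rho>"
    by (intro L2_fun_cmult[OF L2_fun_linear_growth[of _ K]]) auto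
  fix \<phi> :: "real^'n \<Rightarrow> complex" assume \<phi>: "\<phi> \<in> test_functions"
  define u where "u \<psi> = (LINT x|lborel. cis (\<eta> \<bullet> x) * \<psi> x)" for \<psi> :: "real^'n \<Rightarrow> complex"
  have dist: "dist_of_fun (\<lambda>x. a * cis (\<eta> \<bullet> x)) \<psi> = a * u \<psi>" for \<psi>
    by (simp add: dist_of_fun_def u_def mult.assoc)
  have ip: "integrable lborel (\<lambda>x. cis (\<eta> \<bullet> x) * (of_real ((B *v x) $ i) * \<phi> x))" for i
  proof (rule integrable_compact_support[OF _ test_functionD(3)[OF \<phi>]])
    show "continuous_on UNIV (\<lambda>x. cis (\<eta> \<bullet> x) * (of_real ((B *v x) $ i) * \<phi> x))" unfolding cis_conv_exp
      by (intro continuous_intros test_functionD(2)[OF \<phi>] bounded_linear.continuous_on[OF matrix_vector_mul_bounded_linear])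
    fix x assume "x \<notin> closure {x. \<phi> x \<noteq> 0}"
    then have "\<phi> x = 0" by (rule outside_support)
    then show "cis (\<eta> \<bullet> x) * (of_real ((B *v x) $ i) * \<phi> x) = 0" by simp
  qed
  have i\<phi>: "integrable lborel (\<lambda>x. cis (\<eta> \<bullet> x) * \<phi> x)"
  proof (rule integrable_compact_support[OF _ test_functionD(3)[OF \<phi>]])
    show "continuous_on UNIV (\<lambda>x. cis (\<eta> \<bullet> x) * \<phi> x)" unfolding cis_conv_exp
      by (intro continuous_intros test_functionD(2)[OF \<phi>])
    fix x assume "x \<notin> closure {x. \<phi> x \<noteq> 0}"
    then have "\<phi> x = 0" by (rule outside_support)
    then show "cis (\<eta> \<bullet> x) * \<phi> x = 0" by simp
  qed
  have second: "u (partial j (partial i \<phi>)) = - of_real (\<eta> $ i * \<eta> $ j) * u \<phi>" for i j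
    unfolding u_def test_function_cis_by_parts[OF test_function_partial[OF \<phi>]] test_function_cis_by_parts[OF \<phi>]
    by (simp add: mult_ac)
  have first: "u (partial i (\<lambda>x. of_real ((B *v x) $ i) * \<phi> x)) = - (\<i> * of_real (\<eta> $ i)) * u (\<lambda>x. of_real ((B *v x) $ i) * \<phi> x)" for i
    unfolding u_def by (rule test_function_linear_cis_by_parts[OF \<phi>])
  have "ou_operator Q B (dist_of_fun (\<lambda>x. a * cis (\<eta> \<bullet> x))) \<phi>
     = 1/2 * (\<Sum>i\<in>UNIV. \<Sum>j\<in>UNIV. of_real (Q $ i $ j) * (a * u (partial j (partial i \<phi>))))
      + (\<Sum>i\<in>UNIV. - (a * u (partial i (\<lambda>x. of_real ((B *v x) $ i) * \<phi> x))))"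
    by (simp add: ou_operator_def dist_partial_def dist_mult_def dist)
  also have "1/2 * (\<Sum>i\<in>UNIV. \<Sum>j\<in>UNIV. of_real (Q $ i $ j) * (a * u (partial j (partial i \<phi>)))) = a * (of_real (- (1/2) * ((Q *v \<eta>) \<bullet> \<eta>)) * u \<phi>)"
  proof -
    have "(Q *v \<eta>) \<bullet> \<eta> = (\<Sum>i\<in>UNIV. \<Sum>j\<in>UNIV. Q $ i $ j * (\<eta> $ i * \<eta> $ j))"
      by (simp add: inner_vec_def matrix_vector_mult_def sum_distrib_left sum_distrib_right mult_ac)
    then show ?thesis unfolding second
      by (simp add: sum_distrib_left sum_distrib_right sum_negf mult_ac)
  qed
  also have "(\<Sum>i\<in>UNIV. - (a * u (partial i (\<lambda>x. of_real ((B *v x) $ i) * \<phi> x)))) = a * (\<Sum>i\<in>UNIV. \<i> * of_real (\<eta> $ i) * u (\<lambda>x. of_real ((B *v x) $ i) * \<phi> x))"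
    unfolding first by (simp add: sum_distrib_left mult_ac)
  also have "(\<Sum>i\<in>UNIV. \<i> * of_real (\<eta> $ i) * u (\<lambda>x. of_real ((B *v x) $ i) * \<phi> x)) = (LINT x|lborel. (\<Sum>i\<in>UNIV. \<i> * of_real (\<eta> $ i) * (cis (\<eta> \<bullet> x) * (of_real ((B *v x) $ i) * \<phi> x))))"
    unfolding u_def by (subst Bochner_Integration.integral_sum) (auto intro!: integrable_mult_right ip)
  also have "(\<lambda>x. \<Sum>i\<in>UNIV. \<i> * of_real (\<eta> $ i) * (cis (\<eta> \<bullet> x) * (of_real ((B *v x) $ i) * \<phi> x))) = (\<lambda>x. \<i> * of_real ((B *v x) \<bullet> \<eta>) * (cis (\<eta> \<bullet> x) * \<phi> x))"
    by (simp add: inner_vec_def sum_distrib_left sum_distrib_right mult_ac)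
  finally have "ou_operator Q B (dist_of_fun (\<lambda>x. a * cis (\<eta> \<bullet> x))) \<phi>
    = a * (of_real (- (1/2) * ((Q *v \<eta>) \<bullet> \<eta>)) * u \<phi>) + a * (LINT x|lborel. \<i> * of_real ((B *v x) \<bullet> \<eta>) * (cis (\<eta> \<bullet> x) * \<phi> x))" .
  also have "\<dots> = a * (LINT x|lborel. P_cis \<eta> x * \<phi> x)"
  proof -
    have i3: "integrable lborel (\<lambda>x. \<i> * of_real ((B *v x) \<bullet> \<eta>) * (cis (\<eta> \<bullet> x) * \<phi> x))"
    proof -
      have "(\<lambda>x. \<i> * of_real ((B *v x) \<bullet> \<eta>) * (cis (\<eta> \<bullet> x) * \<phi> x)) = (\<lambda>x. \<Sum>i\<in>UNIV. \<i> * of_real (\<eta> $ i) * (cis (\<eta> \<bullet> x) * (of_real ((B *v x) $ i) * \<phi> x)))"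
        by (simp add: inner_vec_def sum_distrib_left sum_distrib_right mult_ac)
      then show ?thesis by (simp only:) (intro Bochner_Integration.integrable_sum integrable_mult_right ip)
    qed
    have "(LINT x|lborel. P_cis \<eta> x * \<phi> x) = (LINT x|lborel. of_real (- (1/2) * ((Q *v \<eta>) \<bullet> \<eta>)) * (cis (\<eta> \<bullet> x) * \<phi> x) + \<i> * of_real ((B *v x) \<bullet> \<eta>) * (cis (\<eta> \<bullet> x) * \<phi> x))"
      by (intro Bochner_Integration.integral_cong refl) (simp add: P_cis_def algebra_simps)
    also have "\<dots> = of_real (- (1/2) * ((Q *v \<eta>) \<bullet> \<eta>)) * u \<phi> + (LINT x|lborel. \<i> * of_real ((B *v x) \<bullet> \<eta>) * (cis (\<eta> \<bullet> x) * \<phi> x))"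
      unfolding u_def by (subst Bochner_Integration.integral_add) (auto intro!: integrable_mult_right i\<phi> i3)
    finally show ?thesis by (simp only: distrib_left)
  qed
  also have "\<dots> = dist_of_fun (\<lambda>x. a * P_cis \<eta> x) \<phi>" by (simp add: dist_of_fun_def mult.assoc)
  finally show "ou_operator Q B (dist_of_fun (\<lambda>x. a * cis (\<eta> \<bullet> x))) \<phi> = dist_of_fun (\<lambda>x. a * P_cis \<eta> x) \<phi>" .
qed

end

text \<open>Let \<sigma> be the supremum of the s with \<phi> s <= \<epsilon> s. The assumption
  \<open>left\<close> puts \<sigma> itself into this set, and \<open>right\<close> leads beyond it
  if \<sigma> < t. The assumptions are one-sided because this is the form in which strong continuity
  and the generator deliver them; no derivative of \<phi> is formed.\<close>

lemma dini_nonpos: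
  fixes \<phi> :: "real \<Rightarrow> real"
  assumes t: "0 \<le> t" and 0: "\<phi> 0 \<le> 0"
    and right: "\<And>s \<epsilon>. 0 \<le> s \<Longrightarrow> s < t \<Longrightarrow> \<epsilon> > 0 \<Longrightarrow> \<exists>h. 0 < h \<and> s + h \<le> t \<and> \<phi> (s + h) \<le> \<phi> s + \<epsilon> * h"
    and left: "\<And>s \<epsilon>. 0 < s \<Longrightarrow> s \<le> t \<Longrightarrow> \<epsilon> > 0 \<Longrightarrow> \<exists>\<delta>>0. \<forall>h. 0 < h \<longrightarrow> h < \<delta> \<longrightarrow> h \<le> s \<longrightarrow> \<phi> s \<le> \<phi> (s - h) + \<epsilon>"
  shows "\<phi> t \<le> 0"
proof (rule field_le_epsilon)
  fix e :: real assume "e > 0"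
  define \<epsilon> where "\<epsilon> = e / (t + 1)"
  have \<epsilon>: "\<epsilon> > 0" "\<epsilon> * t \<le> e" using \<open>e > 0\<close> t by (auto simp: \<epsilon>_def field_simps)
  define X where "X = {s. 0 \<le> s \<and> s \<le> t \<and> \<phi> s \<le> \<epsilon> * s}"
  have X0: "0 \<in> X" using t 0 by (simp add: X_def)
  have bdd: "bdd_above X" by (rule bdd_aboveI[of _ t]) (simp add: X_def)
  define \<sigma> where "\<sigma> = Sup X"
  have up: "s \<le> \<sigma>" if "s \<in> X" for s unfolding \<sigma>_def by (rule cSup_upper[OF that bdd])
  have \<sigma>0: "0 \<le> \<sigma>" by (rule up[OF X0])
  have \<sigma>t: "\<sigma> \<le> t" unfolding \<sigma>_def by (rule cSup_least) (use X0 in \<open>auto simp: X_def\<close>)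
  have \<sigma>X: "\<sigma> \<in> X"
  proof (cases "\<sigma> \<in> X")
    case False
    then have "\<sigma> \<noteq> 0" using X0 by auto
    then have \<sigma>p: "0 < \<sigma>" using \<sigma>0 by simp
    have "\<phi> \<sigma> \<le> \<epsilon> * \<sigma>"
    proof (rule field_le_epsilon)
      fix e' :: real assume "e' > 0"
      from left[OF \<sigma>p \<sigma>t this] obtain \<delta> where \<delta>: "\<delta> > 0" "\<And>h. 0 < h \<Longrightarrow> h < \<delta> \<Longrightarrow> h \<le> \<sigma> \<Longrightarrow> \<phi> \<sigma> \<le> \<phi> (\<sigma> - h) + e'" by blast
      have "\<sigma> - \<delta> < Sup X" using \<delta>(1) by (simp add: \<sigma>_def)
      then obtain s where s: "s \<in> X" "\<sigma> - \<delta> < s" using less_cSupE X0 by (metis empty_iff)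
      have "s < \<sigma>" using up[OF s(1)] s(1) False by (cases "s = \<sigma>") auto
      then have "\<phi> \<sigma> \<le> \<phi> s + e'" using \<delta>(2)[of "\<sigma> - s"] s by (simp add: X_def)
      also have "\<phi> s \<le> \<epsilon> * s" using s(1) by (simp add: X_def)
      also have "\<epsilon> * s \<le> \<epsilon> * \<sigma>" using \<epsilon>(1) \<open>s < \<sigma>\<close> by simp
      finally show "\<phi> \<sigma> \<le> \<epsilon> * \<sigma> + e'" by simp
    qed
    then show ?thesis using \<sigma>0 \<sigma>t by (simp add: X_def)
  qed
  have "\<sigma> = t"
  proof (rule ccontr)
    assume "\<sigma> \<noteq> t"
    then have "\<sigma> < t" using \<sigma>t by simp
    from right[OF \<sigma>0 this \<epsilon>(1)] obtain h where h: "0 < h" "\<sigma> + h \<le> t" "\<phi> (\<sigma> + h) \<le> \<phi> \<sigma> + \<epsilon> * h" by blast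
    have "\<phi> (\<sigma> + h) \<le> \<epsilon> * (\<sigma> + h)" using h(3) \<sigma>X by (simp add: X_def distrib_left)
    then have "\<sigma> + h \<in> X" using h \<sigma>0 by (simp add: X_def)
    then show False using up h(1) by fastforce
  qed
  then show "\<phi> t \<le> 0 + e" using \<sigma>X \<epsilon>(2) by (simp add: X_def)
qed

section \<open>The explicit evolution of one exponential\<close>

context ornstein_uhlenbeck
begin

definition freq :: "real \<Rightarrow> real^'n \<Rightarrow> real^'n" where "freq s \<xi> = transpose (E s) *v \<xi>"

lemma freq_inner: "freq s \<xi> \<bullet> x = \<xi> \<bullet> (E s *v x)"
  by (simp add: freq_def dot_lmul_matrix)

lemma freq_diff: "freq s (\<xi> - \<zeta>) = freq s \<xi> - freq s \<zeta>"
  unfolding freq_def by (rule matrix_vector_mult_diff_distrib)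

lemma freq_0: "freq 0 \<xi> = \<xi>"
  by (simp add: freq_def E_0)

definition ev_coeff :: "real^'n \<Rightarrow> real \<Rightarrow> real" where "ev_coeff \<xi> s = exp (- (1/2) * integral {0..s} (flow_form \<xi>))"

text \<open>The candidate for \<open>S s\<close> on the exponential of frequency \<xi>: the
  characteristic function at \<xi> of the Ornstein-Uhlenbeck transition law over time s, started at
  \<open>x\<close>.\<close>

definition ev :: "real^'n \<Rightarrow> real \<Rightarrow> real^'n \<Rightarrow> complex"
  where "ev \<xi> s x = of_real (ev_coeff \<xi> s) * cis (freq s \<xi> \<bullet> x)"

lemma ev_0: "ev \<xi> 0 = (\<lambda>x. cis (\<xi> \<bullet> x))"
  by (simp add: fun_eq_iff ev_def ev_coeff_def freq_0)

lemma ev_L2: "ev \<xi> s \<in> L2_fun \<rho>"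
  unfolding ev_def[abs_def] by (rule L2_fun_linear_growth[of _ "\<bar>ev_coeff \<xi> s\<bar>"]) (auto simp: norm_mult mult_le_cancel_left1)

text \<open>The evolution equation, pointwise in \<open>x\<close>: the right-hand side is P applied
  to \<open>ev \<xi> s\<close>. The derivative is taken within [0, b] because
  \<open>ev_coeff\<close> is an integral over [0, s].\<close>

lemma ev_derivative:
  assumes s: "s \<in> {0..b}"
  shows "((\<lambda>s. ev \<xi> s x) has_vector_derivative of_real (ev_coeff \<xi> s) * P_cis (freq s \<xi>) x) (at s within {0..b})"
proof -
  have "((\<lambda>u. integral {0..u} (flow_form \<xi>)) has_real_derivative flow_form \<xi> s) (at s within {0..b})"
    unfolding has_real_derivative_iff_has_vector_derivative by (rule integral_has_vector_derivative[OF flow_form_continuous s])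
  then have c: "(ev_coeff \<xi> has_real_derivative - (1/2) * flow_form \<xi> s * ev_coeff \<xi> s) (at s within {0..b})"
    unfolding ev_coeff_def[abs_def] by (auto intro!: derivative_eq_intros)
  have "((\<lambda>s. freq s \<xi> \<bullet> x) has_vector_derivative (transpose B *v freq s \<xi>) \<bullet> x) (at s)"
    unfolding freq_def by (rule bounded_linear.has_vector_derivative[OF bounded_linear_inner_left transpose_E_derivative])
  also have "(transpose B *v freq s \<xi>) \<bullet> x = (B *v x) \<bullet> freq s \<xi>"
    using dot_lmul_matrix[of "freq s \<xi>" B x] by (simp add: inner_commute)
  finally have f: "((\<lambda>s. freq s \<xi> \<bullet> x) has_real_derivative (B *v x) \<bullet> freq s \<xi>) (at s within {0..b})"
    unfolding has_real_derivative_iff_has_vector_derivative by (rule has_vector_derivative_at_within)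
  have cis': "((\<lambda>s. cis (freq s \<xi> \<bullet> x)) has_vector_derivative ((B *v x) \<bullet> freq s \<xi>) *\<^sub>R (\<i> * cis (freq s \<xi> \<bullet> x))) (at s within {0..b})"
  proof -
    have "(cis has_vector_derivative \<i> * cis y) (at y within A)" for y A
      using has_derivative_cis[OF has_derivative_ident, of y A]
      by (simp add: has_vector_derivative_def scaleR_conv_of_real mult_ac)
    from vector_diff_chain_within[OF f[unfolded has_real_derivative_iff_has_vector_derivative] this]
    show ?thesis by (simp add: o_def)
  qed
  have "((\<lambda>s. of_real (ev_coeff \<xi> s) * cis (freq s \<xi> \<bullet> x)) has_vector_derivative
      of_real (ev_coeff \<xi> s) * (((B *v x) \<bullet> freq s \<xi>) *\<^sub>R (\<i> * cis (freq s \<xi> \<bullet> x))) + of_real (- (1/2) * flow_form \<xi> s * ev_coeff \<xi> s) * cis (freq s \<xi> \<bullet> x)) (at s within {0..b})"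
    by (intro has_vector_derivative_mult has_vector_derivative_of_real cis' c)
  moreover have "of_real (ev_coeff \<xi> s) * (((B *v x) \<bullet> freq s \<xi>) *\<^sub>R (\<i> * cis (freq s \<xi> \<bullet> x))) + of_real (- (1/2) * flow_form \<xi> s * ev_coeff \<xi> s) * cis (freq s \<xi> \<bullet> x)
      = of_real (ev_coeff \<xi> s) * P_cis (freq s \<xi>) x"
    by (simp add: P_cis_def flow_form_def freq_def scaleR_conv_of_real algebra_simps del: transpose_matrix_vector)
  ultimately show ?thesis unfolding ev_def by simp
qed

text \<open>Uniform in \<open>s\<close> on a compact interval, so that it serves both as a Lipschitz
  constant in time and as a majorant in \<open>x\<close>.\<close>

lemma ev_derivative_bound: "\<exists>K\<ge>0. \<forall>s\<in>{0..b}. \<forall>x. cmod (of_real (ev_coeff \<xi> s) * P_cis (freq s \<xi>) x) \<le> K * (1 + norm x)"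
proof -
  obtain KB where KB: "KB > 0" "\<And>x. norm (B *v x) \<le> norm x * KB"
    using bounded_linear.pos_bounded[OF matrix_vector_mul_bounded_linear[of B]] by blast
  have cont: "continuous_on {0..b} (\<lambda>s. norm (freq s \<xi>))"
    unfolding freq_def by (intro continuous_intros transpose_E_continuous)
  have "compact ((\<lambda>s. norm (freq s \<xi>)) ` {0..b})" by (rule compact_continuous_image[OF cont]) simp
  then obtain M where M: "\<And>s. s \<in> {0..b} \<Longrightarrow> norm (norm (freq s \<xi>)) \<le> M" 
    using compact_imp_bounded bounded_iff by (metis imageI)
  have "compact (flow_form \<xi> ` {0..b})" by (rule compact_continuous_image[OF flow_form_continuous]) simp
  then obtain M' where M': "\<And>s. s \<in> {0..b} \<Longrightarrow> norm (flow_form \<xi> s) \<le> M'"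
    using compact_imp_bounded bounded_iff by (metis imageI)
  define K where "K = \<bar>M'\<bar> + KB * \<bar>M\<bar>"
  have "cmod (of_real (ev_coeff \<xi> s) * P_cis (freq s \<xi>) x) \<le> K * (1 + norm x)" if s: "s \<in> {0..b}" for s x
  proof -
    have "integral {0..s} (flow_form \<xi>) \<ge> 0" by (intro integral_nonneg integrable_continuous_interval flow_form_continuous flow_form_nonneg)
    then have c: "0 \<le> ev_coeff \<xi> s" "ev_coeff \<xi> s \<le> 1" by (auto simp: ev_coeff_def)
    have "\<bar>(B *v x) \<bullet> freq s \<xi>\<bar> \<le> norm (B *v x) * norm (freq s \<xi>)" by (rule Cauchy_Schwarz_ineq2)
    also have "\<dots> \<le> (norm x * KB) * \<bar>M\<bar>"
      using KB(1) M[OF s] by (intro mult_mono KB(2)) auto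
    finally have 1: "\<bar>(B *v x) \<bullet> freq s \<xi>\<bar> \<le> (KB * \<bar>M\<bar>) * norm x" by (simp add: mult_ac)
    have "cmod (P_cis (freq s \<xi>) x) \<le> \<bar>(1/2) * flow_form \<xi> s\<bar> + \<bar>(B *v x) \<bullet> freq s \<xi>\<bar>"
      unfolding P_cis_def norm_mult norm_cis mult_1_right flow_form_def freq_def
      by (rule order_trans[OF norm_triangle_ineq]) (simp add: norm_mult del: transpose_matrix_vector)
    also have "\<dots> \<le> \<bar>M'\<bar> + (KB * \<bar>M\<bar>) * norm x" using 1 M'[OF s] by (intro add_mono) (auto simp: abs_mult)
    also have "\<dots> \<le> K * (1 + norm x)"
    proof -
      have "0 \<le> \<bar>M'\<bar> * norm x" "0 \<le> KB * \<bar>M\<bar>" using KB(1) by auto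
      then show ?thesis unfolding K_def by (simp add: distrib_left distrib_right)
    qed
    finally have "cmod (P_cis (freq s \<xi>) x) \<le> K * (1 + norm x)" .
    then have "ev_coeff \<xi> s * cmod (P_cis (freq s \<xi>) x) \<le> 1 * (K * (1 + norm x))"
      using c by (intro mult_mono) auto
    then show ?thesis using c by (simp add: norm_mult)
  qed
  moreover have "K \<ge> 0" using KB(1) by (simp add: K_def)
  ultimately show ?thesis by blast
qed

lemma ev_Lipschitz:
  "\<exists>K\<ge>0. \<forall>s\<in>{0..b}. \<forall>t\<in>{0..b}. \<forall>x. cmod (ev \<xi> t x - ev \<xi> s x) \<le> K * (1 + norm x) * \<bar>t - s\<bar>"
proof -
  obtain K where K: "K \<ge> 0" "\<And>s x. s \<in> {0..b} \<Longrightarrow> cmod (of_real (ev_coeff \<xi> s) * P_cis (freq s \<xi>) x) \<le> K * (1 + norm x)"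
    using ev_derivative_bound by blast
  have "norm (ev \<xi> t x - ev \<xi> s x) \<le> K * (1 + norm x) * norm (t - s)" if "s \<in> {0..b}" "t \<in> {0..b}" for s t x
  proof (rule differentiable_bound[where S = "{0..b}" and f = "\<lambda>s. ev \<xi> s x"])
    fix u assume u: "u \<in> {0..b}"
    show "((\<lambda>s. ev \<xi> s x) has_derivative (\<lambda>h. h *\<^sub>R (of_real (ev_coeff \<xi> u) * P_cis (freq u \<xi>) x))) (at u within {0..b})"
      using ev_derivative[OF u] by (simp only: has_vector_derivative_def)
    show "onorm (\<lambda>h. h *\<^sub>R (of_real (ev_coeff \<xi> u) * P_cis (freq u \<xi>) x)) \<le> K * (1 + norm x)"
    proof (rule onorm_bound)
      show "0 \<le> K * (1 + norm x)" using K(1) by simp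
      fix h :: real
      show "norm (h *\<^sub>R (of_real (ev_coeff \<xi> u) * P_cis (freq u \<xi>) x)) \<le> K * (1 + norm x) * norm h"
        using mult_left_mono[OF K(2)[OF u, of x], of "\<bar>h\<bar>"] by (simp add: mult.commute)
    qed
  qed (use that in auto)
  then show ?thesis using K(1) by (intro exI[of _ K]) (simp only: real_norm_def ball_simps, blast)
qed

definition linear_norm :: real where "linear_norm = L2_norm \<rho> (\<lambda>x. of_real (1 + norm x))"

lemma L2_norm_linear_growth:
  assumes "f \<in> borel_measurable borel" "\<And>x. cmod (f x) \<le> K * (1 + norm x)" "K \<ge> 0"
  shows "L2_norm \<rho> f \<le> K * linear_norm"
proof -
  have [measurable]: "f \<in> borel_measurable \<rho>" using assms(1) by (simp add: measurable_cong_sets[OF sets_\<rho> refl])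
  have "(LINT x|\<rho>. (cmod (f x))\<^sup>2) \<le> (LINT x|\<rho>. K\<^sup>2 * (1 + norm x)\<^sup>2)"
  proof (rule integral_mono[OF L2_funD(2)[OF L2_fun_linear_growth[OF assms(1,2)]]])
    show "integrable \<rho> (\<lambda>x. K\<^sup>2 * (1 + norm x)\<^sup>2)" using norm_square_integrable by simp
    fix x show "(cmod (f x))\<^sup>2 \<le> K\<^sup>2 * (1 + norm x)\<^sup>2"
      unfolding power_mult_distrib[symmetric] by (rule power_mono[OF assms(2)]) simp
  qed
  also have "\<dots> = (K * linear_norm)\<^sup>2"
  proof -
    have "cmod (1 + complex_of_real (norm x)) = 1 + norm x" for x :: "real^'n"
      by (metis abs_of_nonneg add_nonneg_nonneg norm_ge_zero norm_of_real of_real_1 of_real_add zero_le_one)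
    then show ?thesis unfolding linear_norm_def power_mult_distrib L2_norm_power2 by simp
  qed
  finally have "(L2_norm \<rho> f)\<^sup>2 \<le> (K * linear_norm)\<^sup>2" unfolding L2_norm_power2 .
  moreover have "0 \<le> K * linear_norm" using assms(3) by (simp add: linear_norm_def L2_norm_nonneg)
  ultimately show ?thesis by (rule power2_le_imp_le)
qed

text \<open>Pointwise differentiability is upgraded to L^2 by dominated convergence: the difference
  quotient and the derivative are both bounded by multiples of 1 + |x|, whose square is integrable
  for \<rho>.\<close>

lemma ev_quotient_limit:
  assumes s: "s \<in> {0..b}"
  shows "((\<lambda>t. L2_norm \<rho> (\<lambda>x. (ev \<xi> t x - ev \<xi> s x) / of_real (t - s) - of_real (ev_coeff \<xi> s) * P_cis (freq s \<xi>) x)) \<longlongrightarrow> 0) (at s within {0..b})"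
proof -
  obtain K where K: "K \<ge> 0" "\<And>s x. s \<in> {0..b} \<Longrightarrow> cmod (of_real (ev_coeff \<xi> s) * P_cis (freq s \<xi>) x) \<le> K * (1 + norm x)"
    using ev_derivative_bound by blast
  obtain K' where K': "K' \<ge> 0" "\<And>s t x. s \<in> {0..b} \<Longrightarrow> t \<in> {0..b} \<Longrightarrow> cmod (ev \<xi> t x - ev \<xi> s x) \<le> K' * (1 + norm x) * \<bar>t - s\<bar>"
    using ev_Lipschitz[of b \<xi>] by blast
  define R where "R t x = (ev \<xi> t x - ev \<xi> s x) / of_real (t - s) - of_real (ev_coeff \<xi> s) * P_cis (freq s \<xi>) x" for t x
  have evm [measurable]: "ev \<xi> t \<in> borel_measurable \<rho>" for t using ev_L2 by (rule L2_funD(1))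
  have Rm: "R t \<in> borel_measurable \<rho>" for t unfolding R_def by measurable
  have "((\<lambda>t. LINT x|\<rho>. (cmod (R t x))\<^sup>2) \<longlongrightarrow> (LINT x|\<rho>. 0)) (at s within {0..b})"
  proof (rule tendsto_integral_dominated_within)
    show "integrable \<rho> (\<lambda>x. (K' + K)\<^sup>2 * (1 + norm x)\<^sup>2)" using norm_square_integrable by simp
    fix x
    have "((\<lambda>t. (ev \<xi> t x - ev \<xi> s x) /\<^sub>R (t - s)) \<longlongrightarrow> of_real (ev_coeff \<xi> s) * P_cis (freq s \<xi>) x) (at s within {0..b})"
      using ev_derivative[OF s, of \<xi> x] unfolding has_vector_derivative_within_quotient .
    then have "((\<lambda>t. (ev \<xi> t x - ev \<xi> s x) /\<^sub>R (t - s) - of_real (ev_coeff \<xi> s) * P_cis (freq s \<xi>) x) \<longlongrightarrow> 0) (at s within {0..b})"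
      by (simp add: LIM_zero)
    then have "((\<lambda>t. R t x) \<longlongrightarrow> 0) (at s within {0..b})"
      by (simp add: R_def scaleR_conv_of_real divide_inverse mult.commute)
    from tendsto_power[OF tendsto_norm[OF this], of 2]
    show "((\<lambda>t. (cmod (R t x))\<^sup>2) \<longlongrightarrow> 0) (at s within {0..b})" by simp
  next
    fix t x assume t: "t \<in> {0..b}" "t \<noteq> s"
    have "cmod (R t x) \<le> cmod (ev \<xi> t x - ev \<xi> s x) / \<bar>t - s\<bar> + cmod (of_real (ev_coeff \<xi> s) * P_cis (freq s \<xi>) x)"
      unfolding R_def by (rule order_trans[OF norm_triangle_ineq4]) (simp only: norm_divide norm_of_real order_refl)
    also have "\<dots> \<le> K' * (1 + norm x) + K * (1 + norm x)"
      using K'(2)[OF s t(1), of x] t(2) by (intro add_mono K(2) s) (simp add: pos_divide_le_eq)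
    finally have "cmod (R t x) \<le> (K' + K) * (1 + norm x)" by (simp add: distrib_right)
    then show "norm ((cmod (R t x))\<^sup>2) \<le> (K' + K)\<^sup>2 * (1 + norm x)\<^sup>2"
      by (simp add: power_mult_distrib[symmetric] power_mono)
  qed (use Rm in auto)
  then have "((\<lambda>t. sqrt (LINT x|\<rho>. (cmod (R t x))\<^sup>2)) \<longlongrightarrow> sqrt 0) (at s within {0..b})"
    by (intro tendsto_real_sqrt) simp
  then show ?thesis by (simp add: L2_norm_altdef R_def)
qed

end

section \<open>The semigroup on exponentials\<close>

locale ornstein_uhlenbeck_semigroup = ornstein_uhlenbeck Q B for Q B :: "real^'n^'n" +
  fixes S :: "real \<Rightarrow> (real^'n \<Rightarrow> complex) \<Rightarrow> (real^'n \<Rightarrow> complex)"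
  assumes semigroup: "ou_semigroup Q B S"
begin

lemma S_C0: "L2_C0_semigroup \<rho> S"
  using semigroup by (simp add: ou_semigroup_def)

lemmas S_operator = L2_C0_semigroupD(1)[OF S_C0]
lemmas S_L2 = L2_bounded_operatorD(1)[OF S_operator]

lemma cis_L2: "(\<lambda>x. a * cis (\<eta> \<bullet> x)) \<in> L2_fun \<rho>"
  by (rule L2_fun_cmult[OF L2_fun_linear_growth[of _ 1]]) auto

lemma S_cis_quotient:
  "((\<lambda>t. L2_norm \<rho> (\<lambda>x. (S t (\<lambda>x. a * cis (\<eta> \<bullet> x)) x - a * cis (\<eta> \<bullet> x)) / of_real t - a * P_cis \<eta> x)) \<longlongrightarrow> 0) (at_right 0)"
proof -
  have "generator_graph \<rho> S (\<lambda>x. a * cis (\<eta> \<bullet> x)) (\<lambda>x. a * P_cis \<eta> x)"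
    using semigroup ou_graph_cis unfolding ou_semigroup_def by blast
  then show ?thesis unfolding generator_graph_def by (elim conjE)
qed

text \<open>\<open>ev \<xi> (s + h)\<close> and \<open>S h (ev \<xi> s)\<close> agree to first order
  in h. With s fixed, \<open>ev \<xi> s\<close> is a multiple of an exponential and so lies in the
  domain of the generator; both curves have its image under P as L^2 derivative at h = 0.\<close>

lemma ev_tangent:
  assumes s: "0 \<le> s" and \<epsilon>: "\<epsilon> > 0"
  shows "\<exists>\<delta>>0. \<forall>h. 0 < h \<longrightarrow> h < \<delta> \<longrightarrow> L2_norm \<rho> (\<lambda>x. ev \<xi> (s + h) x - S h (ev \<xi> s) x) \<le> \<epsilon> * h"
proof -
  define A where "A x = of_real (ev_coeff \<xi> s) * P_cis (freq s \<xi>) x" for x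
  have evs: "ev \<xi> s = (\<lambda>x. of_real (ev_coeff \<xi> s) * cis (freq s \<xi> \<bullet> x))" by (simp add: ev_def fun_eq_iff)
  have "\<forall>\<^sub>F h in at_right 0. L2_norm \<rho> (\<lambda>x. (S h (ev \<xi> s) x - ev \<xi> s x) / of_real h - A x) < \<epsilon> / 2"
    using order_tendstoD(2)[OF S_cis_quotient, of "\<epsilon> / 2" "of_real (ev_coeff \<xi> s)" "freq s \<xi>"] \<epsilon>
    unfolding evs A_def by simp
  then obtain d1 where d1: "d1 > 0" "\<And>h. 0 < h \<Longrightarrow> h < d1 \<Longrightarrow> L2_norm \<rho> (\<lambda>x. (S h (ev \<xi> s) x - ev \<xi> s x) / of_real h - A x) < \<epsilon> / 2"
    unfolding eventually_at_right_field by blast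
  have "\<forall>\<^sub>F t in at s within {0..s+1}. L2_norm \<rho> (\<lambda>x. (ev \<xi> t x - ev \<xi> s x) / of_real (t - s) - A x) < \<epsilon> / 2"
    using order_tendstoD(2)[OF ev_quotient_limit[of s "s + 1" \<xi>], of "\<epsilon> / 2"] s \<epsilon> unfolding A_def by simp
  then obtain d2 where d2: "d2 > 0" "\<And>t. t \<in> {0..s+1} \<Longrightarrow> t \<noteq> s \<Longrightarrow> dist t s < d2 \<Longrightarrow> L2_norm \<rho> (\<lambda>x. (ev \<xi> t x - ev \<xi> s x) / of_real (t - s) - A x) < \<epsilon> / 2"
    unfolding eventually_at by blast
  have AL: "A \<in> L2_fun \<rho>"
  proof -
    obtain K where "\<forall>x. cmod (P_cis (freq s \<xi>) x) \<le> K * (1 + norm x)" using P_cis_growth by blast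
    then show ?thesis unfolding A_def[abs_def] by (intro L2_fun_cmult[OF L2_fun_linear_growth[of _ K]]) auto
  qed
  have "L2_norm \<rho> (\<lambda>x. ev \<xi> (s + h) x - S h (ev \<xi> s) x) \<le> \<epsilon> * h" if h: "0 < h" "h < min d1 (min d2 1)" for h
  proof -
    define X where "X x = (ev \<xi> (s + h) x - ev \<xi> s x) / of_real h - A x" for x
    define Y where "Y x = (S h (ev \<xi> s) x - ev \<xi> s x) / of_real h - A x" for x
    have XL: "X \<in> L2_fun \<rho>"
      using L2_fun_diff[OF L2_fun_cmult[OF L2_fun_diff[OF ev_L2[of \<xi> "s + h"] ev_L2[of \<xi> s]], of "1 / of_real h"] AL]
      by (simp add: X_def[abs_def])
    have YL: "Y \<in> L2_fun \<rho>"
      using L2_fun_diff[OF L2_fun_cmult[OF L2_fun_diff[OF S_L2[OF less_imp_le[OF h(1)] ev_L2[of \<xi> s]] ev_L2[of \<xi> s]], of "1 / of_real h"] AL]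
      by (simp add: Y_def[abs_def])
    have "(\<lambda>x. ev \<xi> (s + h) x - S h (ev \<xi> s) x) = (\<lambda>x. of_real h * (X x - Y x))"
      using h(1) by (simp add: X_def Y_def fun_eq_iff field_simps)
    then have "L2_norm \<rho> (\<lambda>x. ev \<xi> (s + h) x - S h (ev \<xi> s) x) = h * L2_norm \<rho> (\<lambda>x. X x - Y x)"
      using h(1) by (simp add: L2_norm_cmult)
    also have "L2_norm \<rho> (\<lambda>x. X x - Y x) \<le> L2_norm \<rho> X + L2_norm \<rho> Y"
      using L2_norm_triangle_diff[OF XL L2_fun_zero YL] L2_norm_minus_commute[of \<rho> "\<lambda>x. 0" Y] by simp
    also have "L2_norm \<rho> X + L2_norm \<rho> Y \<le> \<epsilon> / 2 + \<epsilon> / 2"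
      using d1(2)[of h] d2(2)[of "s + h"] h s unfolding X_def[abs_def] Y_def[abs_def] by (intro add_mono) (auto simp: dist_real_def)
    finally show ?thesis using h(1) by (simp add: mult.commute)
  qed
  then show ?thesis using d1(1) d2(1) by (intro exI[of _ "min d1 (min d2 1)"]) auto
qed

text \<open>Supplies the left-sided hypothesis of \<open>dini_nonpos\<close>. Here
  \<open>S h\<close> acts on a moving argument, so strong continuity at \<open>ev \<xi> s\<close> is
  combined with the Lipschitz bound for \<open>ev\<close> and the local bound for the
  semigroup.\<close>

lemma ev_left_continuous:
  assumes s: "0 < s" and \<epsilon>: "\<epsilon> > 0"
  shows "\<exists>\<delta>>0. \<forall>h. 0 < h \<longrightarrow> h < \<delta> \<longrightarrow> h \<le> s \<longrightarrow> L2_norm \<rho> (\<lambda>x. ev \<xi> s x - S h (ev \<xi> (s - h)) x) \<le> \<epsilon>"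
proof -
  obtain K where K: "K \<ge> 0" "\<And>u v x. u \<in> {0..s} \<Longrightarrow> v \<in> {0..s} \<Longrightarrow> cmod (ev \<xi> v x - ev \<xi> u x) \<le> K * (1 + norm x) * \<bar>v - u\<bar>"
    using ev_Lipschitz[of s \<xi>] by blast
  obtain M where M: "M \<ge> 0" "\<And>t f. 0 \<le> t \<Longrightarrow> t \<le> s \<Longrightarrow> f \<in> L2_fun \<rho> \<Longrightarrow> L2_norm \<rho> (S t f) \<le> M * L2_norm \<rho> f"
    using C0_semigroup_locally_bounded[OF S_C0, of s] by blast
  define L where "L = M * (K * linear_norm) + 1"
  have L0: "0 \<le> K * linear_norm" using K(1) by (simp add: linear_norm_def L2_norm_nonneg)
  then have L: "L > 0" using M(1) by (simp add: L_def add_nonneg_pos)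
  have "\<forall>\<^sub>F h in at_right 0. L2_norm \<rho> (\<lambda>x. S h (ev \<xi> s) x - ev \<xi> s x) < \<epsilon> / 2"
    using order_tendstoD(2)[OF L2_C0_semigroupD(4)[OF S_C0 ev_L2], of "\<epsilon> / 2"] \<epsilon> by simp
  then obtain d where d: "d > 0" "\<And>h. 0 < h \<Longrightarrow> h < d \<Longrightarrow> L2_norm \<rho> (\<lambda>x. S h (ev \<xi> s) x - ev \<xi> s x) < \<epsilon> / 2"
    unfolding eventually_at_right_field by blast
  have "L2_norm \<rho> (\<lambda>x. ev \<xi> s x - S h (ev \<xi> (s - h)) x) \<le> \<epsilon>" if h: "0 < h" "h < min d (\<epsilon> / (2 * L))" "h \<le> s" for h
  proof -
    have h0: "0 \<le> h" using h(1) by simp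
    have "L2_norm \<rho> (\<lambda>x. ev \<xi> s x - ev \<xi> (s - h) x) \<le> (K * h) * linear_norm"
    proof (rule L2_norm_linear_growth)
      show "(\<lambda>x. ev \<xi> s x - ev \<xi> (s - h) x) \<in> borel_measurable borel" unfolding ev_def by measurable
      show "cmod (ev \<xi> s x - ev \<xi> (s - h) x) \<le> (K * h) * (1 + norm x)" for x using K(2)[of "s - h" s x] h by (simp add: mult_ac)
    qed (use K(1) h0 in simp)
    then have 1: "L2_norm \<rho> (\<lambda>x. S h (ev \<xi> s) x - S h (ev \<xi> (s - h)) x) \<le> M * ((K * h) * linear_norm)"
      unfolding L2_operator_norm_diff[OF S_operator[OF h0] ev_L2 ev_L2]
      using M(2)[OF h0 h(3) L2_fun_diff[OF ev_L2[of \<xi> s] ev_L2[of \<xi> "s - h"]]] mult_left_mono[OF _ M(1)] by (meson order_trans)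
    have "M * ((K * h) * linear_norm) \<le> L * h" using h0 by (simp add: L_def algebra_simps)
    also have "\<dots> \<le> \<epsilon> / 2" using h(2) L by (simp add: field_simps)
    finally have 2: "M * ((K * h) * linear_norm) \<le> \<epsilon> / 2" .
    have "L2_norm \<rho> (\<lambda>x. ev \<xi> s x - S h (ev \<xi> (s - h)) x) \<le> L2_norm \<rho> (\<lambda>x. ev \<xi> s x - S h (ev \<xi> s) x) + L2_norm \<rho> (\<lambda>x. S h (ev \<xi> s) x - S h (ev \<xi> (s - h)) x)"
      by (intro L2_norm_triangle_diff ev_L2 S_L2 h0)
    also have "\<dots> \<le> \<epsilon> / 2 + \<epsilon> / 2"
      using d(2)[of h] h 1 2 L2_norm_minus_commute[of \<rho> "ev \<xi> s" "S h (ev \<xi> s)"] by (intro add_mono) auto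
    finally show ?thesis by simp
  qed
  then show ?thesis using d(1) \<epsilon> L by (intro exI[of _ "min d (\<epsilon> / (2 * L))"]) auto
qed

text \<open>The path S (t - s) (ev s) leads from S t (ev 0) at s = 0 to ev t at s = t. Its distance
  \<phi> s from the starting point grows at rate zero by \<open>ev_tangent\<close>, so it
  vanishes.\<close>

lemma S_cis:
  assumes t: "0 \<le> t"
  shows "AE x in \<rho>. S t (\<lambda>x. cis (\<xi> \<bullet> x)) x = ev \<xi> t x"
proof -
  define v where "v = ev \<xi>"
  have vL: "v s \<in> L2_fun \<rho>" for s unfolding v_def by (rule ev_L2)
  define \<phi> where "\<phi> s = L2_norm \<rho> (\<lambda>x. S (t - s) (v s) x - S t (v 0) x)" for s
  obtain M where M: "M \<ge> 0" "\<And>s f. 0 \<le> s \<Longrightarrow> s \<le> t \<Longrightarrow> f \<in> L2_fun \<rho> \<Longrightarrow> L2_norm \<rho> (S s f) \<le> M * L2_norm \<rho> f"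
    using C0_semigroup_locally_bounded[OF S_C0, of t] by blast
  have step: "\<phi> (s + h) \<le> \<phi> s + M * L2_norm \<rho> (\<lambda>x. v (s + h) x - S h (v s) x)"
    if s: "0 \<le> s" "0 \<le> h" "s + h \<le> t" for s h
  proof -
    have t': "0 \<le> t - (s + h)" "0 \<le> t - s" using s by auto
    have "\<phi> (s + h) \<le> L2_norm \<rho> (\<lambda>x. S (t - (s + h)) (v (s + h)) x - S (t - s) (v s) x) + \<phi> s"
      unfolding \<phi>_def by (intro L2_norm_triangle_diff S_L2 vL t' t)
    also have "L2_norm \<rho> (\<lambda>x. S (t - (s + h)) (v (s + h)) x - S (t - s) (v s) x)
        = L2_norm \<rho> (\<lambda>x. S (t - (s + h)) (v (s + h)) x - S (t - (s + h)) (S h (v s)) x)"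
    proof (rule L2_norm_cong_AE)
      have "AE x in \<rho>. S (t - (s + h) + h) (v s) x = S (t - (s + h)) (S h (v s)) x"
        by (rule L2_C0_semigroupD(3)[OF S_C0 t'(1) s(2) vL])
      then show "AE x in \<rho>. S (t - (s + h)) (v (s + h)) x - S (t - s) (v s) x = S (t - (s + h)) (v (s + h)) x - S (t - (s + h)) (S h (v s)) x"
        by eventually_elim (simp add: algebra_simps)
    qed (intro L2_funD(1) L2_fun_diff S_L2 vL t' s(2))+
    also have "\<dots> = L2_norm \<rho> (S (t - (s + h)) (\<lambda>x. v (s + h) x - S h (v s) x))"
      by (intro L2_operator_norm_diff S_operator S_L2 vL t' s(2))
    also have "\<dots> \<le> M * L2_norm \<rho> (\<lambda>x. v (s + h) x - S h (v s) x)"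
      by (intro M(2) L2_fun_diff S_L2 vL t' s(2)) (use s in auto)
    finally show ?thesis by simp
  qed
  have M1: "M + 1 > 0" "\<And>e. e > 0 \<Longrightarrow> M * (e / (M + 1)) \<le> e" using M(1) by (auto simp: field_simps)
  have "\<phi> t \<le> 0"
  proof (rule dini_nonpos[OF t])
    show "\<phi> 0 \<le> 0" by (simp add: \<phi>_def L2_norm_altdef)
  next
    fix s \<epsilon> :: real assume s: "0 \<le> s" "s < t" and \<epsilon>: "\<epsilon> > 0"
    have e: "\<epsilon> / (M + 1) > 0" using \<epsilon> M1(1) by simp
    from ev_tangent[OF s(1) e, of \<xi>] obtain \<delta> where \<delta>: "\<delta> > 0" "\<And>h. 0 < h \<Longrightarrow> h < \<delta> \<Longrightarrow> L2_norm \<rho> (\<lambda>x. v (s + h) x - S h (v s) x) \<le> \<epsilon> / (M + 1) * h"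
      unfolding v_def by blast
    define h where "h = min (\<delta> / 2) (t - s)"
    have h: "0 < h" "h < \<delta>" "s + h \<le> t" using \<delta>(1) s by (auto simp: h_def)
    have "M * L2_norm \<rho> (\<lambda>x. v (s + h) x - S h (v s) x) \<le> M * (\<epsilon> / (M + 1) * h)" by (intro mult_left_mono \<delta>(2) h M(1))
    also have "\<dots> = M * (\<epsilon> / (M + 1)) * h" by simp
    also have "\<dots> \<le> \<epsilon> * h" using h(1) M1(2)[OF \<epsilon>] by (intro mult_right_mono) auto
    finally show "\<exists>h. 0 < h \<and> s + h \<le> t \<and> \<phi> (s + h) \<le> \<phi> s + \<epsilon> * h"
      using step[of s h] s h by (intro exI[of _ h]) auto
  next
    fix s \<epsilon> :: real assume s: "0 < s" "s \<le> t" and \<epsilon>: "\<epsilon> > 0"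
    have e: "\<epsilon> / (M + 1) > 0" using \<epsilon> M1(1) by simp
    from ev_left_continuous[OF s(1) e, of \<xi>] obtain \<delta> where \<delta>: "\<delta> > 0" "\<And>h. 0 < h \<Longrightarrow> h < \<delta> \<Longrightarrow> h \<le> s \<Longrightarrow> L2_norm \<rho> (\<lambda>x. v s x - S h (v (s - h)) x) \<le> \<epsilon> / (M + 1)"
      unfolding v_def by blast
    have "\<phi> s \<le> \<phi> (s - h) + \<epsilon>" if h: "0 < h" "h < \<delta>" "h \<le> s" for h
    proof -
      have "M * L2_norm \<rho> (\<lambda>x. v s x - S h (v (s - h)) x) \<le> M * (\<epsilon> / (M + 1))" by (intro mult_left_mono \<delta>(2) h M(1))
      then show ?thesis using step[of "s - h" h] s h M1(2)[OF \<epsilon>] by simp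
    qed
    then show "\<exists>\<delta>>0. \<forall>h. 0 < h \<longrightarrow> h < \<delta> \<longrightarrow> h \<le> s \<longrightarrow> \<phi> s \<le> \<phi> (s - h) + \<epsilon>" using \<delta>(1) by blast
  qed
  then have "L2_norm \<rho> (\<lambda>x. S 0 (v t) x - S t (v 0) x) = 0"
    using L2_norm_nonneg[of \<rho> "\<lambda>x. S 0 (v t) x - S t (v 0) x"] by (simp add: \<phi>_def)
  from L2_norm_eq_0_AE[OF L2_fun_diff[OF S_L2[OF order_refl vL] S_L2[OF t vL]] this] L2_C0_semigroupD(2)[OF S_C0 vL[of t]]
  have "AE x in \<rho>. S t (v 0) x = v t x" by eventually_elim simp
  then show ?thesis by (simp only: v_def ev_0)
qed

lemma S_trig_poly:
  assumes t: "0 \<le> t" and F: "finite F"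
  shows "AE x in \<rho>. S t (\<lambda>x. \<Sum>\<xi>\<in>F. c \<xi> * cis (\<xi> \<bullet> x)) x = (\<Sum>\<xi>\<in>F. c \<xi> * ev \<xi> t x)"
  using F
proof induction
  case empty
  show ?case using L2_bounded_operatorD(2)[OF S_operator[OF t] L2_fun_zero L2_fun_zero, of 0 0] by simp
next
  case (insert \<zeta> F)
  have c: "(\<lambda>x. cis (\<zeta> \<bullet> x)) \<in> L2_fun \<rho>" using cis_L2[of 1] by simp
  have "AE x in \<rho>. S t (\<lambda>x. c \<zeta> * cis (\<zeta> \<bullet> x) + 1 * (\<Sum>\<xi>\<in>F. c \<xi> * cis (\<xi> \<bullet> x))) x
      = c \<zeta> * S t (\<lambda>x. cis (\<zeta> \<bullet> x)) x + 1 * S t (\<lambda>x. \<Sum>\<xi>\<in>F. c \<xi> * cis (\<xi> \<bullet> x)) x"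
    by (rule L2_bounded_operatorD(2)[OF S_operator[OF t] c L2_fun_sum[OF cis_L2]])
  with insert.IH S_cis[OF t, of \<zeta>] show ?case
  proof eventually_elim
    case (elim x)
    then show ?case using insert.hyps by simp
  qed
qed

end

section \<open>Gaussian averages of trigonometric polynomials\<close>

lemma cis_mult_cnj: "cis a * cnj (cis b) = cis (a - b)"
  by (simp add: cis_cnj cis_mult)

context finite_borel_ac_measure
begin

lemma integrable_bounded:
  fixes f :: "real^'n \<Rightarrow> 'b::{banach, second_countable_topology}"
  assumes "f \<in> borel_measurable borel" "\<And>x. norm (f x) \<le> K"
  shows "integrable M f"
  by (rule integrable_const_bound[of _ K]) (use assms in \<open>auto simp: measurable_cong_sets[OF sets_M refl]\<close>)

lemma integrable_cis: "integrable M (\<lambda>x. cis (\<theta> \<bullet> x))"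
proof (rule integrable_bounded[of _ 1])
  show "(\<lambda>x. cis (\<theta> \<bullet> x)) \<in> borel_measurable borel"
    unfolding cis_conv_exp by (intro borel_measurable_continuous_onI continuous_intros)
qed simp

lemma trig_square_expand:
  "complex_of_real ((cmod (\<Sum>\<xi>\<in>F. c \<xi> * cis (\<theta> \<xi> \<bullet> x)))\<^sup>2) = (\<Sum>\<xi>\<in>F. \<Sum>\<zeta>\<in>F. c \<xi> * cnj (c \<zeta>) * cis ((\<theta> \<xi> - \<theta> \<zeta>) \<bullet> x))"
  unfolding complex_norm_square cnj_sum sum_product complex_cnj_mult
proof (intro sum.cong refl)
  fix \<xi> \<zeta>
  have "c \<xi> * cis (\<theta> \<xi> \<bullet> x) * (cnj (c \<zeta>) * cnj (cis (\<theta> \<zeta> \<bullet> x))) = c \<xi> * cnj (c \<zeta>) * (cis (\<theta> \<xi> \<bullet> x) * cnj (cis (\<theta> \<zeta> \<bullet> x)))"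
    by (simp only: mult_ac)
  then show "c \<xi> * cis (\<theta> \<xi> \<bullet> x) * (cnj (c \<zeta>) * cnj (cis (\<theta> \<zeta> \<bullet> x))) = c \<xi> * cnj (c \<zeta>) * cis ((\<theta> \<xi> - \<theta> \<zeta>) \<bullet> x)"
    by (simp only: cis_mult_cnj inner_diff_left)
qed

lemma trig_square_integral:
  "complex_of_real (LINT x|M. (cmod (\<Sum>\<xi>\<in>F. c \<xi> * cis (\<theta> \<xi> \<bullet> x)))\<^sup>2)
    = (\<Sum>\<xi>\<in>F. \<Sum>\<zeta>\<in>F. c \<xi> * cnj (c \<zeta>) * (LINT x|M. cis ((\<theta> \<xi> - \<theta> \<zeta>) \<bullet> x)))"
proof -
  have "complex_of_real (LINT x|M. (cmod (\<Sum>\<xi>\<in>F. c \<xi> * cis (\<theta> \<xi> \<bullet> x)))\<^sup>2)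
      = (LINT x|M. (\<Sum>\<xi>\<in>F. \<Sum>\<zeta>\<in>F. c \<xi> * cnj (c \<zeta>) * cis ((\<theta> \<xi> - \<theta> \<zeta>) \<bullet> x)))"
    unfolding trig_square_expand[symmetric] by (rule integral_complex_of_real[symmetric])
  also have "\<dots> = (\<Sum>\<xi>\<in>F. \<Sum>\<zeta>\<in>F. c \<xi> * cnj (c \<zeta>) * (LINT x|M. cis ((\<theta> \<xi> - \<theta> \<zeta>) \<bullet> x)))"
    by (simp add: Bochner_Integration.integral_sum Bochner_Integration.integrable_sum integrable_cis)
  finally show ?thesis .
qed

text \<open>Jensen's inequality for a probability measure, from the nonnegativity of the
  variance.\<close>

lemma square_integral_le:
  fixes f :: "real^'n \<Rightarrow> complex"
  assumes M1: "measure M (space M) = 1" and f: "f \<in> borel_measurable borel" "\<And>x. cmod (f x) \<le> K"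
  shows "(cmod (LINT x|M. f x))\<^sup>2 \<le> (LINT x|M. (cmod (f x))\<^sup>2)"
proof -
  define m where "m = (LINT x|M. f x)"
  have i: "integrable M f" by (rule integrable_bounded[OF f])
  have i2: "integrable M (\<lambda>x. (cmod (f x))\<^sup>2)"
    by (rule integrable_bounded[of _ "K\<^sup>2"]) (use f in \<open>auto intro!: power_mono\<close>)
  define h where "h x = Re (f x * cnj m)" for x
  have iR: "integrable M h" unfolding h_def using i by simp
  have "0 \<le> (LINT x|M. (cmod (f x - m))\<^sup>2)" by simp
  also have "\<dots> = (LINT x|M. (cmod (f x))\<^sup>2 - 2 * h x + (cmod m)\<^sup>2)"
    by (intro Bochner_Integration.integral_cong refl) (simp add: h_def cmod_power2 power2_diff algebra_simps)
  also have "\<dots> = (LINT x|M. (cmod (f x))\<^sup>2) - 2 * (LINT x|M. h x) + (cmod m)\<^sup>2"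
    using i2 iR M1 by simp
  also have "(LINT x|M. h x) = Re (LINT x|M. f x * cnj m)"
    unfolding h_def using i by (intro integral_Re) simp
  also have "(LINT x|M. f x * cnj m) = of_real ((cmod m)\<^sup>2)"
    unfolding complex_norm_square by (simp add: m_def)
  finally show ?thesis by (simp add: m_def)
qed

end

lemma standard_gaussian:
  "\<exists>\<gamma> :: (real^'n) measure. finite_borel_ac_measure \<gamma> \<and> (\<forall>\<zeta>. (LINT z|\<gamma>. cis (\<zeta> \<bullet> z)) = of_real (exp (- (1/2) * (\<zeta> \<bullet> \<zeta>))))"
proof -
  define \<kappa> where "\<kappa> z = exp (- (1/2) * (norm z)\<^sup>2)" for z :: "real^'n"
  have i: "integrable lborel \<kappa>" unfolding \<kappa>_def[abs_def] by (rule integrable_gaussian) simp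
  have [measurable]: "\<kappa> \<in> borel_measurable borel" using i by simp
  have \<kappa>p: "\<kappa> z > 0" for z by (simp add: \<kappa>_def)
  define \<kappa>1 where "\<kappa>1 = (LINT z|lborel. \<kappa> z)"
  have \<kappa>1: "\<kappa>1 > 0"
  proof -
    have "\<kappa>1 \<noteq> 0"
    proof
      assume "\<kappa>1 = 0"
      then have "AE z in lborel. \<kappa> z = 0"
        using integral_nonneg_eq_0_iff_AE[OF i] \<kappa>p by (simp add: \<kappa>1_def less_imp_le)
      then have "AE z in (lborel :: (real^'n) measure). False" by eventually_elim (use \<kappa>p in \<open>simp add: less_le\<close>)
      then have "ae_filter (lborel :: (real^'n) measure) = bot" by (simp only: eventually_False)
      then show False by (simp add: ae_filter_eq_bot_iff)
    qed
    moreover have "\<kappa>1 \<ge> 0" unfolding \<kappa>1_def using \<kappa>p by (intro Bochner_Integration.integral_nonneg) (simp add: less_imp_le)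
    ultimately show ?thesis by simp
  qed
  define \<gamma> where "\<gamma> = density lborel (\<lambda>z. ennreal (\<kappa> z / \<kappa>1))"
  have nn: "\<kappa> z / \<kappa>1 \<ge> 0" for z using \<kappa>p[of z] \<kappa>1 by simp
  have "finite_borel_ac_measure \<gamma>"
    unfolding \<gamma>_def by (rule finite_borel_ac_density) (use i nn in auto)
  moreover have "(LINT z|\<gamma>. cis (\<zeta> \<bullet> z)) = of_real (exp (- (1/2) * (\<zeta> \<bullet> \<zeta>)))" for \<zeta>
  proof -
    have m: "(\<lambda>z. cis (\<zeta> \<bullet> z)) \<in> borel_measurable borel"
      unfolding cis_conv_exp by (intro borel_measurable_continuous_onI continuous_intros)
    have "(LINT z|\<gamma>. cis (\<zeta> \<bullet> z)) = (LINT z|lborel. (\<kappa> z / \<kappa>1) *\<^sub>R cis (\<zeta> \<bullet> z))"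
      unfolding \<gamma>_def by (rule integral_density) (use m nn in auto)
    also have "\<dots> = (LINT z|lborel. (cis (\<zeta> \<bullet> z) * of_real (\<kappa> z)) / of_real \<kappa>1)"
      by (simp add: scaleR_conv_of_real mult.commute)
    also have "\<dots> = (LINT z|lborel. cis (\<zeta> \<bullet> z) * of_real (\<kappa> z)) / of_real \<kappa>1"
      by (rule integral_divide_zero)
    also have "(LINT z|lborel. cis (\<zeta> \<bullet> z) * of_real (\<kappa> z)) = of_real (exp (- (1/2) * (\<zeta> \<bullet> \<zeta>)) * \<kappa>1)"
      using gaussian_fourier[of "mat 1" "mat 1" 1 \<zeta>] by (simp add: \<kappa>_def[abs_def] \<kappa>1_def power2_norm_eq_inner transpose_mat)
    finally show ?thesis using \<kappa>1 by simp
  qed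
  ultimately show ?thesis by blast
qed

context ornstein_uhlenbeck
begin

text \<open>Up to the factor \<open>exp (\<eta> \<bullet> \<eta> / 2)\<close>, the shifted polynomial on the left is the Gaussian average
  of \<open>g (E \<tau> x + A z) * cis (\<eta> \<bullet> z)\<close> over \<open>z\<close>, where \<open>A\<close> is the square root of \<open>Qt \<tau>\<close>.\<close>

lemma shift_estimate:
  assumes \<tau>: "\<tau> \<ge> 0" and \<eta>: "matsqrt (Qt \<tau>) *v \<eta> = E \<tau> *v y"
  shows "(LINT x|\<rho>. (cmod (\<Sum>\<xi>\<in>F. c \<xi> * of_real (ev_coeff \<xi> \<tau> * exp (- (freq \<tau> \<xi> \<bullet> y))) * cis (freq \<tau> \<xi> \<bullet> x)))\<^sup>2)
    \<le> exp (\<eta> \<bullet> \<eta>) * (LINT x|\<rho>. (cmod (\<Sum>\<xi>\<in>F. c \<xi> * cis (\<xi> \<bullet> x)))\<^sup>2)"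
proof -
  obtain \<gamma> :: "(real^'n) measure" where "finite_borel_ac_measure \<gamma>"
    and \<gamma>: "\<And>\<zeta>. (LINT z|\<gamma>. cis (\<zeta> \<bullet> z)) = of_real (exp (- (1/2) * (\<zeta> \<bullet> \<zeta>)))"
    using standard_gaussian by blast
  interpret \<gamma>: finite_borel_ac_measure \<gamma> by fact
  have \<gamma>1: "measure \<gamma> (space \<gamma>) = 1"
  proof -
    have "complex_of_real (measure \<gamma> (space \<gamma>)) = 1" using \<gamma>[of 0] by (simp add: scaleR_conv_of_real)
    then show ?thesis by simp
  qed
  define A where "A = matsqrt (Qt \<tau>)"
  have Asym: "transpose A = A" and AA: "(norm (A *v \<xi>))\<^sup>2 = (Qt \<tau> *v \<xi>) \<bullet> \<xi>" for \<xi>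
    using matsqrt_properties(1)[OF Qt_psd[OF \<tau>]] norm_matsqrt[OF Qt_psd[OF \<tau>]] by (auto simp: A_def symmetric_psd_def)
  have Ay: "freq \<tau> \<xi> \<bullet> y = (A *v \<xi>) \<bullet> \<eta>" for \<xi>
    by (simp only: freq_inner \<eta>[symmetric] A_def[symmetric] symmetric_inner[OF Asym])
  have ev: "ev_coeff \<xi> \<tau> = exp (- (1/2) * (norm (A *v \<xi>))\<^sup>2)" for \<xi>
    unfolding ev_coeff_def AA Qt_form[OF \<tau>] ..
  define U where "U x = (\<Sum>\<xi>\<in>F. c \<xi> * of_real (ev_coeff \<xi> \<tau> * exp (- (freq \<tau> \<xi> \<bullet> y))) * cis (freq \<tau> \<xi> \<bullet> x))" for x
  define d where "d x \<xi> = c \<xi> * cis (freq \<tau> \<xi> \<bullet> x)" for x \<xi>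
  define f where "f x z = (\<Sum>\<xi>\<in>F. d x \<xi> * cis ((A *v \<xi> + \<eta>) \<bullet> z))" for x z
  define J where "J x = (LINT z|\<gamma>. (cmod (f x z))\<^sup>2)" for x
  have gm [measurable]: "(\<lambda>x. cis (\<theta> \<bullet> x)) \<in> borel_measurable borel" for \<theta> :: "real^'n" by (rule cis_measurable)
  have fm: "f x \<in> borel_measurable borel" for x unfolding f_def by measurable
  have fb: "cmod (f x z) \<le> (\<Sum>\<xi>\<in>F. cmod (c \<xi>))" for x z
    unfolding f_def by (rule order_trans[OF norm_sum]) (simp add: norm_mult d_def)
  \<comment> \<open>Completing the square: - |A \<xi>|^2 / 2 - A \<xi> \<bullet> \<eta> = |\<eta>|^2
    / 2 - |A \<xi> + \<eta>|^2 / 2. The shift by y becomes a common shift of the Gaussian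
    frequencies, that is, a pure phase.\<close>
  have Uf: "U x = of_real (exp (1/2 * (\<eta> \<bullet> \<eta>))) * (LINT z|\<gamma>. f x z)" for x
  proof -
    have "(LINT z|\<gamma>. f x z) = (\<Sum>\<xi>\<in>F. d x \<xi> * of_real (exp (- (1/2) * ((A *v \<xi> + \<eta>) \<bullet> (A *v \<xi> + \<eta>)))))"
      unfolding f_def \<gamma>[symmetric] by (simp add: Bochner_Integration.integral_sum \<gamma>.integrable_cis)
    moreover have "ev_coeff \<xi> \<tau> * exp (- (freq \<tau> \<xi> \<bullet> y)) = exp (1/2 * (\<eta> \<bullet> \<eta>)) * exp (- (1/2) * ((A *v \<xi> + \<eta>) \<bullet> (A *v \<xi> + \<eta>)))" for \<xi>
    proof -
      have "- (1/2) * (norm (A *v \<xi>))\<^sup>2 + - ((A *v \<xi>) \<bullet> \<eta>) = 1/2 * (\<eta> \<bullet> \<eta>) + - (1/2) * ((A *v \<xi> + \<eta>) \<bullet> (A *v \<xi> + \<eta>))"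
        by (simp add: power2_norm_eq_inner inner_add_left inner_add_right inner_commute[of \<eta> "A *v \<xi>"] algebra_simps)
      then show ?thesis unfolding ev Ay exp_add[symmetric] by (simp only:)
    qed
    ultimately show ?thesis unfolding U_def d_def by (simp only: sum_distrib_left of_real_mult mult_ac)
  qed
  \<comment> \<open>In |f|^2 only differences of frequencies occur, so \<eta> cancels: J is the
    transition average of the squared modulus of the unshifted polynomial.\<close>
  have J_expand: "complex_of_real (J x) = (\<Sum>\<xi>\<in>F. \<Sum>\<zeta>\<in>F. c \<xi> * cnj (c \<zeta>) * of_real (exp (- (1/2) * ((Qt \<tau> *v (\<xi> - \<zeta>)) \<bullet> (\<xi> - \<zeta>)))) * cis (freq \<tau> (\<xi> - \<zeta>) \<bullet> x))" for x
  proof -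
    have "complex_of_real (J x) = (\<Sum>\<xi>\<in>F. \<Sum>\<zeta>\<in>F. d x \<xi> * cnj (d x \<zeta>) * of_real (exp (- (1/2) * ((A *v (\<xi> - \<zeta>)) \<bullet> (A *v (\<xi> - \<zeta>))))))"
      unfolding J_def f_def \<gamma>.trig_square_integral \<gamma> by (simp add: matrix_vector_mult_diff_distrib)
    also have "\<dots> = (\<Sum>\<xi>\<in>F. \<Sum>\<zeta>\<in>F. c \<xi> * cnj (c \<zeta>) * of_real (exp (- (1/2) * ((Qt \<tau> *v (\<xi> - \<zeta>)) \<bullet> (\<xi> - \<zeta>)))) * cis (freq \<tau> (\<xi> - \<zeta>) \<bullet> x))"
    proof (intro sum.cong refl)
      fix \<xi> \<zeta>
      have "d x \<xi> * cnj (d x \<zeta>) = c \<xi> * cnj (c \<zeta>) * cis (freq \<tau> (\<xi> - \<zeta>) \<bullet> x)"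
        unfolding freq_diff inner_diff_left cis_mult_cnj[symmetric] d_def complex_cnj_mult by (simp only: mult_ac)
      then show "d x \<xi> * cnj (d x \<zeta>) * of_real (exp (- (1/2) * ((A *v (\<xi> - \<zeta>)) \<bullet> (A *v (\<xi> - \<zeta>)))))
          = c \<xi> * cnj (c \<zeta>) * of_real (exp (- (1/2) * ((Qt \<tau> *v (\<xi> - \<zeta>)) \<bullet> (\<xi> - \<zeta>)))) * cis (freq \<tau> (\<xi> - \<zeta>) \<bullet> x)"
        unfolding AA[symmetric] power2_norm_eq_inner by (simp only: mult_ac)
    qed
    finally show ?thesis .
  qed
  have Jm: "J \<in> borel_measurable borel"
  proof -
    have "J = (\<lambda>x. Re (complex_of_real (J x)))" by simp
    then show ?thesis unfolding J_expand by (simp only:) measurable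
  qed
  have "complex_of_real (LINT x|\<rho>. J x) = (LINT x|\<rho>. complex_of_real (J x))" by (rule integral_complex_of_real[symmetric])
  also have "\<dots> = (\<Sum>\<xi>\<in>F. \<Sum>\<zeta>\<in>F. c \<xi> * cnj (c \<zeta>) * of_real (exp (- (1/2) * ((Qt \<tau> *v (\<xi> - \<zeta>)) \<bullet> (\<xi> - \<zeta>)))) * (LINT x|\<rho>. cis (freq \<tau> (\<xi> - \<zeta>) \<bullet> x)))"
    unfolding J_expand by (simp add: Bochner_Integration.integral_sum Bochner_Integration.integrable_sum ac.integrable_cis)
  \<comment> \<open>Invariance of \<rho>, checked on exponentials: the damping by
    \<open>Qt \<tau>\<close> times the Fourier transform of \<rho> at the transported frequency is
    its Fourier transform at the original one.\<close>
  also have "\<dots> = (\<Sum>\<xi>\<in>F. \<Sum>\<zeta>\<in>F. c \<xi> * cnj (c \<zeta>) * (LINT x|\<rho>. cis ((\<xi> - \<zeta>) \<bullet> x)))"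
  proof (intro sum.cong refl)
    fix \<xi> \<zeta> :: "real^'n"
    define v where "v = \<xi> - \<zeta>"
    have "(Qt \<tau> *v v) \<bullet> v + (Qinf *v freq \<tau> v) \<bullet> freq \<tau> v = (Qinf *v v) \<bullet> v"
      unfolding Qt_def freq_def by (simp add: matrix_vector_mult_diff_rdistrib inner_diff_left E_Qinf_form del: transpose_matrix_vector)
    then have "exp (- (1/2) * ((Qt \<tau> *v v) \<bullet> v)) * (mass * exp (- (1/2) * ((Qinf *v freq \<tau> v) \<bullet> freq \<tau> v))) = mass * exp (- (1/2) * ((Qinf *v v) \<bullet> v))"
      by (simp add: exp_add[symmetric] algebra_simps)
    then show "c \<xi> * cnj (c \<zeta>) * of_real (exp (- (1/2) * ((Qt \<tau> *v (\<xi> - \<zeta>)) \<bullet> (\<xi> - \<zeta>)))) * (LINT x|\<rho>. cis (freq \<tau> (\<xi> - \<zeta>) \<bullet> x))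
        = c \<xi> * cnj (c \<zeta>) * (LINT x|\<rho>. cis ((\<xi> - \<zeta>) \<bullet> x))"
      unfolding \<rho>_fourier v_def[symmetric] mult.assoc of_real_mult[symmetric] by (simp only:)
  qed
  also have "\<dots> = complex_of_real (LINT x|\<rho>. (cmod (\<Sum>\<xi>\<in>F. c \<xi> * cis (\<xi> \<bullet> x)))\<^sup>2)"
    by (rule ac.trig_square_integral[symmetric])
  finally have Jint: "(LINT x|\<rho>. J x) = (LINT x|\<rho>. (cmod (\<Sum>\<xi>\<in>F. c \<xi> * cis (\<xi> \<bullet> x)))\<^sup>2)"
    by (simp only: of_real_eq_iff)
  have UJ: "(cmod (U x))\<^sup>2 \<le> exp (\<eta> \<bullet> \<eta>) * J x" for x
  proof -
    have "(cmod (U x))\<^sup>2 = exp (\<eta> \<bullet> \<eta>) * (cmod (LINT z|\<gamma>. f x z))\<^sup>2"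
      unfolding Uf by (simp add: norm_mult power_mult_distrib exp_double[symmetric])
    also have "\<dots> \<le> exp (\<eta> \<bullet> \<eta>) * J x"
      unfolding J_def by (intro mult_left_mono \<gamma>.square_integral_le[OF \<gamma>1 fm fb]) auto
    finally show ?thesis .
  qed
  have Jb: "norm (J x) \<le> (\<Sum>\<xi>\<in>F. cmod (c \<xi>))\<^sup>2" for x
  proof -
    have "J x \<le> (LINT z|\<gamma>. (\<Sum>\<xi>\<in>F. cmod (c \<xi>))\<^sup>2)"
      unfolding J_def
    proof (rule integral_mono)
      show "integrable \<gamma> (\<lambda>z. (cmod (f x z))\<^sup>2)"
        by (rule \<gamma>.integrable_bounded[of _ "(\<Sum>\<xi>\<in>F. cmod (c \<xi>))\<^sup>2"]) (use fm fb in \<open>auto intro!: power_mono\<close>)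
    qed (use fb in \<open>auto intro!: power_mono\<close>)
    then show ?thesis using \<gamma>1 by (simp add: J_def)
  qed
  have "(LINT x|\<rho>. (cmod (U x))\<^sup>2) \<le> (LINT x|\<rho>. exp (\<eta> \<bullet> \<eta>) * J x)"
  proof (rule integral_mono)
    have Um: "U \<in> borel_measurable borel" unfolding U_def[abs_def] by measurable
    show "integrable \<rho> (\<lambda>x. exp (\<eta> \<bullet> \<eta>) * J x)" using ac.integrable_bounded[OF Jm Jb] by simp
    then show "integrable \<rho> (\<lambda>x. (cmod (U x))\<^sup>2)"
      by (rule Bochner_Integration.integrable_bound) (use Um UJ in \<open>auto intro!: AE_I2 order_trans[OF UJ] simp: measurable_cong_sets[OF sets_\<rho> refl]\<close>)
  qed (rule UJ)
  then show ?thesis by (simp add: Jint U_def)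
qed

text \<open>The lower bound for \<open>Qt \<tau>\<close> makes its square root invertible, with an
  inverse of squared norm at most 1 / (c \<tau>^m); this is the source of the factor exp (D /
  \<tau>^m). The matrix \<open>E \<tau>\<close> contributes only a constant, since it is
  bounded.\<close>

lemma shift_vector:
  assumes T: "T > 0"
  shows "\<exists>D\<ge>0. \<forall>\<tau> y. 0 < \<tau> \<longrightarrow> \<tau> \<le> T \<longrightarrow>
    (\<exists>\<eta>. matsqrt (Qt \<tau>) *v \<eta> = E \<tau> *v y \<and> \<eta> \<bullet> \<eta> \<le> D / \<tau> ^ (2 * CARD('n) - 1) * (norm y)\<^sup>2)"
proof -
  obtain c where c: "c > 0" "\<And>t \<xi>. 0 < t \<Longrightarrow> t \<le> T \<Longrightarrow> c * t ^ (2 * CARD('n) - 1) * (norm \<xi>)\<^sup>2 \<le> (Qt t *v \<xi>) \<bullet> \<xi>"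
    using Qt_lower_bound[OF T] by blast
  obtain k where k: "k > 0" "\<And>(A :: real^'n^'n) x. norm (A *v x) \<le> norm A * norm x * k"
    using bounded_bilinear.pos_bounded[OF bounded_bilinear_matrix_vector_mult] by (elim exE conjE) blast
  obtain c' C where C: "c' > 0" "C > 0" "\<And>s. s \<ge> 0 \<Longrightarrow> norm (E s) \<le> C * exp (- c' * s)" using E_decay by blast
  have Ey: "norm (E \<tau> *v y) \<le> C * k * norm y" if "\<tau> > 0" for \<tau> y
  proof -
    have "norm (E \<tau>) \<le> C * exp (- c' * \<tau>)" using C(3) that by simp
    also have "\<dots> \<le> C * 1" using C(1,2) that by (intro mult_left_mono) auto
    finally have "norm (E \<tau>) \<le> C" by simp
    then have "norm (E \<tau>) * norm y * k \<le> C * norm y * k" using k(1) by (intro mult_right_mono) auto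
    then show ?thesis using k(2)[of "E \<tau>" y] by (simp add: mult_ac)
  qed
  define D where "D = (C * k)\<^sup>2 / c"
  have "\<exists>\<eta>. matsqrt (Qt \<tau>) *v \<eta> = E \<tau> *v y \<and> \<eta> \<bullet> \<eta> \<le> D / \<tau> ^ (2 * CARD('n) - 1) * (norm y)\<^sup>2"
    if \<tau>: "0 < \<tau>" "\<tau> \<le> T" for \<tau> y
  proof -
    define A where "A = matsqrt (Qt \<tau>)"
    have lower: "c * \<tau> ^ (2 * CARD('n) - 1) * (norm \<xi>)\<^sup>2 \<le> (norm (A *v \<xi>))\<^sup>2" for \<xi>
      unfolding A_def norm_matsqrt[OF Qt_psd[OF less_imp_le[OF \<tau>(1)]]] by (rule c(2)[OF \<tau>])
    have ctp: "c * \<tau> ^ (2 * CARD('n) - 1) > 0" using c(1) \<tau>(1) by simp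
    have "\<xi> = 0" if "A *v \<xi> = 0" for \<xi>
    proof -
      have "c * \<tau> ^ (2 * CARD('n) - 1) * (norm \<xi>)\<^sup>2 \<le> 0" using lower[of \<xi>] that by simp
      then have "(norm \<xi>)\<^sup>2 \<le> 0"
        using mult_le_cancel_left_pos[OF ctp, of "(norm \<xi>)\<^sup>2" 0] by (simp only: mult_zero_right)
      then show ?thesis by simp
    qed
    then have "\<exists>A'. A' ** A = mat 1" using matrix_left_invertible_ker[of A] by blast
    then obtain A' where A': "A' ** A = mat 1" by blast
    then have "A ** A' = mat 1" by (simp only: matrix_left_right_inverse)
    then have e: "A *v (A' *v z) = z" for z by (simp only: matrix_vector_mul_assoc matrix_vector_mul_lid)
    define \<eta> where "\<eta> = A' *v (E \<tau> *v y)"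
    have "c * \<tau> ^ (2 * CARD('n) - 1) * (norm \<eta>)\<^sup>2 \<le> (norm (E \<tau> *v y))\<^sup>2" using lower[of \<eta>] e by (simp only: \<eta>_def)
    also have "\<dots> \<le> (C * k * norm y)\<^sup>2" by (rule power_mono[OF Ey[OF \<tau>(1)]]) simp
    finally have "(norm \<eta>)\<^sup>2 \<le> D / \<tau> ^ (2 * CARD('n) - 1) * (norm y)\<^sup>2"
      using c(1) \<tau>(1) by (simp add: D_def field_simps power_mult_distrib)
    then show ?thesis using e by (intro exI[of _ \<eta>]) (simp add: \<eta>_def A_def power2_norm_eq_inner)
  qed
  moreover have "D \<ge> 0" using c(1) by (simp add: D_def)
  ultimately show ?thesis by blast
qed

end

section \<open>Contractivity of the semigroup\<close>

context ornstein_uhlenbeck_semigroup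
begin

lemma S_trig_poly_L2_norm:
  assumes t: "0 \<le> t" and F: "finite F"
  shows "L2_norm \<rho> (S t (\<lambda>x. \<Sum>\<xi>\<in>F. c \<xi> * cis (\<xi> \<bullet> x))) = L2_norm \<rho> (\<lambda>x. \<Sum>\<xi>\<in>F. c \<xi> * ev \<xi> t x)"
  by (intro L2_norm_cong_AE S_trig_poly assms L2_funD(1)[of _ \<rho>] S_L2[OF t] L2_fun_sum L2_fun_cmult ev_L2 cis_L2)

text \<open>For trigonometric polynomials this is \<open>shift_estimate\<close> with both shifts
  equal to 0; density and the boundedness of \<open>S t\<close> extend it.\<close>

lemma contraction:
  assumes t: "0 \<le> t" and g: "g \<in> L2_fun \<rho>"
  shows "L2_norm \<rho> (S t g) \<le> L2_norm \<rho> g"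
proof -
  have trig: "L2_norm \<rho> (S t p) \<le> L2_norm \<rho> p" if pt: "p \<in> trig_polys" for p
  proof -
    obtain F c where F: "finite F" and p: "p = (\<lambda>x. \<Sum>\<xi>\<in>F. c \<xi> * cis (\<xi> \<bullet> x))" using pt unfolding trig_polys_def by (elim CollectE exE conjE)
    have "(L2_norm \<rho> (S t p))\<^sup>2 \<le> (L2_norm \<rho> p)\<^sup>2"
      unfolding p S_trig_poly_L2_norm[OF t F] L2_norm_power2
      using shift_estimate[OF t, of 0 0 c F] by (simp add: ev_def mult.assoc)
    then show ?thesis by (rule power2_le_imp_le) (rule L2_norm_nonneg)
  qed
  obtain K where K: "K \<ge> 0" "\<And>f. f \<in> L2_fun \<rho> \<Longrightarrow> L2_norm \<rho> (S t f) \<le> K * L2_norm \<rho> f"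
    using L2_bounded_operatorD(3)[OF S_operator[OF t]] by blast
  show ?thesis
  proof (rule field_le_epsilon)
    fix e :: real assume "e > 0"
    then have "e / (K + 1) > 0" using K(1) by simp
    then obtain p where p: "p \<in> trig_polys" "L2_norm \<rho> (\<lambda>x. g x - p x) < e / (K + 1)"
      using ac.trig_polys_dense[OF g] unfolding trig_approximable_def by blast
    have pL: "p \<in> L2_fun \<rho>" by (rule ac.trig_poly_L2[OF p(1)])
    have "L2_norm \<rho> (S t g) \<le> L2_norm \<rho> (S t p) + L2_norm \<rho> (\<lambda>x. S t g x - S t p x)"
      by (intro L2_norm_le_add_diff S_L2 t g pL)
    also have "L2_norm \<rho> (\<lambda>x. S t g x - S t p x) \<le> K * L2_norm \<rho> (\<lambda>x. g x - p x)"
      unfolding L2_operator_norm_diff[OF S_operator[OF t] g pL] by (intro K(2) L2_fun_diff g pL)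
    also have "L2_norm \<rho> (S t p) \<le> L2_norm \<rho> p" by (rule trig[OF p(1)])
    also have "L2_norm \<rho> p \<le> L2_norm \<rho> g + L2_norm \<rho> (\<lambda>x. g x - p x)"
      using L2_norm_le_add_diff[OF pL g] by (simp add: L2_norm_minus_commute[of \<rho> g p])
    finally have "L2_norm \<rho> (S t g) \<le> L2_norm \<rho> g + (K + 1) * L2_norm \<rho> (\<lambda>x. g x - p x)" by (simp add: algebra_simps)
    also have "(K + 1) * L2_norm \<rho> (\<lambda>x. g x - p x) \<le> e" using p(2) K(1) by (simp add: field_simps)
    finally show "L2_norm \<rho> (S t g) \<le> L2_norm \<rho> g + e" by simp
  qed
qed

end

section \<open>Propagation of smallness for entire functions on an interval\<close>

text \<open>The denominator of the Lagrange weight at the j-th of N equally spaced nodes, up to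
  scaling.\<close>

lemma prod_abs_diff_eq_fact:
  assumes "j < N"
  shows "(\<Prod>i\<in>{..<N} - {j}. \<bar>real j - real i\<bar>) = fact j * fact (N - 1 - j)"
proof -
  have split: "{..<N} - {j} = {..<j} \<union> {Suc j..<N}" using assms by auto
  have "(\<Prod>i\<in>{..<N} - {j}. \<bar>real j - real i\<bar>) = (\<Prod>i\<in>{..<j}. \<bar>real j - real i\<bar>) * (\<Prod>i\<in>{Suc j..<N}. \<bar>real j - real i\<bar>)"
    unfolding split by (rule prod.union_disjoint) auto
  also have "(\<Prod>i\<in>{..<j}. \<bar>real j - real i\<bar>) = (\<Prod>i\<in>{1..j}. real i)"
    by (rule prod.reindex_bij_witness[of _ "\<lambda>i. j - i" "\<lambda>i. j - i"]) auto
  also have "\<dots> = fact j" by (simp add: fact_prod)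
  also have "(\<Prod>i\<in>{Suc j..<N}. \<bar>real j - real i\<bar>) = (\<Prod>i\<in>{1..N - 1 - j}. real i)"
    by (rule prod.reindex_bij_witness[of _ "\<lambda>i. j + i" "\<lambda>i. i - j"]) auto
  also have "\<dots> = fact (N - 1 - j)" by (simp add: fact_prod)
  finally show ?thesis .
qed

lemma power_div_fact_le_exp:
  assumes "(x::real) \<ge> 0"
  shows "x ^ n / fact n \<le> exp x"
proof -
  have "sum (\<lambda>n. x ^ n /\<^sub>R fact n) {n} \<le> (\<Sum>n. x ^ n /\<^sub>R fact n)"
  proof (rule sum_le_suminf)
    show "summable (\<lambda>n. x ^ n /\<^sub>R fact n)" by (rule summable_exp_generic)
  qed (use assms in auto)
  also have "\<dots> = exp x" by (simp add: exp_def)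
  finally have "sum (\<lambda>n. x ^ n /\<^sub>R fact n) {n} \<le> exp x" .
  then show ?thesis by (simp add: divide_inverse mult.commute)
qed

lemma sum_inverse_fact_fact:
  "(\<Sum>j\<le>n. 1 / (fact j * fact (n - j))) = (2 ^ n / fact n :: real)"
proof -
  have "(\<Sum>j\<le>n. 1 / (fact j * fact (n - j))) = (\<Sum>j\<le>n. real (n choose j) / fact n)"
    by (intro sum.cong refl) (simp add: binomial_fact)
  also have "\<dots> = real (\<Sum>j\<le>n. n choose j) / fact n" by (simp add: sum_divide_distrib)
  finally show ?thesis by (simp add: choose_row_sum)
qed

text \<open>Lagrange extrapolation from the nodes \<open>l (j+1) / N\<close> in \<open>(0, l]\<close> to the point 1.\<close>

lemma extrapolation_weights:
  fixes l :: real
  assumes N: "N \<ge> 1" and l: "0 < l" "l \<le> 1"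
  obtains w :: "nat \<Rightarrow> real"
  where "\<And>p :: complex poly. degree p < N \<Longrightarrow>
      poly p 1 = (\<Sum>j<N. of_real (w j) * poly p (of_real (l * real (Suc j) / real N)))"
    and "(\<Sum>j<N. \<bar>w j\<bar>) \<le> (6 / l) ^ N"
proof -
  define t where "t j = l * real (Suc j) / real N" for j
  have t: "0 < t j" "t j \<le> 1" if "j < N" for j
  proof -
    show "0 < t j" using N l by (simp add: t_def)
    have "real (Suc j) / real N \<le> 1" using that by simp
    then have "l * (real (Suc j) / real N) \<le> 1 * 1" using l by (intro mult_mono) auto
    then show "t j \<le> 1" by (simp add: t_def)
  qed
  have td: "t j - t i = l / real N * (real j - real i)" for i j
    using N by (simp add: t_def field_simps)
  have tinj: "t i = t j \<longleftrightarrow> i = j" for i j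
    using td[of j i] l N by auto
  define w where "w j = (\<Prod>i\<in>{..<N} - {j}. (1 - t i) / (t j - t i))" for j
  have exact: "poly p 1 = (\<Sum>j<N. of_real (w j) * poly p (of_real (t j)))" if dp: "degree p < N" for p :: "complex poly"
  proof -
    define b :: "nat \<Rightarrow> complex poly" where
      "b j = (\<Prod>i\<in>{..<N} - {j}. smult (of_real (1 / (t j - t i))) [:- of_real (t i), 1:])" for j
    have pb: "poly (b j) (of_real x) = of_real (\<Prod>i\<in>{..<N} - {j}. (x - t i) / (t j - t i))" for j x
      unfolding b_def poly_prod by (simp add: of_real_prod diff_divide_distrib)
    have db: "degree (b j) \<le> N - 1" if "j < N" for j
    proof -
      have "degree (b j) \<le> (\<Sum>i\<in>{..<N} - {j}. degree (smult (of_real (1 / (t j - t i))) [:- of_real (t i), 1 :: complex:]))"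
        unfolding b_def
        using degree_prod_sum_le[of "{..<N} - {j}" "\<lambda>i. smult (of_real (1 / (t j - t i))) [:- of_real (t i), 1 :: complex:]"]
        by (simp only: o_def finite_Diff finite_lessThan)
      also have "\<dots> \<le> (\<Sum>i\<in>{..<N} - {j}. 1)" by (intro sum_mono) (auto intro: order_trans[OF degree_smult_le])
      also have "\<dots> = N - 1" using that by simp
      finally show ?thesis .
    qed
    define q where "q = (\<Sum>j<N. smult (poly p (of_real (t j))) (b j))"
    have "degree q \<le> N - 1" unfolding q_def
      using db by (intro degree_sum_le) (auto intro!: order_trans[OF degree_smult_le])
    then have dr: "degree (p - q) < N" using dp N by (intro degree_diff_less) auto
    have root: "poly (p - q) (of_real (t k)) = 0" if k: "k < N" for k
    proof -
      have bk: "poly (b j) (of_real (t k)) = (if j = k then 1 else 0)" if "j < N" for j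
      proof (cases "j = k")
        case True
        have "(\<Prod>i\<in>{..<N} - {j}. (t j - t i) / (t j - t i)) = (\<Prod>i\<in>{..<N} - {j}. 1)"
          by (intro prod.cong) (auto simp: tinj)
        then show ?thesis using True by (simp add: pb)
      next
        case False
        then have "(\<Prod>i\<in>{..<N} - {j}. (t k - t i) / (t j - t i)) = 0" using k by (intro prod_zero) (auto intro!: bexI[of _ k])
        then show ?thesis using False by (simp add: pb)
      qed
      have "poly q (of_real (t k)) = (\<Sum>j<N. if j = k then poly p (of_real (t j)) else 0)"
        unfolding q_def poly_sum by (intro sum.cong) (auto simp: bk)
      also have "\<dots> = poly p (of_real (t k))" using k by simp
      finally show ?thesis by simp
    qed
    have "p - q = 0"
    proof (rule ccontr)
      assume nz: "p - q \<noteq> 0"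
      have "(\<lambda>k. complex_of_real (t k)) ` {..<N} \<subseteq> {x. poly (p - q) x = 0}" using root by auto
      then have "card ((\<lambda>k. complex_of_real (t k)) ` {..<N}) \<le> card {x. poly (p - q) x = 0}"
        by (intro card_mono poly_roots_finite nz)
      also have "\<dots> \<le> degree (p - q)" by (rule card_poly_roots_bound[OF nz])
      finally show False using dr by (subst (asm) card_image) (auto simp: inj_on_def tinj)
    qed
    then have "poly p 1 = poly q (of_real 1)" by simp
    also have "\<dots> = (\<Sum>j<N. of_real (w j) * poly p (of_real (t j)))"
      unfolding q_def poly_sum poly_smult pb w_def by (simp add: mult.commute)
    finally show ?thesis .
  qed
  have wb: "\<bar>w j\<bar> \<le> (real N / l) ^ (N - 1) * (1 / (fact j * fact (N - 1 - j)))" if j: "j < N" for j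
  proof -
    have "\<bar>w j\<bar> = (\<Prod>i\<in>{..<N} - {j}. \<bar>(1 - t i) / (t j - t i)\<bar>)" by (simp add: w_def abs_prod)
    also have "\<dots> \<le> (\<Prod>i\<in>{..<N} - {j}. (real N / l) * (1 / \<bar>real j - real i\<bar>))"
    proof (intro prod_mono conjI)
      fix i assume i: "i \<in> {..<N} - {j}"
      then have "\<bar>1 - t i\<bar> \<le> 1" using t[of i] by auto
      then have "\<bar>1 - t i\<bar> / \<bar>t j - t i\<bar> \<le> 1 / \<bar>t j - t i\<bar>" by (intro divide_right_mono) auto
      also have "\<dots> = (real N / l) * (1 / \<bar>real j - real i\<bar>)" using l N by (simp add: td abs_mult)
      finally show "\<bar>(1 - t i) / (t j - t i)\<bar> \<le> (real N / l) * (1 / \<bar>real j - real i\<bar>)" by (simp add: abs_divide)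
    qed auto
    also have "\<dots> = (real N / l) ^ (N - 1) * (1 / (\<Prod>i\<in>{..<N} - {j}. \<bar>real j - real i\<bar>))"
      using j by (simp only: prod.distrib prod_constant prod_dividef) simp
    finally show ?thesis unfolding prod_abs_diff_eq_fact[OF j] .
  qed
  have "(\<Sum>j<N. \<bar>w j\<bar>) \<le> (\<Sum>j<N. (real N / l) ^ (N - 1) * (1 / (fact j * fact (N - 1 - j))))"
    by (intro sum_mono wb) auto
  also have "\<dots> = (real N / l) ^ (N - 1) * (\<Sum>j<N. 1 / (fact j * fact (N - 1 - j)))" by (simp add: sum_distrib_left)
  also have setN: "{..<N} = {..N - 1}" using N by auto
  also have "(\<Sum>j\<le>N - 1. 1 / (fact j * fact (N - 1 - j))) = (2 ^ (N - 1) / fact (N - 1) :: real)" by (rule sum_inverse_fact_fact)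
  also have "(real N / l) ^ (N - 1) * (2 ^ (N - 1) / fact (N - 1)) = (2 / l) ^ (N - 1) * (real N ^ (N - 1) / fact (N - 1))"
    by (simp add: power_divide power_mult_distrib)
  also have "real N ^ (N - 1) / fact (N - 1) = real N ^ N / fact N"
  proof -
    obtain n where n: "N = Suc n" using N by (cases N) auto
    show ?thesis unfolding n diff_Suc_1 power_Suc fact_Suc
      by (rule mult_divide_mult_cancel_left[symmetric]) simp
  qed
  \<comment> \<open>The base 6 is 2 times 3: the 2 comes from the binomial sum over the nodes, the 3
    bounds exp 1 in N^N / N! <= exp N.\<close>
  also have "(2 / l) ^ (N - 1) * (real N ^ N / fact N) \<le> (2 / l) ^ N * 3 ^ N"
  proof (intro mult_mono)
    show "(2 / l) ^ (N - 1) \<le> (2 / l) ^ N" using l by (intro power_increasing) auto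
    have "real N ^ N / fact N \<le> exp (real N)" by (rule power_div_fact_le_exp) simp
    also have "\<dots> = exp 1 ^ N" by (simp flip: exp_of_nat_mult)
    also have "\<dots> \<le> 3 ^ N" using exp_le by (intro power_mono) auto
    finally show "real N ^ N / fact N \<le> 3 ^ N" .
  qed (use l in auto)
  also have "\<dots> = (6 / l) ^ N" by (simp flip: power_mult_distrib)
  finally have "(\<Sum>j<N. \<bar>w j\<bar>) \<le> (6 / l) ^ N" unfolding setN .
  with exact show ?thesis using that[of w] unfolding t_def by blast
qed

section \<open>A Remez-type inequality for polynomials in mean square\<close>

lemma ennreal_mult3:
  "0 \<le> x \<Longrightarrow> 0 \<le> y \<Longrightarrow> 0 \<le> z \<Longrightarrow> ennreal (x * (y * z)) = ennreal x * (ennreal y * ennreal z)"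
  by (simp add: ennreal_mult)

text \<open>Contracting [a, b] towards c by the factor l stays in [a, b] by convexity and within l
  (b - a) <= r of c; the factor 1 / l is the Jacobian.\<close>

lemma nn_integral_interval_dilation:
  fixes f :: "real \<Rightarrow> ennreal"
  assumes [measurable]: "f \<in> borel_measurable borel" and l: "0 < l" "l \<le> 1" and c: "a \<le> c" "c \<le> b" and r: "l * (b - a) \<le> r"
  shows "(\<integral>\<^sup>+x\<in>{a..b}. f (c + l * (x - c)) \<partial>lborel) \<le> ennreal (1 / l) * (\<integral>\<^sup>+x\<in>{a..b} \<inter> {c - r..c + r}. f x \<partial>lborel)"
proof -
  define I where "I = {a..b} \<inter> {c - r..c + r}"
  have "(\<integral>\<^sup>+x. f x * indicator I x \<partial>lborel) = ennreal l * (\<integral>\<^sup>+x. f ((c - l * c) + l * x) * indicator I ((c - l * c) + l * x) \<partial>lborel)"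
    using l by (subst nn_integral_real_affine[where c = l and t = "c - l * c"]) (auto simp: I_def)
  moreover have "(\<integral>\<^sup>+x\<in>{a..b}. f (c + l * (x - c)) \<partial>lborel) \<le> (\<integral>\<^sup>+x. f ((c - l * c) + l * x) * indicator I ((c - l * c) + l * x) \<partial>lborel)"
  proof (intro nn_integral_mono)
    fix x :: real
    have e: "(c - l * c) + l * x = c + l * (x - c)" by (simp add: algebra_simps)
    have "c + l * (x - c) \<in> I" if "x \<in> {a..b}"
    proof -
      have x: "a \<le> x" "x \<le> b" using that by auto
      have "l * (x - c) \<le> l * (b - a)" "l * (c - x) \<le> l * (b - a)" using l c x by (auto intro!: mult_left_mono)
      moreover have "0 \<le> (1 - l) * (c - a) + l * (x - a)" "0 \<le> (1 - l) * (b - c) + l * (b - x)"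
        using l c x by (auto intro!: add_nonneg_nonneg)
      ultimately show ?thesis using r by (auto simp: I_def algebra_simps)
    qed
    then show "f (c + l * (x - c)) * indicator {a..b} x \<le> f ((c - l * c) + l * x) * indicator I ((c - l * c) + l * x)"
      unfolding e by (auto simp: indicator_def)
  qed
  then have "(\<integral>\<^sup>+x\<in>{a..b}. f (c + l * (x - c)) \<partial>lborel) \<le> ennreal (1 / l) * (ennreal l * (\<integral>\<^sup>+x. f ((c - l * c) + l * x) * indicator I ((c - l * c) + l * x) \<partial>lborel))"
    using l by (simp add: mult.assoc[symmetric] flip: ennreal_mult)
  ultimately show ?thesis by (simp add: I_def)
qed

text \<open>A Remez-type inequality: the restriction of \<open>p\<close> to each ray from \<open>c\<close> is extrapolated from the
  dilated points \<open>c + l (j+1)/N (x - c)\<close>, all of which lie in the small interval.\<close>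

lemma polynomial_remez:
  fixes p :: "complex poly"
  assumes p: "degree p < N" and ab: "a \<le> c" "c \<le> b" and l: "0 < l" "l \<le> 1" "l * (b - a) \<le> r"
  shows "(\<integral>\<^sup>+x\<in>{a..b}. ennreal ((cmod (poly p (of_real x)))\<^sup>2) \<partial>lborel)
    \<le> ennreal ((144 / l ^ 3) ^ N) * (\<integral>\<^sup>+x\<in>{a..b} \<inter> {c - r..c + r}. ennreal ((cmod (poly p (of_real x)))\<^sup>2) \<partial>lborel)"
proof -
  have N: "N \<ge> 1" using p by simp
  obtain w where w: "\<And>p :: complex poly. degree p < N \<Longrightarrow>
      poly p 1 = (\<Sum>j<N. of_real (w j) * poly p (of_real (l * real (Suc j) / real N)))"
    and wb: "(\<Sum>j<N. \<bar>w j\<bar>) \<le> (6 / l) ^ N"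
    using extrapolation_weights[OF N l(1,2)] by blast
  define t where "t j = l * real (Suc j) / real N" for j
  have t: "0 < t j" "t j \<le> l" "l / N \<le> t j" if "j < N" for j
  proof -
    show "0 < t j" using N l by (simp add: t_def)
    have "real (Suc j) / real N \<le> 1" using that by simp
    then have "l * (real (Suc j) / real N) \<le> l * 1" using l by (intro mult_left_mono) auto
    then show "t j \<le> l" by (simp add: t_def)
    show "l / N \<le> t j" using l N by (simp add: t_def field_simps)
  qed
  define F where "F x = ennreal ((cmod (poly p (of_real x)))\<^sup>2)" for x :: real
  have cont: "continuous_on UNIV (\<lambda>x. cmod (poly p (of_real x)))" for p by (intro continuous_intros)
  have [measurable]: "F \<in> borel_measurable borel" unfolding F_def[abs_def]
    using borel_measurable_continuous_onI[OF cont] by measurable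
  define I where "I = (\<integral>\<^sup>+x\<in>{a..b} \<inter> {c - r..c + r}. F x \<partial>lborel)"
  \<comment> \<open>The extrapolation formula, squared: the absolute weights add up to at most (6 /
    l)^N, hence the base 36 / l^2.\<close>
  have pt: "F x \<le> ennreal ((36 / l\<^sup>2) ^ N) * (\<Sum>j<N. F (c + t j * (x - c)))" for x :: real
  proof -
    define q where "q = pcompose p [:of_real c, of_real (x - c):]"
    have "degree q \<le> degree p * 1" unfolding q_def
      by (rule order_trans[OF degree_pcompose_le]) (intro mult_le_mono2, rule order_trans[OF degree_pCons_le], simp)
    then have "degree q < N" using p by simp
    from w[OF this] have eq: "poly p (of_real x) = (\<Sum>j<N. of_real (w j) * poly p (of_real (c + t j * (x - c))))"
      by (simp add: q_def poly_pcompose t_def algebra_simps)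
    define v where "v j = cmod (poly p (of_real (c + t j * (x - c))))" for j
    have "cmod (poly p (of_real x)) \<le> (\<Sum>j<N. \<bar>w j\<bar> * v j)"
      unfolding eq by (rule order_trans[OF norm_sum]) (simp add: norm_mult v_def)
    also have "\<dots> \<le> (\<Sum>j<N. \<bar>w j\<bar> * sqrt (\<Sum>j<N. (v j)\<^sup>2))"
    proof (intro sum_mono mult_left_mono)
      fix j assume "j \<in> {..<N}"
      then have "(v j)\<^sup>2 \<le> (\<Sum>j<N. (v j)\<^sup>2)" by (intro member_le_sum) auto
      then show "v j \<le> sqrt (\<Sum>j<N. (v j)\<^sup>2)" by (rule real_le_rsqrt)
    qed auto
    also have "\<dots> = (\<Sum>j<N. \<bar>w j\<bar>) * sqrt (\<Sum>j<N. (v j)\<^sup>2)" by (simp add: sum_distrib_right)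
    also have "\<dots> \<le> (6 / l) ^ N * sqrt (\<Sum>j<N. (v j)\<^sup>2)"
      using wb by (intro mult_right_mono) (auto intro: sum_nonneg)
    finally have "(cmod (poly p (of_real x)))\<^sup>2 \<le> ((6 / l) ^ N * sqrt (\<Sum>j<N. (v j)\<^sup>2))\<^sup>2" by (intro power_mono) auto
    also have "\<dots> = (36 / l\<^sup>2) ^ N * (\<Sum>j<N. (v j)\<^sup>2)"
    proof -
      have "((6 / l) ^ N)\<^sup>2 = (36 / l\<^sup>2) ^ N" by (simp add: power2_eq_square flip: power_mult_distrib)
      then show ?thesis by (simp add: power_mult_distrib[of "(6 / l) ^ N"] sum_nonneg)
    qed
    finally show ?thesis using l unfolding F_def v_def
      by (simp add: sum_ennreal sum_nonneg flip: ennreal_mult)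
  qed
  have "(\<integral>\<^sup>+x\<in>{a..b}. F x \<partial>lborel) \<le> (\<integral>\<^sup>+x. ennreal ((36 / l\<^sup>2) ^ N) * (\<Sum>j<N. F (c + t j * (x - c)) * indicator {a..b} x) \<partial>lborel)"
    using pt by (intro nn_integral_mono) (auto simp: indicator_def)
  also have "\<dots> = ennreal ((36 / l\<^sup>2) ^ N) * (\<Sum>j<N. \<integral>\<^sup>+x\<in>{a..b}. F (c + t j * (x - c)) \<partial>lborel)"
  proof -
    have m: "(\<lambda>x. \<Sum>j<N. F (c + t j * (x - c)) * indicator {a..b} x) \<in> borel_measurable lborel" by measurable
    have "(\<integral>\<^sup>+x. (\<Sum>j<N. F (c + t j * (x - c)) * indicator {a..b} x) \<partial>lborel) = (\<Sum>j<N. \<integral>\<^sup>+x\<in>{a..b}. F (c + t j * (x - c)) \<partial>lborel)"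
      by (intro nn_integral_sum) measurable
    then show ?thesis by (simp only: nn_integral_cmult[OF m])
  qed
  also have "\<dots> \<le> ennreal ((36 / l\<^sup>2) ^ N) * (\<Sum>j<N. ennreal (real N / l) * I)"
  proof (intro mult_left_mono sum_mono)
    fix j assume j: "j \<in> {..<N}"
    have "t j * (b - a) \<le> l * (b - a)" using t[of j] j ab by (intro mult_right_mono) auto
    then have "(\<integral>\<^sup>+x\<in>{a..b}. F (c + t j * (x - c)) \<partial>lborel) \<le> ennreal (1 / t j) * I"
      unfolding I_def using t[of j] j l ab by (intro nn_integral_interval_dilation) auto
    also have "\<dots> \<le> ennreal (real N / l) * I"
    proof (intro mult_right_mono ennreal_leI)
      have "1 / t j \<le> 1 / (l / N)" using t[of j] j l N by (intro divide_left_mono) auto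
      then show "1 / t j \<le> real N / l" by simp
    qed auto
    finally show "(\<integral>\<^sup>+x\<in>{a..b}. F (c + t j * (x - c)) \<partial>lborel) \<le> ennreal (real N / l) * I" .
  qed auto
  also have "\<dots> = ennreal ((36 / l\<^sup>2) ^ N * (real N * (real N / l))) * I"
  proof -
    have "ennreal ((36 / l\<^sup>2) ^ N * (real N * (real N / l))) = ennreal ((36 / l\<^sup>2) ^ N) * (ennreal (real N) * ennreal (real N / l))"
      by (rule ennreal_mult3) (use l in auto)
    then show ?thesis by (simp only: sum_constant card_lessThan ennreal_of_nat_eq_real_of_nat mult.assoc)
  qed
  \<comment> \<open>The polynomial loss N^2 / l, from N nodes with Jacobians at most N / l, is
    absorbed by 4^N and one more power of 1 / l; 144 is 36 times 4.\<close>
  also have "\<dots> \<le> ennreal ((144 / l ^ 3) ^ N) * I"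
  proof (intro mult_right_mono ennreal_leI)
    have "real N \<le> 2 ^ N" by (metis less_imp_le of_nat_less_two_power)
    then have "real N * real N \<le> 2 ^ N * 2 ^ N" by (intro mult_mono) auto
    then have "real N * real N \<le> 4 ^ N" by (simp flip: power_mult_distrib)
    moreover have "1 / l \<le> (1 / l) ^ N" using l N by (metis less_eq_real_def one_le_power power_increasing power_one_right divide_le_eq_1_pos le_divide_eq_1_pos)
    ultimately have "(real N * real N) * (1 / l) \<le> 4 ^ N * (1 / l) ^ N" using l by (intro mult_mono) auto
    then have "(36 / l\<^sup>2) ^ N * ((real N * real N) * (1 / l)) \<le> (36 / l\<^sup>2) ^ N * (4 ^ N * (1 / l) ^ N)"
      using l by (intro mult_left_mono) auto
    also have "\<dots> = (144 / l ^ 3) ^ N" by (simp add: power2_eq_square power3_eq_cube flip: power_mult_distrib)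
    finally show "(36 / l\<^sup>2) ^ N * (real N * (real N / l)) \<le> (144 / l ^ 3) ^ N" by simp
  qed auto
  finally show ?thesis unfolding I_def F_def .
qed

section \<open>Circle means and Taylor approximation\<close>

lemma square_integral_le_integral_square:
  fixes g :: "real \<Rightarrow> real"
  assumes "continuous_on {0..1} g"
  shows "(integral {0..1} g)\<^sup>2 \<le> integral {0..1} (\<lambda>t. (g t)\<^sup>2)"
proof -
  define m where "m = integral {0..1} g"
  have g: "g integrable_on {0..1}" "(\<lambda>t. (g t)\<^sup>2) integrable_on {0..1}"
    using assms by (auto intro!: integrable_continuous_interval continuous_intros)
  have c: "(\<lambda>t. m\<^sup>2) integrable_on {0..1::real}" by (rule integrable_const_ivl)
  have "((\<lambda>t. (g t)\<^sup>2 - 2 * m * g t + m\<^sup>2) has_integral (integral {0..1} (\<lambda>t. (g t)\<^sup>2) - 2 * m * m + m\<^sup>2)) {0..1}"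
    using has_integral_const_real[of "m\<^sup>2" 0 1]
    by (intro has_integral_add has_integral_diff has_integral_mult_right integrable_integral g) (auto simp: m_def intro: g integrable_integral)
  moreover have "0 \<le> (g t)\<^sup>2 - 2 * m * g t + m\<^sup>2" for t
  proof -
    have "(g t)\<^sup>2 - 2 * m * g t + m\<^sup>2 = (g t - m)\<^sup>2" by (simp add: power2_eq_square algebra_simps)
    then show ?thesis by simp
  qed
  ultimately have "0 \<le> integral {0..1} (\<lambda>t. (g t)\<^sup>2) - 2 * m * m + m\<^sup>2"
    using has_integral_nonneg by blast
  then show ?thesis by (simp add: m_def power2_eq_square)
qed

text \<open>The mean of |h|^2 over the circle of radius \<open>R\<close> about \<open>z\<close>,
  parametrised by [0, 1]. A mean square is used instead of a maximum because it can be integrated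
  over the centre and exchanged with integrals over space.\<close>

definition circle_mean_square :: "(complex \<Rightarrow> complex) \<Rightarrow> real \<Rightarrow> complex \<Rightarrow> real"
  where "circle_mean_square h R z =
    integral {0..1} (\<lambda>t. (cmod (h (z + of_real R * exp (2 * of_real pi * \<i> * of_real t))))\<^sup>2)"

lemma circle_param_continuous:
  assumes "h holomorphic_on UNIV"
  shows "continuous_on S (\<lambda>t. h (z + of_real R * exp (2 * of_real pi * \<i> * of_real t)))"
  by (rule continuous_on_compose2[OF holomorphic_on_imp_continuous_on[OF assms]]) (auto intro!: continuous_intros)

lemma circle_mean_square_nonneg: "0 \<le> circle_mean_square h R z"
  unfolding circle_mean_square_def
  by (metis (no_types, lifting) Henstock_Kurzweil_Integration.integral_nonneg not_integrable_integral order_refl zero_le_power2)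

text \<open>Cauchy's formula bounds the coefficient by the mean of |h| on the circle, and Jensen's
  inequality bounds that by the root of the mean square.\<close>

lemma taylor_coeff_bound:
  assumes h: "h holomorphic_on UNIV" and R: "R > 0"
  shows "cmod ((deriv ^^ k) h z / fact k) * R ^ k \<le> sqrt (circle_mean_square h R z)"
proof -
  define e where "e t = exp (2 * of_real pi * \<i> * of_real t)" for t :: real
  have ne: "cmod (e t) = 1" for t unfolding e_def by simp
  define G where "G t = h (z + of_real R * e t)" for t
  have cG: "circle_mean_square h R z = integral {0..1} (\<lambda>t. (cmod (G t))\<^sup>2)"
    by (simp add: circle_mean_square_def G_def e_def)
  have Gc: "continuous_on {0..1} G" unfolding G_def e_def by (rule circle_param_continuous[OF h])
  have "((\<lambda>u. h u / (u - z) ^ Suc k) has_contour_integral (2 * pi * \<i> / fact k * (deriv ^^ k) h z)) (circlepath z R)"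
    using R h by (intro Cauchy_has_contour_integral_higher_derivative_circlepath)
      (auto intro: holomorphic_on_subset holomorphic_on_imp_continuous_on continuous_on_subset)
  then have hi: "((\<lambda>t. h (circlepath z R t) / (circlepath z R t - z) ^ Suc k * vector_derivative (circlepath z R) (at t within {0..1}))
     has_integral (2 * pi * \<i> / fact k * (deriv ^^ k) h z)) {0..1}"
    by (simp add: has_contour_integral_def)
  have val: "cmod (h (circlepath z R t) / (circlepath z R t - z) ^ Suc k * vector_derivative (circlepath z R) (at t within {0..1}))
      = 2 * pi / R ^ k * cmod (G t)" if "t \<in> {0..1}" for t
    using that R by (subst vector_derivative_circlepath01)
      (auto simp: circlepath G_def e_def norm_mult norm_divide norm_power power_mult_distrib field_simps ne[unfolded e_def])
  have "cmod (2 * pi * \<i> / fact k * (deriv ^^ k) h z) \<le> integral {0..1} (\<lambda>t. 2 * pi / R ^ k * cmod (G t))"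
  proof -
    have "(\<lambda>t. 2 * pi / R ^ k * cmod (G t)) integrable_on {0..1}"
      using Gc by (intro integrable_continuous_interval continuous_intros)
    then show ?thesis
      using integral_norm_bound_integral[of _ "{0..1}" "\<lambda>t. 2 * pi / R ^ k * cmod (G t)"] hi val
      by (metis (no_types, lifting) has_integral_integrable integral_unique order_refl)
  qed
  also have "\<dots> = 2 * pi / R ^ k * integral {0..1} (\<lambda>t. cmod (G t))" by simp
  finally have "2 * pi * cmod ((deriv ^^ k) h z / fact k) \<le> 2 * pi * (integral {0..1} (\<lambda>t. cmod (G t)) / R ^ k)"
    by (simp add: norm_mult norm_divide field_simps)
  then have "cmod ((deriv ^^ k) h z / fact k) * R ^ k \<le> integral {0..1} (\<lambda>t. cmod (G t))"
    using R by (simp add: field_simps)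
  also have "\<dots> \<le> sqrt (circle_mean_square h R z)"
  proof (rule real_le_rsqrt)
    show "(integral {0..1} (\<lambda>t. cmod (G t)))\<^sup>2 \<le> circle_mean_square h R z"
      unfolding cG by (rule square_integral_le_integral_square) (intro continuous_on_norm Gc)
  qed
  finally show ?thesis .
qed

text \<open>The coefficient bound turns the Taylor tail into a geometric series of ratio L / R <=
  1/2, whose sum accounts for the factor 2.\<close>

lemma taylor_polynomial_approx:
  assumes h: "h holomorphic_on UNIV" and L: "0 < L" "2 * L \<le> R"
  obtains p where "degree p < Suc n"
    "\<And>x. cmod (x - z) \<le> L \<Longrightarrow> cmod (h x - poly p x) \<le> 2 * sqrt (circle_mean_square h R z) * (L / R) ^ Suc n"
proof -
  define M where "M = sqrt (circle_mean_square h R z)"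
  define a where "a k = (deriv ^^ k) h z / fact k" for k
  have R: "R > 0" using L by simp
  have ab: "cmod (a k) \<le> M / R ^ k" for k
    using taylor_coeff_bound[OF h R, of k z] R by (simp add: a_def M_def field_simps)
  define p where "p = (\<Sum>k<Suc n. smult (a k) ([:- z, 1:] ^ k))"
  have "degree p \<le> n" unfolding p_def
    by (intro degree_sum_le) (auto intro!: order_trans[OF degree_smult_le] order_trans[OF degree_power_le])
  moreover have "cmod (h x - poly p x) \<le> 2 * M * (L / R) ^ Suc n" if x: "cmod (x - z) \<le> L" for x
  proof -
    have "(\<lambda>k. a k * (x - z) ^ k) sums h x"
      unfolding a_def using x L by (intro holomorphic_power_series[of h z R] holomorphic_on_subset[OF h]) (auto simp: dist_norm norm_minus_commute)
    then have "(\<lambda>k. a (k + Suc n) * (x - z) ^ (k + Suc n)) sums (h x - (\<Sum>k<Suc n. a k * (x - z) ^ k))"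
      by (rule sums_split_initial_segment)
    moreover have "poly p x = (\<Sum>k<Suc n. a k * (x - z) ^ k)" unfolding p_def poly_sum by (simp add: poly_power)
    ultimately have s: "(\<lambda>k. a (k + Suc n) * (x - z) ^ (k + Suc n)) sums (h x - poly p x)" by simp
    have q: "0 \<le> L / R" "L / R \<le> 1/2" using L R by (auto simp: field_simps)
    have tb: "cmod (a (k + Suc n) * (x - z) ^ (k + Suc n)) \<le> M * (L / R) ^ Suc n * (1/2) ^ k" for k
    proof -
      have M0: "M \<ge> 0" unfolding M_def by (simp add: circle_mean_square_nonneg)
      have "cmod (a (k + Suc n) * (x - z) ^ (k + Suc n)) \<le> (M / R ^ (k + Suc n)) * L ^ (k + Suc n)"
        unfolding norm_mult norm_power using x ab[of "k + Suc n"] R M0 by (intro mult_mono power_mono) auto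
      also have "\<dots> = M * ((L / R) ^ Suc n * (L / R) ^ k)" by (simp add: power_divide power_add field_simps)
      also have "\<dots> \<le> M * ((L / R) ^ Suc n * (1/2) ^ k)" using q M0 L R by (intro mult_left_mono power_mono) auto
      finally show ?thesis by (simp add: mult.assoc)
    qed
    have sm: "summable (\<lambda>k. M * (L / R) ^ Suc n * (1/2) ^ k)" by (intro summable_mult summable_geometric) simp
    have "cmod (h x - poly p x) \<le> (\<Sum>k. M * (L / R) ^ Suc n * (1/2) ^ k)"
      unfolding sums_unique[OF s] by (rule norm_suminf_le[OF tb sm])
    also have "\<dots> = 2 * M * (L / R) ^ Suc n" by (subst suminf_mult) (auto simp: suminf_geometric intro: summable_geometric)
    finally show ?thesis .
  qed
  ultimately show ?thesis using that[of p] unfolding M_def by simp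
qed

lemma nn_integral_circle_mean_square:
  assumes "h holomorphic_on UNIV"
  shows "(\<integral>\<^sup>+t\<in>{0..1}. ennreal ((cmod (h (z + of_real R * exp (2 * of_real pi * \<i> * of_real t))))\<^sup>2) \<partial>lborel)
    = ennreal (circle_mean_square h R z)"
proof -
  define g where "g t = (cmod (h (z + of_real R * exp (2 * of_real pi * \<i> * of_real t))))\<^sup>2" for t
  have gc: "continuous_on S g" for S unfolding g_def by (intro continuous_intros circle_param_continuous assms)
  have g0: "0 \<le> g t" for t by (simp add: g_def)
  have gi: "(g has_integral (circle_mean_square h R z)) {0..1}"
    unfolding circle_mean_square_def g_def[symmetric] by (intro integrable_integral integrable_continuous_interval gc)
  have "(\<integral>\<^sup>+t. ennreal (indicator {0..1} t * g t) \<partial>lborel) = ennreal (circle_mean_square h R z)"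
  proof (rule nn_integral_has_integral_lborel)
    show "((\<lambda>t. indicator {0..1} t * g t) has_integral circle_mean_square h R z) UNIV"
      using gi unfolding has_integral_restrict_UNIV[of "{0..1}" g, symmetric]
      by (rule has_integral_cong[THEN iffD1, rotated]) (simp add: indicator_def)
    have [measurable]: "g \<in> borel_measurable borel" by (rule borel_measurable_continuous_onI[OF gc])
    show "(\<lambda>t. indicator {0..1} t * g t) \<in> borel_measurable borel" by measurable
  qed (simp add: g0)
  moreover have "ennreal (indicator {0..1} t * g t) = ennreal (g t) * indicator {0..1} t" for t
    by (simp add: indicator_def)
  ultimately show ?thesis by (simp add: g_def)
qed

lemma two_squares: "(cmod a)\<^sup>2 \<le> 2 * (cmod b)\<^sup>2 + 2 * (cmod (a - b))\<^sup>2"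
proof -
  have "cmod a \<le> cmod b + cmod (a - b)" by (metis norm_triangle_sub)
  then have "(cmod a)\<^sup>2 \<le> (cmod b + cmod (a - b))\<^sup>2" by (intro power_mono) auto
  also have "\<dots> \<le> 2 * (cmod b)\<^sup>2 + 2 * (cmod (a - b))\<^sup>2"
    using zero_le_power2[of "cmod b - cmod (a - b)"] by (simp add: power2_eq_square algebra_simps)
  finally show ?thesis .
qed

text \<open>The Remez inequality is applied to the Taylor polynomial of \<open>h\<close> about
  \<open>s\<close>; passing from \<open>h\<close> to the polynomial and back costs the Taylor error
  twice. The centre \<open>s\<close> is left free in [a, b] so that it can be averaged over.\<close>

lemma interval_smallness_at:
  assumes h: "h holomorphic_on UNIV" and N: "N \<ge> 1" and ab: "a < b" "a \<le> c" "c \<le> b"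
    and l: "0 < l" "l \<le> 1" "l * (b - a) \<le> r" and R: "2 * (b - a) \<le> R" and s: "a \<le> s" "s \<le> b"
  shows "(\<integral>\<^sup>+x\<in>{a..b}. ennreal ((cmod (h (of_real x)))\<^sup>2) \<partial>lborel)
    \<le> ennreal (4 * (144 / l ^ 3) ^ N) * (\<integral>\<^sup>+x\<in>{a..b} \<inter> {c - r..c + r}. ennreal ((cmod (h (of_real x)))\<^sup>2) \<partial>lborel)
     + ennreal (24 * (144 / l ^ 3) ^ N * (b - a) * ((b - a) / R) ^ (2 * N) * circle_mean_square h R (of_real s))"
proof -
  obtain n where n: "N = Suc n" using N by (cases N) auto
  define L where "L = b - a"
  have L: "0 < L" "2 * L \<le> R" using ab R by (auto simp: L_def)
  define A where "A = circle_mean_square h R (of_real s)"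
  have A0: "A \<ge> 0" by (simp add: A_def circle_mean_square_nonneg)
  obtain p where p: "degree p < Suc n"
    "\<And>x. cmod (x - of_real s) \<le> L \<Longrightarrow> cmod (h x - poly p x) \<le> 2 * sqrt A * (L / R) ^ Suc n"
    using taylor_polynomial_approx[OF h L, of n "of_real s"] unfolding A_def by blast
  define e where "e = 4 * A * (L / R) ^ (2 * N)"
  have e0: "e \<ge> 0" using A0 by (simp add: e_def)
  have pe: "(cmod (h (of_real x) - poly p (of_real x)))\<^sup>2 \<le> e" if "x \<in> {a..b}" for x
  proof -
    have "\<bar>x - s\<bar> \<le> L" using that s by (auto simp: L_def abs_le_iff)
    then have "cmod (of_real x - of_real s) \<le> L" by (simp flip: of_real_diff)
    then have "(cmod (h (of_real x) - poly p (of_real x)))\<^sup>2 \<le> (2 * sqrt A * (L / R) ^ Suc n)\<^sup>2"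
      using p(2) by (intro power_mono) auto
    also have "\<dots> = e" using A0 by (simp only: e_def n power_mult_distrib power_even_eq) simp
    finally show ?thesis .
  qed
  have hc: "continuous_on UNIV (\<lambda>x. h (of_real x))"
    by (rule continuous_on_compose2[OF holomorphic_on_imp_continuous_on[OF h]]) (auto intro!: continuous_intros)
  have [measurable]: "(\<lambda>x. h (of_real x)) \<in> borel_measurable borel" by (rule borel_measurable_continuous_onI[OF hc])
  have [measurable]: "(\<lambda>x. poly p (complex_of_real x)) \<in> borel_measurable borel"
    by (rule borel_measurable_continuous_onI) (intro continuous_intros)
  define I where "I = {a..b} \<inter> {c - r..c + r}"
  define C where "C = (144 / l ^ 3) ^ N"
  have l3: "l ^ 3 \<le> 1" using l by (simp add: power_le_one)
  have C1: "C \<ge> 1" unfolding C_def using l l3 by (intro one_le_power) (simp add: field_simps)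
  let ?h = "\<lambda>S. \<integral>\<^sup>+x\<in>S. ennreal ((cmod (h (of_real x)))\<^sup>2) \<partial>lborel"
  let ?p = "\<lambda>S. \<integral>\<^sup>+x\<in>S. ennreal ((cmod (poly p (of_real x)))\<^sup>2) \<partial>lborel"
  have aux: "(\<integral>\<^sup>+x\<in>S. ennreal (F x) \<partial>lborel) \<le> 2 * (\<integral>\<^sup>+x\<in>S. ennreal (G x) \<partial>lborel) + ennreal (2 * e * L)"
    if FG: "\<And>x. x \<in> {a..b} \<Longrightarrow> F x \<le> 2 * G x + 2 * e" and [measurable]: "G \<in> borel_measurable borel" and G0: "\<And>x. G x \<ge> 0"
      and S: "S \<subseteq> {a..b}" and [measurable]: "S \<in> sets borel" for F G :: "real \<Rightarrow> real" and S
  proof -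
    have "(\<integral>\<^sup>+x\<in>S. ennreal (F x) \<partial>lborel) \<le> (\<integral>\<^sup>+x. 2 * (ennreal (G x) * indicator S x) + ennreal (2 * e) * indicator {a..b} x \<partial>lborel)"
    proof (rule nn_integral_mono)
      fix x
      show "ennreal (F x) * indicator S x \<le> 2 * (ennreal (G x) * indicator S x) + ennreal (2 * e) * indicator {a..b} x"
      proof (cases "x \<in> S")
        case True
        then have "ennreal (F x) \<le> ennreal (2 * G x + 2 * e)" using FG S by (intro ennreal_leI) auto
        also have "\<dots> = 2 * ennreal (G x) + ennreal (2 * e)"
          using G0 e0 by (subst ennreal_plus) (auto simp: ennreal_mult)
        finally show ?thesis using True S by auto
      qed simp
    qed
    also have "\<dots> = 2 * (\<integral>\<^sup>+x\<in>S. ennreal (G x) \<partial>lborel) + ennreal (2 * e) * emeasure lborel {a..b}"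
      by (subst nn_integral_add) (auto simp: nn_integral_cmult)
    also have "ennreal (2 * e) * emeasure lborel {a..b} = ennreal (2 * e * L)"
      using ab e0 by (simp add: L_def flip: ennreal_mult)
    finally show ?thesis .
  qed
  have 1: "?h {a..b} \<le> 2 * ?p {a..b} + ennreal (2 * e * L)"
  proof (rule aux)
    fix x assume "x \<in> {a..b}"
    then show "(cmod (h (of_real x)))\<^sup>2 \<le> 2 * (cmod (poly p (of_real x)))\<^sup>2 + 2 * e"
      using pe[of x] two_squares[of "h (of_real x)" "poly p (of_real x)"] by linarith
  qed auto
  have 2: "?p I \<le> 2 * ?h I + ennreal (2 * e * L)"
  proof (rule aux)
    fix x assume "x \<in> {a..b}"
    then have "(cmod (poly p (of_real x) - h (of_real x)))\<^sup>2 \<le> e" using pe[of x] by (simp add: norm_minus_commute)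
    then show "(cmod (poly p (of_real x)))\<^sup>2 \<le> 2 * (cmod (h (of_real x)))\<^sup>2 + 2 * e"
      using two_squares[of "poly p (of_real x)" "h (of_real x)"] by linarith
  qed (auto simp: I_def)
  have rem: "?p {a..b} \<le> ennreal C * ?p I"
    unfolding C_def I_def by (rule polynomial_remez) (use p n ab l in auto)
  note 1
  also have "2 * ?p {a..b} + ennreal (2 * e * L) \<le> 2 * (ennreal C * ?p I) + ennreal (2 * e * L)"
    by (intro add_right_mono mult_left_mono rem) simp
  also have "\<dots> \<le> 2 * (ennreal C * (2 * ?h I + ennreal (2 * e * L))) + ennreal (2 * e * L)"
    by (intro add_mono mult_left_mono 2) auto
  also have "\<dots> = ennreal (4 * C) * ?h I + ennreal (4 * C * e * L + 2 * e * L)"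
  proof -
    have a1: "2 * (ennreal C * 2) = ennreal (4 * C)"
      using ennreal_mult3[of 2 C 2] C1 by simp
    have a2: "2 * (ennreal C * ennreal (2 * e * L)) = ennreal (4 * C * e * L)"
      using ennreal_mult3[of 2 C "2 * e * L"] C1 e0 L by (simp add: mult_ac)
    have "ennreal (4 * C * e * L) + ennreal (2 * e * L) = ennreal (4 * C * e * L + 2 * e * L)"
      using C1 e0 L by (intro ennreal_plus[symmetric]) auto
    then have "ennreal (4 * C) * ?h I + ennreal (4 * C * e * L + 2 * e * L) = (2 * (ennreal C * 2)) * ?h I + (2 * (ennreal C * ennreal (2 * e * L)) + ennreal (2 * e * L))"
      by (simp only: a1 a2)
    then show ?thesis by (simp only: distrib_left mult.assoc add.assoc)
  qed
  \<comment> \<open>The two errors 4 C e L and 2 e L merge into 6 C e L because C >= 1, and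
    \<open>e\<close> carries a further factor 4: hence 24.\<close>
  also have "\<dots> \<le> ennreal (4 * C) * ?h I + ennreal (24 * C * L * (L / R) ^ (2 * N) * A)"
  proof -
    have 1: "e * L \<le> C * (e * L)" using mult_right_mono[OF C1, of "e * L"] e0 L by simp
    have 2: "24 * C * L * (L / R) ^ (2 * N) * A = 6 * (C * (e * L))" unfolding e_def by algebra
    have 3: "4 * C * e * L + 2 * e * L = 4 * (C * (e * L)) + 2 * (e * L)" by algebra
    have "4 * C * e * L + 2 * e * L \<le> 24 * C * L * (L / R) ^ (2 * N) * A" unfolding 2 3 using 1 by linarith
    then show ?thesis by (rule add_left_mono[OF ennreal_leI])
  qed
  finally show ?thesis by (simp add: C_def I_def L_def A_def)
qed

text \<open>Averaging over the centre \<open>s\<close> replaces the circle mean at one point by its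
  integral over the interval, which an integration over space will control. The interval is
  half-open because the cells have to partition the line.\<close>

lemma interval_smallness:
  assumes h: "h holomorphic_on UNIV" and N: "N \<ge> 1" and ab: "a < b" "a \<le> c" "c \<le> b"
    and l: "0 < l" "l \<le> 1" "l * (b - a) \<le> r" and R: "2 * (b - a) \<le> R"
  defines "B \<equiv> 24 * (144 / l ^ 3) ^ N"
  shows "(\<integral>\<^sup>+x\<in>{a..<b}. ennreal ((cmod (h (of_real x)))\<^sup>2) \<partial>lborel)
    \<le> ennreal B * (\<integral>\<^sup>+x\<in>{a..<b} \<inter> {c - r..c + r}. ennreal ((cmod (h (of_real x)))\<^sup>2) \<partial>lborel)
     + ennreal (B * ((b - a) / R) ^ (2 * N)) * (\<integral>\<^sup>+s\<in>{a..<b}. ennreal (circle_mean_square h R (of_real s)) \<partial>lborel)"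
proof -
  define L where "L = b - a"
  have L: "L > 0" using ab by (simp add: L_def)
  define C where "C = (144 / l ^ 3) ^ N"
  have C0: "C \<ge> 0" using l by (simp add: C_def)
  define H where "H = (\<integral>\<^sup>+x\<in>{a..b}. ennreal ((cmod (h (of_real x)))\<^sup>2) \<partial>lborel)"
  define HI where "HI = (\<integral>\<^sup>+x\<in>{a..b} \<inter> {c - r..c + r}. ennreal ((cmod (h (of_real x)))\<^sup>2) \<partial>lborel)"
  define A where "A s = circle_mean_square h R (complex_of_real s)" for s
  have hc: "continuous_on UNIV h" by (rule holomorphic_on_imp_continuous_on[OF h])
  have [measurable]: "h \<in> borel_measurable borel" by (rule borel_measurable_continuous_onI[OF hc])
  have [measurable]: "exp \<in> borel_measurable (borel :: complex measure)"
    by (rule borel_measurable_continuous_onI) (intro continuous_intros)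
  have "(\<lambda>s. ennreal (A s)) = (\<lambda>s. \<integral>\<^sup>+t. ennreal ((cmod (h (of_real s + of_real R * exp (2 * of_real pi * \<i> * of_real t))))\<^sup>2) * indicator {0..1} t \<partial>lborel)"
    by (simp add: nn_integral_circle_mean_square[OF h] A_def)
  also have "\<dots> \<in> borel_measurable lborel" by measurable
  finally have [measurable]: "(\<lambda>s. ennreal (A s)) \<in> borel_measurable borel" by simp
  have "(\<integral>\<^sup>+s\<in>{a..b}. H \<partial>lborel) \<le> (\<integral>\<^sup>+s. (ennreal (4 * C) * HI) * indicator {a..b} s + ennreal (24 * C * L * (L / R) ^ (2 * N)) * (ennreal (A s) * indicator {a..b} s) \<partial>lborel)"
  proof (intro nn_integral_mono)
    fix s
    have "H \<le> ennreal (4 * C) * HI + ennreal (24 * C * L * (L / R) ^ (2 * N) * A s)" if "s \<in> {a..b}"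
      unfolding H_def HI_def A_def C_def L_def using that by (intro interval_smallness_at assms) auto
    moreover have "ennreal (24 * C * L * (L / R) ^ (2 * N) * A s) = ennreal (24 * C * L * (L / R) ^ (2 * N)) * ennreal (A s)"
      using C0 L by (intro ennreal_mult) (auto simp: A_def circle_mean_square_nonneg)
    ultimately show "H * indicator {a..b} s \<le> (ennreal (4 * C) * HI) * indicator {a..b} s + ennreal (24 * C * L * (L / R) ^ (2 * N)) * (ennreal (A s) * indicator {a..b} s)"
      by (auto simp: indicator_def)
  qed
  also have "\<dots> = (ennreal (4 * C) * HI) * ennreal L + ennreal (24 * C * L * (L / R) ^ (2 * N)) * (\<integral>\<^sup>+s\<in>{a..b}. ennreal (A s) \<partial>lborel)"
    using ab by (subst nn_integral_add) (auto simp: nn_integral_cmult nn_integral_cmult_indicator L_def)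
  also have "(\<integral>\<^sup>+s\<in>{a..b}. H \<partial>lborel) = H * ennreal L" using ab by (simp add: nn_integral_cmult_indicator L_def)
  finally have "ennreal (1 / L) * (H * ennreal L) \<le> ennreal (1 / L) * ((ennreal (4 * C) * HI) * ennreal L + ennreal (24 * C * L * (L / R) ^ (2 * N)) * (\<integral>\<^sup>+s\<in>{a..b}. ennreal (A s) \<partial>lborel))"
    by (intro mult_left_mono) auto
  also have "ennreal (1 / L) * (H * ennreal L) = H"
    using L by (simp add: mult.left_commute[of _ H] flip: ennreal_mult)
  also have "ennreal (1 / L) * ((ennreal (4 * C) * HI) * ennreal L + ennreal (24 * C * L * (L / R) ^ (2 * N)) * (\<integral>\<^sup>+s\<in>{a..b}. ennreal (A s) \<partial>lborel))
    = (ennreal (1 / L) * ennreal L) * (ennreal (4 * C) * HI) + (ennreal (1 / L) * ennreal (24 * C * L * (L / R) ^ (2 * N))) * (\<integral>\<^sup>+s\<in>{a..b}. ennreal (A s) \<partial>lborel)"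
    by (simp add: distrib_left mult_ac)
  also have "ennreal (1 / L) * ennreal L = 1" using L by (simp flip: ennreal_mult)
  also have "ennreal (1 / L) * ennreal (24 * C * L * (L / R) ^ (2 * N)) = ennreal (B * (L / R) ^ (2 * N))"
  proof -
    have q0: "0 \<le> (L / R) ^ (2 * N)" using L R by (intro zero_le_power) (auto simp: L_def)
    have "ennreal (1 / L) * ennreal (24 * C * L * (L / R) ^ (2 * N)) = ennreal (1 / L * (24 * C * L * (L / R) ^ (2 * N)))"
      by (rule ennreal_mult[symmetric]) (use L C0 q0 in auto)
    also have "1 / L * (24 * C * L * (L / R) ^ (2 * N)) = B * (L / R) ^ (2 * N)" using L by (simp add: B_def C_def)
    finally show ?thesis .
  qed
  also have "1 * (ennreal (4 * C) * HI) + ennreal (B * (L / R) ^ (2 * N)) * (\<integral>\<^sup>+s\<in>{a..b}. ennreal (A s) \<partial>lborel)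
    \<le> ennreal B * HI + ennreal (B * (L / R) ^ (2 * N)) * (\<integral>\<^sup>+s\<in>{a..b}. ennreal (A s) \<partial>lborel)"
    using C0 by (intro add_right_mono) (auto simp: B_def C_def intro!: mult_right_mono ennreal_leI)
  finally have main: "H \<le> ennreal B * HI + ennreal (B * (L / R) ^ (2 * N)) * (\<integral>\<^sup>+s\<in>{a..b}. ennreal (A s) \<partial>lborel)" .
  have ho: "(\<integral>\<^sup>+x\<in>{a..<b} \<inter> S. F x \<partial>lborel) = (\<integral>\<^sup>+x\<in>{a..b} \<inter> S. F x \<partial>lborel)" for F :: "real \<Rightarrow> ennreal" and S
    by (intro nn_integral_cong_AE eventually_mono[OF AE_lborel_singleton[of b]]) (auto simp: indicator_def)
  show ?thesis
    using main unfolding H_def HI_def A_def L_def ho using ho[of _ UNIV] by simp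
qed

section \<open>Propagation of smallness over cells of \<open>R\<^sup>n\<close>\<close>

lemma borel_measurable_vec_component [measurable]: "(\<lambda>x :: real^'n. x $ i) \<in> borel_measurable borel"
  by (rule borel_measurable_continuous_onI) (intro continuous_intros)

lemma nn_integral_lborel_translate:
  fixes F :: "'a::euclidean_space \<Rightarrow> ennreal"
  assumes [measurable]: "F \<in> borel_measurable borel"
  shows "(\<integral>\<^sup>+x. F (c + x) \<partial>lborel) = (\<integral>\<^sup>+x. F x \<partial>lborel)"
proof -
  have "(\<integral>\<^sup>+x. F x \<partial>lborel) = (\<integral>\<^sup>+x. F x \<partial>distr lborel borel ((+) c))" by (simp add: lborel_distr_plus)
  also have "\<dots> = (\<integral>\<^sup>+x. F (c + x) \<partial>lborel)" by (subst nn_integral_distr) auto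
  finally show ?thesis ..
qed

text \<open>Integrating first over the cell segment through x and then over x counts each point once
  for every displacement u that stays inside its cell, so with total weight L. \<open>J y u\<close>
  indicates that y and y + u lie in the same cell; Tonelli and translation by u do the rest.\<close>

lemma nn_integral_cell_average:
  fixes F :: "real^'n \<Rightarrow> ennreal" and L :: real
  assumes [measurable]: "F \<in> borel_measurable borel" and L: "L > 0"
  shows "(\<integral>\<^sup>+x. (\<integral>\<^sup>+s\<in>{\<lfloor>x $ k / L\<rfloor> * L..<\<lfloor>x $ k / L\<rfloor> * L + L}. F (x + (s - x $ k) *\<^sub>R axis k 1) \<partial>lborel) \<partial>lborel)
    = ennreal L * (\<integral>\<^sup>+x. F x \<partial>lborel)"
proof -
  define J :: "real \<Rightarrow> real \<Rightarrow> ennreal" where "J y u = (if real_of_int \<lfloor>(y + u) / L\<rfloor> = real_of_int \<lfloor>y / L\<rfloor> then 1 else 0)" for y u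
  define e :: "real^'n" where "e = axis k 1"
  have [measurable]: "(\<lambda>z. J (f z) (g z)) \<in> borel_measurable M" if [measurable]: "f \<in> borel_measurable M" "g \<in> borel_measurable M" for f g and M :: "'b measure"
    unfolding J_def by measurable
  have fl: "s \<in> {\<lfloor>y / L\<rfloor> * L..<\<lfloor>y / L\<rfloor> * L + L} \<longleftrightarrow> \<lfloor>s / L\<rfloor> = \<lfloor>y / L\<rfloor>" for s y :: real
    using L by (simp add: floor_eq_iff field_simps)
  have "(\<integral>\<^sup>+s\<in>{\<lfloor>x $ k / L\<rfloor> * L..<\<lfloor>x $ k / L\<rfloor> * L + L}. F (x + (s - x $ k) *\<^sub>R e) \<partial>lborel)
    = (\<integral>\<^sup>+u. F (u *\<^sub>R e + x) * J (x $ k) u \<partial>lborel)" for x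
  proof -
    have "(\<integral>\<^sup>+s\<in>{\<lfloor>x $ k / L\<rfloor> * L..<\<lfloor>x $ k / L\<rfloor> * L + L}. F (x + (s - x $ k) *\<^sub>R e) \<partial>lborel)
       = (\<integral>\<^sup>+u. F (x + ((x $ k + u) - x $ k) *\<^sub>R e) * indicator {\<lfloor>x $ k / L\<rfloor> * L..<\<lfloor>x $ k / L\<rfloor> * L + L} (x $ k + u) \<partial>lborel)"
      by (rule nn_integral_lborel_translate[symmetric]) measurable
    then show ?thesis using fl by (simp add: J_def indicator_def of_bool_def add.commute)
  qed
  then have "(\<integral>\<^sup>+x. (\<integral>\<^sup>+s\<in>{\<lfloor>x $ k / L\<rfloor> * L..<\<lfloor>x $ k / L\<rfloor> * L + L}. F (x + (s - x $ k) *\<^sub>R e) \<partial>lborel) \<partial>lborel)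
    = (\<integral>\<^sup>+x. (\<integral>\<^sup>+u. F (u *\<^sub>R e + x) * J (x $ k) u \<partial>lborel) \<partial>lborel)" by simp
  also have "\<dots> = (\<integral>\<^sup>+u. (\<integral>\<^sup>+x. F (u *\<^sub>R e + x) * J (x $ k) u \<partial>lborel) \<partial>lborel)"
    by (rule lborel_pair.Fubini') measurable
  also have "\<dots> = (\<integral>\<^sup>+u. (\<integral>\<^sup>+x. F x * J (x $ k - u) u \<partial>lborel) \<partial>lborel)"
  proof (rule nn_integral_cong)
    fix u
    have "(\<integral>\<^sup>+x. F (u *\<^sub>R e + x) * J ((u *\<^sub>R e + x) $ k - u) u \<partial>lborel) = (\<integral>\<^sup>+x. F x * J (x $ k - u) u \<partial>lborel)"
      by (rule nn_integral_lborel_translate) measurable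
    then show "(\<integral>\<^sup>+x. F (u *\<^sub>R e + x) * J (x $ k) u \<partial>lborel) = (\<integral>\<^sup>+x. F x * J (x $ k - u) u \<partial>lborel)"
      by (simp add: e_def axis_def)
  qed
  also have "\<dots> = (\<integral>\<^sup>+x. (\<integral>\<^sup>+u. F x * J (x $ k - u) u \<partial>lborel) \<partial>lborel)"
    by (rule lborel_pair.Fubini') measurable
  also have "\<dots> = (\<integral>\<^sup>+x. F x * ennreal L \<partial>lborel)"
  proof (rule nn_integral_cong)
    fix x :: "real^'n"
    define y m where "y = x $ k" and "m = \<lfloor>y / L\<rfloor>"
    have "(J (y - u) u) = indicator {y - m * L - L<..y - m * L} u" for u
    proof -
      have "\<lfloor>y / L\<rfloor> = \<lfloor>(y - u) / L\<rfloor> \<longleftrightarrow> \<lfloor>(y - u) / L\<rfloor> = m" by (auto simp: m_def)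
      also have "\<dots> \<longleftrightarrow> u \<in> {y - m * L - L<..y - m * L}" using L by (auto simp: floor_eq_iff field_simps)
      finally show ?thesis by (simp add: J_def indicator_def)
    qed
    then have "(\<integral>\<^sup>+u. F x * J (y - u) u \<partial>lborel) = (\<integral>\<^sup>+u. F x * indicator {y - m * L - L<..y - m * L} u \<partial>lborel)" by simp
    also have "\<dots> = F x * ennreal L" using L by (subst nn_integral_cmult_indicator) auto
    finally show "(\<integral>\<^sup>+u. F x * J (x $ k - u) u \<partial>lborel) = F x * ennreal L" by (simp add: y_def)
  qed
  also have "\<dots> = ennreal L * (\<integral>\<^sup>+x. F x \<partial>lborel)" by (simp add: nn_integral_cmult mult.commute[of _ "ennreal L"])
  finally show ?thesis by (simp add: e_def)
qed

section \<open>Cells, constrained sets and coordinatewise entire functions\<close>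

definition cell_index :: "real \<Rightarrow> real^'n \<Rightarrow> int^'n"
  where "cell_index L x = (\<chi> i. \<lfloor>x $ i / L\<rfloor>)"

text \<open>Interpolates between the whole space, for empty \<open>K\<close>, and small cubes about
  the points \<open>G m\<close>, cut off at their cells, for \<open>K = UNIV\<close>. The
  coordinates can thus be constrained one at a time.\<close>

definition observed :: "real \<Rightarrow> (int^'n \<Rightarrow> real^'n) \<Rightarrow> real \<Rightarrow> 'n set \<Rightarrow> (real^'n) set"
  where "observed L G r K = {x. \<forall>i\<in>K. \<bar>x $ i - G (cell_index L x) $ i\<bar> \<le> r}"

text \<open>\<open>H k x\<close> is the entire extension of \<open>f\<close> along the line through \<open>x\<close> in the direction of
  the \<open>k\<close>-th coordinate.\<close>

locale coordinatewise_entire =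
  fixes f :: "real^'n \<Rightarrow> complex" and H :: "'n \<Rightarrow> real^'n \<Rightarrow> complex \<Rightarrow> complex"
  assumes H_cont: "\<And>k. continuous_on UNIV (\<lambda>p. H k (fst p) (snd p))"
    and H_hol: "\<And>k x. H k x holomorphic_on UNIV"
    and H_shift: "\<And>k x s z. H k (x + s *\<^sub>R axis k 1) z = H k x (z + of_real s)"
    and H_0: "\<And>k x. H k x 0 = f x"
begin

lemma f_measurable [measurable]: "f \<in> borel_measurable borel"
proof -
  have "continuous_on UNIV (\<lambda>x. H undefined (fst (x, 0 :: complex)) (snd (x, 0 :: complex)))"
    by (rule continuous_on_compose2[OF H_cont]) (auto intro!: continuous_intros)
  then show ?thesis by (simp add: H_0 borel_measurable_continuous_onI)
qed

text \<open>Valued in \<open>ennreal\<close>, so that Tonelli applies to it directly.\<close>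

definition cms :: "'n \<Rightarrow> real \<Rightarrow> real^'n \<Rightarrow> ennreal"
  where "cms k R x = ennreal (circle_mean_square (H k x) R 0)"

lemma cms_eq: "cms k R x = (\<integral>\<^sup>+t\<in>{0..1}. ennreal ((cmod (H k x (of_real R * exp (2 * of_real pi * \<i> * of_real t))))\<^sup>2) \<partial>lborel)"
  using nn_integral_circle_mean_square[OF H_hol, of k x 0 R] by (simp add: cms_def)

lemma H_circle_measurable [measurable]:
  "(\<lambda>q :: (real^'n) \<times> real. H k (fst q) (of_real R * exp (2 * of_real pi * \<i> * of_real (snd q)))) \<in> borel_measurable (borel \<Otimes>\<^sub>M borel)"
proof -
  have "continuous_on UNIV (\<lambda>q :: (real^'n) \<times> real. H k (fst (fst q, of_real R * exp (2 * of_real pi * \<i> * of_real (snd q)) :: complex)) (snd (fst q, of_real R * exp (2 * of_real pi * \<i> * of_real (snd q)) :: complex)))"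
    by (rule continuous_on_compose2[OF H_cont]) (auto intro!: continuous_intros)
  then have "(\<lambda>q :: (real^'n) \<times> real. H k (fst q) (of_real R * exp (2 * of_real pi * \<i> * of_real (snd q)))) \<in> borel_measurable borel"
    by (simp add: borel_measurable_continuous_onI)
  then show ?thesis by (simp add: borel_prod)
qed

lemma cms_measurable [measurable]: "cms k R \<in> borel_measurable borel"
proof -
  have "(\<lambda>x. \<integral>\<^sup>+t. ennreal ((cmod (H k (fst (x, t)) (of_real R * exp (2 * of_real pi * \<i> * of_real (snd (x, t))))))\<^sup>2) * indicator {0..1} t \<partial>lborel) \<in> borel_measurable borel"
    by (intro lborel.borel_measurable_nn_integral) measurable
  then show ?thesis by (simp add: cms_eq[abs_def])
qed

lemma nn_integral_cms:
  "(\<integral>\<^sup>+x. cms k R x \<partial>lborel) = (\<integral>\<^sup>+t\<in>{0..1}. (\<integral>\<^sup>+x. ennreal ((cmod (H k x (of_real R * exp (2 * of_real pi * \<i> * of_real t))))\<^sup>2) \<partial>lborel) \<partial>lborel)"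
proof -
  have m: "(\<lambda>q :: (real^'n) \<times> real. ennreal ((cmod (H k (fst q) (of_real R * exp (2 * of_real pi * \<i> * of_real (snd q)))))\<^sup>2) * indicator {0..1} (snd q)) \<in> borel_measurable (lborel \<Otimes>\<^sub>M lborel)"
    by measurable
  have "(\<integral>\<^sup>+x. cms k R x \<partial>lborel) = (\<integral>\<^sup>+t. (\<integral>\<^sup>+x. ennreal ((cmod (H k x (of_real R * exp (2 * of_real pi * \<i> * of_real t))))\<^sup>2) * indicator {0..1} t \<partial>lborel) \<partial>lborel)"
    unfolding cms_eq using lborel_pair.Fubini'[of "\<lambda>x t. ennreal ((cmod (H k x (of_real R * exp (2 * of_real pi * \<i> * of_real t))))\<^sup>2) * indicator {0..1} t"] m
    by (simp add: case_prod_beta)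
  also have "\<dots> = (\<integral>\<^sup>+t\<in>{0..1}. (\<integral>\<^sup>+x. ennreal ((cmod (H k x (of_real R * exp (2 * of_real pi * \<i> * of_real t))))\<^sup>2) \<partial>lborel) \<partial>lborel)"
    by (intro nn_integral_cong) (auto simp: indicator_def)
  finally show ?thesis .
qed

lemma observed_sets [measurable]: "observed L G r (K :: 'n set) \<in> sets borel"
proof -
  have "observed L G r K = (\<Union>m. {x. (\<forall>i\<in>UNIV. real_of_int \<lfloor>x $ i / L\<rfloor> = real_of_int (m $ i)) \<and> (\<forall>i\<in>K. \<bar>x $ i - G m $ i\<bar> \<le> r)})"
  proof (intro set_eqI iffI)
    fix x assume "x \<in> observed L G r K"
    then show "x \<in> (\<Union>m. {x. (\<forall>i\<in>UNIV. real_of_int \<lfloor>x $ i / L\<rfloor> = real_of_int (m $ i)) \<and> (\<forall>i\<in>K. \<bar>x $ i - G m $ i\<bar> \<le> r)})"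
      by (auto simp: observed_def cell_index_def intro!: exI[of _ "cell_index L x"])
  next
    fix x assume "x \<in> (\<Union>m. {x. (\<forall>i\<in>UNIV. real_of_int \<lfloor>x $ i / L\<rfloor> = real_of_int (m $ i)) \<and> (\<forall>i\<in>K. \<bar>x $ i - G m $ i\<bar> \<le> r)})"
    then obtain m where m: "\<And>i. \<lfloor>x $ i / L\<rfloor> = m $ i" "\<And>i. i \<in> K \<Longrightarrow> \<bar>x $ i - G m $ i\<bar> \<le> r" by auto
    then have "cell_index L x = m" by (simp add: cell_index_def vec_eq_iff)
    then show "x \<in> observed L G r K" using m by (auto simp: observed_def)
  qed
  moreover have "{x :: real^'n. (\<forall>i\<in>UNIV. real_of_int \<lfloor>x $ i / L\<rfloor> = real_of_int (m $ i)) \<and> (\<forall>i\<in>K. \<bar>x $ i - G m $ i\<bar> \<le> r)} \<in> sets borel" for m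
    by measurable
  ultimately show ?thesis by (simp only:) (intro sets.countable_UN'' countableI_type)
qed

text \<open>Along a line in direction k inside one cell, neither the cell index nor the constraints
  in \<open>K\<close> change, so \<open>interval_smallness\<close> applies to the entire extension
  along that line, about the point \<open>G m $ k\<close>. Averaging over these segments with
  \<open>nn_integral_cell_average\<close> gives the inequality on the whole space.\<close>

lemma smallness_step:
  assumes k: "k \<notin> K" and N: "N \<ge> 1" and L: "L > 0" and l: "0 < l" "l \<le> 1" "l * L \<le> r" and R: "2 * L \<le> R"
    and G: "\<And>m. of_int (m $ k) * L \<le> G m $ k" "\<And>m. G m $ k \<le> of_int (m $ k) * L + L"
  defines "B \<equiv> 24 * (144 / l ^ 3) ^ N"
  shows "(\<integral>\<^sup>+x\<in>observed L G r K. ennreal ((cmod (f x))\<^sup>2) \<partial>lborel)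
    \<le> ennreal B * (\<integral>\<^sup>+x\<in>observed L G r (insert k K). ennreal ((cmod (f x))\<^sup>2) \<partial>lborel)
      + ennreal (B * (L / R) ^ (2 * N)) * (\<integral>\<^sup>+x. cms k R x \<partial>lborel)"
proof -
  define e :: "real^'n" where "e = axis k 1"
  define cell where "cell x = {\<lfloor>x $ k / L\<rfloor> * L..<\<lfloor>x $ k / L\<rfloor> * L + L}" for x :: "real^'n"
  define F where "F S x = ennreal ((cmod (f x))\<^sup>2) * indicator (observed L G r S) x" for S x
  have [measurable]: "F S \<in> borel_measurable borel" for S unfolding F_def[abs_def] by measurable
  have pt: "(\<integral>\<^sup>+s\<in>cell x. F K (x + (s - x $ k) *\<^sub>R e) \<partial>lborel)
     \<le> ennreal B * (\<integral>\<^sup>+s\<in>cell x. F (insert k K) (x + (s - x $ k) *\<^sub>R e) \<partial>lborel)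
      + ennreal (B * (L / R) ^ (2 * N)) * (\<integral>\<^sup>+s\<in>cell x. cms k R (x + (s - x $ k) *\<^sub>R e) \<partial>lborel)" for x
  proof -
    \<comment> \<open>\<open>x\<close> with its k-th coordinate set to 0: the points of the line are
      \<open>x0 + s *\<^sub>R e\<close>, and s is their k-th coordinate.\<close>
    define x0 where "x0 = x - (x $ k) *\<^sub>R e"
    define m where "m = cell_index L x"
    have xs: "x + (s - x $ k) *\<^sub>R e = x0 + s *\<^sub>R e" for s by (simp add: x0_def algebra_simps)
    have comp: "(x0 + s *\<^sub>R e) $ i = (if i = k then s else x $ i)" for s i
      by (simp add: x0_def e_def axis_def)
    have ci: "cell_index L (x0 + s *\<^sub>R e) = m" if "s \<in> cell x" for s
    proof -
      have "\<lfloor>s / L\<rfloor> = \<lfloor>x $ k / L\<rfloor>" using that L by (simp add: cell_def floor_eq_iff field_simps)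
      then show ?thesis unfolding m_def cell_index_def comp by (auto simp: vec_eq_iff)
    qed
    have mk: "m $ k = \<lfloor>x $ k / L\<rfloor>" by (simp add: m_def cell_index_def)
    have oK: "x0 + s *\<^sub>R e \<in> observed L G r K \<longleftrightarrow> x \<in> observed L G r K" if "s \<in> cell x" for s
      using k unfolding observed_def mem_Collect_eq ci[OF that] m_def[symmetric] comp by auto
    have oK': "x0 + s *\<^sub>R e \<in> observed L G r (insert k K) \<longleftrightarrow> x \<in> observed L G r K \<and> \<bar>s - G m $ k\<bar> \<le> r" if "s \<in> cell x" for s
      using k unfolding observed_def mem_Collect_eq ci[OF that] m_def[symmetric] comp by auto
    show ?thesis
    proof (cases "x \<in> observed L G r K")
      case False
      then have "(\<integral>\<^sup>+s\<in>cell x. F K (x + (s - x $ k) *\<^sub>R e) \<partial>lborel) = (\<integral>\<^sup>+s. 0 \<partial>(lborel :: real measure))"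
        unfolding xs F_def by (intro nn_integral_cong) (auto simp: indicator_def oK)
      then show ?thesis by simp
    next
      case True
      define h where "h = H k x0"
      have hf: "h (of_real s) = f (x0 + s *\<^sub>R e)" for s
        unfolding h_def e_def using H_shift[of k x0 s 0] H_0[of k "x0 + s *\<^sub>R axis k 1"] by simp
      have hc: "circle_mean_square h R (of_real s) = circle_mean_square (H k (x0 + s *\<^sub>R e)) R 0" for s
        unfolding circle_mean_square_def h_def e_def H_shift by (simp add: add.commute)
      define a where "a = of_int (m $ k) * L"
      have cell: "cell x = {a..<a + L}" by (simp add: cell_def a_def mk)
      have "(\<integral>\<^sup>+s\<in>{a..<a + L}. ennreal ((cmod (h (of_real s)))\<^sup>2) \<partial>lborel)
        \<le> ennreal B * (\<integral>\<^sup>+s\<in>{a..<a + L} \<inter> {G m $ k - r..G m $ k + r}. ennreal ((cmod (h (of_real s)))\<^sup>2) \<partial>lborel)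
         + ennreal (B * ((a + L - a) / R) ^ (2 * N)) * (\<integral>\<^sup>+s\<in>{a..<a + L}. ennreal (circle_mean_square h R (of_real s)) \<partial>lborel)"
        unfolding B_def using L l R N G[of m] by (intro interval_smallness) (auto simp: h_def H_hol a_def)
      also have "(\<integral>\<^sup>+s\<in>{a..<a + L}. ennreal ((cmod (h (of_real s)))\<^sup>2) \<partial>lborel) = (\<integral>\<^sup>+s\<in>cell x. F K (x + (s - x $ k) *\<^sub>R e) \<partial>lborel)"
        unfolding xs F_def hf cell[symmetric] using True by (intro nn_integral_cong) (auto simp: indicator_def oK)
      also have "(\<integral>\<^sup>+s\<in>{a..<a + L} \<inter> {G m $ k - r..G m $ k + r}. ennreal ((cmod (h (of_real s)))\<^sup>2) \<partial>lborel) = (\<integral>\<^sup>+s\<in>cell x. F (insert k K) (x + (s - x $ k) *\<^sub>R e) \<partial>lborel)"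
        unfolding xs F_def hf cell[symmetric] using True by (intro nn_integral_cong) (auto simp: indicator_def oK' abs_le_iff)
      also have "(\<integral>\<^sup>+s\<in>{a..<a + L}. ennreal (circle_mean_square h R (of_real s)) \<partial>lborel) = (\<integral>\<^sup>+s\<in>cell x. cms k R (x + (s - x $ k) *\<^sub>R e) \<partial>lborel)"
        unfolding xs hc cms_def cell ..
      finally show ?thesis by simp
    qed
  qed
  have avg: "(\<integral>\<^sup>+x. (\<integral>\<^sup>+s\<in>cell x. Q (x + (s - x $ k) *\<^sub>R e) \<partial>lborel) \<partial>lborel) = ennreal L * (\<integral>\<^sup>+x. Q x \<partial>lborel)"
    if "Q \<in> borel_measurable borel" for Q :: "real^'n \<Rightarrow> ennreal"
    unfolding cell_def e_def by (rule nn_integral_cell_average[OF that L])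
  have cm: "(\<lambda>x. \<integral>\<^sup>+s\<in>cell x. Q (x + (s - x $ k) *\<^sub>R e) \<partial>lborel) \<in> borel_measurable lborel"
    if [measurable]: "Q \<in> borel_measurable borel" for Q :: "real^'n \<Rightarrow> ennreal"
  proof -
    have "indicator (cell x) s = (if real_of_int \<lfloor>x $ k / L\<rfloor> * L \<le> s \<and> s < real_of_int \<lfloor>x $ k / L\<rfloor> * L + L then 1 else 0 :: ennreal)" for x s
      by (simp add: cell_def indicator_def)
    then show ?thesis by simp
  qed
  have "ennreal L * (\<integral>\<^sup>+x. F K x \<partial>lborel) \<le>
    (\<integral>\<^sup>+x. ennreal B * (\<integral>\<^sup>+s\<in>cell x. F (insert k K) (x + (s - x $ k) *\<^sub>R e) \<partial>lborel)
      + ennreal (B * (L / R) ^ (2 * N)) * (\<integral>\<^sup>+s\<in>cell x. cms k R (x + (s - x $ k) *\<^sub>R e) \<partial>lborel) \<partial>lborel)"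
    unfolding avg[of "F K", symmetric, simplified] by (intro nn_integral_mono pt)
  also have "\<dots> = ennreal B * (ennreal L * (\<integral>\<^sup>+x. F (insert k K) x \<partial>lborel)) + ennreal (B * (L / R) ^ (2 * N)) * (ennreal L * (\<integral>\<^sup>+x. cms k R x \<partial>lborel))"
    using cm[of "F (insert k K)"] cm[of "cms k R"] by (subst nn_integral_add) (auto simp: nn_integral_cmult avg)
  finally have "ennreal (1 / L) * (ennreal L * (\<integral>\<^sup>+x. F K x \<partial>lborel)) \<le> ennreal (1 / L) * (ennreal B * (ennreal L * (\<integral>\<^sup>+x. F (insert k K) x \<partial>lborel)) + ennreal (B * (L / R) ^ (2 * N)) * (ennreal L * (\<integral>\<^sup>+x. cms k R x \<partial>lborel)))"
    by (intro mult_left_mono) auto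
  moreover have "ennreal (1 / L) * ennreal L = 1" using L by (simp flip: ennreal_mult)
  then have "ennreal (1 / L) * (ennreal L * X) = X" "ennreal (1 / L) * (X * (ennreal L * Y)) = X * Y" for X Y
    by (simp_all add: mult.assoc[symmetric]) (simp add: mult_ac)
  ultimately show ?thesis by (simp add: F_def distrib_left)
qed

text \<open>Each step constrains one more coordinate, multiplies what was accumulated by B and adds
  an error of size B (L / R)^(2 N) E. Since B >= 1, the n errors are together at most n times the
  largest, which carries B^n.\<close>

lemma smallness_propagation:
  assumes N: "N \<ge> 1" and L: "L > 0" and l: "0 < l" "l \<le> 1" "l * L \<le> r" and R: "2 * L \<le> R"
    and G: "\<And>m k. of_int (m $ k) * L \<le> G m $ k" "\<And>m k. G m $ k \<le> of_int (m $ k) * L + L"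
    and E: "\<And>k. (\<integral>\<^sup>+x. cms k R x \<partial>lborel) \<le> ennreal E" and E0: "E \<ge> 0"
  defines "B \<equiv> 24 * (144 / l ^ 3) ^ N"
  shows "(\<integral>\<^sup>+x. ennreal ((cmod (f x))\<^sup>2) \<partial>lborel)
    \<le> ennreal (B ^ CARD('n)) * (\<integral>\<^sup>+x\<in>observed L G r UNIV. ennreal ((cmod (f x))\<^sup>2) \<partial>lborel)
      + ennreal (real CARD('n) * B ^ CARD('n) * (L / R) ^ (2 * N) * E)"
proof -
  have "l ^ 3 \<le> 1" using l by (simp add: power_le_one)
  then have "1 \<le> (144 / l ^ 3) ^ N" using l by (intro one_le_power) (simp add: field_simps)
  then have B1: "B \<ge> 1" by (simp add: B_def)
  define q where "q = (L / R) ^ (2 * N)"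
  have q0: "q \<ge> 0" using L R by (simp add: q_def)
  have "(\<integral>\<^sup>+x. ennreal ((cmod (f x))\<^sup>2) \<partial>lborel)
    \<le> ennreal (B ^ card K) * (\<integral>\<^sup>+x\<in>observed L G r K. ennreal ((cmod (f x))\<^sup>2) \<partial>lborel)
      + ennreal (real (card K) * B ^ card K * q * E)" if "finite K" for K
    using that
  proof (induction K)
    case empty
    have "observed L G r {} = UNIV" by (simp add: observed_def)
    then show ?case by simp
  next
    case (insert k K)
    let ?I = "\<lambda>S. \<integral>\<^sup>+x\<in>observed L G r S. ennreal ((cmod (f x))\<^sup>2) \<partial>lborel"
    have st: "?I K \<le> ennreal B * ?I (insert k K) + ennreal (B * q * E)"
    proof -
      have "?I K \<le> ennreal B * ?I (insert k K) + ennreal (B * q) * (\<integral>\<^sup>+x. cms k R x \<partial>lborel)"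
        unfolding B_def q_def using insert N L l R G by (intro smallness_step) auto
      also have "\<dots> \<le> ennreal B * ?I (insert k K) + ennreal (B * q) * ennreal E"
        by (intro add_left_mono mult_left_mono E) auto
      finally show ?thesis using B1 q0 E0 by (simp flip: ennreal_mult)
    qed
    have "(\<integral>\<^sup>+x. ennreal ((cmod (f x))\<^sup>2) \<partial>lborel) \<le> ennreal (B ^ card K) * (ennreal B * ?I (insert k K) + ennreal (B * q * E)) + ennreal (real (card K) * B ^ card K * q * E)"
      by (rule order_trans[OF insert.IH]) (intro add_right_mono mult_left_mono st, simp)
    also have "\<dots> = ennreal (B ^ Suc (card K)) * ?I (insert k K) + ennreal (B ^ Suc (card K) * q * E + real (card K) * B ^ card K * q * E)"
      using B1 q0 E0 by (simp add: distrib_left add.assoc mult.assoc[symmetric] mult.commute[of B] flip: ennreal_mult ennreal_plus)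
    also have "\<dots> \<le> ennreal (B ^ Suc (card K)) * ?I (insert k K) + ennreal (real (Suc (card K)) * B ^ Suc (card K) * q * E)"
    proof (intro add_left_mono ennreal_leI)
      have "B ^ card K \<le> B ^ Suc (card K)" using B1 by (intro power_increasing) auto
      then have "real (card K) * (B ^ card K) * (q * E) \<le> real (card K) * (B ^ Suc (card K)) * (q * E)"
        using q0 E0 by (intro mult_right_mono mult_left_mono) auto
      then show "B ^ Suc (card K) * q * E + real (card K) * B ^ card K * q * E \<le> real (Suc (card K)) * B ^ Suc (card K) * q * E"
        by (simp add: algebra_simps)
    qed
    finally show ?case using insert by simp
  qed
  from this[of UNIV] show ?thesis by (simp add: q_def)
qed

end

section \<open>From interpolation to observability\<close>

text \<open>The times \<open>T q\<^sup>j\<close> decrease to 0 so slowly (\<open>q\<^sup>-\<^sup>m = \<sigma>\<close> close to 1) that the weights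
  \<open>exp (- G \<sigma>\<^sup>j)\<close> absorb both the blow-up of the interpolation constants and the loss of the previous
  step; the resulting inequalities are telescoped.\<close>

lemma observability_telescope:
  fixes K A D T :: real and m :: nat
  assumes K: "K > 0" and A: "A \<ge> 1" and D: "D \<ge> 0" and m: "m \<ge> 1" and T: "T > 0"
  shows "\<exists>C>0. \<forall>a b :: real \<Rightarrow> real.
    (\<forall>t. 0 \<le> t \<longrightarrow> 0 \<le> a t) \<longrightarrow> (\<forall>t. 0 \<le> t \<longrightarrow> 0 \<le> b t) \<longrightarrow> (\<forall>s t. 0 \<le> s \<longrightarrow> s \<le> t \<longrightarrow> a t \<le> a s) \<longrightarrow>
    continuous_on {0..T} b \<longrightarrow>
    (\<forall>s t N. 0 \<le> s \<longrightarrow> s < t \<longrightarrow> t \<le> T \<longrightarrow> (1 :: nat) \<le> N \<longrightarrow>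
       a t \<le> K * A ^ N * b t + K * (1/2) ^ N * exp (D / (t - s) ^ m) * a s) \<longrightarrow>
    a T \<le> C * integral {0..T} b"
proof -
  \<comment> \<open>So close to 1 that 4 A (\<sigma> - 1) = 1, which makes the coupled choice of
    \<open>G\<close> and \<open>\<beta>\<close> solvable.\<close>
  define \<sigma> where "\<sigma> = 1 + 1 / (4 * A)"
  have \<sigma>: "\<sigma> > 1" "4 * A * (\<sigma> - 1) = 1" using A by (auto simp: \<sigma>_def)
  define q where "q = root m (1 / \<sigma>)"
  have q: "0 < q" "q < 1" "q ^ m = 1 / \<sigma>"
    using m \<sigma>(1) by (auto simp: q_def real_root_gt_0_iff)
  define D' where "D' = D * (2 / (T * (1 - q))) ^ m"
  have D': "D' \<ge> 0" using D T q by (simp add: D'_def)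
  \<comment> \<open>Two demands are coupled. The number of Taylor terms per unit of
    \<open>X j\<close> is \<open>\<beta>\<close>, and \<open>loss\<close> asks for \<beta> = 2 (K +
    D' + G (\<sigma> - 1)); the decay \<open>G\<close> of the weights has to equal A \<beta> + 1 for
    \<open>gain\<close>. With 4 A (\<sigma> - 1) = 1 the term A \<beta> contains only G / 2, and
    solving for G gives this value.\<close>
  define G where "G = 2 * (2 * A * (K + D') + 1)"
  have G: "G > 0" using A K D' by (simp add: G_def add_nonneg_pos)
  define \<beta> where "\<beta> = 2 * (K + D' + G * (\<sigma> - 1))"
  have \<beta>: "\<beta> > 0" using K D' G \<sigma> by (simp add: \<beta>_def add_pos_nonneg add_nonneg_pos)
  define X where "X j = \<sigma> ^ j" for j
  have X1: "X j \<ge> 1" for j using \<sigma> by (simp add: X_def one_le_power)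
  have XS: "X (Suc j) = \<sigma> * X j" for j by (simp add: X_def)
  define N where "N j = nat \<lceil>\<beta> * X j\<rceil>" for j
  have bX: "\<beta> * X j > 0" for j using \<beta> X1[of j] by (intro mult_pos_pos) auto
  have N: "\<beta> * X j \<le> real (N j)" "real (N j) \<le> \<beta> * X j + 1" "N j \<ge> 1" for j
  proof -
    show "\<beta> * X j \<le> real (N j)" unfolding N_def by linarith
    show "real (N j) \<le> \<beta> * X j + 1" unfolding N_def using bX[of j] by linarith
    show "N j \<ge> 1" unfolding N_def using bX[of j] by linarith
  qed
  define w where "w j = exp (- G * X j)" for j
  define t where "t j = T * q ^ j" for j
  have t0: "t 0 = T" by (simp add: t_def)
  have tp: "t j > 0" for j using T q by (simp add: t_def)
  define \<tau> where "\<tau> j = t j - t (Suc j)" for j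
  have \<tau>_eq: "\<tau> j = T * (1 - q) * q ^ j" for j by (simp add: \<tau>_def t_def algebra_simps)
  have \<tau>p: "\<tau> j > 0" for j using T q by (simp add: \<tau>_eq)
  have tT: "t j \<le> T" for j using T q by (simp add: t_def power_le_one mult_le_cancel_left1)
  define C0 where "C0 = 2 * K * exp A / (T * (1 - q))"
  have C0: "C0 > 0" using K T q by (simp add: C0_def)
  have qX: "1 / q ^ j \<le> X j" for j
  proof -
    have "q ^ m \<le> q ^ 1" using q m by (intro power_decreasing) auto
    then have "1 / q \<le> \<sigma>" using q \<sigma> by (simp add: field_simps)
    then have "(1 / q) ^ j \<le> \<sigma> ^ j" using q by (intro power_mono) auto
    then show ?thesis by (simp add: X_def power_one_over)
  qed
  have xexp: "x \<le> exp x" for x :: real using exp_ge_add_one_self[of x] by linarith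
  \<comment> \<open>The exponential factor equals exp (D' X j). The estimate 1/2 <= exp (- 1/2)
    explains the factor 2 in \<open>\<beta>\<close>, and the surplus G (\<sigma> - 1) is exactly
    what leads from one weight to the next.\<close>
  have loss: "w j * (K * (1/2) ^ N j * exp (D / (\<tau> j / 2) ^ m)) \<le> w (Suc j)" for j
  proof -
    have "(\<tau> j / 2) ^ m = (T * (1 - q) / 2) ^ m * (q ^ m) ^ j"
      unfolding \<tau>_eq by (simp add: power_mult_distrib power_divide mult.commute flip: power_mult)
    then have "D / (\<tau> j / 2) ^ m = D' * X j"
      unfolding q(3) D'_def X_def by (simp add: power_divide field_simps)
    moreover have "K \<le> exp (K * X j)"
      using order_trans[OF xexp[of K], of "exp (K * X j)"] X1[of j] K by simp
    moreover have "(1/2 :: real) ^ N j \<le> exp (- (K + D' + G * (\<sigma> - 1)) * X j)"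
    proof -
      have "(1/2 :: real) \<le> exp (- (1/2))"
        using exp_ge_add_one_self[of "- (1/2) :: real"] by simp
      then have "(1/2 :: real) ^ N j \<le> exp (- (1/2)) ^ N j" by (intro power_mono) auto
      also have "\<dots> = exp (real (N j) * (- (1/2)))" by (rule exp_of_nat_mult[symmetric])
      also have "\<dots> \<le> exp (- (K + D' + G * (\<sigma> - 1)) * X j)" using N(1)[of j] by (simp add: \<beta>_def algebra_simps)
      finally show ?thesis .
    qed
    ultimately have "K * (1/2) ^ N j * exp (D / (\<tau> j / 2) ^ m) \<le> exp (K * X j) * exp (- (K + D' + G * (\<sigma> - 1)) * X j) * exp (D' * X j)"
      using K by (simp only:) (intro mult_right_mono mult_mono, auto)
    also have "\<dots> = exp (- G * (\<sigma> - 1) * X j)" by (simp add: algebra_simps flip: exp_add)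
    finally have "w j * (K * (1/2) ^ N j * exp (D / (\<tau> j / 2) ^ m)) \<le> w j * exp (- G * (\<sigma> - 1) * X j)"
      by (intro mult_left_mono) (auto simp: w_def)
    also have "\<dots> = w (Suc j)" by (simp add: w_def XS algebra_simps flip: exp_add)
    finally show ?thesis .
  qed
  \<comment> \<open>By A <= exp A and 1 / q^j <= X j, the cost A^N / \<tau> j grows at most like exp
    (X j (A \<beta> + 1)), which the weight cancels. The factor exp A in \<open>C0\<close> is the
    price of rounding N up.\<close>
  have gain: "w j * (2 * K * A ^ N j / \<tau> j) \<le> C0" for j
  proof -
    have "A ^ N j \<le> exp A ^ N j" using xexp[of A] A by (intro power_mono) auto
    also have "\<dots> = exp (real (N j) * A)" by (rule exp_of_nat_mult[symmetric])
    also have "\<dots> \<le> exp ((\<beta> * X j + 1) * A)" using N(2)[of j] A by simp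
    finally have AN: "A ^ N j \<le> exp ((\<beta> * X j + 1) * A)" .
    have "w j * (2 * K * A ^ N j / \<tau> j) = 2 * K / (T * (1 - q)) * (w j * A ^ N j * (1 / q ^ j))"
      by (simp add: \<tau>_eq)
    also have "\<dots> \<le> 2 * K / (T * (1 - q)) * (w j * exp ((\<beta> * X j + 1) * A) * exp (X j))"
      using AN qX[of j] xexp[of "X j"] K T q A
      by (intro mult_left_mono mult_mono) (auto simp: w_def intro: order_trans)
    also have "w j * exp ((\<beta> * X j + 1) * A) * exp (X j) = exp (A + X j * (A * \<beta> + 1 - G))"
      unfolding w_def by (simp add: algebra_simps flip: exp_add)
    also have "A * \<beta> + 1 - G = 0"
    proof -
      have "A * \<beta> = 2 * A * (K + D') + G / 2 * (4 * A * (\<sigma> - 1))" by (simp add: \<beta>_def algebra_simps)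
      then show ?thesis unfolding \<sigma>(2) by (simp add: G_def field_simps)
    qed
    finally show ?thesis by (simp add: C0_def)
  qed
  define C where "C = C0 / w 0"
  have C: "C > 0" using C0 by (simp add: C_def w_def)
  have "a T \<le> C * integral {0..T} b"
    if a0: "\<And>t. 0 \<le> t \<Longrightarrow> 0 \<le> a t" and b0: "\<And>t. 0 \<le> t \<Longrightarrow> 0 \<le> b t"
      and dec: "\<And>s t. 0 \<le> s \<Longrightarrow> s \<le> t \<Longrightarrow> a t \<le> a s" and bc: "continuous_on {0..T} b"
      and ineq: "\<And>s t N. 0 \<le> s \<Longrightarrow> s < t \<Longrightarrow> t \<le> T \<Longrightarrow> (1 :: nat) \<le> N \<Longrightarrow>
         a t \<le> K * A ^ N * b t + K * (1/2) ^ N * exp (D / (t - s) ^ m) * a s"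
    for a b :: "real \<Rightarrow> real"
  proof -
    have bi: "b integrable_on {u..v}" if "0 \<le> u" "v \<le> T" for u v
      using that by (intro integrable_continuous_interval continuous_on_subset[OF bc]) auto
    define I where "I j = integral {t (Suc j)..t j} b" for j
    have ts: "t (Suc j) \<le> t j" for j using \<tau>p[of j] by (simp add: \<tau>_def)
    have I0: "I j \<ge> 0" for j unfolding I_def
      using tp[of "Suc j"] tT[of j] by (intro integral_nonneg bi b0) auto
    have step: "w j * a (t j) \<le> C0 * I j + w (Suc j) * a (t (Suc j))" for j
    proof -
      \<comment> \<open>Only the upper half of the interval between consecutive times is integrated:
        there the elapsed time is at least \<open>\<tau> j / 2\<close>, and the exponential factor
        is uniformly bounded.\<close>
      define u where "u = t j - \<tau> j / 2"
      have u: "t (Suc j) \<le> u" "u \<le> t j" "u - t (Suc j) = \<tau> j / 2" using \<tau>p[of j] by (auto simp: u_def \<tau>_def field_simps)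
      define L where "L = K * (1/2) ^ N j * exp (D / (\<tau> j / 2) ^ m) * a (t (Suc j))"
      have "integral {u..t j} (\<lambda>_. a (t j) - L) \<le> integral {u..t j} (\<lambda>s. K * A ^ N j * b s)"
      proof (rule integral_le)
        show "(\<lambda>_. a (t j) - L) integrable_on {u..t j}" by (rule integrable_const_ivl)
        show "(\<lambda>s. K * A ^ N j * b s) integrable_on {u..t j}"
          using u tp[of "Suc j"] tT[of j] by (intro integrable_on_mult_right bi) auto
        fix s assume s: "s \<in> {u..t j}"
        have sp: "t (Suc j) < s" using s u \<tau>p[of j] by auto
        have "a (t j) \<le> a s" using s sp tp[of "Suc j"] by (intro dec) auto
        also have "\<dots> \<le> K * A ^ N j * b s + K * (1/2) ^ N j * exp (D / (s - t (Suc j)) ^ m) * a (t (Suc j))"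
          using sp s tp[of "Suc j"] tT[of j] N(3)[of j] by (intro ineq) auto
        also have "K * (1/2) ^ N j * exp (D / (s - t (Suc j)) ^ m) * a (t (Suc j)) \<le> L"
        proof -
          have "(\<tau> j / 2) ^ m \<le> (s - t (Suc j)) ^ m" using s u \<tau>p[of j] by (intro power_mono) auto
          then have "D / (s - t (Suc j)) ^ m \<le> D / (\<tau> j / 2) ^ m" using D \<tau>p[of j] by (intro divide_left_mono) (auto intro!: mult_pos_pos zero_less_power sp simp: sp)
          then show ?thesis unfolding L_def using K a0[of "t (Suc j)"] tp[of "Suc j"] by (intro mult_right_mono mult_left_mono) auto
        qed
        finally show "a (t j) - L \<le> K * A ^ N j * b s" by simp
      qed
      also have "\<dots> = K * A ^ N j * integral {u..t j} b" by simp
      also have "\<dots> \<le> K * A ^ N j * I j"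
        unfolding I_def using K A u tp[of "Suc j"] tT[of j]
        by (intro mult_left_mono integral_subset_le bi) (auto intro!: b0)
      finally have "\<tau> j / 2 * (a (t j) - L) \<le> K * A ^ N j * I j" using u \<tau>p[of j] by (simp add: u_def)
      then have "a (t j) \<le> 2 * K * A ^ N j / \<tau> j * I j + L" using \<tau>p[of j] by (simp add: field_simps)
      then have "w j * a (t j) \<le> w j * (2 * K * A ^ N j / \<tau> j * I j + L)" by (intro mult_left_mono) (auto simp: w_def)
      also have "\<dots> = (w j * (2 * K * A ^ N j / \<tau> j)) * I j + (w j * (K * (1/2) ^ N j * exp (D / (\<tau> j / 2) ^ m))) * a (t (Suc j))"
        by (simp add: L_def distrib_left)
      also have "\<dots> \<le> C0 * I j + w (Suc j) * a (t (Suc j))"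
        using gain[of j] loss[of j] I0[of j] a0[of "t (Suc j)"] tp[of "Suc j"] by (intro add_mono mult_right_mono) auto
      finally show ?thesis .
    qed
    have sum: "w 0 * a T \<le> C0 * integral {t J..T} b + w J * a (t J)" for J
    proof (induction J)
      case 0 then show ?case by (simp add: t0)
    next
      case (Suc J)
      have "integral {t (Suc J)..T} b = I J + integral {t J..T} b"
        unfolding I_def using tp[of "Suc J"] tT[of J] ts[of J] by (intro Henstock_Kurzweil_Integration.integral_combine[symmetric] bi) auto
      then show ?case using Suc step[of J] by (simp add: distrib_left)
    qed
    have "w 0 * a T \<le> C0 * integral {0..T} b + w J * a 0" for J
    proof -
      have "integral {t J..T} b \<le> integral {0..T} b"
        using tp[of J] by (intro integral_subset_le bi) (auto intro!: b0)
      then have "C0 * integral {t J..T} b \<le> C0 * integral {0..T} b" using C0 by simp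
      moreover have "w J * a (t J) \<le> w J * a 0" using dec[of 0 "t J"] tp[of J] by (intro mult_left_mono) (auto simp: w_def)
      ultimately show ?thesis using sum[of J] by linarith
    qed
    \<comment> \<open>The weights tend to 0 while \<open>a 0\<close> is fixed, so the remainder of
      the telescoped sum disappears.\<close>
    moreover have "(\<lambda>J. C0 * integral {0..T} b + w J * a 0) \<longlonglongrightarrow> C0 * integral {0..T} b + 0 * a 0"
    proof (intro tendsto_intros)
      have "filterlim X at_top sequentially" unfolding X_def[abs_def] using \<sigma>(1)
        by (intro filterlim_at_infinity_imp_filterlim_at_top filterlim_realpow_sequentially_gt1) auto
      then have "filterlim (\<lambda>j. G * X j) at_top sequentially" using G by (intro filterlim_tendsto_pos_mult_at_top[OF tendsto_const])
      then have "filterlim (\<lambda>j. - (G * X j)) at_bot sequentially" by (simp add: filterlim_uminus_at_bot)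
      then show "w \<longlonglongrightarrow> 0" unfolding w_def[abs_def] using filterlim_compose[OF exp_at_bot] by simp
    qed
    ultimately have "w 0 * a T \<le> C0 * integral {0..T} b"
      by (intro LIMSEQ_le_const[where X = "\<lambda>J. C0 * integral {0..T} b + w J * a 0"]) auto
    then show ?thesis by (simp add: C_def w_def field_simps)
  qed
  then show ?thesis using C by (intro exI[of _ C]) blast
qed

section \<open>Interpolation and observability\<close>

context ornstein_uhlenbeck
begin

text \<open>The evolved polynomial at the complex point x + i y; for y = 0 it is what
  \<open>S \<tau>\<close> makes of the polynomial, up to a null set.\<close>

definition wave :: "(real^'n) set \<Rightarrow> (real^'n \<Rightarrow> complex) \<Rightarrow> real \<Rightarrow> real^'n \<Rightarrow> real^'n \<Rightarrow> complex"
  where "wave F c \<tau> y x = (\<Sum>\<xi>\<in>F. c \<xi> * of_real (ev_coeff \<xi> \<tau> * exp (- (freq \<tau> \<xi> \<bullet> y))) * cis (freq \<tau> \<xi> \<bullet> x))"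

text \<open>The holomorphic extension in the \<open>k\<close>-th coordinate of the evolved polynomial times the square root
  of the weight.\<close>

definition extension :: "(real^'n) set \<Rightarrow> (real^'n \<Rightarrow> complex) \<Rightarrow> real \<Rightarrow> 'n \<Rightarrow> real^'n \<Rightarrow> complex \<Rightarrow> complex"
  where "extension F c \<tau> k x z =
    (\<Sum>\<xi>\<in>F. c \<xi> * of_real (ev_coeff \<xi> \<tau>) * exp (\<i> * (of_real (freq \<tau> \<xi> \<bullet> x) + z * of_real (freq \<tau> \<xi> $ k))))
    * (of_real (sqrt weight_const)
      * exp (- (1/4) * (of_real ((\<Lambda> *v x) \<bullet> x) + 2 * z * of_real ((\<Lambda> *v x) $ k) + z\<^sup>2 * of_real (\<Lambda> $ k $ k))))"

lemma \<Lambda>_axis: "(\<Lambda> *v axis k 1) \<bullet> x = (\<Lambda> *v x) $ k" "(\<Lambda> *v axis k 1) $ k = \<Lambda> $ k $ k"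
proof -
  show "(\<Lambda> *v axis k 1) \<bullet> x = (\<Lambda> *v x) $ k" for x
    by (simp add: symmetric_inner[OF \<Lambda>_symmetric] inner_axis')
  show "(\<Lambda> *v axis k 1) $ k = \<Lambda> $ k $ k"
    by (simp add: matrix_vector_mult_basis column_def)
qed

text \<open>Along a coordinate line the phases are affine and the quadratic form of \<Lambda> is a
  quadratic polynomial in the line parameter, so the parameter may be complex. The shift property is
  the identity between these polynomials at z and z + s.\<close>

lemma extension_coordinatewise_entire:
  "coordinatewise_entire (\<lambda>x. extension F c \<tau> undefined x 0) (extension F c \<tau>)"
proof
  fix k
  show "continuous_on UNIV (\<lambda>p. extension F c \<tau> k (fst p) (snd p))"
    unfolding extension_def
    by (intro continuous_intros bounded_linear.continuous_on[OF matrix_vector_mul_bounded_linear])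
  show "extension F c \<tau> k x holomorphic_on UNIV" for x
    unfolding extension_def by (intro holomorphic_intros)
  show "extension F c \<tau> k x 0 = extension F c \<tau> undefined x 0" for x
    by (simp add: extension_def)
  fix x :: "real^'n" and s :: real and z :: complex
  have 1: "of_real (freq \<tau> \<xi> \<bullet> (x + s *\<^sub>R axis k 1)) + z * of_real (freq \<tau> \<xi> $ k)
      = of_real (freq \<tau> \<xi> \<bullet> x) + (z + of_real s) * of_real (freq \<tau> \<xi> $ k)" for \<xi>
    by (simp add: inner_add_right inner_axis algebra_simps)
  have 2: "(\<Lambda> *v (x + s *\<^sub>R axis k 1)) $ k = (\<Lambda> *v x) $ k + s * \<Lambda> $ k $ k"
    by (simp add: matrix_vector_right_distrib matrix_vector_mult_scaleR \<Lambda>_axis)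
  have 3: "(\<Lambda> *v (x + s *\<^sub>R axis k 1)) \<bullet> (x + s *\<^sub>R axis k 1) = (\<Lambda> *v x) \<bullet> x + 2 * s * (\<Lambda> *v x) $ k + s\<^sup>2 * \<Lambda> $ k $ k"
    by (simp add: matrix_vector_right_distrib matrix_vector_mult_scaleR inner_add_left inner_add_right inner_axis \<Lambda>_axis power2_eq_square algebra_simps)
  have 4: "of_real ((\<Lambda> *v (x + s *\<^sub>R axis k 1)) \<bullet> (x + s *\<^sub>R axis k 1)) + 2 * z * of_real ((\<Lambda> *v (x + s *\<^sub>R axis k 1)) $ k) + z\<^sup>2 * of_real (\<Lambda> $ k $ k)
      = of_real ((\<Lambda> *v x) \<bullet> x) + 2 * (z + of_real s) * of_real ((\<Lambda> *v x) $ k) + (z + of_real s)\<^sup>2 * of_real (\<Lambda> $ k $ k)"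
    unfolding 2 3 by (simp add: power2_eq_square algebra_simps)
  show "extension F c \<tau> k (x + s *\<^sub>R axis k 1) z = extension F c \<tau> k x (z + of_real s)"
    unfolding extension_def 1 4 ..
qed

text \<open>At z = i b the phases give the polynomial shifted by b along the k-th axis, and the
  continued square root of the Gaussian gains the modulus exp (b^2 \<Lambda>_kk / 4). Imaginary z
  suffice, since a real part of z is a translation of \<open>x\<close>.\<close>

lemma extension_modulus:
  "(cmod (extension F c \<tau> k x (\<i> * of_real b)))\<^sup>2
    = exp (1/2 * b\<^sup>2 * \<Lambda> $ k $ k) * (weight_const * gauss x * (cmod (wave F c \<tau> (b *\<^sub>R axis k 1) x))\<^sup>2)"
proof -
  have "exp (\<i> * (of_real (freq \<tau> \<xi> \<bullet> x) + \<i> * of_real b * of_real (freq \<tau> \<xi> $ k)))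
      = of_real (exp (- (freq \<tau> \<xi> \<bullet> (b *\<^sub>R axis k 1)))) * cis (freq \<tau> \<xi> \<bullet> x)" for \<xi>
    by (simp add: inner_axis cis_conv_exp exp_of_real[symmetric] exp_add[symmetric] algebra_simps)
  then have w: "(\<Sum>\<xi>\<in>F. c \<xi> * of_real (ev_coeff \<xi> \<tau>) * exp (\<i> * (of_real (freq \<tau> \<xi> \<bullet> x) + \<i> * of_real b * of_real (freq \<tau> \<xi> $ k))))
      = wave F c \<tau> (b *\<^sub>R axis k 1) x"
    by (simp add: wave_def mult.assoc)
  define v where "v = - (1/4) * (of_real ((\<Lambda> *v x) \<bullet> x) + 2 * (\<i> * of_real b) * of_real ((\<Lambda> *v x) $ k) + (\<i> * of_real b)\<^sup>2 * complex_of_real (\<Lambda> $ k $ k))"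
  have v: "2 * Re v = 1/2 * b\<^sup>2 * \<Lambda> $ k $ k + - (1/2) * ((\<Lambda> *v x) \<bullet> x)"
    by (simp add: v_def power2_eq_square field_simps)
  have "(cmod (exp v))\<^sup>2 = exp (2 * Re v)" by (simp add: exp_double)
  also have "\<dots> = exp (1/2 * b\<^sup>2 * \<Lambda> $ k $ k) * gauss x" unfolding v exp_add gauss_def ..
  finally show ?thesis
    unfolding extension_def w v_def[symmetric] using weight_const_pos
    by (simp add: norm_mult power_mult_distrib mult_ac del: norm_exp_eq_Re)
qed

lemma wave_measurable [measurable]: "wave F c \<tau> y \<in> borel_measurable borel"
  unfolding wave_def[abs_def] by measurable

lemma wave_L2: "wave F c \<tau> y \<in> L2_fun \<rho>"
proof (rule ac.L2_fun_bounded[OF wave_measurable])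
  show "cmod (wave F c \<tau> y x) \<le> (\<Sum>\<xi>\<in>F. cmod (c \<xi> * of_real (ev_coeff \<xi> \<tau> * exp (- (freq \<tau> \<xi> \<bullet> y)))))" for x
    unfolding wave_def by (rule order_trans[OF norm_sum]) (simp add: norm_mult)
qed

lemma nn_integral_extension:
  assumes A: "A \<in> sets borel"
  shows "(\<integral>\<^sup>+x\<in>A. ennreal ((cmod (extension F c \<tau> k x (\<i> * of_real b)))\<^sup>2) \<partial>lborel)
    = ennreal (exp (1/2 * b\<^sup>2 * \<Lambda> $ k $ k) * (L2_norm_on \<rho> A (wave F c \<tau> (b *\<^sub>R axis k 1)))\<^sup>2)"
proof -
  let ?w = "wave F c \<tau> (b *\<^sub>R axis k 1)"
  define e where "e = exp (1/2 * b\<^sup>2 * \<Lambda> $ k $ k)"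
  note [measurable] = A
  have [measurable]: "?w \<in> borel_measurable borel" "?w \<in> borel_measurable lborel" by (simp_all add: wave_measurable)
  have "(\<integral>\<^sup>+x\<in>A. ennreal ((cmod (extension F c \<tau> k x (\<i> * of_real b)))\<^sup>2) \<partial>lborel)
      = (\<integral>\<^sup>+x. ennreal e * (ennreal (weight_const * gauss x) * ennreal ((cmod (indicator A x * ?w x))\<^sup>2)) \<partial>lborel)"
    using weight_const_pos gauss_pos
    by (intro nn_integral_cong_AE AE_I2) (simp add: extension_modulus e_def ennreal_mult less_imp_le mult_ac indicator_def)
  also have "\<dots> = ennreal e * (\<integral>\<^sup>+x. ennreal (weight_const * gauss x) * ennreal ((cmod (indicator A x * ?w x))\<^sup>2) \<partial>lborel)"
    by (intro nn_integral_cmult) measurable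
  also have "(\<integral>\<^sup>+x. ennreal (weight_const * gauss x) * ennreal ((cmod (indicator A x * ?w x))\<^sup>2) \<partial>lborel) = (\<integral>\<^sup>+x. ennreal ((cmod (indicator A x * ?w x))\<^sup>2) \<partial>\<rho>)"
    unfolding \<rho>_eq by (intro nn_integral_density[symmetric]) measurable
  also have "\<dots> = ennreal ((L2_norm_on \<rho> A ?w)\<^sup>2)"
    unfolding L2_norm_on_altdef[of \<rho> A] using A by (intro nn_integral_L2_norm L2_fun_indicator wave_L2) (simp add: sets_\<rho>)
  finally show ?thesis by (simp add: e_def ennreal_mult)
qed

lemma wave_norm_le:
  assumes \<tau>: "\<tau> \<ge> 0" and \<eta>: "matsqrt (Qt \<tau>) *v \<eta> = E \<tau> *v y"
  shows "(L2_norm \<rho> (wave F c \<tau> y))\<^sup>2 \<le> exp (\<eta> \<bullet> \<eta>) * (L2_norm \<rho> (\<lambda>x. \<Sum>\<xi>\<in>F. c \<xi> * cis (\<xi> \<bullet> x)))\<^sup>2"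
  unfolding L2_norm_power2 wave_def by (rule shift_estimate[OF assms])

text \<open>A point of the circle is a + i b with |b| <= |R|. The real part a is removed by
  translating x; the imaginary part is paid for by \<open>wave_norm_le\<close> with the vector from
  \<open>shift_vector\<close>, uniformly in the polynomial.\<close>

lemma nn_integral_cms_extension:
  assumes T: "T > 0"
  shows "\<exists>D\<ge>0. \<forall>F c \<tau> k. 0 < \<tau> \<longrightarrow> \<tau> \<le> T \<longrightarrow>
    (\<integral>\<^sup>+x. coordinatewise_entire.cms (extension F c \<tau>) k R x \<partial>lborel)
      \<le> ennreal (exp (D / \<tau> ^ (2 * CARD('n) - 1)) * (L2_norm \<rho> (\<lambda>x. \<Sum>\<xi>\<in>F. c \<xi> * cis (\<xi> \<bullet> x)))\<^sup>2)"
proof -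
  define m where "m = 2 * CARD('n) - 1"
  obtain D0 where D0: "D0 \<ge> 0" "\<And>\<tau> y. 0 < \<tau> \<Longrightarrow> \<tau> \<le> T \<Longrightarrow> \<exists>\<eta>. matsqrt (Qt \<tau>) *v \<eta> = E \<tau> *v y \<and> \<eta> \<bullet> \<eta> \<le> D0 / \<tau> ^ m * (norm y)\<^sup>2"
    using shift_vector[OF T] unfolding m_def by blast
  define tr where "tr = (\<Sum>k\<in>UNIV. \<bar>\<Lambda> $ k $ k\<bar>)"
  have tr: "\<Lambda> $ k $ k \<le> tr" "0 \<le> tr" for k
  proof -
    have "\<bar>\<Lambda> $ k $ k\<bar> \<le> tr" unfolding tr_def by (rule member_le_sum) auto
    then show "\<Lambda> $ k $ k \<le> tr" by simp
    show "0 \<le> tr" unfolding tr_def by (rule sum_nonneg) simp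
  qed
  \<comment> \<open>The bounded contribution R^2 tr / 2 of the continued weight is turned into a
    multiple of 1 / \<tau>^m by 1 <= T^m / \<tau>^m, so that a single constant serves.\<close>
  define D where "D = (1/2 * tr * T ^ m + D0) * R\<^sup>2"
  have "(\<integral>\<^sup>+x. coordinatewise_entire.cms (extension F c \<tau>) k R x \<partial>lborel)
      \<le> ennreal (exp (D / \<tau> ^ m) * (L2_norm \<rho> (\<lambda>x. \<Sum>\<xi>\<in>F. c \<xi> * cis (\<xi> \<bullet> x)))\<^sup>2)"
    if \<tau>: "0 < \<tau>" "\<tau> \<le> T" for F c \<tau> k
  proof -
    interpret coordinatewise_entire "\<lambda>x. extension F c \<tau> undefined x 0" "extension F c \<tau>"
      by (rule extension_coordinatewise_entire)
    define g where "g = (L2_norm \<rho> (\<lambda>x. \<Sum>\<xi>\<in>F. c \<xi> * cis (\<xi> \<bullet> x)))\<^sup>2"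
    have g0: "g \<ge> 0" by (simp add: g_def)
    have "(\<integral>\<^sup>+x. ennreal ((cmod (extension F c \<tau> k x (of_real R * exp (2 * of_real pi * \<i> * of_real t))))\<^sup>2) \<partial>lborel) \<le> ennreal (exp (D / \<tau> ^ m) * g)" for t
    proof -
      define a b where "a = R * cos (2 * pi * t)" and "b = R * sin (2 * pi * t)"
      have "exp (2 * of_real pi * \<i> * of_real t) = cis (2 * pi * t)" by (simp add: cis_conv_exp mult_ac)
      then have ab: "of_real R * exp (2 * of_real pi * \<i> * of_real t) = \<i> * of_real b + of_real a"
        by (simp add: complex_eq_iff a_def b_def)
      have b2: "b\<^sup>2 \<le> R\<^sup>2"
        using sin_squared_eq[of "2 * pi * t"] by (simp add: b_def power_mult_distrib mult_left_le)
      obtain \<eta> where \<eta>: "matsqrt (Qt \<tau>) *v \<eta> = E \<tau> *v (b *\<^sub>R axis k 1)" "\<eta> \<bullet> \<eta> \<le> D0 / \<tau> ^ m * b\<^sup>2"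
        using D0(2)[OF \<tau>, of "b *\<^sub>R axis k 1"] by auto
      have "(\<integral>\<^sup>+x. ennreal ((cmod (extension F c \<tau> k x (of_real R * exp (2 * of_real pi * \<i> * of_real t))))\<^sup>2) \<partial>lborel)
          = (\<integral>\<^sup>+x. ennreal ((cmod (extension F c \<tau> k (x + a *\<^sub>R axis k 1) (\<i> * of_real b)))\<^sup>2) \<partial>lborel)"
        unfolding ab H_shift ..
      also have "\<dots> = (\<integral>\<^sup>+x. ennreal ((cmod (extension F c \<tau> k x (\<i> * of_real b)))\<^sup>2) \<partial>lborel)"
      proof -
        have "(\<lambda>x. extension F c \<tau> k x (\<i> * of_real b)) \<in> borel_measurable borel"
        proof -
          have "continuous_on UNIV (\<lambda>x. extension F c \<tau> k (fst (x, \<i> * complex_of_real b)) (snd (x, \<i> * complex_of_real b)))"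
            by (rule continuous_on_compose2[OF H_cont]) (auto intro!: continuous_intros)
          then show ?thesis by (simp add: borel_measurable_continuous_onI)
        qed
        then have "(\<lambda>x. ennreal ((cmod (extension F c \<tau> k x (\<i> * of_real b)))\<^sup>2)) \<in> borel_measurable borel" by measurable
        from nn_integral_lborel_translate[OF this, of "a *\<^sub>R axis k 1"] show ?thesis by (simp add: add.commute)
      qed
      also have "\<dots> = ennreal (exp (1/2 * b\<^sup>2 * \<Lambda> $ k $ k) * (L2_norm \<rho> (wave F c \<tau> (b *\<^sub>R axis k 1)))\<^sup>2)"
        using nn_integral_extension[of UNIV F c \<tau> k b] by simp
      also have "\<dots> \<le> ennreal (exp (D / \<tau> ^ m) * g)"
      proof (rule ennreal_leI)
        have "(L2_norm \<rho> (wave F c \<tau> (b *\<^sub>R axis k 1)))\<^sup>2 \<le> exp (\<eta> \<bullet> \<eta>) * g"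
          unfolding g_def using \<tau> \<eta>(1) by (intro wave_norm_le) auto
        then have "exp (1/2 * b\<^sup>2 * \<Lambda> $ k $ k) * (L2_norm \<rho> (wave F c \<tau> (b *\<^sub>R axis k 1)))\<^sup>2
            \<le> exp (1/2 * b\<^sup>2 * \<Lambda> $ k $ k) * (exp (\<eta> \<bullet> \<eta>) * g)" by (rule mult_left_mono) simp
        also have "\<dots> = exp (1/2 * b\<^sup>2 * \<Lambda> $ k $ k + \<eta> \<bullet> \<eta>) * g" by (simp only: exp_add mult.assoc)
        also have "\<dots> \<le> exp (D / \<tau> ^ m) * g"
        proof -
          have "1/2 * b\<^sup>2 * \<Lambda> $ k $ k \<le> 1/2 * b\<^sup>2 * tr" using tr(1)[of k] by (intro mult_left_mono) auto
          also have "\<dots> \<le> 1/2 * R\<^sup>2 * tr" using b2 tr(2) by (intro mult_right_mono mult_left_mono) auto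
          also have "\<dots> \<le> 1/2 * R\<^sup>2 * tr * (T ^ m / \<tau> ^ m)"
          proof -
            have "\<tau> ^ m \<le> T ^ m" using \<tau> by (intro power_mono) auto
            then have "1 \<le> T ^ m / \<tau> ^ m" using \<tau> by simp
            moreover have "0 \<le> 1/2 * R\<^sup>2 * tr" using tr(2) by simp
            ultimately show ?thesis using mult_left_mono by fastforce
          qed
          finally have 1: "1/2 * b\<^sup>2 * \<Lambda> $ k $ k \<le> 1/2 * R\<^sup>2 * tr * (T ^ m / \<tau> ^ m)" .
          have "D0 / \<tau> ^ m * b\<^sup>2 \<le> D0 / \<tau> ^ m * R\<^sup>2" using b2 D0(1) \<tau> by (intro mult_left_mono) auto
          then have "1/2 * b\<^sup>2 * \<Lambda> $ k $ k + \<eta> \<bullet> \<eta> \<le> 1/2 * R\<^sup>2 * tr * (T ^ m / \<tau> ^ m) + D0 / \<tau> ^ m * R\<^sup>2"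
            using 1 \<eta>(2) by linarith
          also have "\<dots> = D / \<tau> ^ m" using \<tau>(1) by (simp add: D_def field_simps)
          finally show ?thesis using g0 by (intro mult_right_mono) auto
        qed
        finally show "exp (1/2 * b\<^sup>2 * \<Lambda> $ k $ k) * (L2_norm \<rho> (wave F c \<tau> (b *\<^sub>R axis k 1)))\<^sup>2 \<le> exp (D / \<tau> ^ m) * g" .
      qed
      finally show ?thesis .
    qed
    then have "(\<integral>\<^sup>+x. cms k R x \<partial>lborel) \<le> (\<integral>\<^sup>+t\<in>{0..1 :: real}. ennreal (exp (D / \<tau> ^ m) * g) \<partial>lborel)"
      unfolding nn_integral_cms by (intro nn_integral_mono mult_right_mono) auto
    also have "\<dots> = ennreal (exp (D / \<tau> ^ m) * g)" by (simp add: nn_integral_cmult_indicator)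
    finally show ?thesis by (simp add: g_def)
  qed
  moreover have "D \<ge> 0" using D0(1) tr(2) T by (simp add: D_def)
  ultimately show ?thesis unfolding m_def by blast
qed

end

text \<open>In cells of side 2 \<delta>, the ball centre chosen for the centre of a cell is within
  \<delta> of it and so lies in the closed cell. Cubes of half-side r / (n + 1) fit into the ball of
  radius r, because the Euclidean norm is at most the sum of the n absolute coordinates.\<close>

lemma thick_cells:
  fixes \<omega> :: "(real^'n) set"
  assumes \<delta>: "\<delta> > 0" and r: "r > 0" and thick: "\<forall>y. \<exists>y'\<in>\<omega>. ball y' r \<subseteq> \<omega> \<and> norm (y - y') < \<delta>"
  shows "\<exists>G. (\<forall>m k. of_int (m $ k) * (2 * \<delta>) \<le> G m $ k \<and> G m $ k \<le> of_int (m $ k) * (2 * \<delta>) + 2 * \<delta>) \<and>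
    observed (2 * \<delta>) G (r / (real CARD('n) + 1)) UNIV \<subseteq> \<omega>"
proof -
  define ctr where "ctr m = (\<chi> k. of_int (m $ k) * (2 * \<delta>) + \<delta>)" for m :: "int^'n"
  have "\<forall>m. \<exists>y'. ball y' r \<subseteq> \<omega> \<and> norm (ctr m - y') < \<delta>" using thick by blast
  then obtain G where G: "\<And>m. ball (G m) r \<subseteq> \<omega>" "\<And>m. norm (ctr m - G m) < \<delta>" by metis
  have "of_int (m $ k) * (2 * \<delta>) \<le> G m $ k \<and> G m $ k \<le> of_int (m $ k) * (2 * \<delta>) + 2 * \<delta>" for m k
  proof -
    have "\<bar>(ctr m - G m) $ k\<bar> < \<delta>" using component_le_norm_cart[of "ctr m - G m" k] G(2)[of m] by linarith
    then show ?thesis by (simp add: ctr_def abs_less_iff)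
  qed
  moreover have "observed (2 * \<delta>) G (r / (real CARD('n) + 1)) UNIV \<subseteq> \<omega>"
  proof
    fix x assume x: "x \<in> observed (2 * \<delta>) G (r / (real CARD('n) + 1)) UNIV"
    let ?g = "G (cell_index (2 * \<delta>) x)"
    have "norm (x - ?g) \<le> (\<Sum>i\<in>UNIV. \<bar>(x - ?g) $ i\<bar>)" by (rule norm_le_l1_cart)
    also have "\<dots> \<le> (\<Sum>i\<in>(UNIV :: 'n set). r / (real CARD('n) + 1))"
      using x by (intro sum_mono) (simp add: observed_def)
    also have "\<dots> < r" using r by (simp add: field_simps)
    finally have "x \<in> ball ?g r" by (simp add: dist_norm norm_minus_commute)
    then show "x \<in> \<omega>" using G(1) by blast
  qed
  ultimately show ?thesis by blast
qed

section \<open>The interpolation inequality and its consequence for the semigroup\<close>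

context ornstein_uhlenbeck_semigroup
begin

definition thick :: "(real^'n) set \<Rightarrow> bool"
  where "thick \<omega> \<longleftrightarrow> (\<exists>\<delta>>0. \<exists>r>0. \<forall>y. \<exists>y'\<in>\<omega>. ball y' r \<subseteq> \<omega> \<and> norm (y - y') < \<delta>)"

text \<open>The n one-dimensional steps give the constant (24 C^N)^n = 24^n A^N with A = C^n,
  independent of \<tau> and of the polynomial; time enters only through the bound on the circle
  means.\<close>

lemma interpolation_trig_polys:
  assumes T: "T > 0" and \<omega>: "\<omega> \<in> sets borel" "thick \<omega>"
  shows "\<exists>K>0. \<exists>A\<ge>1. \<exists>D\<ge>0. \<forall>\<tau> p N. 0 < \<tau> \<longrightarrow> \<tau> \<le> T \<longrightarrow> p \<in> trig_polys \<longrightarrow> (1 :: nat) \<le> N \<longrightarrow>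
    (L2_norm \<rho> (S \<tau> p))\<^sup>2 \<le> K * A ^ N * (L2_norm_on \<rho> \<omega> (S \<tau> p))\<^sup>2
      + K * (1/2) ^ N * exp (D / \<tau> ^ (2 * CARD('n) - 1)) * (L2_norm \<rho> p)\<^sup>2"
proof -
  obtain \<delta> r where \<delta>: "\<delta> > 0" and r: "r > 0" and th: "\<forall>y. \<exists>y'\<in>\<omega>. ball y' r \<subseteq> \<omega> \<and> norm (y - y') < \<delta>"
    using \<omega>(2) unfolding thick_def by blast
  define n where "n = CARD('n)"
  have n: "n \<ge> 1" by (simp add: n_def Suc_leI)
  define L where "L = 2 * \<delta>"
  define r' where "r' = r / (real n + 1)"
  define l where "l = min 1 (r' / L)"
  have L: "L > 0" using \<delta> by (simp add: L_def)
  have r': "r' > 0" using r by (simp add: r'_def)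
  have l: "0 < l" "l \<le> 1" "l * L \<le> r'" using L r' by (auto simp: l_def min_def field_simps)
  obtain G :: "int^'n \<Rightarrow> real^'n" where G: "\<And>m k. of_int (m $ k) * L \<le> G m $ k" "\<And>m k. G m $ k \<le> of_int (m $ k) * L + L"
    and obs: "observed L G r' UNIV \<subseteq> \<omega>"
    using thick_cells[OF \<delta> r th] unfolding L_def r'_def n_def by blast
  define C where "C = 144 / l ^ 3"
  have C: "C \<ge> 1"
  proof -
    have "l ^ 3 \<le> 1" using l by (simp add: power_le_one)
    then show ?thesis using l by (simp add: C_def field_simps)
  qed
  define A where "A = C ^ n"
  have A: "A \<ge> 1" using C by (simp add: A_def one_le_power)
  \<comment> \<open>A is already fixed here. The choice gives A (L / R)^2 = 1 / (4 A) <= 1/2, so the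
    Taylor error wins over the Remez constant for every N.\<close>
  define R where "R = 2 * L * A"
  have R: "2 * L \<le> R" using A L by (simp add: R_def)
  define K where "K = real n * 24 ^ n"
  have K: "K > 0" "24 ^ n \<le> K" using n by (auto simp: K_def)
  obtain D where D: "D \<ge> 0" "\<And>F c \<tau> k. 0 < \<tau> \<Longrightarrow> \<tau> \<le> T \<Longrightarrow>
    (\<integral>\<^sup>+x. coordinatewise_entire.cms (extension F c \<tau>) k R x \<partial>lborel)
      \<le> ennreal (exp (D / \<tau> ^ (2 * CARD('n) - 1)) * (L2_norm \<rho> (\<lambda>x. \<Sum>\<xi>\<in>F. c \<xi> * cis (\<xi> \<bullet> x)))\<^sup>2)"
    using nn_integral_cms_extension[OF T, of R] by blast
  have "(L2_norm \<rho> (S \<tau> p))\<^sup>2 \<le> K * A ^ N * (L2_norm_on \<rho> \<omega> (S \<tau> p))\<^sup>2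
      + K * (1/2) ^ N * exp (D / \<tau> ^ (2 * CARD('n) - 1)) * (L2_norm \<rho> p)\<^sup>2"
    if \<tau>: "0 < \<tau>" "\<tau> \<le> T" and p: "p \<in> trig_polys" and N: "1 \<le> N" for \<tau> p and N :: nat
  proof -
    obtain F c where F: "finite F" and p: "p = (\<lambda>x. \<Sum>\<xi>\<in>F. c \<xi> * cis (\<xi> \<bullet> x))" using p unfolding trig_polys_def by (elim CollectE exE conjE)
    have \<tau>0: "0 \<le> \<tau>" using \<tau> by simp
    define f where "f x = extension F c \<tau> undefined x 0" for x
    interpret coordinatewise_entire f "extension F c \<tau>"
      unfolding f_def[abs_def] by (rule extension_coordinatewise_entire)
    define w where "w = wave F c \<tau> 0"
    define e where "e = exp (D / \<tau> ^ (2 * CARD('n) - 1)) * (L2_norm \<rho> p)\<^sup>2"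
    have e0: "e \<ge> 0" by (simp add: e_def)
    have f_int: "(\<integral>\<^sup>+x\<in>X. ennreal ((cmod (f x))\<^sup>2) \<partial>lborel) = ennreal ((L2_norm_on \<rho> X w)\<^sup>2)" if "X \<in> sets borel" for X
      using nn_integral_extension[OF that, of F c \<tau> undefined 0] by (simp add: f_def w_def)
    define B where "B = 24 * (144 / l ^ 3) ^ N"
    have Bn: "B ^ n = 24 ^ n * A ^ N"
      by (simp add: B_def A_def C_def power_mult_distrib mult.commute flip: power_mult)
    have "(\<integral>\<^sup>+x. ennreal ((cmod (f x))\<^sup>2) \<partial>lborel) \<le> ennreal (B ^ CARD('n)) * (\<integral>\<^sup>+x\<in>observed L G r' UNIV. ennreal ((cmod (f x))\<^sup>2) \<partial>lborel)
        + ennreal (real CARD('n) * B ^ CARD('n) * (L / R) ^ (2 * N) * e)"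
      unfolding B_def using D(2)[OF \<tau>, of F c, folded p]
      by (intro smallness_propagation[OF N L l R G _ e0]) (simp add: e_def)
    also have "(\<integral>\<^sup>+x\<in>observed L G r' UNIV. ennreal ((cmod (f x))\<^sup>2) \<partial>lborel) \<le> (\<integral>\<^sup>+x\<in>\<omega>. ennreal ((cmod (f x))\<^sup>2) \<partial>lborel)"
      using obs by (intro nn_integral_mono) (auto simp: indicator_def)
    finally have "ennreal ((L2_norm \<rho> w)\<^sup>2) \<le> ennreal (B ^ n) * ennreal ((L2_norm_on \<rho> \<omega> w)\<^sup>2) + ennreal (real n * B ^ n * (L / R) ^ (2 * N) * e)"
      using f_int[of UNIV] f_int[OF \<omega>(1)] by (simp add: n_def mult_left_mono add_right_mono)
    also have "\<dots> = ennreal (B ^ n * (L2_norm_on \<rho> \<omega> w)\<^sup>2 + real n * B ^ n * (L / R) ^ (2 * N) * e)"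
    proof -
      have "B ^ n \<ge> 0" "(L / R) ^ (2 * N) \<ge> 0" using A L R unfolding Bn by auto
      then show ?thesis using e0 by (simp add: ennreal_mult ennreal_plus)
    qed
    finally have "(L2_norm \<rho> w)\<^sup>2 \<le> B ^ n * (L2_norm_on \<rho> \<omega> w)\<^sup>2 + real n * B ^ n * (L / R) ^ (2 * N) * e"
    proof (rule ennreal_le_iff[THEN iffD1, rotated])
      have "B ^ n \<ge> 0" "(L / R) ^ (2 * N) \<ge> 0" using A L R unfolding Bn by auto
      then show "0 \<le> B ^ n * (L2_norm_on \<rho> \<omega> w)\<^sup>2 + real n * B ^ n * (L / R) ^ (2 * N) * e" using e0 by simp
    qed
    also have "B ^ n * (L2_norm_on \<rho> \<omega> w)\<^sup>2 \<le> K * A ^ N * (L2_norm_on \<rho> \<omega> w)\<^sup>2"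
      unfolding Bn using K(2) A by (intro mult_right_mono) auto
    also have "real n * B ^ n * (L / R) ^ (2 * N) * e \<le> K * (1/2) ^ N * e"
    proof -
      have "A ^ N * (L / R) ^ (2 * N) = (A * (L / R)\<^sup>2) ^ N" by (simp add: power_mult_distrib power_mult)
      also have "\<dots> \<le> (1/2) ^ N"
      proof (rule power_mono)
        have "A * (L / R)\<^sup>2 = 1 / (4 * A)" using L A by (simp add: R_def power2_eq_square field_simps)
        also have "\<dots> \<le> 1/2" using A by (simp add: field_simps)
        finally show "A * (L / R)\<^sup>2 \<le> 1/2" .
      qed (use A in simp)
      finally have "K * (A ^ N * (L / R) ^ (2 * N)) * e \<le> K * (1/2) ^ N * e" using K(1) e0 by (intro mult_right_mono mult_left_mono) auto
      then show ?thesis unfolding Bn by (simp add: K_def mult_ac)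
    qed
    finally have main: "(L2_norm \<rho> w)\<^sup>2 \<le> K * A ^ N * (L2_norm_on \<rho> \<omega> w)\<^sup>2 + K * (1/2) ^ N * e" by simp
    have wS: "AE x in \<rho>. S \<tau> p x = w x"
      using S_trig_poly[OF \<tau>0 F, of c] unfolding p w_def wave_def ev_def by (simp add: mult.assoc)
    have SL: "S \<tau> p \<in> L2_fun \<rho>" unfolding p by (intro S_L2[OF \<tau>0] L2_fun_sum cis_L2)
    have "L2_norm \<rho> (S \<tau> p) = L2_norm \<rho> w"
      by (rule L2_norm_cong_AE[OF _ _ wS]) (auto intro: L2_funD(1) SL wave_L2 simp: w_def)
    moreover have "L2_norm_on \<rho> \<omega> (S \<tau> p) = L2_norm_on \<rho> \<omega> w"
      unfolding L2_norm_on_altdef[of \<rho> \<omega>]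
    proof (rule L2_norm_cong_AE)
      have s: "\<omega> \<in> sets \<rho>" using \<omega>(1) by (simp add: sets_\<rho>)
      show "(\<lambda>x. indicator \<omega> x * S \<tau> p x) \<in> borel_measurable \<rho>" by (rule L2_funD(1)[OF L2_fun_indicator[OF SL s]])
      show "(\<lambda>x. indicator \<omega> x * w x) \<in> borel_measurable \<rho>" unfolding w_def by (rule L2_funD(1)[OF L2_fun_indicator[OF wave_L2 s]])
      show "AE x in \<rho>. indicator \<omega> x * S \<tau> p x = indicator \<omega> x * w x" using wS by eventually_elim simp
    qed
    ultimately show ?thesis using main by (simp only: e_def mult.assoc)
  qed
  then show ?thesis using K(1) A D(1) by blast
qed

text \<open>Since \<open>S \<tau>\<close> is a contraction, all three norms depend continuously on
  \<open>g\<close>, and the inequality passes from the dense trigonometric polynomials to the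
  limit.\<close>

lemma interpolation:
  assumes T: "T > 0" and \<omega>: "\<omega> \<in> sets borel" "thick \<omega>"
  shows "\<exists>K>0. \<exists>A\<ge>1. \<exists>D\<ge>0. \<forall>\<tau> g N. 0 < \<tau> \<longrightarrow> \<tau> \<le> T \<longrightarrow> g \<in> L2_fun \<rho> \<longrightarrow> (1 :: nat) \<le> N \<longrightarrow>
    (L2_norm \<rho> (S \<tau> g))\<^sup>2 \<le> K * A ^ N * (L2_norm_on \<rho> \<omega> (S \<tau> g))\<^sup>2
      + K * (1/2) ^ N * exp (D / \<tau> ^ (2 * CARD('n) - 1)) * (L2_norm \<rho> g)\<^sup>2"
proof -
  obtain K A D where KAD: "K > 0" "A \<ge> 1" "D \<ge> 0"
    and trig: "\<And>\<tau> p N. 0 < \<tau> \<Longrightarrow> \<tau> \<le> T \<Longrightarrow> p \<in> trig_polys \<Longrightarrow> (1 :: nat) \<le> N \<Longrightarrow>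
      (L2_norm \<rho> (S \<tau> p))\<^sup>2 \<le> K * A ^ N * (L2_norm_on \<rho> \<omega> (S \<tau> p))\<^sup>2
      + K * (1/2) ^ N * exp (D / \<tau> ^ (2 * CARD('n) - 1)) * (L2_norm \<rho> p)\<^sup>2"
    using interpolation_trig_polys[OF assms] by blast
  have "(L2_norm \<rho> (S \<tau> g))\<^sup>2 \<le> K * A ^ N * (L2_norm_on \<rho> \<omega> (S \<tau> g))\<^sup>2
      + K * (1/2) ^ N * exp (D / \<tau> ^ (2 * CARD('n) - 1)) * (L2_norm \<rho> g)\<^sup>2"
    if \<tau>: "0 < \<tau>" "\<tau> \<le> T" and g: "g \<in> L2_fun \<rho>" and N: "1 \<le> N" for \<tau> g and N :: nat
  proof -
    have \<tau>0: "0 \<le> \<tau>" using \<tau> by simp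
    have s: "\<omega> \<in> sets \<rho>" using \<omega>(1) by (simp add: sets_\<rho>)
    have "\<exists>p\<in>trig_polys. L2_norm \<rho> (\<lambda>x. p x - g x) < inverse (real (Suc k))" for k
      using ac.trig_polys_dense[OF g] unfolding trig_approximable_def L2_norm_minus_commute[of \<rho> g] by simp
    then obtain p where p: "\<And>k. p k \<in> trig_polys" "\<And>k. L2_norm \<rho> (\<lambda>x. p k x - g x) < inverse (real (Suc k))" by metis
    have pL: "p k \<in> L2_fun \<rho>" for k by (rule ac.trig_poly_L2[OF p(1)])
    have lim: "X \<longlonglongrightarrow> l" if "\<And>k. \<bar>X k - l\<bar> \<le> L2_norm \<rho> (\<lambda>x. p k x - g x)" for X :: "nat \<Rightarrow> real" and l
    proof -
      have "\<forall>k. norm (X k - l) \<le> inverse (real (Suc k))" using that p(2) by (metis less_imp_le order_trans real_norm_def)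
      then have "(\<lambda>k. X k - l) \<longlonglongrightarrow> 0" by (intro Lim_null_comparison[OF _ LIMSEQ_inverse_real_of_nat]) auto
      then show ?thesis by (rule LIM_zero_cancel)
    qed
    have Sdiff: "L2_norm \<rho> (\<lambda>x. S \<tau> (p k) x - S \<tau> g x) \<le> L2_norm \<rho> (\<lambda>x. p k x - g x)" for k
      unfolding L2_operator_norm_diff[OF S_operator[OF \<tau>0] pL g] by (intro contraction \<tau>0 L2_fun_diff pL g)
    have 1: "(\<lambda>k. L2_norm \<rho> (S \<tau> (p k))) \<longlonglongrightarrow> L2_norm \<rho> (S \<tau> g)"
      by (rule lim, rule order_trans[OF L2_norm_on_diff_le Sdiff]) (use S_L2[OF \<tau>0] pL g sets_\<rho> in auto)
    have 2: "(\<lambda>k. L2_norm_on \<rho> \<omega> (S \<tau> (p k))) \<longlonglongrightarrow> L2_norm_on \<rho> \<omega> (S \<tau> g)"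
      by (rule lim, rule order_trans[OF L2_norm_on_diff_le Sdiff]) (use S_L2[OF \<tau>0] pL g s in auto)
    have 3: "(\<lambda>k. L2_norm \<rho> (p k)) \<longlonglongrightarrow> L2_norm \<rho> g"
      by (rule lim, rule L2_norm_on_diff_le) (use pL g sets_\<rho> in auto)
    show ?thesis
      by (rule LIMSEQ_le[of "\<lambda>k. (L2_norm \<rho> (S \<tau> (p k)))\<^sup>2"], rule tendsto_power[OF 1],
        rule tendsto_add[OF tendsto_mult[OF tendsto_const tendsto_power[OF 2]] tendsto_mult[OF tendsto_const tendsto_power[OF 3]]])
        (use trig[OF \<tau> p(1) N] in blast)
  qed
  then show ?thesis using KAD by blast
qed

lemma S_chain:
  assumes "0 \<le> s" "s \<le> t" "g \<in> L2_fun \<rho>"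
  shows "AE x in \<rho>. S t g x = S (t - s) (S s g) x"
  using L2_C0_semigroupD(3)[OF S_C0, of "t - s" s g] assms by simp

lemma S_norm_on_chain:
  assumes st: "0 \<le> s" "s \<le> t" and g: "g \<in> L2_fun \<rho>" and A: "A \<in> sets \<rho>"
  shows "L2_norm_on \<rho> A (S t g) = L2_norm_on \<rho> A (S (t - s) (S s g))"
  unfolding L2_norm_on_altdef[of \<rho> A]
proof (rule L2_norm_cong_AE)
  have t0: "0 \<le> t" "0 \<le> t - s" using st by auto
  show "(\<lambda>x. indicator A x * S t g x) \<in> borel_measurable \<rho>" "(\<lambda>x. indicator A x * S (t - s) (S s g) x) \<in> borel_measurable \<rho>"
    by (intro L2_funD(1)[of _ \<rho>] L2_fun_indicator S_L2 t0 st(1) g A)+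
  show "AE x in \<rho>. indicator A x * S t g x = indicator A x * S (t - s) (S s g) x"
    using S_chain[OF st g] by eventually_elim simp
qed

text \<open>For s <= t the norms differ by at most the norm of S (t - s) g - g, because
  \<open>S s\<close> is a contraction. Strong continuity at 0 therefore gives continuity from both
  sides.\<close>

lemma S_norm_on_continuous:
  assumes g: "g \<in> L2_fun \<rho>" and A: "A \<in> sets \<rho>"
  shows "continuous_on {0..T} (\<lambda>t. L2_norm_on \<rho> A (S t g))"
  unfolding continuous_on_iff
proof (intro ballI allI impI)
  have le: "\<bar>L2_norm_on \<rho> A (S t g) - L2_norm_on \<rho> A (S s g)\<bar> \<le> L2_norm \<rho> (\<lambda>x. S (t - s) g x - g x)"
    if st: "0 \<le> s" "s \<le> t" for s t
  proof -
    have t0: "0 \<le> t" "0 \<le> t - s" using st by auto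
    have "\<bar>L2_norm_on \<rho> A (S t g) - L2_norm_on \<rho> A (S s g)\<bar> \<le> L2_norm \<rho> (\<lambda>x. S t g x - S s g x)"
      by (intro L2_norm_on_diff_le S_L2 t0 st(1) g A)
    also have "\<dots> = L2_norm \<rho> (\<lambda>x. S s (S (t - s) g) x - S s g x)"
    proof (rule L2_norm_cong_AE)
      show "AE x in \<rho>. S t g x - S s g x = S s (S (t - s) g) x - S s g x"
        using L2_C0_semigroupD(3)[OF S_C0 st(1) t0(2) g] by eventually_elim simp
    qed (intro L2_funD(1)[of _ \<rho>] L2_fun_diff S_L2 t0 st(1) g)+
    also have "\<dots> \<le> L2_norm \<rho> (\<lambda>x. S (t - s) g x - g x)"
      unfolding L2_operator_norm_diff[OF S_operator[OF st(1)] S_L2[OF t0(2) g] g]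
      by (intro contraction st(1) L2_fun_diff S_L2 t0 g)
    finally show ?thesis .
  qed
  fix s e :: real assume s: "s \<in> {0..T}" and e: "e > 0"
  have "\<forall>\<^sub>F h in at_right 0. L2_norm \<rho> (\<lambda>x. S h g x - g x) < e"
    using order_tendstoD(2)[OF L2_C0_semigroupD(4)[OF S_C0 g] e] .
  then obtain d where d: "d > 0" "\<And>h. 0 < h \<Longrightarrow> h < d \<Longrightarrow> L2_norm \<rho> (\<lambda>x. S h g x - g x) < e"
    unfolding eventually_at_right_field by blast
  have "dist (L2_norm_on \<rho> A (S t g)) (L2_norm_on \<rho> A (S s g)) < e" if t: "t \<in> {0..T}" "dist t s < d" for t
  proof (cases t s rule: linorder_cases)
    case less
    then show ?thesis using le[of t s] d(2)[of "s - t"] s t by (simp add: dist_real_def abs_minus_commute)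
  next
    case equal
    then show ?thesis using e by simp
  next
    case greater
    then show ?thesis using le[of s t] d(2)[of "t - s"] s t by (simp add: dist_real_def)
  qed
  then show "\<exists>d>0. \<forall>t\<in>{0..T}. dist t s < d \<longrightarrow> dist (L2_norm_on \<rho> A (S t g)) (L2_norm_on \<rho> A (S s g)) < e"
    using d(1) by blast
qed

text \<open>Between times s < t, interpolation is applied with initial datum S s g, and
  contractivity makes the squared norm nonincreasing; these are the hypotheses of
  \<open>observability_telescope\<close>. Continuity of the observed norm identifies the two notions
  of integral.\<close>

lemma observability:
  assumes T: "T > 0" and \<omega>: "\<omega> \<in> sets borel" "thick \<omega>"
  shows "\<exists>C>0. \<forall>g\<in>L2_fun \<rho>. (L2_norm \<rho> (S T g))\<^sup>2 \<le> C * (LINT t:{0..T}|lborel. (L2_norm_on \<rho> \<omega> (S t g))\<^sup>2)"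
proof -
  obtain K A D where KAD: "K > 0" "A \<ge> 1" "D \<ge> 0"
    and int: "\<And>\<tau> g N. 0 < \<tau> \<Longrightarrow> \<tau> \<le> T \<Longrightarrow> g \<in> L2_fun \<rho> \<Longrightarrow> (1 :: nat) \<le> N \<Longrightarrow>
      (L2_norm \<rho> (S \<tau> g))\<^sup>2 \<le> K * A ^ N * (L2_norm_on \<rho> \<omega> (S \<tau> g))\<^sup>2
      + K * (1/2) ^ N * exp (D / \<tau> ^ (2 * CARD('n) - 1)) * (L2_norm \<rho> g)\<^sup>2"
    using interpolation[OF assms] by blast
  have s: "\<omega> \<in> sets \<rho>" "UNIV \<in> sets \<rho>" using \<omega>(1) by (simp_all add: sets_\<rho>)
  have m: "2 * CARD('n) - 1 \<ge> 1"
  proof -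
    have "CARD('n) \<ge> 1" by (simp add: Suc_leI)
    then show ?thesis by linarith
  qed
  obtain C where C: "C > 0" "\<And>a b :: real \<Rightarrow> real.
    (\<forall>t. 0 \<le> t \<longrightarrow> 0 \<le> a t) \<Longrightarrow> (\<forall>t. 0 \<le> t \<longrightarrow> 0 \<le> b t) \<Longrightarrow> (\<forall>s t. 0 \<le> s \<longrightarrow> s \<le> t \<longrightarrow> a t \<le> a s) \<Longrightarrow>
    continuous_on {0..T} b \<Longrightarrow>
    (\<forall>s t N. 0 \<le> s \<longrightarrow> s < t \<longrightarrow> t \<le> T \<longrightarrow> (1 :: nat) \<le> N \<longrightarrow>
       a t \<le> K * A ^ N * b t + K * (1/2) ^ N * exp (D / (t - s) ^ (2 * CARD('n) - 1)) * a s) \<Longrightarrow>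
    a T \<le> C * integral {0..T} b"
    using observability_telescope[OF KAD m T] by (elim exE conjE) blast
  have "(L2_norm \<rho> (S T g))\<^sup>2 \<le> C * (LINT t:{0..T}|lborel. (L2_norm_on \<rho> \<omega> (S t g))\<^sup>2)" if g: "g \<in> L2_fun \<rho>" for g
  proof -
    define a where "a t = (L2_norm \<rho> (S t g))\<^sup>2" for t
    define b where "b t = (L2_norm_on \<rho> \<omega> (S t g))\<^sup>2" for t
    have bc: "continuous_on {0..T} b" unfolding b_def by (intro continuous_intros S_norm_on_continuous g s)
    have "a T \<le> C * integral {0..T} b"
    proof (rule C(2))
      show "\<forall>s t. 0 \<le> s \<longrightarrow> s \<le> t \<longrightarrow> a t \<le> a s"
      proof (intro allI impI)
        fix s t :: real assume st: "0 \<le> s" "s \<le> t"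
        then show "a t \<le> a s" unfolding a_def S_norm_on_chain[OF st g s(2)]
          by (intro power_mono contraction S_L2 g L2_norm_nonneg) auto
      qed
      show "\<forall>s t N. 0 \<le> s \<longrightarrow> s < t \<longrightarrow> t \<le> T \<longrightarrow> (1 :: nat) \<le> N \<longrightarrow>
        a t \<le> K * A ^ N * b t + K * (1/2) ^ N * exp (D / (t - s) ^ (2 * CARD('n) - 1)) * a s"
      proof (intro allI impI)
        fix u t :: real and N :: nat assume *: "0 \<le> u" "u < t" "t \<le> T" "1 \<le> N"
        have ut: "u \<le> t" using * by simp
        show "a t \<le> K * A ^ N * b t + K * (1/2) ^ N * exp (D / (t - u) ^ (2 * CARD('n) - 1)) * a u"
          unfolding a_def b_def S_norm_on_chain[OF *(1) ut g s(1)] S_norm_on_chain[OF *(1) ut g s(2)]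
          by (rule int) (use * S_L2[OF *(1) g] in auto)
      qed
    qed (use bc in \<open>auto simp: a_def b_def\<close>)
    also have "integral {0..T} b = (LINT t:{0..T}|lborel. b t)"
      by (rule set_borel_integral_eq_integral(2)[symmetric, OF borel_integrable_atLeastAtMost'[OF bc]])
    finally show ?thesis by (simp only: a_def b_def)
  qed
  then show ?thesis using C(1) by blast
qed

end

theorem corollary1p7:
  fixes Q B :: "real^'n^'n"
    and S :: "real \<Rightarrow> (real^'n \<Rightarrow> complex) \<Rightarrow> (real^'n \<Rightarrow> complex)"
    and T :: real
    and \<omega> :: "(real^'n) set"
  assumes "symmetric_psd Q"
    and "rank (kalman_matrix Q B) = CARD('n)"
    and "matspectrum B \<subseteq> {z. Re z < 0}"
    and "ou_semigroup Q B S"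
    and "T > 0"
    and "open \<omega>"
    and "\<exists>\<delta>>0. \<exists>r>0. \<forall>y. \<exists>y'\<in>\<omega>. ball y' r \<subseteq> \<omega> \<and> norm (y - y') < \<delta>"
  shows "\<exists>C>0. \<forall>g \<in> L2_fun (ou_measure Q B).
    (L2_norm (ou_measure Q B) (S T g))\<^sup>2
      \<le> C * (LINT t:{0..T}|lborel. (L2_norm_on (ou_measure Q B) \<omega> (S t g))\<^sup>2)"
proof -
  interpret ornstein_uhlenbeck_semigroup Q B S
    using assms(1-4) by unfold_locales
  show ?thesis
    using observability[OF assms(5) borel_open[OF assms(6)]] assms(7) unfolding thick_def by blast
qed

end
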